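(* There exists an absolute constant $C>0$ such that for all real $M,N\ge 1$ and every $\varepsilon>0$, $$\mathcal B(M,N)\le \exp_4(C\varepsilon^{-1})\,(MN)^{\varepsilon}(M+N),$$ where $\mathcal B(M,N)=\sup_{\|a\|\neq 0}\Sigma(M,N,a)/\|a\|^2$, the supremum being over complex sequences $a=\{a_n\}_{n\sim N}$, and $$\Sigma(M,N,a)=\sum_{m\sim M}^{*}\left|\sum_{n\sim N}^{*}a_n\left(\frac nm\right)\right|^2 .$$
   Context: $n\sim N$ means that $n$ is an integer with $N<n\le 2N$. $\sum^*$ denotes a sum restricted to positive squarefree odd integers. $\left(\frac{n}{m}\right)$ is the Jacobi symbol. $\|a\|^2=\sum_{n\sim N}|a_n|^2$. $\exp_k$ is the $k$-fold iterated exponential ($\exp_1=\exp$, $\exp_{k+1}=\exp\circ\exp_k$). *)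

theory Defs
  imports
    "HOL-Analysis.Analysis"
    "HOL-Number_Theory.Residues"
    "HOL-Computational_Algebra.Squarefree"
begin

text \<open>The Jacobi symbol \<open>(a/m)\<close>; the bottom argument is meant to be odd and positive.\<close>

definition Jacobi :: "int \<Rightarrow> int \<Rightarrow> int" where
  "Jacobi a m = (\<Prod>p\<in>#prime_factorization m. Legendre a p)"

definition dyadic :: "real \<Rightarrow> int set" where
  "dyadic N = {n. N < real_of_int n \<and> real_of_int n \<le> 2 * N}"

text \<open>The range of a starred sum over \<open>n \<sim> N\<close>.\<close>

definition dyadic_star :: "real \<Rightarrow> int set" where
  "dyadic_star N = {n \<in> dyadic N. n > 0 \<and> squarefree n \<and> odd n}"

text \<open>The norm runs over all of \<open>n \<sim> N\<close>, not only over the odd squarefree \<open>n\<close>. Values of \<open>a\<close>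
  outside \<open>n \<sim> N\<close> play no role, so a sequence indexed by \<open>n \<sim> N\<close> is given by a total function.\<close>

definition seq_norm :: "real \<Rightarrow> (int \<Rightarrow> complex) \<Rightarrow> real" where
  "seq_norm N a = L2_set (\<lambda>n. cmod (a n)) (dyadic N)"

definition sieve_sum :: "real \<Rightarrow> real \<Rightarrow> (int \<Rightarrow> complex) \<Rightarrow> real" where
  "sieve_sum M N a =
     (\<Sum>m\<in>dyadic_star M. (cmod (\<Sum>n\<in>dyadic_star N. a n * of_int (Jacobi n m)))\<^sup>2)"

definition sieve_const :: "real \<Rightarrow> real \<Rightarrow> real" where
  "sieve_const M N =
     (SUP a\<in>{a. seq_norm N a \<noteq> 0}. sieve_sum M N a / (seq_norm N a)\<^sup>2)"

text \<open>The supremum above is taken in the reals; the following facts show that for \<open>N \<ge> 1\<close> it is a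
  genuine one, i.e. of a nonempty set that is bounded above.\<close>

lemma finite_dyadic: "finite (dyadic N)"
proof (rule finite_subset)
  show "dyadic N \<subseteq> {\<lfloor>N\<rfloor>..\<lfloor>2 * N\<rfloor>}"
    unfolding dyadic_def by (auto simp: le_floor_iff floor_le_iff)
qed simp

lemma finite_dyadic_star: "finite (dyadic_star N)"
  unfolding dyadic_star_def using finite_dyadic by simp

lemma seq_norm_power2: "(seq_norm N a)\<^sup>2 = (\<Sum>n\<in>dyadic N. (cmod (a n))\<^sup>2)"
  unfolding seq_norm_def L2_set_def by (simp add: sum_nonneg)

lemma seq_norm_nontrivial:
  assumes "N \<ge> 1"
  shows "{a. seq_norm N a \<noteq> 0} \<noteq> {}"
proof -
  have "\<lfloor>2 * N\<rfloor> \<in> dyadic N"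
    using assms unfolding dyadic_def by (simp, linarith)
  hence "seq_norm N (\<lambda>_. 1) \<noteq> 0"
    unfolding seq_norm_def using finite_dyadic[of N] by (auto simp: L2_set_eq_0_iff)
  thus ?thesis by blast
qed

lemma sieve_sum_bdd_above:
  "bdd_above ((\<lambda>a. sieve_sum M N a / (seq_norm N a)\<^sup>2) ` {a. seq_norm N a \<noteq> 0})"
proof (rule bdd_aboveI2)
  fix a assume "a \<in> {a. seq_norm N a \<noteq> 0}"
  hence pos: "(seq_norm N a)\<^sup>2 > 0" by simp
  let ?K = "\<lambda>m. \<Sum>n\<in>dyadic_star N. (real_of_int (Jacobi n m))\<^sup>2"
  have "sieve_sum M N a \<le> (\<Sum>m\<in>dyadic_star M. (seq_norm N a)\<^sup>2 * ?K m)"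
    unfolding sieve_sum_def
  proof (rule sum_mono)
    fix m
    have "cmod (\<Sum>n\<in>dyadic_star N. a n * of_int (Jacobi n m))
            \<le> (\<Sum>n\<in>dyadic_star N. cmod (a n) * \<bar>real_of_int (Jacobi n m)\<bar>)"
      by (rule order_trans[OF norm_sum]) (simp add: norm_mult)
    hence "(cmod (\<Sum>n\<in>dyadic_star N. a n * of_int (Jacobi n m)))\<^sup>2
            \<le> (\<Sum>n\<in>dyadic_star N. cmod (a n) * \<bar>real_of_int (Jacobi n m)\<bar>)\<^sup>2"
      by (intro power_mono) auto
    also have "\<dots> \<le> (\<Sum>n\<in>dyadic_star N. (cmod (a n))\<^sup>2) * ?K m"
      using Cauchy_Schwarz_ineq_sum[of "\<lambda>n. cmod (a n)"
          "\<lambda>n. \<bar>real_of_int (Jacobi n m)\<bar>" "dyadic_star N"] by simp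
    also have "\<dots> \<le> (seq_norm N a)\<^sup>2 * ?K m"
      unfolding seq_norm_power2
      by (intro mult_right_mono sum_mono2 finite_dyadic sum_nonneg)
         (auto simp: dyadic_star_def)
    finally show "(cmod (\<Sum>n\<in>dyadic_star N. a n * of_int (Jacobi n m)))\<^sup>2
                    \<le> (seq_norm N a)\<^sup>2 * ?K m" .
  qed
  hence "sieve_sum M N a \<le> (seq_norm N a)\<^sup>2 * (\<Sum>m\<in>dyadic_star M. ?K m)"
    by (simp add: sum_distrib_left)
  thus "sieve_sum M N a / (seq_norm N a)\<^sup>2 \<le> (\<Sum>m\<in>dyadic_star M. ?K m)"
    using pos by (simp add: divide_le_eq mult.commute)
qed

end

theory Submission
  imports
    Defs
    "HOL-Probability.Probability"
    "HOL-Number_Theory.Quadratic_Reciprocity"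
    "HOL-Number_Theory.Euler_Criterion"
begin

text \<open>Let the sieve of length \<open>N\<close> over the squarefree \<open>s \<le> Y\<close> be bounded by
  \<open>K N\<^sup>\<eta> (Y + N\<^sup>\<xi>)\<close>. Heath-Brown's recursion improves \<open>\<xi>\<close> to \<open>2 - 1/\<xi>\<close>, at the cost of larger \<open>K\<close> and \<open>\<eta>\<close>.
  Duality and reciprocity first interchange the two variables. Then the sum over \<open>s\<close> is enlarged to a Gaussian-smoothed
  sum over all integers \<open>m = s h\<^sup>2\<close> with \<open>s > S\<close>, where \<open>S = max 1 (N\<^sup>2 / M)\<close>. After opening the square, Poisson summation
  turns the complete sum over \<open>m\<close> into one of the same shape. The frequencies with \<open>s > S\<close> are exponentially damped; for
  \<open>s \<le> S\<close> the sums over \<open>h\<close> on both sides have main terms that cancel, and the remainders are bounded by the assumed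
  estimate once the variables are separated. Starting from \<open>\<xi> = 2\<close> the exponents are \<open>\<xi> = 1 + 1/m\<close>; for \<open>m\<close> about \<open>2/\<epsilon>\<close>
  and divisor bounds \<open>\<tau>(n) \<le> 2 powr (2 powr (1/\<delta>)) n\<^sup>\<delta>\<close> with \<open>\<delta>\<close> about \<open>\<epsilon>\<^sup>2\<close> the constants stay below
  \<open>exp\<^sub>4 (C/\<epsilon>)\<close>.\<close>

section \<open>Multipliers of trilinear sums\<close>

text \<open>The obstacle is the weight: once the square is opened it couples \<open>s\<close> with
  both columns, while the hypothesis is a bilinear estimate. On blocks of ratio 11/10 multiplier
  norms undo the coupling, in place of a Mellin transform. The Gaussian is its own Fourier
  transform, so Poisson summation rests on one explicit identity and returns the same weight with
  length \<open>e\<^sup>2 q / M\<close>. For columns \<open>d * l\<close>, \<open>d * l'\<close>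
  with \<open>q = l * l'\<close> and \<open>e\<close> dividing \<open>d\<close> this is at most
  about \<open>N\<^sup>2 / M\<close>, which explains \<open>S\<close>. Coprimality conditions are
  opened by Moebius sums, each at the price of a divisor function. The hypothesis then yields
  \<open>M + sqrt (M / S) * S powr \<xi>\<close>, whose terms balance at
  \<open>M = N powr (2 - 1 / \<xi>)\<close>. The fixed point 1 of this map is approached only like
  \<open>1 + 1/m\<close>; the losses \<open>8 * \<delta>\<close> of \<open>m\<close> steps must also
  stay below \<open>\<epsilon>\<close>, which forces \<open>\<delta>\<close> down to the order
  \<open>\<epsilon>\<^sup>2\<close>. Even \<open>s\<close> occur once all integers are summed, so
  rows are all squarefree \<open>s\<close>, and duality has to sort them by the power of 2 and the
  class mod 4.\<close>

definition tri_bd :: "'a set \<Rightarrow> 'b set \<Rightarrow> 'c set \<Rightarrow> ('a \<Rightarrow> 'b \<Rightarrow> 'c \<Rightarrow> complex) \<Rightarrow> real \<Rightarrow> bool" where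
  "tri_bd X P R T B \<longleftrightarrow> (\<forall>u v w. (\<forall>s\<in>X. cmod (u s) \<le> 1) \<longrightarrow> (\<forall>p\<in>P. cmod (v p) \<le> 1) \<longrightarrow>
     (\<forall>r\<in>R. cmod (w r) \<le> 1) \<longrightarrow> cmod (\<Sum>s\<in>X. \<Sum>p\<in>P. \<Sum>r\<in>R. T s p r * u s * v p * w r) \<le> B)"

text \<open>Separation of variables: multiplying the coefficients of a trilinear sum by a function \<open>h\<close> of norm \<open>c\<close>
  costs only a factor \<open>c\<close>. Multipliers form an algebra closed under limits, exponentials and integrals.\<close>

definition multiplier :: "'a set \<Rightarrow> 'b set \<Rightarrow> 'c set \<Rightarrow> ('a \<Rightarrow> 'b \<Rightarrow> 'c \<Rightarrow> real) \<Rightarrow> real \<Rightarrow> bool" where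
  "multiplier X P R h c \<longleftrightarrow> (\<forall>T B. tri_bd X P R T B \<longrightarrow>
     tri_bd X P R (\<lambda>s p r. of_real (h s p r) * T s p r) (c * B))"

lemma tri_bdD:
  assumes "tri_bd X P R T B" "\<And>s. s \<in> X \<Longrightarrow> cmod (u s) \<le> 1" "\<And>p. p \<in> P \<Longrightarrow> cmod (v p) \<le> 1"
    "\<And>r. r \<in> R \<Longrightarrow> cmod (w r) \<le> 1"
  shows "cmod (\<Sum>s\<in>X. \<Sum>p\<in>P. \<Sum>r\<in>R. T s p r * u s * v p * w r) \<le> B"
  using assms unfolding tri_bd_def by blast

lemma tri_bd_nonneg: "tri_bd X P R T B \<Longrightarrow> B \<ge> 0"
  using tri_bdD[of X P R T B "\<lambda>_. 0" "\<lambda>_. 0" "\<lambda>_. 0"] by simp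

lemma tri_bd_mono: "tri_bd X P R T B \<Longrightarrow> B \<le> B' \<Longrightarrow> tri_bd X P R T B'"
  unfolding tri_bd_def by (intro allI impI, rule order_trans[of _ B]) auto

lemma multiplierD:
  "multiplier X P R h c \<Longrightarrow> tri_bd X P R T B \<Longrightarrow>
     tri_bd X P R (\<lambda>s p r. of_real (h s p r) * T s p r) (c * B)"
  by (simp add: multiplier_def)

lemma multiplier_mono:
  assumes "multiplier X P R h c" "c \<le> c'" shows "multiplier X P R h c'"
  unfolding multiplier_def
proof (intro allI impI)
  fix T B assume T: "tri_bd X P R T B"
  show "tri_bd X P R (\<lambda>s p r. of_real (h s p r) * T s p r) (c' * B)"
    by (rule tri_bd_mono[OF multiplierD[OF assms(1) T]])
       (use assms(2) tri_bd_nonneg[OF T] in \<open>simp add: mult_right_mono\<close>)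
qed

lemma multiplier_cong:
  assumes "multiplier X P R h c"
    "\<And>s p r. s \<in> X \<Longrightarrow> p \<in> P \<Longrightarrow> r \<in> R \<Longrightarrow> h s p r = h' s p r"
  shows "multiplier X P R h' c"
proof -
  have "tri_bd X P R (\<lambda>s p r. of_real (h' s p r) * T s p r) B =
        tri_bd X P R (\<lambda>s p r. of_real (h s p r) * T s p r) B" for T B
    unfolding tri_bd_def by (simp add: assms(2) cong: sum.cong)
  thus ?thesis using assms(1) unfolding multiplier_def by simp
qed

lemma multiplier_add:
  assumes "multiplier X P R h c" "multiplier X P R h' c'"
  shows "multiplier X P R (\<lambda>s p r. h s p r + h' s p r) (c + c')"
  unfolding multiplier_def
proof (intro allI impI)
  fix T B assume T: "tri_bd X P R T B"
  show "tri_bd X P R (\<lambda>s p r. of_real (h s p r + h' s p r) * T s p r) ((c + c') * B)"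
    unfolding tri_bd_def
  proof (intro allI impI)
    fix u v w assume b: "\<forall>s\<in>X. cmod (u s) \<le> 1" "\<forall>p\<in>P. cmod (v p) \<le> 1" "\<forall>r\<in>R. cmod (w r) \<le> 1"
    let ?A = "\<Sum>s\<in>X. \<Sum>p\<in>P. \<Sum>r\<in>R. of_real (h s p r) * T s p r * u s * v p * w r"
    let ?B = "\<Sum>s\<in>X. \<Sum>p\<in>P. \<Sum>r\<in>R. of_real (h' s p r) * T s p r * u s * v p * w r"
    have A: "cmod ?A \<le> c * B"
      using tri_bdD[OF multiplierD[OF assms(1) T], of u v w] b by blast
    have B: "cmod ?B \<le> c' * B"
      using tri_bdD[OF multiplierD[OF assms(2) T], of u v w] b by blast
    have "(\<Sum>s\<in>X. \<Sum>p\<in>P. \<Sum>r\<in>R. of_real (h s p r + h' s p r) * T s p r * u s * v p * w r) = ?A + ?B"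
      by (simp only: sum.distrib[symmetric] of_real_add distrib_right)
    thus "cmod (\<Sum>s\<in>X. \<Sum>p\<in>P. \<Sum>r\<in>R. of_real (h s p r + h' s p r) * T s p r * u s * v p * w r)
        \<le> (c + c') * B"
      using norm_triangle_ineq[of ?A ?B] A B by (simp only: distrib_right)
  qed
qed

lemma multiplier_mult:
  assumes "multiplier X P R h c" "multiplier X P R h' c'"
  shows "multiplier X P R (\<lambda>s p r. h s p r * h' s p r) (c * c')"
  unfolding multiplier_def
proof (intro allI impI)
  fix T B assume T: "tri_bd X P R T B"
  show "tri_bd X P R (\<lambda>s p r. of_real (h s p r * h' s p r) * T s p r) (c * c' * B)"
    using multiplierD[OF assms(1) multiplierD[OF assms(2) T]] by (simp add: mult.assoc)
qed

lemma multiplier_const: "multiplier X P R (\<lambda>_ _ _. a) \<bar>a\<bar>"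
  unfolding multiplier_def
proof (intro allI impI)
  fix T B assume T: "tri_bd X P R T B"
  show "tri_bd X P R (\<lambda>s p r. of_real a * T s p r) (\<bar>a\<bar> * B)"
    unfolding tri_bd_def
  proof (intro allI impI)
    fix u v w assume b: "\<forall>s\<in>X. cmod (u s) \<le> 1" "\<forall>p\<in>P. cmod (v p) \<le> 1" "\<forall>r\<in>R. cmod (w r) \<le> 1"
    have "(\<Sum>s\<in>X. \<Sum>p\<in>P. \<Sum>r\<in>R. of_real a * T s p r * u s * v p * w r) =
      of_real a * (\<Sum>s\<in>X. \<Sum>p\<in>P. \<Sum>r\<in>R. T s p r * u s * v p * w r)"
      by (simp add: sum_distrib_left mult.assoc)
    thus "cmod (\<Sum>s\<in>X. \<Sum>p\<in>P. \<Sum>r\<in>R. of_real a * T s p r * u s * v p * w r) \<le> \<bar>a\<bar> * B"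
      using tri_bdD[OF T, of u v w] b by (simp add: norm_mult mult_left_mono)
  qed
qed

lemma multiplier_cmult:
  "multiplier X P R h c \<Longrightarrow> multiplier X P R (\<lambda>s p r. a * h s p r) (\<bar>a\<bar> * c)"
  by (rule multiplier_mult[OF multiplier_const])

lemma multiplier_sum:
  assumes "finite I" "\<And>i. i \<in> I \<Longrightarrow> multiplier X P R (h i) (c i)"
  shows "multiplier X P R (\<lambda>s p r. \<Sum>i\<in>I. h i s p r) (\<Sum>i\<in>I. c i)"
  using assms
proof (induction I rule: finite_induct)
  case empty
  show ?case using multiplier_const[of X P R 0] by simp
next
  case (insert i I)
  thus ?case using multiplier_add[of X P R "h i" "c i" "\<lambda>s p r. \<Sum>i\<in>I. h i s p r"] by simp
qed

lemma multiplier_power: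
  assumes "multiplier X P R h c"
  shows "multiplier X P R (\<lambda>s p r. h s p r ^ n) (c ^ n)"
proof (induction n)
  case 0
  show ?case using multiplier_const[of X P R 1] by simp
next
  case (Suc n)
  show ?case using multiplier_mult[OF assms Suc] by simp
qed

lemma multiplier_lim:
  assumes "\<And>n. multiplier X P R (h n) (c n)"
    "\<And>s p r. s \<in> X \<Longrightarrow> p \<in> P \<Longrightarrow> r \<in> R \<Longrightarrow> (\<lambda>n. h n s p r) \<longlonglongrightarrow> h' s p r" "c \<longlonglongrightarrow> c'"
  shows "multiplier X P R h' c'"
  unfolding multiplier_def tri_bd_def
proof (intro allI impI)
  fix T B and u v w
  assume b: "\<forall>s\<in>X. cmod (u s) \<le> 1" "\<forall>p\<in>P. cmod (v p) \<le> 1" "\<forall>r\<in>R. cmod (w r) \<le> 1"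
  assume "\<forall>u v w. (\<forall>s\<in>X. cmod (u s) \<le> 1) \<longrightarrow> (\<forall>p\<in>P. cmod (v p) \<le> 1) \<longrightarrow>
     (\<forall>r\<in>R. cmod (w r) \<le> 1) \<longrightarrow> cmod (\<Sum>s\<in>X. \<Sum>p\<in>P. \<Sum>r\<in>R. T s p r * u s * v p * w r) \<le> B"
  hence T: "tri_bd X P R T B" unfolding tri_bd_def .
  show "cmod (\<Sum>s\<in>X. \<Sum>p\<in>P. \<Sum>r\<in>R. of_real (h' s p r) * T s p r * u s * v p * w r) \<le> c' * B"
  proof (rule LIMSEQ_le)
    show "(\<lambda>n. cmod (\<Sum>s\<in>X. \<Sum>p\<in>P. \<Sum>r\<in>R. of_real (h n s p r) * T s p r * u s * v p * w r))
       \<longlonglongrightarrow> cmod (\<Sum>s\<in>X. \<Sum>p\<in>P. \<Sum>r\<in>R. of_real (h' s p r) * T s p r * u s * v p * w r)"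
      by (intro tendsto_norm tendsto_sum tendsto_mult tendsto_of_real assms(2) tendsto_const)
    show "(\<lambda>n. c n * B) \<longlonglongrightarrow> c' * B" by (intro tendsto_mult assms(3) tendsto_const)
    show "\<exists>N. \<forall>n\<ge>N. cmod (\<Sum>s\<in>X. \<Sum>p\<in>P. \<Sum>r\<in>R. of_real (h n s p r) * T s p r * u s * v p * w r) \<le> c n * B"
      using tri_bdD[OF multiplierD[OF assms(1) T]] b by auto
  qed
qed

text \<open>The partial sums of the exponential series are multipliers whose norms are the partial
  sums for \<open>exp c\<close>. The bound ignores the sign of \<open>h\<close>, so a decaying
  exponential has to be centred before this is applied.\<close>

lemma multiplier_exp:
  assumes "multiplier X P R h c"
  shows "multiplier X P R (\<lambda>s p r. exp (h s p r)) (exp c)"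
proof (rule multiplier_lim)
  show "multiplier X P R (\<lambda>s p r. \<Sum>i<n. inverse (fact i) * h s p r ^ i) (\<Sum>i<n. inverse (fact i) * c ^ i)" for n
    by (rule multiplier_sum, simp)
       (use multiplier_cmult[OF multiplier_power[OF assms], of "inverse (fact i)" i for i] in simp)
  have *: "(\<lambda>n. \<Sum>i<n. inverse (fact i) * x ^ i) \<longlonglongrightarrow> exp x" for x :: real
    using exp_converges[of x] by (simp add: sums_def divide_inverse mult.commute)
  show "(\<lambda>n. \<Sum>i<n. inverse (fact i) * h s p r ^ i) \<longlonglongrightarrow> exp (h s p r)" for s p r by (rule *)
  show "(\<lambda>n. \<Sum>i<n. inverse (fact i) * c ^ i) \<longlonglongrightarrow> exp c" by (rule *)
qed

text \<open>A function of \<open>s\<close> alone can be merged with the test coefficient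
  \<open>u\<close>, which keeps modulus at most 1 after division by \<open>A\<close>; this is why
  \<open>tri_bd\<close> quantifies over all \<open>u\<close>, \<open>v\<close>, \<open>w\<close>.
  The division makes \<open>A = 0\<close> a separate case.\<close>

lemma multiplier_first:
  assumes "\<And>s. s \<in> X \<Longrightarrow> \<bar>a s\<bar> \<le> A" "A \<ge> 0"
  shows "multiplier X P R (\<lambda>s p r. a s) A"
  unfolding multiplier_def
proof (intro allI impI)
  fix T B
  assume T: "tri_bd X P R T B"
  show "tri_bd X P R (\<lambda>s p r. of_real (a s) * T s p r) (A * B)"
  proof (cases "A = 0")
    case True
    thus ?thesis using assms(1) by (simp add: tri_bd_def)
  next
    case False
    hence A: "A > 0" using assms(2) by simp
    show ?thesis unfolding tri_bd_def
    proof (intro allI impI)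
      fix u v w
      assume b: "\<forall>s\<in>X. cmod (u s) \<le> 1" "\<forall>p\<in>P. cmod (v p) \<le> 1" "\<forall>r\<in>R. cmod (w r) \<le> 1"
      define U where "U = (\<lambda>s. complex_of_real (a s / A) * u s)"
      have U: "cmod (U s) \<le> 1" if "s \<in> X" for s
      proof -
        have "\<bar>a s / A\<bar> \<le> 1" using assms(1)[OF that] A by (simp add: abs_divide)
        thus ?thesis using b that mult_mono[of "\<bar>a s / A\<bar>" 1 "cmod (u s)" 1]
          unfolding U_def norm_mult norm_of_real by simp
      qed
      have le: "cmod (\<Sum>s\<in>X. \<Sum>p\<in>P. \<Sum>r\<in>R. T s p r * U s * v p * w r) \<le> B"
        by (rule tri_bdD[OF T]) (use U b in auto)
      have eq: "(\<Sum>s\<in>X. \<Sum>p\<in>P. \<Sum>r\<in>R. of_real (a s) * T s p r * u s * v p * w r) =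
        of_real A * (\<Sum>s\<in>X. \<Sum>p\<in>P. \<Sum>r\<in>R. T s p r * U s * v p * w r)"
        using A by (simp add: U_def sum_distrib_left field_simps)
      show "cmod (\<Sum>s\<in>X. \<Sum>p\<in>P. \<Sum>r\<in>R. of_real (a s) * T s p r * u s * v p * w r) \<le> A * B"
        unfolding eq norm_mult norm_of_real using A le by simp
    qed
  qed
qed

lemma multiplier_second:
  assumes "\<And>p. p \<in> P \<Longrightarrow> \<bar>a p\<bar> \<le> A" "A \<ge> 0"
  shows "multiplier X P R (\<lambda>s p r. a p) A"
  unfolding multiplier_def
proof (intro allI impI)
  fix T B
  assume T: "tri_bd X P R T B"
  show "tri_bd X P R (\<lambda>s p r. of_real (a p) * T s p r) (A * B)"
  proof (cases "A = 0")
    case True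
    thus ?thesis using assms(1) by (simp add: tri_bd_def)
  next
    case False
    hence A: "A > 0" using assms(2) by simp
    show ?thesis unfolding tri_bd_def
    proof (intro allI impI)
      fix u v w
      assume b: "\<forall>s\<in>X. cmod (u s) \<le> 1" "\<forall>p\<in>P. cmod (v p) \<le> 1" "\<forall>r\<in>R. cmod (w r) \<le> 1"
      define U where "U = (\<lambda>p. complex_of_real (a p / A) * v p)"
      have U: "cmod (U p) \<le> 1" if "p \<in> P" for p
      proof -
        have "\<bar>a p / A\<bar> \<le> 1" using assms(1)[OF that] A by (simp add: abs_divide)
        thus ?thesis using b that mult_mono[of "\<bar>a p / A\<bar>" 1 "cmod (v p)" 1]
          unfolding U_def norm_mult norm_of_real by simp
      qed
      have le: "cmod (\<Sum>s\<in>X. \<Sum>p\<in>P. \<Sum>r\<in>R. T s p r * u s * U p * w r) \<le> B"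
        by (rule tri_bdD[OF T]) (use U b in auto)
      have eq: "(\<Sum>s\<in>X. \<Sum>p\<in>P. \<Sum>r\<in>R. of_real (a p) * T s p r * u s * v p * w r) =
        of_real A * (\<Sum>s\<in>X. \<Sum>p\<in>P. \<Sum>r\<in>R. T s p r * u s * U p * w r)"
        using A by (simp add: U_def sum_distrib_left field_simps)
      show "cmod (\<Sum>s\<in>X. \<Sum>p\<in>P. \<Sum>r\<in>R. of_real (a p) * T s p r * u s * v p * w r) \<le> A * B"
        unfolding eq norm_mult norm_of_real using A le by simp
    qed
  qed
qed

lemma multiplier_third:
  assumes "\<And>r. r \<in> R \<Longrightarrow> \<bar>a r\<bar> \<le> A" "A \<ge> 0"
  shows "multiplier X P R (\<lambda>s p r. a r) A"
  unfolding multiplier_def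
proof (intro allI impI)
  fix T B
  assume T: "tri_bd X P R T B"
  show "tri_bd X P R (\<lambda>s p r. of_real (a r) * T s p r) (A * B)"
  proof (cases "A = 0")
    case True
    thus ?thesis using assms(1) by (simp add: tri_bd_def)
  next
    case False
    hence A: "A > 0" using assms(2) by simp
    show ?thesis unfolding tri_bd_def
    proof (intro allI impI)
      fix u v w
      assume b: "\<forall>s\<in>X. cmod (u s) \<le> 1" "\<forall>p\<in>P. cmod (v p) \<le> 1" "\<forall>r\<in>R. cmod (w r) \<le> 1"
      define U where "U = (\<lambda>r. complex_of_real (a r / A) * w r)"
      have U: "cmod (U r) \<le> 1" if "r \<in> R" for r
      proof -
        have "\<bar>a r / A\<bar> \<le> 1" using assms(1)[OF that] A by (simp add: abs_divide)
        thus ?thesis using b that mult_mono[of "\<bar>a r / A\<bar>" 1 "cmod (w r)" 1]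
          unfolding U_def norm_mult norm_of_real by simp
      qed
      have le: "cmod (\<Sum>s\<in>X. \<Sum>p\<in>P. \<Sum>r\<in>R. T s p r * u s * v p * U r) \<le> B"
        by (rule tri_bdD[OF T]) (use U b in auto)
      have eq: "(\<Sum>s\<in>X. \<Sum>p\<in>P. \<Sum>r\<in>R. of_real (a r) * T s p r * u s * v p * w r) =
        of_real A * (\<Sum>s\<in>X. \<Sum>p\<in>P. \<Sum>r\<in>R. T s p r * u s * v p * U r)"
        using A by (simp add: U_def sum_distrib_left field_simps)
      show "cmod (\<Sum>s\<in>X. \<Sum>p\<in>P. \<Sum>r\<in>R. of_real (a r) * T s p r * u s * v p * w r) \<le> A * B"
        unfolding eq norm_mult norm_of_real using A le by simp
    qed
  qed
qed

text \<open>Minkowski's integral inequality for the multiplier norm: the trilinear sum, being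
  finite, is integrated term by term.\<close>

lemma multiplier_integral:
  fixes \<nu> :: "real \<Rightarrow> real"
  assumes fin: "finite X" "finite P" "finite R"
    and m: "\<And>u. u \<in> {a..b} \<Longrightarrow> multiplier X P R (h u) (\<nu> u)"
    and ch: "\<And>s p r. s \<in> X \<Longrightarrow> p \<in> P \<Longrightarrow> r \<in> R \<Longrightarrow> continuous_on {a..b} (\<lambda>u. h u s p r)"
    and cn: "continuous_on {a..b} \<nu>"
  shows "multiplier X P R (\<lambda>s p r. integral {a..b} (\<lambda>u. h u s p r)) (integral {a..b} \<nu>)"
  unfolding multiplier_def tri_bd_def
proof (intro allI impI)
  fix T B and u v w
  assume b: "\<forall>s\<in>X. cmod (u s) \<le> 1" "\<forall>p\<in>P. cmod (v p) \<le> 1" "\<forall>r\<in>R. cmod (w r) \<le> 1"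
  assume "\<forall>u v w. (\<forall>s\<in>X. cmod (u s) \<le> 1) \<longrightarrow> (\<forall>p\<in>P. cmod (v p) \<le> 1) \<longrightarrow>
     (\<forall>r\<in>R. cmod (w r) \<le> 1) \<longrightarrow> cmod (\<Sum>s\<in>X. \<Sum>p\<in>P. \<Sum>r\<in>R. T s p r * u s * v p * w r) \<le> B"
  hence T: "tri_bd X P R T B" unfolding tri_bd_def .
  let ?F = "\<lambda>x. \<Sum>s\<in>X. \<Sum>p\<in>P. \<Sum>r\<in>R. of_real (h x s p r) * T s p r * u s * v p * w r"
  have int: "((\<lambda>x. of_real (h x s p r) * T s p r * u s * v p * w r) has_integral
      (of_real (integral {a..b} (\<lambda>u. h u s p r)) * T s p r * u s * v p * w r)) {a..b}"
    if "s \<in> X" "p \<in> P" "r \<in> R" for s p r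
    by (intro has_integral_mult_left has_integral_of_real integrable_integral
          integrable_continuous_real ch that)
  have F: "(?F has_integral (\<Sum>s\<in>X. \<Sum>p\<in>P. \<Sum>r\<in>R.
      of_real (integral {a..b} (\<lambda>u. h u s p r)) * T s p r * u s * v p * w r)) {a..b}"
    by (intro has_integral_sum fin int)
  have "norm (\<Sum>s\<in>X. \<Sum>p\<in>P. \<Sum>r\<in>R.
      of_real (integral {a..b} (\<lambda>u. h u s p r)) * T s p r * u s * v p * w r) \<le> integral {a..b} (\<lambda>x. \<nu> x * B)"
    unfolding integral_unique[OF F, symmetric]
  proof (rule integral_norm_bound_integral)
    show "?F integrable_on {a..b}" using F by blast
    show "(\<lambda>x. \<nu> x * B) integrable_on {a..b}"
      by (intro integrable_continuous_real continuous_intros cn)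
    show "norm (?F x) \<le> \<nu> x * B" if "x \<in> {a..b}" for x
      using tri_bdD[OF multiplierD[OF m[OF that] T]] b by simp
  qed
  thus "cmod (\<Sum>s\<in>X. \<Sum>p\<in>P. \<Sum>r\<in>R.
      of_real (integral {a..b} (\<lambda>u. h u s p r)) * T s p r * u s * v p * w r) \<le> integral {a..b} \<nu> * B"
    by simp
qed

text \<open>The ratio \<open>11/10\<close> is such that \<open>(11/10) ^ 6 - 1 < 4/5\<close>: then \<open>t\<^sup>2 - t0\<^sup>2\<close> has multiplier norm at most
  \<open>4/5 t0\<^sup>2\<close>, and \<open>exp (- \<kappa> t\<^sup>2)\<close> retains the decay \<open>exp (- \<kappa> t0\<^sup>2 / 5)\<close>.\<close>

locale block =
  fixes X :: "'a set" and P :: "'b set" and R :: "'c set" and x :: "'a \<Rightarrow> real"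
    and y :: "'b \<Rightarrow> real" and z :: "'c \<Rightarrow> real" and x0 y0 z0 :: real
  assumes fin: "finite X" "finite P" "finite R"
    and pos: "x0 > 0" "y0 > 0" "z0 > 0"
    and x: "\<And>s. s \<in> X \<Longrightarrow> x0 \<le> x s \<and> x s \<le> 11/10 * x0"
    and y: "\<And>s. s \<in> P \<Longrightarrow> y0 \<le> y s \<and> y s \<le> 11/10 * y0"
    and z: "\<And>s. s \<in> R \<Longrightarrow> z0 \<le> z s \<and> z s \<le> 11/10 * z0"
begin

text \<open>The argument of the theta functions below. It has one factor per variable, which is what
  permits separation; \<open>t0\<close> is its value at the lower corner of the block.\<close>

definition t where "t s p r = x s * y p * z r"
definition t0 where "t0 = x0 * y0 * z0"

lemma t0_pos: "t0 > 0" unfolding t0_def using pos by simp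

lemma ratio: fixes w0 w :: real assumes "w0 > 0" "w0 \<le> w \<and> w \<le> 11/10 * w0"
  shows "\<bar>(w / w0)\<^sup>2 - 1\<bar> \<le> 21/100" "\<bar>(w / w0)\<^sup>2\<bar> \<le> 121/100"
proof -
  have 1: "1 \<le> w / w0" "w / w0 \<le> 11/10" using assms by (auto simp: field_simps)
  have "1 \<le> (w / w0)\<^sup>2" using 1 by simp
  moreover have "(w / w0)\<^sup>2 \<le> (11/10)\<^sup>2" using 1 by (intro power_mono) auto
  ultimately show "\<bar>(w / w0)\<^sup>2 - 1\<bar> \<le> 21/100" "\<bar>(w / w0)\<^sup>2\<bar> \<le> 121/100"
    by (auto simp: power2_eq_square)
qed

lemma mult_sq: "multiplier X P R (\<lambda>s p r. (t s p r)\<^sup>2) (2 * t0\<^sup>2)"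
proof -
  let ?a = "\<lambda>s. (x s / x0)\<^sup>2" and ?b = "\<lambda>s. (y s / y0)\<^sup>2" and ?c = "\<lambda>s. (z s / z0)\<^sup>2"
  have a: "multiplier X P R (\<lambda>s p r. ?a s) (121/100)"
    by (rule multiplier_first, use ratio pos x in auto)
  have b: "multiplier X P R (\<lambda>s p r. ?b p) (121/100)"
    by (rule multiplier_second, use ratio pos y in auto)
  have c: "multiplier X P R (\<lambda>s p r. ?c r) (121/100)"
    by (rule multiplier_third, use ratio pos z in auto)
  have "multiplier X P R (\<lambda>s p r. t0\<^sup>2 * (?a s * ?b p * ?c r)) (\<bar>t0\<^sup>2\<bar> * (121/100 * (121/100) * (121/100)))"
    by (rule multiplier_cmult[OF multiplier_mult[OF multiplier_mult[OF a b] c]])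
  hence "multiplier X P R (\<lambda>s p r. t0\<^sup>2 * (?a s * ?b p * ?c r)) (2 * t0\<^sup>2)"
    by (rule multiplier_mono) (use t0_pos in simp)
  thus ?thesis
    by (rule multiplier_cong) (use pos in \<open>simp add: t_def t0_def field_simps\<close>)
qed

text \<open>The exponential series of the whole exponent would give growth instead of decay. The
  exponent is therefore split into its value at the corner, which is a scalar factor
  \<open>exp (- \<kappa> * t0\<^sup>2)\<close>, and a deviation; only the deviation goes through
  \<open>multiplier_exp\<close>.\<close>

lemma mult_gauss:
  assumes "\<kappa> \<ge> 0"
  shows "multiplier X P R (\<lambda>s p r. exp (- (\<kappa> * (t s p r)\<^sup>2))) (exp (- (\<kappa> * t0\<^sup>2 / 5)))"
proof -
  let ?a = "\<lambda>s. (x s / x0)\<^sup>2" and ?b = "\<lambda>s. (y s / y0)\<^sup>2" and ?c = "\<lambda>s. (z s / z0)\<^sup>2"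
  have a: "multiplier X P R (\<lambda>s p r. ?a s) (121/100)" and a1: "multiplier X P R (\<lambda>s p r. ?a s - 1) (21/100)"
    by (rule multiplier_first, use ratio pos x in auto)+
  have b: "multiplier X P R (\<lambda>s p r. ?b p) (121/100)" and b1: "multiplier X P R (\<lambda>s p r. ?b p - 1) (21/100)"
    by (rule multiplier_second, use ratio pos y in auto)+
  have c1: "multiplier X P R (\<lambda>s p r. ?c r - 1) (21/100)"
    by (rule multiplier_third, use ratio pos z in auto)
  \<comment> \<open>The telescoping form of \<open>a * b * c - 1\<close>; its norm is
    \<open>21/100 * (1 + 121/100 + (121/100)\<^sup>2)\<close>, which is below 4/5.\<close>
  have "multiplier X P R (\<lambda>s p r. (?a s - 1) + (?a s * (?b p - 1) + ?a s * ?b p * (?c r - 1)))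
     (21/100 + (121/100 * (21/100) + 121/100 * (121/100) * (21/100)))"
    by (intro multiplier_add multiplier_mult[OF a b1] multiplier_mult[OF multiplier_mult[OF a b] c1] a1)
  hence "multiplier X P R (\<lambda>s p r. (?a s - 1) + (?a s * (?b p - 1) + ?a s * ?b p * (?c r - 1))) (4/5)"
    by (rule multiplier_mono) simp
  hence "multiplier X P R (\<lambda>s p r. exp (- \<kappa> * t0\<^sup>2) * exp ((- \<kappa> * t0\<^sup>2) *
     ((?a s - 1) + (?a s * (?b p - 1) + ?a s * ?b p * (?c r - 1)))))
     (\<bar>exp (- \<kappa> * t0\<^sup>2)\<bar> * exp (\<bar>- \<kappa> * t0\<^sup>2\<bar> * (4/5)))"
    by (intro multiplier_cmult multiplier_exp)
  also have "\<bar>exp (- \<kappa> * t0\<^sup>2)\<bar> * exp (\<bar>- \<kappa> * t0\<^sup>2\<bar> * (4/5)) = exp (- (\<kappa> * t0\<^sup>2 / 5))"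
    using assms by (simp add: exp_add[symmetric] abs_mult)
  finally show ?thesis
  proof (rule multiplier_cong)
    fix s p r assume "s \<in> X" "p \<in> P" "r \<in> R"
    have "t0\<^sup>2 * (?a s * ?b p * ?c r) = (t s p r)\<^sup>2"
      using pos by (simp add: t_def t0_def field_simps)
    hence "- \<kappa> * t0\<^sup>2 + (- \<kappa> * t0\<^sup>2) * ((?a s - 1) + (?a s * (?b p - 1) + ?a s * ?b p * (?c r - 1)))
      = - (\<kappa> * (t s p r)\<^sup>2)"
      by (simp add: algebra_simps)
    thus "exp (- \<kappa> * t0\<^sup>2) * exp ((- \<kappa> * t0\<^sup>2) *
     ((?a s - 1) + (?a s * (?b p - 1) + ?a s * ?b p * (?c r - 1)))) = exp (- (\<kappa> * (t s p r)\<^sup>2))"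
      by (simp add: exp_add[symmetric])
  qed
qed

lemma mult_inv_sqrt: "multiplier X P R (\<lambda>s p r. 1 / sqrt (t s p r)) (1 / sqrt t0)"
proof -
  have *: "\<bar>1 / sqrt w\<bar> \<le> 1 / sqrt w0 \<and> 0 \<le> 1 / sqrt w0" if "w0 > 0" "w0 \<le> w \<and> w \<le> 11/10 * w0" for w w0 :: real
    using that by (simp add: frac_le)
  have "multiplier X P R (\<lambda>s p r. 1 / sqrt (x s) * (1 / sqrt (y p)) * (1 / sqrt (z r)))
     (1 / sqrt x0 * (1 / sqrt y0) * (1 / sqrt z0))"
    by (rule multiplier_mult[OF multiplier_mult[OF multiplier_first multiplier_second] multiplier_third])
       (use *[OF pos(1) x] *[OF pos(2) y] *[OF pos(3) z] pos in \<open>auto simp del: abs_divide\<close>)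
  thus ?thesis unfolding t_def t0_def by (simp add: real_sqrt_mult)
qed

end

section \<open>The quartic theta sum, its main term and its remainder\<close>

definition quartic_int :: "real \<Rightarrow> real" where
  "quartic_int x = integral {0..x} (\<lambda>v. exp (- (pi * v ^ 4)))"

text \<open>Since \<open>2 * v\<^sup>2 \<le> 1 + v ^ 4\<close>, the integrand is at most
  \<open>2 / (1 + v\<^sup>2)\<close>, whose integral over the half line is
  \<open>pi\<close>.\<close>

lemma quartic_int_le_pi: "quartic_int x \<le> pi" 
proof (cases "x \<ge> 0")
  case True
  have "quartic_int x \<le> integral {0..x} (\<lambda>v. 2 * inverse (1 + v\<^sup>2))"
    unfolding quartic_int_def
  proof (rule integral_le)
    show "(\<lambda>v. exp (- (pi * v ^ 4))) integrable_on {0..x}"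
      by (intro integrable_continuous_real continuous_intros)
    show "(\<lambda>v. 2 * inverse (1 + v\<^sup>2)) integrable_on {0..x}"
      by (intro integrable_continuous_real continuous_intros) (auto simp: add_nonneg_eq_0_iff)
    fix v :: real
    have "1 + v\<^sup>2 \<le> 2 * (1 + pi * v ^ 4)"
    proof -
      have "0 \<le> (v\<^sup>2 - 1)\<^sup>2" by simp
      hence "2 * v\<^sup>2 \<le> 1 + v ^ 4" by (simp add: power2_eq_square power4_eq_xxxx algebra_simps)
      moreover have "v ^ 4 \<le> pi * v ^ 4" using pi_gt3 by (simp add: mult_le_cancel_right1)
      moreover have "0 \<le> v ^ 4" by simp
      moreover have "2 * (1 + pi * v ^ 4) = 2 + 2 * (pi * v ^ 4)" by simp
      ultimately show ?thesis by linarith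
    qed
    also have "1 + pi * v ^ 4 \<le> exp (pi * v ^ 4)" by (rule exp_ge_add_one_self)
    finally have *: "1 + v\<^sup>2 \<le> 2 * exp (pi * v ^ 4)" by simp
    have "0 < 1 + v\<^sup>2" by (simp add: add_pos_nonneg)
    hence "inverse (exp (pi * v ^ 4)) \<le> 2 * inverse (1 + v\<^sup>2)"
      using * by (simp add: field_simps)
    thus "exp (- (pi * v ^ 4)) \<le> 2 * inverse (1 + v\<^sup>2)"
      by (simp add: exp_minus)
  qed
  also have "\<dots> = 2 * arctan x - 2 * arctan 0"
  proof (rule integral_unique[OF fundamental_theorem_of_calculus[OF True]])
    fix v :: real
    show "((\<lambda>v. 2 * arctan v) has_vector_derivative 2 * inverse (1 + v\<^sup>2)) (at v within {0..x})"
      by (auto intro!: derivative_eq_intros simp flip: has_real_derivative_iff_has_vector_derivative)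
  qed
  also have "\<dots> \<le> pi" using arctan_bounded[of x] by simp
  finally show ?thesis .
qed (use pi_gt_zero in \<open>auto simp: quartic_int_def less_imp_le\<close>)

lemma quartic_int_mono: assumes "0 \<le> x" "x \<le> y" shows "quartic_int x \<le> quartic_int y"
  unfolding quartic_int_def
  by (rule integral_subset_le) (use assms in \<open>auto intro!: integrable_continuous_real continuous_intros\<close>)

lemma quartic_int_limit: "\<exists>I. (quartic_int \<longlongrightarrow> I) at_top \<and> 0 \<le> I \<and> I \<le> pi"
proof -
  define I where "I = (SUP x\<in>{0..}. quartic_int x)"
  have bdd: "bdd_above (quartic_int ` {0..})" using quartic_int_le_pi by (intro bdd_aboveI2)
  have up: "quartic_int x \<le> I" if "x \<ge> 0" for x unfolding I_def by (rule cSUP_upper[OF _ bdd]) (use that in simp)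
  have "(quartic_int \<longlongrightarrow> I) at_top"
  proof (rule order_tendstoI)
    fix a assume "a < I"
    then obtain x where x: "x \<ge> 0" "a < quartic_int x"
      unfolding I_def using less_cSUP_iff[OF _ bdd, of a] by auto
    show "\<forall>\<^sub>F x in at_top. a < quartic_int x"
      using eventually_ge_at_top[of x] by eventually_elim (use x quartic_int_mono[of x] in fastforce)
  next
    fix a assume "I < a"
    show "\<forall>\<^sub>F x in at_top. quartic_int x < a"
      using eventually_ge_at_top[of 0] by eventually_elim (use up \<open>I < a\<close> in fastforce)
  qed
  moreover have "I \<le> pi" unfolding I_def by (rule cSUP_least) (auto intro: quartic_int_le_pi)
  moreover have "0 \<le> I" using up[of 0] by (simp add: quartic_int_def)
  ultimately show ?thesis by blast
qed

text \<open>The integral of \<open>exp (- (pi * v ^ 4))\<close> over the half line. It multiplies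
  main terms that later cancel against each other, so only its range is recorded.\<close>

definition quartic_const :: real where
  "quartic_const = (SOME I. (quartic_int \<longlongrightarrow> I) at_top \<and> 0 \<le> I \<and> I \<le> pi)"

lemma quartic_const: "(quartic_int \<longlongrightarrow> quartic_const) at_top" "0 \<le> quartic_const" "quartic_const \<le> pi"
  using someI_ex[OF quartic_int_limit] unfolding quartic_const_def by auto

text \<open>The Gaussian weight at \<open>m = s * h\<^sup>2\<close> is quartic in \<open>h\<close>;
  this is the resulting sum over all \<open>h \<ge> 1\<close>, with \<open>t\<close> proportional to
  \<open>s\<close>.\<close>

definition qtheta :: "real \<Rightarrow> real" where
  "qtheta t = (\<Sum>k. exp (- (pi * t\<^sup>2 * real (Suc k) ^ 4)))"

definition qerr :: "real \<Rightarrow> real" where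
  "qerr t = qtheta t - quartic_const / sqrt t"

lemma qscale:
  assumes "a > 0" "n \<ge> 0"
  shows "integral {0..n} (\<lambda>u. exp (- (pi * a\<^sup>2 * u ^ 4))) = quartic_int (sqrt a * n) / sqrt a"
proof -
  have s: "sqrt a > 0" using assms by simp
  have "((\<lambda>v. exp (- (pi * v ^ 4))) has_integral quartic_int (sqrt a * n)) (cbox (sqrt a * 0 + 0) (sqrt a * n + 0))"
    unfolding quartic_int_def cbox_interval by (simp, intro integrable_integral integrable_continuous_real continuous_intros)
  from has_integral_affinity[OF this, of "sqrt a" 0] s
  have "((\<lambda>u. exp (- (pi * (sqrt a * u) ^ 4))) has_integral quartic_int (sqrt a * n) / sqrt a) {0..n}"
    using assms by (simp add: field_simps)
  moreover have "(sqrt a * u) ^ 4 = a\<^sup>2 * u ^ 4" for u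
    using assms by (simp add: power_mult_distrib power4_eq_xxxx power2_eq_square)
  ultimately show ?thesis by (simp add: integral_unique mult.assoc)
qed

lemma qtheta_summable: assumes "t > 0" shows "summable (\<lambda>k. exp (- (pi * t\<^sup>2 * real (Suc k) ^ 4)))"
proof (rule summable_comparison_test')
  show "summable (\<lambda>k. exp (- (pi * t\<^sup>2)) ^ Suc k)"
    unfolding summable_Suc_iff using assms by (intro summable_geometric) simp
  fix k :: nat
  have "real (Suc k) ^ 1 \<le> real (Suc k) ^ 4" by (intro power_increasing) auto
  hence "pi * t\<^sup>2 * real (Suc k) \<le> pi * t\<^sup>2 * real (Suc k) ^ 4"
    by (intro mult_left_mono) auto
  thus "norm (exp (- (pi * t\<^sup>2 * real (Suc k) ^ 4))) \<le> exp (- (pi * t\<^sup>2)) ^ Suc k"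
    by (simp only: exp_of_nat_mult[symmetric] norm_exp exp_le_cancel_iff) (simp add: mult_ac)
qed

lemma qtheta_LIMSEQ:
  assumes "t > 0"
  shows "(\<lambda>n. \<Sum>k<n. exp (- (pi * t\<^sup>2 * real (Suc k) ^ 4))) \<longlonglongrightarrow> qtheta t"
  unfolding qtheta_def using qtheta_summable[OF assms] by (rule summable_LIMSEQ)

lemma qerr_LIMSEQ:
  assumes "t > 0"
  shows "(\<lambda>n. (\<Sum>k<n. exp (- (pi * t\<^sup>2 * real (Suc k) ^ 4))) -
      integral {0..real n} (\<lambda>u. exp (- (pi * t\<^sup>2 * u ^ 4)))) \<longlonglongrightarrow> qerr t"
  unfolding qerr_def
proof (rule tendsto_diff[OF qtheta_LIMSEQ[OF assms]])
  have "filterlim (\<lambda>n. sqrt t * real n) at_top sequentially"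
    using assms by (intro filterlim_tendsto_pos_mult_at_top[OF tendsto_const]) (auto simp: filterlim_real_sequentially)
  hence "(\<lambda>n. quartic_int (sqrt t * real n)) \<longlonglongrightarrow> quartic_const"
    by (rule filterlim_compose[OF quartic_const(1)])
  hence "(\<lambda>n. quartic_int (sqrt t * real n) / sqrt t) \<longlonglongrightarrow> quartic_const / sqrt t"
    by (intro tendsto_divide tendsto_const) (use assms in auto)
  thus "(\<lambda>n. integral {0..real n} (\<lambda>u. exp (- (pi * t\<^sup>2 * u ^ 4)))) \<longlonglongrightarrow> quartic_const / sqrt t"
    by (simp add: qscale[OF assms])
qed

text \<open>Euler-Maclaurin of first order: on each unit interval the derivative of
  \<open>(u - k) * g u\<close> is integrated, where \<open>g\<close> is the summand. The dependence
  on \<open>t\<close> is collected in \<open>t\<^sup>2 * exp (- (pi * u ^ 4 * t\<^sup>2))\<close>,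
  whose multiplier norm is known at every fixed \<open>u\<close>.\<close>

lemma sum_minus_integral:
  fixes t :: real
  shows "(\<Sum>k<n. exp (- (pi * t\<^sup>2 * real (Suc k) ^ 4))) - integral {0..real n} (\<lambda>u. exp (- (pi * t\<^sup>2 * u ^ 4)))
   = (\<Sum>k<n. integral {real k..real (Suc k)} (\<lambda>u. (u - real k) * (-4 * pi * u ^ 3) * (t\<^sup>2 * exp (- (pi * u ^ 4 * t\<^sup>2)))))"
proof (induction n)
  case (Suc n)
  let ?g = "\<lambda>u::real. exp (- (pi * t\<^sup>2 * u ^ 4))"
  let ?h = "\<lambda>u. (u - real n) * (-4 * pi * u ^ 3) * (t\<^sup>2 * exp (- (pi * u ^ 4 * t\<^sup>2)))"
  have "((\<lambda>u. ?g u + ?h u) has_integral ((real (Suc n) - real n) * ?g (real (Suc n)) - (real n - real n) * ?g (real n)))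
     {real n..real (Suc n)}"
    by (rule fundamental_theorem_of_calculus)
       (auto intro!: derivative_eq_intros simp: algebra_simps simp flip: has_real_derivative_iff_has_vector_derivative)
  hence "integral {real n..real (Suc n)} (\<lambda>u. ?g u + ?h u) = ?g (real (Suc n))" by (simp add: integral_unique)
  moreover have "integral {real n..real (Suc n)} (\<lambda>u. ?g u + ?h u) =
     integral {real n..real (Suc n)} ?g + integral {real n..real (Suc n)} ?h"
    by (intro integral_add integrable_continuous_real continuous_intros)
  moreover have "integral {0..real (Suc n)} ?g = integral {0..real n} ?g + integral {real n..real (Suc n)} ?g"
    by (rule Henstock_Kurzweil_Integration.integral_combine[symmetric])
           (auto intro!: integrable_continuous_real continuous_intros)
  ultimately show ?case using Suc by simp
qed simp

context block begin

lemma t_pos: "s \<in> X \<Longrightarrow> p \<in> P \<Longrightarrow> r \<in> R \<Longrightarrow> t s p r > 0"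
  unfolding t_def using x[of s] y[of p] z[of r] pos by (auto intro!: mult_pos_pos)

text \<open>The bound for small \<open>t0\<close>. The norms of the Euler-Maclaurin integrands have
  the antiderivative \<open>- 10 * exp (- (pi * u ^ 4 * t0\<^sup>2 / 5))\<close>, so their total is
  at most 10, whatever \<open>t0\<close> is.\<close>

lemma mult_qerr: "multiplier X P R (\<lambda>s p r. qerr (t s p r)) 10"
proof (rule multiplier_lim)
  let ?\<nu> = "\<lambda>u. 4 * pi * \<bar>u\<bar> ^ 3 * (2 * t0\<^sup>2 * exp (- (pi * u ^ 4 * t0\<^sup>2 / 5)))"
  show "multiplier X P R (\<lambda>s p r. (\<Sum>k<n. exp (- (pi * (t s p r)\<^sup>2 * real (Suc k) ^ 4))) -
      integral {0..real n} (\<lambda>u. exp (- (pi * (t s p r)\<^sup>2 * u ^ 4)))) 10" for n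
  proof -
    have "multiplier X P R (\<lambda>s p r. \<Sum>k<n. integral {real k..real (Suc k)}
        (\<lambda>u. (u - real k) * (-4 * pi * u ^ 3) * ((t s p r)\<^sup>2 * exp (- (pi * u ^ 4 * (t s p r)\<^sup>2)))))
        (\<Sum>k<n. integral {real k..real (Suc k)} ?\<nu>)"
    proof (intro multiplier_sum multiplier_integral fin finite_lessThan)
      fix k :: nat and u assume u: "u \<in> {real k..real (Suc k)}"
      have m: "multiplier X P R (\<lambda>s p r. ((u - real k) * (-4 * pi * u ^ 3)) * ((t s p r)\<^sup>2 * exp (- (pi * u ^ 4 * (t s p r)\<^sup>2))))
        (\<bar>(u - real k) * (-4 * pi * u ^ 3)\<bar> * (2 * t0\<^sup>2 * exp (- (pi * u ^ 4 * t0\<^sup>2 / 5))))"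
        by (intro multiplier_cmult multiplier_mult mult_sq mult_gauss) simp
      have "\<bar>(u - real k) * (-4 * pi * u ^ 3)\<bar> \<le> 4 * pi * \<bar>u\<bar> ^ 3"
      proof -
        have "\<bar>(u - real k) * (-4 * pi * u ^ 3)\<bar> = \<bar>u - real k\<bar> * (4 * pi * \<bar>u\<bar> ^ 3)"
          by (simp add: abs_mult power_abs)
        also have "\<dots> \<le> 1 * (4 * pi * \<bar>u\<bar> ^ 3)" using u by (intro mult_right_mono) auto
        finally show ?thesis by simp
      qed
      thus "multiplier X P R (\<lambda>s p r. (u - real k) * (-4 * pi * u ^ 3) * ((t s p r)\<^sup>2 * exp (- (pi * u ^ 4 * (t s p r)\<^sup>2)))) (?\<nu> u)"
        by (intro multiplier_mono[OF m] mult_right_mono) auto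
    qed (auto intro!: continuous_intros)
    moreover have "(\<Sum>k<n. integral {real k..real (Suc k)} ?\<nu>) \<le> 10"
    proof -
      have "(\<Sum>k<n. integral {real k..real (Suc k)} ?\<nu>) = 10 - 10 * exp (- (pi * real n ^ 4 * t0\<^sup>2 / 5))"
      proof (induction n)
        case (Suc n)
        have "((\<lambda>u. 4 * pi * u ^ 3 * (2 * t0\<^sup>2 * exp (- (pi * u ^ 4 * t0\<^sup>2 / 5)))) has_integral
          (- 10 * exp (- (pi * real (Suc n) ^ 4 * t0\<^sup>2 / 5)) - (- 10 * exp (- (pi * real n ^ 4 * t0\<^sup>2 / 5))))) {real n..real (Suc n)}"
          by (rule fundamental_theorem_of_calculus)
             (auto intro!: derivative_eq_intros simp: algebra_simps simp flip: has_real_derivative_iff_has_vector_derivative)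
        moreover have "integral {real n..real (Suc n)} ?\<nu> = integral {real n..real (Suc n)}
            (\<lambda>u. 4 * pi * u ^ 3 * (2 * t0\<^sup>2 * exp (- (pi * u ^ 4 * t0\<^sup>2 / 5))))"
          by (rule integral_cong) auto
        ultimately have "integral {real n..real (Suc n)} ?\<nu> =
          - 10 * exp (- (pi * real (Suc n) ^ 4 * t0\<^sup>2 / 5)) - (- 10 * exp (- (pi * real n ^ 4 * t0\<^sup>2 / 5)))"
          by (simp only: integral_unique)
        thus ?case using Suc by simp
      qed simp
      thus ?thesis by simp
    qed
    ultimately show ?thesis unfolding sum_minus_integral by (rule multiplier_mono)
  qed
  show "(\<lambda>n. (\<Sum>k<n. exp (- (pi * (t s p r)\<^sup>2 * real (Suc k) ^ 4))) -
      integral {0..real n} (\<lambda>u. exp (- (pi * (t s p r)\<^sup>2 * u ^ 4)))) \<longlonglongrightarrow> qerr (t s p r)"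
    if "s \<in> X" "p \<in> P" "r \<in> R" for s p r using t_pos[OF that] by (rule qerr_LIMSEQ)
  show "(\<lambda>n::nat. 10::real) \<longlonglongrightarrow> 10" by simp
qed

lemma qtheta_partial_le:
  assumes "a > 0"
  shows "(\<Sum>k<n. exp (- (pi * a\<^sup>2 * real (Suc k) ^ 4))) \<le> pi / sqrt a"
proof -
  let ?g = "\<lambda>u::real. exp (- (pi * a\<^sup>2 * u ^ 4))"
  have "(\<Sum>k<n. ?g (real (Suc k))) \<le> integral {0..real n} ?g"
  proof (induction n)
    case (Suc n)
    have "integral {real n..real (Suc n)} (\<lambda>_. ?g (real (Suc n))) \<le> integral {real n..real (Suc n)} ?g"
    proof (rule integral_le)
      fix u assume u: "u \<in> {real n..real (Suc n)}"
      have "u ^ 4 \<le> real (Suc n) ^ 4" using u by (intro power_mono) auto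
      thus "?g (real (Suc n)) \<le> ?g u" by (simp add: mult_left_mono)
    qed (auto intro!: integrable_continuous_real continuous_intros)
    moreover have "integral {0..real (Suc n)} ?g = integral {0..real n} ?g + integral {real n..real (Suc n)} ?g"
      by (rule Henstock_Kurzweil_Integration.integral_combine[symmetric])
           (auto intro!: integrable_continuous_real continuous_intros)
    ultimately show ?case using Suc by simp
  qed simp
  also have "\<dots> = quartic_int (sqrt a * n) / sqrt a" using assms by (simp add: qscale)
  also have "\<dots> \<le> pi / sqrt a" using assms by (intro divide_right_mono quartic_int_le_pi) auto
  finally show ?thesis .
qed

text \<open>The bound for large \<open>t0\<close>. Here the theta sum and its main term are not
  compared; each of them alone is at most a multiple of \<open>1 / sqrt t0\<close>.\<close>

lemma mult_qerr': "multiplier X P R (\<lambda>s p r. qerr (t s p r)) (10 / sqrt t0)"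
proof -
  have "multiplier X P R (\<lambda>s p r. qtheta (t s p r)) (3/2 * pi / sqrt t0)"
  proof (rule multiplier_lim)
    show "multiplier X P R (\<lambda>s p r. \<Sum>k<n. exp (- (pi * (t s p r)\<^sup>2 * real (Suc k) ^ 4))) (3/2 * pi / sqrt t0)" for n
    proof -
      have m: "multiplier X P R (\<lambda>s p r. \<Sum>k<n. exp (- (pi * real (Suc k) ^ 4 * (t s p r)\<^sup>2)))
        (\<Sum>k<n. exp (- (pi * real (Suc k) ^ 4 * t0\<^sup>2 / 5)))"
        by (intro multiplier_sum mult_gauss) auto
      have "(\<Sum>k<n. exp (- (pi * real (Suc k) ^ 4 * t0\<^sup>2 / 5))) \<le> pi / sqrt (t0 / sqrt 5)"
        using qtheta_partial_le[of "t0 / sqrt 5" n] t0_pos by (simp add: power_divide mult_ac)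
      \<comment> \<open>The fourth root of 5 is the price of the factor 1/5 in the exponent of
        \<open>mult_gauss\<close>; it is at most 3/2.\<close>
      also have "pi / sqrt (t0 / sqrt 5) \<le> 3/2 * pi / sqrt t0"
      proof -
        have "sqrt 5 \<le> (3/2)\<^sup>2"
          by (rule real_le_lsqrt) (auto simp: power2_eq_square)
        hence "sqrt (sqrt 5) \<le> 3/2" by (rule real_le_lsqrt[rotated]) simp
        hence "pi * sqrt (sqrt 5) / sqrt t0 \<le> pi * (3/2) / sqrt t0"
          using t0_pos by (intro divide_right_mono mult_left_mono) auto
        thus ?thesis by (simp add: real_sqrt_divide mult_ac)
      qed
      finally show ?thesis by (rule multiplier_cong[OF multiplier_mono[OF m]]) (simp add: mult_ac)
    qed
    show "(\<lambda>n. \<Sum>k<n. exp (- (pi * (t s p r)\<^sup>2 * real (Suc k) ^ 4))) \<longlonglongrightarrow> qtheta (t s p r)"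
      if "s \<in> X" "p \<in> P" "r \<in> R" for s p r using t_pos[OF that] by (rule qtheta_LIMSEQ)
  qed simp
  from multiplier_add[OF this multiplier_cmult[OF mult_inv_sqrt, of "- quartic_const"]]
  have "multiplier X P R (\<lambda>s p r. qerr (t s p r)) (3/2 * pi / sqrt t0 + \<bar>- quartic_const\<bar> * (1 / sqrt t0))"
    by (simp add: qerr_def)
  moreover have "3/2 * pi / sqrt t0 + \<bar>- quartic_const\<bar> * (1 / sqrt t0) \<le> 10 / sqrt t0"
  proof -
    have "3/2 * pi + quartic_const \<le> 10" using quartic_const(3) pi_less_4 by linarith
    hence "(3/2 * pi + quartic_const) / sqrt t0 \<le> 10 / sqrt t0"
      using t0_pos by (intro divide_right_mono) auto
    thus ?thesis using quartic_const(2) by (simp add: add_divide_distrib)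
  qed
  ultimately show ?thesis by (rule multiplier_mono)
qed

end

section \<open>Poisson summation for the Gaussian\<close>

lemma cos_integral_int:
  "((\<lambda>x. cos (2 * pi * of_int k * x)) has_integral (if k = 0 then 1 else 0)) {0..1::real}" for k :: int
proof (cases "k = 0")
  case True
  have "((\<lambda>x. 1::real) has_integral 1) {0..1::real}"
    using has_integral_const_real[of "1::real" 0 1] by simp
  thus ?thesis using True by simp
next
  case False
  define K where "K = 2 * pi * of_int k"
  have K: "K \<noteq> 0" using False by (simp add: K_def)
  have "((\<lambda>x. cos (K * x)) has_integral (sin (K * 1) / K - sin (K * 0) / K)) {0..1::real}"
  proof (rule fundamental_theorem_of_calculus)
    fix x :: real
    have "((\<lambda>x. sin (K * x) / K) has_real_derivative cos (K * x)) (at x within {0..1})"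
      using K by (auto intro!: derivative_eq_intros)
    thus "((\<lambda>x. sin (K * x) / K) has_vector_derivative cos (K * x)) (at x within {0..1})"
      by (simp add: has_real_derivative_iff_has_vector_derivative)
  qed simp
  moreover have "sin K = 0" unfolding K_def by (rule sin_int_2pin)
  ultimately show ?thesis using False by (simp add: K_def)
qed

lemma cos_cos_integral:
  "((\<lambda>x. cos (2 * pi * of_int b * x) * cos (2 * pi * real n * x)) has_integral
     ((if b = int n then 1 else 0) + (if b = - int n then 1 else 0)) / 2) {0..1::real}"
proof -
  have "((\<lambda>x. (cos (2 * pi * of_int (b - int n) * x) + cos (2 * pi * of_int (b + int n) * x)) / 2) has_integral
     ((if b - int n = 0 then 1 else 0) + (if b + int n = 0 then 1 else 0)) / 2) {0..1::real}"
    by (rule has_integral_divide[OF has_integral_add[OF cos_integral_int cos_integral_int]])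
  moreover have "(\<lambda>x. (cos (2 * pi * of_int (b - int n) * x) + cos (2 * pi * of_int (b + int n) * x)) / 2) =
     (\<lambda>x. cos (2 * pi * of_int b * x) * cos (2 * pi * real n * x))"
    by (rule ext) (simp add: cos_times_cos ring_distribs)
  ultimately show ?thesis by (simp add: eq_neg_iff_add_eq_0)
qed

text \<open>A continuous even function is a continuous function of \<open>cos (2 \<pi> x)\<close>, hence a uniform limit of
  polynomials in it.\<close>

lemma cosine_coefficients_zero:
  fixes h :: "real \<Rightarrow> real"
  assumes cont: "continuous_on {0..1} h" and sym: "\<And>x. x \<in> {0..1} \<Longrightarrow> h (1 - x) = h x"
    and coeff: "\<And>n. integral {0..1} (\<lambda>x. h x * cos (2 * pi * real n * x)) = 0"
    and x: "x \<in> {0..1}"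
  shows "h x = 0"
proof -
  \<comment> \<open>The product formula for cosines reduces integrals against powers of
    \<open>cos (2 * pi * x)\<close> to the given coefficients, one power at a time.\<close>
  have pow: "integral {0..1} (\<lambda>x. h x * (cos (2 * pi * x) ^ i * cos (2 * pi * real n * x))) = 0" for i n
  proof (induction i arbitrary: n)
    case 0
    show ?case using coeff[of n] by simp
  next
    case (Suc i)
    \<comment> \<open>At \<open>n = 0\<close> the two cosines of the product formula coincide
      because the cosine is even, so 1 takes the place of \<open>n - 1\<close>.\<close>
    define m where "m = (if n = 0 then 1 else n - 1)"
    have c: "cos (2 * pi * y) * cos (2 * pi * real n * y) =
       (cos (2 * pi * real m * y) + cos (2 * pi * real (Suc n) * y)) / 2" for y
    proof (cases n)
      case (Suc k)
      have "cos (2 * pi * y - 2 * pi * real n * y) = cos (2 * pi * real k * y)"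
        using cos_minus[of "2 * pi * real k * y"] by (simp add: Suc algebra_simps)
      thus ?thesis by (simp add: cos_times_cos m_def Suc algebra_simps)
    qed (simp add: m_def)
    have "(\<lambda>x. h x * (cos (2 * pi * x) ^ Suc i * cos (2 * pi * real n * x))) =
      (\<lambda>x. (h x * (cos (2 * pi * x) ^ i * cos (2 * pi * real m * x)) +
            h x * (cos (2 * pi * x) ^ i * cos (2 * pi * real (Suc n) * x))) / 2)"
    proof
      fix x
      have "h x * (cos (2 * pi * x) ^ Suc i * cos (2 * pi * real n * x)) =
         h x * cos (2 * pi * x) ^ i * (cos (2 * pi * x) * cos (2 * pi * real n * x))" by simp
      thus "h x * (cos (2 * pi * x) ^ Suc i * cos (2 * pi * real n * x)) =
        (h x * (cos (2 * pi * x) ^ i * cos (2 * pi * real m * x)) +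
            h x * (cos (2 * pi * x) ^ i * cos (2 * pi * real (Suc n) * x))) / 2"
        unfolding c by (simp add: algebra_simps add_divide_distrib)
    qed
    moreover have "(\<lambda>x. h x * (cos (2 * pi * x) ^ i * cos (2 * pi * real k * x))) integrable_on {0..1}" for k
      by (intro integrable_continuous_real continuous_intros cont)
    ultimately show ?case using Suc by (simp add: integral_add del: of_nat_Suc)
  qed
  \<comment> \<open>\<open>h\<close> as a function of the cosine: the symmetry makes the half
    interval up to 1/2, on which \<open>arccos\<close> inverts, sufficient.\<close>
  define \<phi> where "\<phi> t = h (arccos t / (2 * pi))" for t
  have "continuous_on {-1..1} \<phi>" unfolding \<phi>_def
  proof (rule continuous_on_compose2[OF cont])
    show "continuous_on {-1..1} (\<lambda>t. arccos t / (2 * pi))"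
      by (intro continuous_intros) auto
    show "(\<lambda>t. arccos t / (2 * pi)) ` {- 1..1} \<subseteq> {0..1}"
    proof
      fix y assume "y \<in> (\<lambda>t. arccos t / (2 * pi)) ` {- 1..1}"
      then obtain t where t: "t \<in> {-1..1}" "y = arccos t / (2 * pi)" by blast
      have "0 \<le> arccos t" "arccos t \<le> pi" using t arccos_bounded[of t] by auto
      moreover have "arccos t / (2 * pi) \<le> 1" using \<open>arccos t \<le> pi\<close> pi_gt_zero by (subst divide_le_eq_1_pos) linarith+
      ultimately show "y \<in> {0..1}" unfolding t(2) by simp
    qed
  qed
  have \<phi>: "\<phi> (cos (2 * pi * x)) = h x" if x: "x \<in> {0..1}" for x
  proof (cases "x \<le> 1/2")
    case True
    hence "2 * pi * x \<le> pi" using mult_left_mono[of x "1/2" "2 * pi"] by simp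
    thus ?thesis using x by (simp add: \<phi>_def arccos_cos)
  next
    case False
    hence "2 * pi * (1 - x) \<le> pi" using mult_left_mono[of "1 - x" "1/2" "2 * pi"] by simp
    moreover have "cos (2 * pi * x) = cos (2 * pi * (1 - x))"
      by (simp add: algebra_simps cos_diff)
    ultimately show ?thesis using x sym[OF x] by (simp add: \<phi>_def arccos_cos)
  qed
  have hi: "(\<lambda>x. \<bar>h x\<bar>) integrable_on {0..1}" "(\<lambda>x. (h x)\<^sup>2) integrable_on {0..1}"
    by (intro integrable_continuous_real continuous_intros cont)+
  define J where "J = integral {0..1} (\<lambda>x. \<bar>h x\<bar>)"
  have J: "J \<ge> 0" unfolding J_def by (intro integral_nonneg hi) auto
  \<comment> \<open>\<open>h\<close> times a polynomial \<open>g\<close> in the cosine has integral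
    0, so the integral of \<open>h\<^sup>2\<close> equals that of \<open>h\<close> times
    \<open>\<phi> - g\<close> at the cosine, which uniform approximation makes small.\<close>
  have small: "integral {0..1} (\<lambda>x. (h x)\<^sup>2) \<le> e * J" if e: "e > 0" for e
  proof -
    obtain g where g: "real_polynomial_function g" "\<And>t. t \<in> {-1..1} \<Longrightarrow> \<bar>\<phi> t - g t\<bar> < e"
      using Stone_Weierstrass_real_polynomial_function[OF compact_Icc \<open>continuous_on {-1..1} \<phi>\<close> e] by blast
    then obtain a N where a: "g = (\<lambda>x. \<Sum>i\<le>N. a i * x ^ i)"
      unfolding real_polynomial_function_iff_sum by blast
    define k where "k x = h x * g (cos (2 * pi * x))" for x
    have kc: "continuous_on {0..1} k"
      unfolding k_def a by (intro continuous_intros cont)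
    have "((\<lambda>x. \<Sum>i\<le>N. a i * (h x * (cos (2 * pi * x) ^ i * cos (2 * pi * real 0 * x)))) has_integral
       (\<Sum>i\<le>N. a i * 0)) {0..1}"
    proof (intro has_integral_sum has_integral_mult_right)
      fix i
      have "(\<lambda>x. h x * (cos (2 * pi * x) ^ i * cos (2 * pi * real 0 * x))) integrable_on {0..1}"
        by (intro integrable_continuous_real continuous_intros cont)
      thus "((\<lambda>x. h x * (cos (2 * pi * x) ^ i * cos (2 * pi * real 0 * x))) has_integral 0) {0..1}"
        using pow[of i 0] unfolding has_integral_iff by (rule conjI)
    qed auto
    hence k0: "(k has_integral 0) {0..1}"
      by (simp add: k_def[abs_def] a sum_distrib_left mult_ac)
    have "((\<lambda>x. (h x)\<^sup>2 - k x) has_integral (integral {0..1} (\<lambda>x. (h x)\<^sup>2) - 0)) {0..1}"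
      by (intro has_integral_diff k0 integrable_integral hi)
    moreover have "((\<lambda>x. e * \<bar>h x\<bar>) has_integral (e * J)) {0..1}"
      unfolding J_def by (intro has_integral_mult_right integrable_integral hi)
    ultimately have "integral {0..1} (\<lambda>x. (h x)\<^sup>2) - 0 \<le> e * J"
    proof (rule has_integral_le)
      fix x :: real assume x: "x \<in> {0..1}"
      have "(h x)\<^sup>2 - k x = h x * (\<phi> (cos (2 * pi * x)) - g (cos (2 * pi * x)))"
        unfolding \<phi>[OF x] k_def by (simp add: power2_eq_square algebra_simps)
      also have "\<dots> \<le> \<bar>h x\<bar> * \<bar>\<phi> (cos (2 * pi * x)) - g (cos (2 * pi * x))\<bar>"
        using abs_ge_self abs_mult by metis
      also have "\<dots> \<le> \<bar>h x\<bar> * e"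
        by (rule mult_left_mono[OF less_imp_le[OF g(2)]]) auto
      finally show "(h x)\<^sup>2 - k x \<le> e * \<bar>h x\<bar>" by (simp add: mult.commute)
    qed
    thus ?thesis by simp
  qed
  have "integral {0..1} (\<lambda>x. (h x)\<^sup>2) \<le> 0"
  proof (rule field_le_epsilon)
    fix e :: real assume e: "e > 0"
    have "integral {0..1} (\<lambda>x. (h x)\<^sup>2) \<le> e / (J + 1) * J" using small[of "e / (J + 1)"] e J by simp
    also have "\<dots> \<le> 0 + e" using e J by (simp add: field_simps)
    finally show "integral {0..1} (\<lambda>x. (h x)\<^sup>2) \<le> 0 + e" .
  qed
  moreover have "integral {0..1} (\<lambda>x. (h x)\<^sup>2) \<ge> 0" by (intro integral_nonneg hi) auto
  ultimately have "integral {0..1} (\<lambda>x. (h x)\<^sup>2) = 0" by simp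
  hence "((\<lambda>x. (h x)\<^sup>2) has_integral 0) (cbox 0 1)"
    using integrable_integral[OF hi(2)] by simp
  note hi0 = this
  have cc: "continuous_on (cbox 0 1) (\<lambda>x. (h x)\<^sup>2)" by (auto intro!: continuous_intros cont)
  have ne: "box (0::real) 1 \<noteq> {}" by simp
  have xc: "x \<in> cbox 0 1" using x by simp
  have "(h x)\<^sup>2 = 0"
    by (rule has_integral_0_cbox_imp_0[OF cc _ hi0 ne xc]) simp
  thus ?thesis by simp
qed

text \<open>The characteristic function of the standard normal distribution, rescaled by its
  standard deviation \<open>1 / sqrt (2 * c)\<close>.\<close>

lemma gauss_cos_integral:
  assumes c: "c > 0"
  shows "((\<lambda>x. exp (- (c * x\<^sup>2)) * cos (t * x)) has_integral (sqrt (pi / c) * exp (- (t\<^sup>2 / (4 * c))))) UNIV"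
proof -
  define \<sigma> where "\<sigma> = 1 / sqrt (2 * c)"
  have \<sigma>: "\<sigma> > 0" "\<sigma>\<^sup>2 = 1 / (2 * c)" using c by (auto simp: \<sigma>_def power_divide)
  define F where "F = (\<lambda>u. std_normal_density u *\<^sub>R iexp (\<sigma> * t * u))"
  have Fi: "integrable lborel F" unfolding F_def
  proof (rule Bochner_Integration.integrable_bound)
    show "integrable lborel std_normal_density"
      using integrable_std_normal_moment[of 0] by simp
    show "AE x in lborel. norm (std_normal_density x *\<^sub>R iexp (\<sigma> * t * x)) \<le> norm (std_normal_density x)"
      by (simp add: norm_mult)
  qed simp
  have "char std_normal_distribution (\<sigma> * t) = (\<integral>u. F u \<partial>lborel)"
    unfolding char_def F_def by (subst integral_density) auto
  hence "(\<integral>u. F u \<partial>lborel) = complex_of_real (exp (- ((\<sigma> * t)\<^sup>2) / 2))"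
    by (simp add: char_std_normal_distribution)
  hence "(\<integral>u. Re (F u) \<partial>lborel) = exp (- ((\<sigma> * t)\<^sup>2) / 2)"
    using integral_Re[OF Fi] by simp
  moreover have "integrable lborel (\<lambda>u. Re (F u))" using Fi by simp
  ultimately have "has_bochner_integral lborel (\<lambda>u. Re (F u)) (exp (- ((\<sigma> * t)\<^sup>2) / 2))"
    by (simp add: has_bochner_integral_iff)
  from lborel_has_bochner_integral_real_affine_iff[of "1 / \<sigma>" "\<lambda>u. Re (F u)" _ 0] this \<sigma>
  have "has_bochner_integral lborel (\<lambda>x. Re (F (x / \<sigma>))) (\<sigma> * exp (- ((\<sigma> * t)\<^sup>2) / 2))"
    by (simp add: field_simps)
  hence "((\<lambda>x. Re (F (x / \<sigma>))) has_integral (\<sigma> * exp (- ((\<sigma> * t)\<^sup>2) / 2))) UNIV"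
    using has_integral_integral_lborel[of "\<lambda>x. Re (F (x / \<sigma>))"] unfolding has_bochner_integral_iff by simp
  hence "((\<lambda>x. sqrt (2 * pi) * Re (F (x / \<sigma>))) has_integral (sqrt (2 * pi) * (\<sigma> * exp (- ((\<sigma> * t)\<^sup>2) / 2)))) UNIV"
    by (rule has_integral_mult_right)
  moreover have "sqrt (2 * pi) * Re (F (x / \<sigma>)) = exp (- (c * x\<^sup>2)) * cos (t * x)" for x
  proof -
    have "(x / \<sigma>)\<^sup>2 / 2 = c * x\<^sup>2" using \<sigma> c by (simp add: power_divide)
    thus ?thesis using \<sigma>(1) unfolding F_def std_normal_density_def
      by (simp add: Re_exp real_sqrt_mult mult_ac)
  qed
  moreover have "sqrt (2 * pi) * (\<sigma> * exp (- ((\<sigma> * t)\<^sup>2) / 2)) = sqrt (pi / c) * exp (- (t\<^sup>2 / (4 * c)))"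
    using c by (simp add: power_mult_distrib \<sigma>(2)) (simp add: \<sigma>_def real_sqrt_mult real_sqrt_divide)
  ultimately show ?thesis by simp
qed

lemma int_geometric_summable:
  assumes "0 \<le> r" "r < (1::real)"
  shows "(\<lambda>k::int. r ^ nat \<bar>k\<bar>) summable_on UNIV"
proof -
  have g: "(\<lambda>n::nat. r ^ n) summable_on UNIV"
    using assms by (intro norm_summable_imp_summable_on) (auto intro: summable_geometric)
  have "(\<lambda>k::int. r ^ nat \<bar>k\<bar>) summable_on (range int \<union> range (\<lambda>n. - int n))"
  proof (rule summable_on_union)
    show "(\<lambda>k::int. r ^ nat \<bar>k\<bar>) summable_on range int"
      using g by (subst summable_on_reindex) (auto simp: o_def)
    show "(\<lambda>k::int. r ^ nat \<bar>k\<bar>) summable_on range (\<lambda>n. - int n)"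
      using g by (subst summable_on_reindex) (auto simp: o_def inj_on_def)
  qed
  moreover have "range int \<union> range (\<lambda>n. - int n) = UNIV"
    by (auto simp: image_iff) (metis int_cases2)
  ultimately show ?thesis by simp
qed

text \<open>From \<open>0 \<le> (\<bar>y\<bar> - 1/2)\<^sup>2\<close> the square is at least
  \<open>\<bar>y\<bar> - 1/4\<close>. This replaces quadratic by linear growth and gives a geometric
  majorant, uniform on the unit interval, for the Weierstrass test.\<close>

lemma gauss_shift_bound:
  fixes c x :: real and k :: int
  assumes "c \<ge> 0" "x \<in> {0..1}"
  shows "exp (- (c * (x + of_int k)\<^sup>2)) \<le> exp (5/4 * c) * exp (- c) ^ nat \<bar>k\<bar>"
proof -
  let ?t = "x + of_int k"
  have "0 \<le> (\<bar>?t\<bar> - 1/2)\<^sup>2" by simp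
  hence "\<bar>?t\<bar> - 1/4 \<le> ?t\<^sup>2" by (simp add: power2_diff power_one_over)
  moreover have "\<bar>real_of_int k\<bar> - 1 \<le> \<bar>?t\<bar>" using assms(2) by auto
  ultimately have "real_of_int \<bar>k\<bar> - 5/4 \<le> ?t\<^sup>2" by simp
  hence "c * (real_of_int \<bar>k\<bar> - 5/4) \<le> c * ?t\<^sup>2" using assms(1) by (intro mult_left_mono)
  moreover have "exp (- c) ^ nat \<bar>k\<bar> = exp (- (c * real_of_int \<bar>k\<bar>))"
    by (simp add: exp_of_nat_mult[symmetric] mult_ac)
  ultimately show ?thesis by (simp add: exp_add[symmetric] algebra_simps)
qed

lemma gauss_shift_summable:
  fixes c :: real
  assumes "c > 0" shows "(\<lambda>k::int. exp (5/4 * c) * exp (- c) ^ nat \<bar>k\<bar>) summable_on UNIV"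
proof -
  have "(\<lambda>k::int. exp (- c) ^ nat \<bar>k\<bar>) summable_on UNIV"
    by (rule int_geometric_summable) (use assms in auto)
  thus ?thesis by (rule summable_on_cmult_right)
qed

text \<open>An unordered sum over all integers may thus be evaluated along the sets
  \<open>{- K..<K}\<close>, whose unit intervals fill the interval from \<open>- K\<close> to
  \<open>K\<close> exactly.\<close>

lemma interval_sets_filterlim:
  "filterlim (\<lambda>K. {- int K..<int K}) (finite_subsets_at_top UNIV) sequentially"
  unfolding filterlim_iff eventually_finite_subsets_at_top
proof (intro allI impI, elim exE conjE)
  fix P and X :: "int set"
  assume X: "finite X" and P: "\<forall>Y. finite Y \<and> X \<subseteq> Y \<and> Y \<subseteq> UNIV \<longrightarrow> P Y"
  obtain B where B: "\<And>x. x \<in> X \<Longrightarrow> nat \<bar>x\<bar> < B"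
    using finite_nat_bounded[of "(\<lambda>x. nat \<bar>x\<bar>) ` X"] X by auto
  show "\<forall>\<^sub>F K in sequentially. P {- int K..<int K}"
    using eventually_ge_at_top[of B]
  proof eventually_elim
    case (elim K)
    have "X \<subseteq> {- int K..<int K}"
    proof
      fix x assume "x \<in> X"
      from B[OF this] elim show "x \<in> {- int K..<int K}" by auto
    qed
    thus ?case using P by simp
  qed
qed

lemma has_integral_UNIV_LIMSEQ:
  fixes f :: "real \<Rightarrow> real"
  assumes "(f has_integral V) UNIV"
  shows "(\<lambda>K. integral {- real K..real K} f) \<longlonglongrightarrow> V"
proof (rule metric_LIMSEQ_I)
  fix e :: real assume e: "e > 0"
  have "\<not> (\<exists>a b :: real. UNIV = cbox a b)" using bounded_cbox not_bounded_UNIV by metis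
  hence "\<forall>e>0. \<exists>B>0. \<forall>a b. ball 0 B \<subseteq> cbox a b \<longrightarrow>
      (\<exists>z. ((\<lambda>x. if x \<in> UNIV then f x else 0) has_integral z) (cbox a b) \<and> norm (z - V) < e)"
    using assms has_integral_alt[of f V UNIV] by presburger
  from mp[OF spec[OF this, of e] e] obtain B where
    "B > 0 \<and> (\<forall>a b. ball 0 B \<subseteq> cbox a b \<longrightarrow>
      (\<exists>z. ((\<lambda>x. if x \<in> UNIV then f x else 0) has_integral z) (cbox a b) \<and> norm (z - V) < e))"
    by (elim exE)
  hence B: "\<exists>z. (f has_integral z) (cbox a b) \<and> norm (z - V) < e" if "ball 0 B \<subseteq> cbox a b" for a b
    using that by simp
  show "\<exists>K0. \<forall>K\<ge>K0. dist (integral {- real K..real K} f) V < e"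
  proof (rule exI[of _ "nat \<lceil>B\<rceil>"], rule allI, rule impI)
    fix K assume K: "nat \<lceil>B\<rceil> \<le> K"
    hence "B \<le> real K" by linarith
    hence "ball 0 B \<subseteq> cbox (- real K) (real K)" by (auto simp: dist_real_def)
    from B[OF this] obtain z where "(f has_integral z) (cbox (- real K) (real K))" "norm (z - V) < e" by blast
    thus "dist (integral {- real K..real K} f) V < e"
      by (simp add: dist_real_def integral_unique)
  qed
qed

text \<open>Both sides are continuous on the unit interval, invariant under \<open>x\<close> to
  \<open>1 - x\<close>, and have the same cosine coefficients. Uniqueness of the coefficients then
  gives equality without pointwise convergence of a Fourier series.\<close>

theorem gauss_poisson:
  fixes x y :: real
  assumes y: "y > 0" and x: "x \<in> {0..1}"
  shows "(\<Sum>\<^sub>\<infinity>k::int. exp (- (pi / y\<^sup>2 * (x + of_int k)\<^sup>2))) =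
         y * (\<Sum>\<^sub>\<infinity>b::int. exp (- (pi * y\<^sup>2 * (of_int b)\<^sup>2)) * cos (2 * pi * of_int b * x))"
proof -
  define c where "c = pi / y\<^sup>2"
  define d where "d = pi * y\<^sup>2"
  have c: "c > 0" and d: "d > 0" using y by (auto simp: c_def d_def)
  define F where "F x = (\<Sum>\<^sub>\<infinity>k::int. exp (- (c * (x + of_int k)\<^sup>2)))" for x
  define G where "G x = (\<Sum>\<^sub>\<infinity>b::int. exp (- (d * (of_int b)\<^sup>2)) * cos (2 * pi * of_int b * x))" for x
  let ?f = "\<lambda>K x. \<Sum>k\<in>K. exp (- (c * (x + of_int k)\<^sup>2))"
  let ?g = "\<lambda>K x. \<Sum>b\<in>K. exp (- (d * (of_int b)\<^sup>2)) * cos (2 * pi * of_int b * x)"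
  have uF: "uniform_limit {0..1} ?f F (finite_subsets_at_top UNIV)"
    unfolding F_def by (rule Weierstrass_m_test_general[OF _ gauss_shift_summable[OF c]])
      (use gauss_shift_bound[of c] c in auto)
  have uG: "uniform_limit {0..1} ?g G (finite_subsets_at_top UNIV)"
    unfolding G_def
  proof (rule Weierstrass_m_test_general[OF _ gauss_shift_summable[OF d]])
    fix b :: int and y :: real
    have "norm (exp (- (d * (of_int b)\<^sup>2)) * cos (2 * pi * of_int b * y)) \<le> exp (- (d * (0 + of_int b)\<^sup>2)) * 1"
      unfolding norm_mult by (intro mult_mono) auto
    also have "\<dots> \<le> exp (5/4 * d) * exp (- d) ^ nat \<bar>b\<bar>"
      using gauss_shift_bound[of d 0 b] d by simp
    finally show "norm (exp (- (d * (of_int b)\<^sup>2)) * cos (2 * pi * of_int b * y)) \<le> exp (5/4 * d) * exp (- d) ^ nat \<bar>b\<bar>" .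
  qed
  have cF: "continuous_on {0..1} F"
    by (rule uniform_limit_theorem[OF _ uF]) (auto intro!: always_eventually continuous_intros)
  have cG: "continuous_on {0..1} G"
    by (rule uniform_limit_theorem[OF _ uG]) (auto intro!: always_eventually continuous_intros)
  have mult_cos: "uniform_limit {0..1} (\<lambda>K x. s K x * cos (2 * pi * real n * x)) (\<lambda>x. S x * cos (2 * pi * real n * x))
      (finite_subsets_at_top UNIV)"
    if "uniform_limit {0..1} s S (finite_subsets_at_top UNIV)" for s :: "int set \<Rightarrow> real \<Rightarrow> real" and S n
  proof (rule uniform_limitI)
    fix e :: real assume "e > 0"
    from uniform_limitD[OF that this]
    show "\<forall>\<^sub>F K in finite_subsets_at_top UNIV. \<forall>x\<in>{0..1}. dist (s K x * cos (2 * pi * real n * x)) (S x * cos (2 * pi * real n * x)) < e"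
    proof eventually_elim
      case (elim K)
      show ?case
      proof
        fix x :: real assume "x \<in> {0..1}"
        have "dist (s K x * cos (2 * pi * real n * x)) (S x * cos (2 * pi * real n * x)) =
           \<bar>s K x - S x\<bar> * \<bar>cos (2 * pi * real n * x)\<bar>"
          by (simp add: dist_real_def left_diff_distrib[symmetric] abs_mult)
        also have "\<dots> \<le> \<bar>s K x - S x\<bar> * 1" by (intro mult_left_mono) auto
        also have "\<dots> < e" using elim \<open>x \<in> {0..1}\<close> by (simp add: dist_real_def)
        finally show "dist (s K x * cos (2 * pi * real n * x)) (S x * cos (2 * pi * real n * x)) < e" .
      qed
    qed
  qed
  \<comment> \<open>Orthogonality leaves only the frequencies \<open>n\<close> and
    \<open>- n\<close>. At \<open>n = 0\<close> this set has one element, at which both halves add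
    up.\<close>
  have coefG: "integral {0..1} (\<lambda>x. G x * cos (2 * pi * real n * x)) = exp (- (d * (real n)\<^sup>2))" for n
  proof -
    obtain I J where IJ: "\<And>K. ((\<lambda>x. ?g K x * cos (2 * pi * real n * x)) has_integral I K) {0..1}"
      "((\<lambda>x. G x * cos (2 * pi * real n * x)) has_integral J) {0..1}" "(I \<longlongrightarrow> J) (finite_subsets_at_top UNIV)"
      by (rule uniform_limit_integral[OF mult_cos[OF uG, of n]]) (auto intro!: continuous_intros)
    let ?v = "\<lambda>b. exp (- (d * (of_int b)\<^sup>2)) * (((if b = int n then 1 else 0) + (if b = - int n then 1 else 0)) / 2)"
    have I: "I K = (\<Sum>b\<in>K. ?v b)" if "finite K" for K
    proof (rule has_integral_unique[OF IJ(1)])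
      have "((\<lambda>x. \<Sum>b\<in>K. exp (- (d * (of_int b)\<^sup>2)) * (cos (2 * pi * of_int b * x) * cos (2 * pi * real n * x)))
         has_integral (\<Sum>b\<in>K. ?v b)) {0..1}"
        by (intro has_integral_sum that has_integral_mult_right cos_cos_integral)
      thus "((\<lambda>x. ?g K x * cos (2 * pi * real n * x)) has_integral (\<Sum>b\<in>K. ?v b)) {0..1}"
        by (simp add: sum_distrib_right mult.assoc)
    qed
    have v0: "?v b = 0" if "b \<notin> {int n, - int n}" for b using that by simp
    have sv: "(\<Sum>b\<in>{int n, - int n}. ?v b) = exp (- (d * (real n)\<^sup>2))"
      by (cases "n = 0") auto
    have "\<forall>\<^sub>F K in finite_subsets_at_top UNIV. I K = exp (- (d * (real n)\<^sup>2))"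
    proof -
      have "\<forall>\<^sub>F K in finite_subsets_at_top UNIV. finite K \<and> {int n, - int n} \<subseteq> K \<and> K \<subseteq> UNIV"
        unfolding eventually_finite_subsets_at_top by (rule exI[of _ "{int n, - int n}"]) auto
      thus ?thesis
      proof eventually_elim
        case (elim K)
        have "(\<Sum>b\<in>K. ?v b) = (\<Sum>b\<in>{int n, - int n}. ?v b)"
          by (rule sum.mono_neutral_right) (use elim v0 in auto)
        thus ?case using sv I elim by simp
      qed
    qed
    hence "(I \<longlongrightarrow> exp (- (d * (real n)\<^sup>2))) (finite_subsets_at_top UNIV)"
      by (rule tendsto_eventually)
    hence "J = exp (- (d * (real n)\<^sup>2))"
      using IJ(3) tendsto_unique finite_subsets_at_top_neq_bot by blast
    thus ?thesis using IJ(2) by (simp add: integral_unique)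
  qed
  \<comment> \<open>Unfolding: the cosine has period 1, so the integrals of the translated Gaussians
    over the unit interval join to a Fourier integral over the line.\<close>
  have coefF: "integral {0..1} (\<lambda>x. F x * cos (2 * pi * real n * x)) = y * exp (- (d * (real n)\<^sup>2))" for n
  proof -
    obtain I J where IJ: "\<And>K. ((\<lambda>x. ?f K x * cos (2 * pi * real n * x)) has_integral I K) {0..1}"
      "((\<lambda>x. F x * cos (2 * pi * real n * x)) has_integral J) {0..1}" "(I \<longlongrightarrow> J) (finite_subsets_at_top UNIV)"
      by (rule uniform_limit_integral[OF mult_cos[OF uF, of n]]) (auto intro!: continuous_intros)
    let ?u = "\<lambda>x. exp (- (c * x\<^sup>2)) * cos (2 * pi * real n * x)"
    have shift: "((\<lambda>x. exp (- (c * (x + of_int k)\<^sup>2)) * cos (2 * pi * real n * x)) has_integral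
       integral {of_int k..of_int k + 1} ?u) {0..1}" for k
    proof -
      have "(?u has_integral integral {of_int k..of_int k + 1} ?u) (cbox (1 * 0 + of_int k) (1 * 1 + of_int k))"
        by (auto intro!: integrable_integral integrable_continuous_real continuous_intros simp: add.commute)
      from has_integral_affinity[OF this, of 1 "of_int k"]
      have "((\<lambda>x. ?u (x + of_int k)) has_integral integral {of_int k..of_int k + 1} ?u) {0..1}"
        by simp
      moreover have "cos (2 * pi * real n * (x + of_int k)) = cos (2 * pi * real n * x)" for x
      proof -
        have "2 * pi * real n * (x + of_int k) = 2 * pi * real n * x + 2 * pi * of_int (int n * k)"
          by (simp add: algebra_simps)
        thus ?thesis by (simp only: cos_add cos_int_2pin sin_int_2pin mult_1_right mult_zero_right diff_zero)
      qed
      ultimately show ?thesis by simp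
    qed
    have I: "I {- int K..<int K} = integral {- real K..real K} ?u" for K
    proof -
      have "((\<lambda>x. \<Sum>k\<in>{- int K..<int K}. exp (- (c * (x + of_int k)\<^sup>2)) * cos (2 * pi * real n * x)) has_integral
        (\<Sum>k\<in>{- int K..<int K}. integral {of_int k..of_int k + 1} ?u)) {0..1}"
        by (intro has_integral_sum shift) auto
      hence "I {- int K..<int K} = (\<Sum>k\<in>{- int K..<int K}. integral {of_int k..of_int k + 1} ?u)"
        using IJ(1) has_integral_unique by (simp add: sum_distrib_right) blast
      also have "\<dots> = integral {- real K..real K} ?u"
      proof (induction K)
        case (Suc K)
        have "{- int (Suc K)..<int (Suc K)} = insert (- int K - 1) (insert (int K) {- int K..<int K})" by auto
        moreover have "integral {- real (Suc K)..real (Suc K)} ?u =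
          integral {- real (Suc K)..- real K} ?u + integral {- real K..real (Suc K)} ?u"
          by (rule Henstock_Kurzweil_Integration.integral_combine[symmetric])
             (auto intro!: integrable_continuous_real continuous_intros)
        moreover have "integral {- real K..real (Suc K)} ?u =
          integral {- real K..real K} ?u + integral {real K..real (Suc K)} ?u"
          by (rule Henstock_Kurzweil_Integration.integral_combine[symmetric])
             (auto intro!: integrable_continuous_real continuous_intros)
        moreover have "integral {- real K - 1..- real K} ?u = integral {- 1 - real K..- real K} ?u"
          by (rule arg_cong[of _ _ "\<lambda>a. integral {a..- real K} ?u"]) simp
        ultimately show ?case using Suc by (simp add: algebra_simps)
      qed simp
      finally show ?thesis .
    qed
    have V: "y * exp (- (d * (real n)\<^sup>2)) = sqrt (pi / c) * exp (- ((2 * pi * real n)\<^sup>2 / (4 * c)))"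
      using y by (simp add: c_def d_def power_mult_distrib power2_eq_square)
    have "(\<lambda>K. integral {- real K..real K} ?u) \<longlonglongrightarrow> y * exp (- (d * (real n)\<^sup>2))"
      unfolding V by (rule has_integral_UNIV_LIMSEQ[OF gauss_cos_integral[OF c]])
    moreover have "(\<lambda>K. I {- int K..<int K}) \<longlonglongrightarrow> J"
      by (rule filterlim_compose[OF IJ(3) interval_sets_filterlim])
    ultimately have "J = y * exp (- (d * (real n)\<^sup>2))" unfolding I using LIMSEQ_unique by blast
    thus ?thesis using IJ(2) by (simp add: integral_unique)
  qed
  have "F x - y * G x = 0"
  proof (rule cosine_coefficients_zero[of "\<lambda>x. F x - y * G x"])
    show "continuous_on {0..1} (\<lambda>x. F x - y * G x)" by (intro continuous_intros cF cG)
    fix x :: real assume x: "x \<in> {0..1}"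
    have "F (1 - x) = F x" unfolding F_def
    proof (rule infsum_reindex_bij_witness[of _ "\<lambda>k. - 1 - k" "\<lambda>k. - 1 - k"])
      fix k :: int
      have "(x + of_int (- 1 - k))\<^sup>2 = (1 - x + of_int k)\<^sup>2" by (simp add: power2_eq_square algebra_simps)
      thus "exp (- (c * (x + of_int (- 1 - k))\<^sup>2)) = exp (- (c * (1 - x + of_int k)\<^sup>2))" by simp
    qed auto
    moreover have "cos (2 * pi * of_int b * (1 - x)) = cos (2 * pi * of_int b * x)" for b :: int
      by (simp add: right_diff_distrib cos_diff cos_int_2pin sin_int_2pin)
    hence "G (1 - x) = G x" unfolding G_def by simp
    ultimately show "F (1 - x) - y * G (1 - x) = F x - y * G x" by simp
  next
    fix n
    have "integral {0..1} (\<lambda>x. F x * cos (2 * pi * real n * x) - y * (G x * cos (2 * pi * real n * x))) =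
      integral {0..1} (\<lambda>x. F x * cos (2 * pi * real n * x)) - integral {0..1} (\<lambda>x. y * (G x * cos (2 * pi * real n * x)))"
      by (intro integral_diff integrable_continuous_real continuous_intros cF cG)
    also have "\<dots> = 0" by (simp only: integral_mult_right coefF coefG)
    finally show "integral {0..1} (\<lambda>x. (F x - y * G x) * cos (2 * pi * real n * x)) = 0"
      by (simp only: left_diff_distrib mult.assoc)
  qed (rule x)
  thus ?thesis by (simp add: F_def G_def c_def d_def)
qed

section \<open>The Jacobi symbol and quadratic Gauss sums\<close>

definition jac :: "int \<Rightarrow> nat \<Rightarrow> int" where "jac a n = Jacobi a (int n)"

lemma jac_1 [simp]: "jac a (Suc 0) = 1" "jac a 1 = 1"
  by (simp_all add: jac_def Jacobi_def)

lemma jac_mult_bottom: "m > 0 \<Longrightarrow> n > 0 \<Longrightarrow> jac a (m * n) = jac a m * jac a n"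
  by (simp add: jac_def Jacobi_def prime_factorization_mult)

lemma jac_prime: "prime p \<Longrightarrow> jac a p = Legendre a (int p)"
  by (simp add: jac_def Jacobi_def prime_factorization_prime)

lemma odd_nat_prime_induct [consumes 1, case_names one mult]:
  assumes "odd n" "P 1" "\<And>p m. prime p \<Longrightarrow> p > 2 \<Longrightarrow> odd m \<Longrightarrow> P m \<Longrightarrow> P (p * m)"
  shows "P (n::nat)"
  using assms(1)
proof (induction n rule: less_induct)
  case (less n)
  show ?case
  proof (cases "n = 1")
    case False
    then obtain p where p: "prime p" "p dvd n" using prime_factor_nat by blast
    then obtain m where m: "n = p * m" by blast
    have "odd p" "odd m" using less.prems m by auto
    moreover have "p > 2" using p(1) \<open>odd p\<close> prime_ge_2_nat[of p] by (cases "p = 2") auto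
    moreover have "m < n" using m \<open>odd m\<close> prime_gt_1_nat[OF p(1)] by (cases "m = 0") auto
    ultimately show ?thesis using less.IH[of m] assms(3)[OF p(1)] m by blast
  qed (use assms in simp)
qed

lemma Legendre_values: "Legendre a p \<in> {-1, 0, 1}"
  by (simp add: Legendre_def)

text \<open>Euler's criterion determines a Legendre symbol only modulo \<open>p\<close>; for
  \<open>p > 2\<close> the three possible values are incongruent.\<close>

lemma small_cong_eq:
  assumes "x \<in> {-1, 0, 1}" "y \<in> {-1, 0, 1 :: int}" "[x = y] (mod p)" "p > 2"
  shows "x = y"
proof -
  have "p dvd x - y" using assms(3) by (simp add: cong_iff_dvd_diff)
  moreover have "\<bar>x - y\<bar> \<le> 2" using assms(1,2) by auto
  ultimately show ?thesis using assms(4) zdvd_imp_le[of p "\<bar>x - y\<bar>"] by (cases "x = y") auto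
qed

lemma Legendre_mult:
  assumes "prime p" "p > 2"
  shows "Legendre (a * b) (int p) = Legendre a (int p) * Legendre b (int p)"
proof (rule small_cong_eq)
  have "[Legendre (a * b) (int p) = (a * b) ^ ((p - 1) div 2)] (mod int p)"
    by (rule euler_criterion[OF assms])
  moreover have "[Legendre a (int p) * Legendre b (int p) = a ^ ((p - 1) div 2) * b ^ ((p - 1) div 2)] (mod int p)"
    by (rule cong_mult[OF euler_criterion[OF assms] euler_criterion[OF assms]])
  ultimately show "[Legendre (a * b) (int p) = Legendre a (int p) * Legendre b (int p)] (mod int p)"
    by (simp add: power_mult_distrib cong_def)
  show "Legendre a (int p) * Legendre b (int p) \<in> {-1, 0, 1}"
    using Legendre_values[of a "int p"] Legendre_values[of b "int p"] by auto
qed (use assms Legendre_values in auto)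

lemma Legendre_cong: "[a = b] (mod p) \<Longrightarrow> Legendre a p = Legendre b p"
  unfolding Legendre_def QuadRes_def by (simp add: cong_def)

lemma jac_mult_top: assumes "odd n" shows "jac (a * b) n = jac a n * jac b n"
  using assms
proof (induction n rule: odd_nat_prime_induct)
  case (mult p m)
  thus ?case using odd_pos[of m] prime_gt_0_nat[of p]
    by (simp add: jac_mult_bottom jac_prime Legendre_mult mult_ac)
qed simp

lemma jac_cong: assumes "odd n" "[a = b] (mod int n)" shows "jac a n = jac b n"
  using assms
proof (induction n rule: odd_nat_prime_induct)
  case (mult p m)
  hence "[a = b] (mod int p)" "[a = b] (mod int m)"
    by (auto simp: cong_iff_dvd_diff intro: dvd_mult_left dvd_mult_right)
  thus ?case using mult odd_pos[of m] prime_gt_0_nat[of p]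
    by (simp add: jac_mult_bottom jac_prime Legendre_cong[of a b "int p"])
qed simp

lemma jac_mod: "odd n \<Longrightarrow> jac (a mod int n) n = jac a n"
  by (rule jac_cong) (auto simp: cong_def)

lemma jac_values: assumes "odd n" shows "jac a n \<in> {-1, 0, 1}"
  using assms
proof (induction n rule: odd_nat_prime_induct)
  case (mult p m)
  thus ?case using odd_pos[of m] prime_gt_0_nat[of p] Legendre_values[of a "int p"]
    by (auto simp: jac_mult_bottom jac_prime)
qed simp

lemma jac_eq_0_iff: assumes "odd n" shows "jac a n = 0 \<longleftrightarrow> \<not> coprime a (int n)"
  using assms
proof (induction n rule: odd_nat_prime_induct)
  case (mult p m)
  have "Legendre a (int p) = 0 \<longleftrightarrow> int p dvd a" by (simp add: Legendre_def cong_0_iff)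
  moreover have "int p dvd a \<longleftrightarrow> \<not> coprime a (int p)"
    using mult(1) prime_imp_coprime[of "int p" a] coprime_common_divisor[of a "int p" "int p"]
      prime_gt_1_nat[of p] by (auto simp: coprime_commute)
  ultimately show ?case using mult odd_pos[of m] prime_gt_0_nat[of p]
    by (simp add: jac_mult_bottom jac_prime)
qed simp

lemma jac_square: assumes "odd n" shows "(jac a n)\<^sup>2 = (if coprime a (int n) then 1 else 0)"
  using jac_eq_0_iff[OF assms, of a] jac_values[OF assms, of a] by (auto simp: power2_eq_square)

lemma jac_abs_le: "odd n \<Longrightarrow> \<bar>jac a n\<bar> \<le> 1"
  using jac_values[of n a] by auto

definition rsgn :: "nat \<Rightarrow> nat \<Rightarrow> int" where
  "rsgn m n = (if m mod 4 = 3 \<and> n mod 4 = 3 then -1 else 1)"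

lemma odd_mod_4: "odd (n::nat) \<Longrightarrow> n mod 4 = 1 \<or> n mod 4 = 3"
  by presburger

lemma odd_mult_mod_4:
  assumes "odd (m::nat)" "odd n"
  shows "(m * n) mod 4 = (if m mod 4 = n mod 4 then 1 else 3)"
proof -
  have "(m * n) mod 4 = ((m mod 4) * (n mod 4)) mod 4" by (simp add: mod_mult_eq)
  thus ?thesis using odd_mod_4[OF assms(1)] odd_mod_4[OF assms(2)] by auto
qed

lemma even_half_iff: "odd (n::nat) \<Longrightarrow> even ((n - 1) div 2) \<longleftrightarrow> n mod 4 = 1"
  by presburger

lemma rsgn_eq: assumes "odd m" "odd n" shows "(-1) ^ ((m - 1) div 2 * ((n - 1) div 2)) = rsgn m n"
proof -
  have "even ((m - 1) div 2 * ((n - 1) div 2)) \<longleftrightarrow> m mod 4 = 1 \<or> n mod 4 = 1"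
    using even_half_iff[OF assms(1)] even_half_iff[OF assms(2)] by simp
  thus ?thesis using odd_mod_4[OF assms(1)] odd_mod_4[OF assms(2)]
    by (auto simp: rsgn_def minus_one_power_iff)
qed

lemma rsgn_mult: "odd m \<Longrightarrow> odd n \<Longrightarrow> rsgn (m * n) k = rsgn m k * rsgn n k"
  using odd_mod_4[of m] odd_mod_4[of n] by (auto simp: rsgn_def odd_mult_mod_4)

lemma rsgn_commute: "rsgn m n = rsgn n m" by (simp add: rsgn_def)

text \<open>Induction over the prime factors of the lower entry, with the law for two primes at each
  factor. A second induction, over the upper entry, gives the general law.\<close>

lemma jac_reciprocity_prime:
  assumes "odd n" "prime p" "p > 2" "coprime p n"
  shows "jac (int p) n * jac (int n) p = rsgn p n"
  using assms
proof (induction n rule: odd_nat_prime_induct)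
  case one
  have "coprime (1::int) (int p)" by simp
  \<comment> \<open>\<open>jac 1 p\<close> is nonzero and equals its own square, hence is 1.\<close>
  hence "jac 1 p \<noteq> 0" using one odd_pos prime_odd_nat[of p] by (subst jac_eq_0_iff) auto
  moreover have "jac 1 p = jac 1 p * jac 1 p" using jac_mult_top[of p 1 1] prime_odd_nat[of p] one by simp
  ultimately show ?case by (simp add: rsgn_def)
next
  case (mult q m)
  have op: "odd p" using mult prime_odd_nat[of p] by simp
  have oq: "odd q" using mult prime_odd_nat[of q] by simp
  have "p \<noteq> q" using mult by auto
  hence "Legendre (int p) (int q) * Legendre (int q) (int p) = (-1) ^ ((p - 1) div 2 * ((q - 1) div 2))"
    using mult by (intro Quadratic_Reciprocity) auto
  hence 1: "jac (int p) q * jac (int q) p = rsgn p q"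
    using mult rsgn_eq[OF op oq] by (simp add: jac_prime)
  have 2: "jac (int p) m * jac (int m) p = rsgn p m" using mult by simp
  have "jac (int p) (q * m) * jac (int (q * m)) p = (jac (int p) q * jac (int q) p) * (jac (int p) m * jac (int m) p)"
    using mult op oq odd_pos[of m] odd_pos[of q] by (simp add: jac_mult_bottom jac_mult_top)
  also have "\<dots> = rsgn p (q * m)" unfolding 1 2 using rsgn_mult[of q m p] mult oq by (simp add: rsgn_commute)
  finally show ?case .
qed

theorem jac_reciprocity:
  assumes "odd m" "odd n" "coprime m n"
  shows "jac (int m) n * jac (int n) m = rsgn m n"
  using assms
proof (induction m rule: odd_nat_prime_induct)
  case one
  have "jac 1 n \<noteq> 0" using one by (subst jac_eq_0_iff) auto
  moreover have "jac 1 n = jac 1 n * jac 1 n" using jac_mult_top[of n 1 1] one by simp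
  ultimately show ?case by (simp add: rsgn_def)
next
  case (mult p m)
  have op: "odd p" using mult prime_odd_nat[of p] by simp
  have 1: "jac (int p) n * jac (int n) p = rsgn p n" using mult by (intro jac_reciprocity_prime) auto
  have 2: "jac (int m) n * jac (int n) m = rsgn m n" using mult by simp
  have "jac (int (p * m)) n * jac (int n) (p * m) = (jac (int p) n * jac (int n) p) * (jac (int m) n * jac (int n) m)"
    using mult op odd_pos[of m] odd_pos[of p] by (simp add: jac_mult_bottom jac_mult_top)
  also have "\<dots> = rsgn (p * m) n" unfolding 1 2 using rsgn_mult[of p m n] mult op by simp
  finally show ?case .
qed

lemma jac_minus_one: assumes "odd n" shows "jac (-1) n = (if n mod 4 = 1 then 1 else -1)"
  using assms
proof (induction n rule: odd_nat_prime_induct)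
  case (mult p m)
  have op: "odd p" using mult prime_odd_nat[of p] by simp
  have "Legendre (-1) (int p) = (-1) ^ ((p - 1) div 2)"
    by (rule small_cong_eq[OF Legendre_values _ euler_criterion])
       (use mult in \<open>auto simp: minus_one_power_iff\<close>)
  hence "Legendre (-1) (int p) = (if p mod 4 = 1 then 1 else -1)"
    using even_half_iff[OF op] by (simp add: minus_one_power_iff)
  thus ?case using mult odd_pos[of m] odd_pos[of p] op odd_mod_4[of p] odd_mod_4[of m]
    by (auto simp: jac_mult_bottom jac_prime odd_mult_mod_4)
qed simp

section \<open>Additive characters and quadratic Gauss sums\<close>

definition ee :: "real \<Rightarrow> complex" where "ee x = cis (2 * pi * x)"

lemma ee_add: "ee (x + y) = ee x * ee y"
  by (simp add: ee_def cis_mult ring_distribs)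

lemma ee_int [simp]: "ee (of_int k) = 1"
  by (simp add: ee_def complex_eq_iff cos_int_2pin sin_int_2pin)

lemma ee_0 [simp]: "ee 0 = 1" by (simp add: ee_def)

lemma norm_ee [simp]: "cmod (ee x) = 1" by (simp add: ee_def)

lemma cnj_ee: "cnj (ee x) = ee (- x)" by (simp add: ee_def cis_cnj)

lemma ee_power: "ee x ^ n = ee (real n * x)"
  by (induction n) (simp_all add: ee_add ring_distribs mult.commute)

lemma ee_cong:
  assumes "[a = b] (mod int n)" "n > 0" shows "ee (of_int a / real n) = ee (of_int b / real n)"
proof -
  obtain k where "a = b + int n * k" using assms(1) by (metis cong_iff_lin cong_sym)
  hence "of_int a / real n = of_int b / real n + of_int k" using assms(2) by (simp add: field_simps)
  thus ?thesis by (simp add: ee_add)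
qed

lemma ee_eq_1_imp: assumes "ee x = 1" shows "x \<in> \<int>"
proof -
  have "cos (2 * pi * x) = 1" using assms by (simp add: ee_def complex_eq_iff)
  then obtain n :: int where "2 * pi * x = of_int n * 2 * pi" using cos_one_2pi_int by blast
  hence "x = of_int n" by simp
  thus ?thesis by simp
qed

text \<open>An injection modulo \<open>n\<close> from a set of \<open>n\<close> elements meets every
  residue class once. All changes of variables in the Gauss sums below are instances with different
  \<open>h\<close>.\<close>

lemma residue_sum:
  fixes f :: "int \<Rightarrow> complex" and n :: nat
  assumes "finite A" "card A = n" "n > 0" "inj_on (\<lambda>x. h x mod int n) A" "\<And>x. f (x mod int n) = f x"
  shows "(\<Sum>x\<in>A. f (h x)) = (\<Sum>r\<in>{0..<int n}. f r)"
proof -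
  have "(\<lambda>x. h x mod int n) ` A = {0..<int n}"
    by (rule card_subset_eq) (use assms in \<open>auto simp: card_image\<close>)
  hence "(\<Sum>r\<in>{0..<int n}. f r) = (\<Sum>x\<in>A. f (h x mod int n))"
    using sum.reindex[OF assms(4), of f] by (simp add: o_def)
  thus ?thesis using assms(5) by simp
qed

lemma root_sum:
  assumes "n > 0"
  shows "(\<Sum>v\<in>{0..<int n}. ee (of_int k * of_int v / real n)) = (if int n dvd k then of_nat n else 0)"
proof -
  let ?z = "ee (of_int k / real n)"
  have "(\<Sum>v\<in>{0..<int n}. ee (of_int k * of_int v / real n)) = (\<Sum>v<n. ?z ^ v)"
    by (rule sum.reindex_bij_witness[of _ int nat]) (auto simp: ee_power mult_ac)
  also have "\<dots> = (if int n dvd k then of_nat n else 0)"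
  proof (cases "int n dvd k")
    case True
    then obtain j where "k = int n * j" by blast
    hence "of_int k / real n = of_int j" using assms by simp
    hence "?z = 1" by (simp only: ee_int)
    thus ?thesis using True by simp
  next
    case False
    have "?z \<noteq> 1"
    proof
      assume "?z = 1"
      then obtain j where "of_int k / real n = of_int j" using ee_eq_1_imp Ints_cases by metis
      hence "real_of_int k = of_int (int n * j)" using assms by (simp add: field_simps)
      hence "k = int n * j" by (simp only: of_int_eq_iff)
      thus False using False by simp
    qed
    moreover have "?z ^ n = 1" using assms by (simp add: ee_power)
    ultimately show ?thesis using False by (simp add: sum_gp_strict)
  qed
  finally show ?thesis .
qed

definition quad_gauss :: "nat \<Rightarrow> complex" where
  "quad_gauss n = (\<Sum>r\<in>{0..<int n}. ee (of_int (r\<^sup>2) / real n))"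

definition gauss_sum :: "int \<Rightarrow> nat \<Rightarrow> complex" where
  "gauss_sum b n = (\<Sum>a\<in>{0..<int n}. of_int (jac a n) * ee (of_int (a * b) / real n))"

lemma ee_sq_mod: "n > 0 \<Longrightarrow> ee (of_int ((r mod int n)\<^sup>2) / real n) = ee (of_int (r\<^sup>2) / real n)"
  by (rule ee_cong) (auto simp: cong_def power_mod)

text \<open>In the double sum over \<open>r\<close> and \<open>s\<close> the shift
  \<open>r = u + s\<close> makes the phase linear in \<open>s\<close>. The complete sum over
  \<open>s\<close> vanishes unless \<open>n\<close> divides \<open>2 * u\<close>, and as
  \<open>n\<close> is odd this leaves \<open>u = 0\<close>.\<close>

lemma quad_gauss_norm:
  assumes "odd n" shows "quad_gauss n * cnj (quad_gauss n) = of_nat n"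
proof -
  have n: "n > 0" using assms odd_pos by blast
  let ?R = "{0..<int n}"
  have "quad_gauss n * cnj (quad_gauss n) = (\<Sum>s\<in>?R. (\<Sum>r\<in>?R. ee (of_int (r\<^sup>2) / real n)) * ee (- of_int (s\<^sup>2) / real n))"
    by (simp add: quad_gauss_def cnj_ee sum_distrib_left)
  also have "\<dots> = (\<Sum>s\<in>?R. (\<Sum>u\<in>?R. ee (of_int ((u + s)\<^sup>2) / real n)) * ee (- of_int (s\<^sup>2) / real n))"
  proof (rule sum.cong[OF refl])
    fix s
    have "(\<Sum>r\<in>?R. ee (of_int (r\<^sup>2) / real n)) = (\<Sum>u\<in>?R. ee (of_int ((u + s)\<^sup>2) / real n))"
    proof (rule residue_sum[symmetric, where f = "\<lambda>r. ee (of_int (r\<^sup>2) / real n)"])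
      show "inj_on (\<lambda>x. (x + s) mod int n) ?R"
      proof (rule inj_onI)
        fix x y assume xy: "x \<in> ?R" "y \<in> ?R" "(x + s) mod int n = (y + s) mod int n"
        hence "[x = y] (mod int n)" using cong_add_rcancel[of x s y "int n"] by (simp add: cong_def)
        thus "x = y" using xy by (simp add: cong_def)
      qed
    qed (use n ee_sq_mod[OF n] in auto)
    thus "(\<Sum>r\<in>?R. ee (of_int (r\<^sup>2) / real n)) * ee (- of_int (s\<^sup>2) / real n) =
      (\<Sum>u\<in>?R. ee (of_int ((u + s)\<^sup>2) / real n)) * ee (- of_int (s\<^sup>2) / real n)" by (simp only:)
  qed
  also have "\<dots> = (\<Sum>s\<in>?R. \<Sum>u\<in>?R. ee (of_int (u\<^sup>2) / real n) * ee (of_int (2 * u) * of_int s / real n))"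
  proof (intro sum.cong refl, subst sum_distrib_right, intro sum.cong refl)
    fix s u
    have "of_int ((u + s)\<^sup>2) / real n + - of_int (s\<^sup>2) / real n =
      of_int (u\<^sup>2) / real n + of_int (2 * u) * of_int s / real n"
      using n by (simp add: field_simps power2_eq_square)
    thus "ee (of_int ((u + s)\<^sup>2) / real n) * ee (- of_int (s\<^sup>2) / real n) =
      ee (of_int (u\<^sup>2) / real n) * ee (of_int (2 * u) * of_int s / real n)"
      by (simp only: ee_add[symmetric])
  qed
  also have "\<dots> = (\<Sum>u\<in>?R. ee (of_int (u\<^sup>2) / real n) * (\<Sum>s\<in>?R. ee (of_int (2 * u) * of_int s / real n)))"
    by (subst sum.swap) (simp only: sum_distrib_left)
  also have "\<dots> = (\<Sum>u\<in>?R. if u = 0 then of_nat n else 0)"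
  proof (intro sum.cong refl)
    fix u assume u: "u \<in> ?R"
    have "coprime (int n) 2" using assms by simp
    hence "int n dvd 2 * u \<longleftrightarrow> int n dvd u" by (simp add: coprime_dvd_mult_right_iff)
    also have "\<dots> \<longleftrightarrow> u = 0" using u zdvd_not_zless[of u "int n"] by (cases "u = 0") auto
    finally show "ee (of_int (u\<^sup>2) / real n) * (\<Sum>s\<in>?R. ee (of_int (2 * u) * of_int s / real n)) =
      (if u = 0 then of_nat n else 0)"
      using root_sum[OF n, of "2 * u"] by simp
  qed
  also have "\<dots> = of_nat n" using n by simp
  finally show ?thesis .
qed

text \<open>The Chinese remainder theorem in the form \<open>a = x * n + y * m\<close>: the phase
  splits additively, and modulo \<open>m\<close> and \<open>n\<close> the symbol splits up to the
  two mutual symbols.\<close>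

lemma gauss_sum_mult:
  assumes "odd m" "odd n" "coprime m n"
  shows "gauss_sum b (m * n) = of_int (jac (int n) m * jac (int m) n) * (gauss_sum b m * gauss_sum b n)"
proof -
  have mn: "m > 0" "n > 0" using assms odd_pos by auto
  let ?f = "\<lambda>a. of_int (jac a (m * n)) * ee (of_int (a * b) / real (m * n))"
  let ?h = "\<lambda>(x, y). x * int n + y * int m"
  have "(\<Sum>p\<in>{0..<int m} \<times> {0..<int n}. ?f (?h p)) = (\<Sum>r\<in>{0..<int (m * n)}. ?f r)"
  proof (rule residue_sum)
    show "inj_on (\<lambda>p. ?h p mod int (m * n)) ({0..<int m} \<times> {0..<int n})"
    proof (rule inj_onI, clarify)
      fix x y x' y'
      assume b: "x \<in> {0..<int m}" "y \<in> {0..<int n}" "x' \<in> {0..<int m}" "y' \<in> {0..<int n}"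
        and eq: "(x * int n + y * int m) mod int (m * n) = (x' * int n + y' * int m) mod int (m * n)"
      have "int (m * n) dvd (x * int n + y * int m) - (x' * int n + y' * int m)"
        using eq by (simp add: mod_eq_dvd_iff)
      hence d: "int (m * n) dvd (x - x') * int n + (y - y') * int m" by (simp add: algebra_simps)
      have "int m dvd (x - x') * int n + (y - y') * int m" using d unfolding of_nat_mult by (rule dvd_mult_left)
      hence "int m dvd (x - x') * int n" by (simp add: dvd_add_left_iff)
      hence "int m dvd x - x'" using assms(3) by (simp add: coprime_dvd_mult_left_iff)
      hence "[x = x'] (mod int m)" by (simp add: cong_iff_dvd_diff)
      moreover have "int n dvd (x - x') * int n + (y - y') * int m" using d unfolding of_nat_mult by (rule dvd_mult_right)
      hence "int n dvd (y - y') * int m" by (simp add: dvd_add_right_iff)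
      hence "int n dvd y - y'" using assms(3) by (simp add: coprime_dvd_mult_left_iff coprime_commute)
      hence "[y = y'] (mod int n)" by (simp add: cong_iff_dvd_diff)
      ultimately show "x = x' \<and> y = y'" using b by (simp add: cong_def)
    qed
    fix x
    show "?f (x mod int (m * n)) = ?f x"
    proof -
      have "jac (x mod int (m * n)) (m * n) = jac x (m * n)" using assms by (intro jac_mod) simp
      moreover have "ee (of_int (x mod int (m * n) * b) / real (m * n)) = ee (of_int (x * b) / real (m * n))"
        by (rule ee_cong) (use mn in \<open>auto simp: cong_def mod_mult_left_eq\<close>)
      ultimately show ?thesis by simp
    qed
  qed (use mn in auto)
  moreover have "?f (?h p) = of_int (jac (int n) m * jac (int m) n) *
      ((of_int (jac (fst p) m) * ee (of_int (fst p * b) / real m)) * (of_int (jac (snd p) n) * ee (of_int (snd p * b) / real n)))" for p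
  proof (cases p)
    case (Pair x y)
    have "jac (x * int n + y * int m) m = jac (x * int n) m" "jac (x * int n + y * int m) n = jac (y * int m) n"
      using assms by (auto intro!: jac_cong simp: cong_iff_dvd_diff)
    hence 1: "jac (x * int n + y * int m) (m * n) = jac (int n) m * jac (int m) n * (jac x m * jac y n)"
      using assms mn by (simp add: jac_mult_bottom jac_mult_top)
    have "of_int ((x * int n + y * int m) * b) / real (m * n) = of_int (x * b) / real m + of_int (y * b) / real n"
      using mn by (simp add: field_simps)
    thus ?thesis using 1 by (simp add: Pair ee_add)
  qed
  ultimately have "gauss_sum b (m * n) = (\<Sum>p\<in>{0..<int m} \<times> {0..<int n}. of_int (jac (int n) m * jac (int m) n) *
      ((of_int (jac (fst p) m) * ee (of_int (fst p * b) / real m)) * (of_int (jac (snd p) n) * ee (of_int (snd p * b) / real n))))"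
    unfolding gauss_sum_def by simp
  also have "\<dots> = of_int (jac (int n) m * jac (int m) n) * (gauss_sum b m * gauss_sum b n)"
    by (simp only: gauss_sum_def sum_product) (simp only: sum.cartesian_product sum_distrib_left case_prod_beta)
  finally show ?thesis .
qed

lemma sq_eq_imp:
  assumes p: "prime p" and "x \<in> {0..<int p}" "y \<in> {0..<int p}" "x\<^sup>2 mod int p = y\<^sup>2 mod int p"
  shows "x = y \<or> x + y = int p \<or> (x = 0 \<and> y = 0)"
proof -
  have "int p dvd x\<^sup>2 - y\<^sup>2" using assms(4) by (simp add: mod_eq_dvd_iff)
  hence "int p dvd (x - y) * (x + y)" by (simp add: power2_eq_square algebra_simps)
  hence "int p dvd x - y \<or> int p dvd x + y" using p by (simp add: prime_dvd_mult_iff)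
  thus ?thesis
  proof
    assume "int p dvd x - y"
    hence "[x = y] (mod int p)" by (simp add: cong_iff_dvd_diff)
    thus ?thesis using assms by (simp add: cong_def)
  next
    assume "int p dvd x + y"
    then obtain k where k: "x + y = int p * k" by blast
    have "p > 0" using p prime_gt_0_nat by blast
    have "0 \<le> int p * k" "int p * k < int p * 2" unfolding k[symmetric] using assms by auto
    hence "0 \<le> k" using \<open>p > 0\<close> by (simp add: zero_le_mult_iff)
    moreover have "k < 2" using \<open>int p * k < int p * 2\<close> \<open>p > 0\<close> mult_less_cancel_left_pos[of "int p" k 2] by simp
    ultimately have "k = 0 \<or> k = 1" by auto
    thus ?thesis using k assms by auto
  qed
qed

lemma card_square_roots:
  assumes p: "prime p" "p > 2" and a: "a \<in> {0..<int p}"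
  shows "int (card {r \<in> {0..<int p}. r\<^sup>2 mod int p = a}) = 1 + jac a p"
proof -
  let ?S = "{r \<in> {0..<int p}. r\<^sup>2 mod int p = a}"
  have op: "odd p" using p prime_odd_nat by simp
  have J: "jac a p = Legendre a (int p)" by (rule jac_prime[OF p(1)])
  consider "a = 0" | "a \<noteq> 0" "QuadRes (int p) a" | "a \<noteq> 0" "\<not> QuadRes (int p) a" by blast
  thus ?thesis
  proof cases
    case 1
    have "?S = {0}"
    proof
      show "?S \<subseteq> {0}"
      proof
        fix r assume r: "r \<in> ?S"
        hence "r\<^sup>2 mod int p = 0\<^sup>2 mod int p" using 1 by simp
        with sq_eq_imp[OF p(1), of r 0] r p show "r \<in> {0}" by auto
      qed
    qed (use 1 p in auto)
    thus ?thesis using 1 J by (simp add: Legendre_def)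
  next
    case 2
    then obtain y0 where "[y0\<^sup>2 = a] (mod int p)" unfolding QuadRes_def by blast
    define y where "y = y0 mod int p"
    have y: "y \<in> {0..<int p}" "y\<^sup>2 mod int p = a"
      using p a \<open>[y0\<^sup>2 = a] (mod int p)\<close> by (auto simp: y_def power_mod cong_def)
    have "y \<noteq> 0" using y(2) 2 by auto
    have z: "int p - y \<in> {0..<int p}" using y \<open>y \<noteq> 0\<close> by auto
    have "(int p - y)\<^sup>2 - y\<^sup>2 = int p * (int p - 2 * y)" by (simp add: power2_eq_square algebra_simps)
    hence "(int p - y)\<^sup>2 mod int p = y\<^sup>2 mod int p"
      by (simp add: mod_eq_dvd_iff)
    hence "?S = {y, int p - y}"
    proof (intro equalityI subsetI)
      fix r assume r: "r \<in> ?S"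
      hence "r\<^sup>2 mod int p = y\<^sup>2 mod int p" using y by simp
      with sq_eq_imp[OF p(1), of r y] r y \<open>y \<noteq> 0\<close> show "r \<in> {y, int p - y}" by auto
    qed (use y z in auto)
    moreover have "y \<noteq> int p - y"
    proof
      assume "y = int p - y"
      hence "even (int p)" by presburger
      thus False using op by simp
    qed
    moreover have "Legendre a (int p) = 1"
      using 2 a zdvd_not_zless[of a "int p"] by (auto simp: Legendre_def cong_0_iff)
    ultimately show ?thesis using J by simp
  next
    case 3
    have "?S = {}" using 3 p by (auto simp: QuadRes_def cong_def)
    hence "card ?S = 0" by (simp only: card.empty)
    moreover have "Legendre a (int p) = -1"
      using 3 a zdvd_not_zless[of a "int p"] by (auto simp: Legendre_def cong_0_iff)
    ultimately show ?thesis using J by simp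
  qed
qed

text \<open>The residue \<open>a\<close> has \<open>1 + jac a p\<close> square roots. Grouping the
  squares by their residue, the constant 1 contributes a complete exponential sum, which is
  0.\<close>

lemma gauss_sum_1_prime:
  assumes p: "prime p" "p > 2"
  shows "gauss_sum 1 p = quad_gauss p"
proof -
  let ?R = "{0..<int p}"
  let ?f = "\<lambda>a::int. ee (of_int a / real p)"
  have "quad_gauss p = (\<Sum>r\<in>?R. ?f (r\<^sup>2 mod int p))"
    unfolding quad_gauss_def
  proof (rule sum.cong[OF refl])
    fix r
    show "?f (r\<^sup>2) = ?f (r\<^sup>2 mod int p)"
      by (rule ee_cong) (use p in \<open>auto simp: cong_def\<close>)
  qed
  also have "\<dots> = (\<Sum>a\<in>?R. \<Sum>r\<in>{r \<in> ?R. r\<^sup>2 mod int p = a}. ?f (r\<^sup>2 mod int p))"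
    by (rule sum.group[symmetric]) (use p in auto)
  also have "\<dots> = (\<Sum>a\<in>?R. of_int (1 + jac a p) * ?f a)"
  proof (rule sum.cong[OF refl])
    fix a assume a: "a \<in> ?R"
    let ?S = "{r \<in> ?R. r\<^sup>2 mod int p = a}"
    have "(\<Sum>r\<in>?S. ?f (r\<^sup>2 mod int p)) = (\<Sum>r\<in>?S. ?f a)" by (rule sum.cong) auto
    also have "\<dots> = of_int (int (card ?S)) * ?f a" by simp
    finally show "(\<Sum>r\<in>?S. ?f (r\<^sup>2 mod int p)) = of_int (1 + jac a p) * ?f a"
      unfolding card_square_roots[OF p a] .
  qed
  also have "\<dots> = (\<Sum>a\<in>?R. ?f a) + gauss_sum 1 p"
    by (simp add: gauss_sum_def ring_distribs sum.distrib)
  also have "(\<Sum>a\<in>?R. ?f a) = 0"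
    using root_sum[of p 1] p zdvd_not_zless[of 1 "int p"] by simp
  finally show ?thesis by simp
qed

lemma gauss_sum_prime:
  assumes p: "prime p" "p > 2"
  shows "gauss_sum b p = of_int (jac b p) * quad_gauss p"
proof (cases "int p dvd b")
  case True
  have op: "odd p" using p prime_odd_nat by simp
  have "\<not> coprime b (int p)" using True p coprime_common_divisor[of b "int p" "int p"] by auto
  hence "jac b p = 0" using jac_eq_0_iff[OF op] by simp
  moreover have "gauss_sum b p = 0"
  proof -
    have "ee (of_int (a * b) / real p) = 1" for a
      using ee_cong[of "a * b" 0 p] True p by (simp add: cong_0_iff)
    hence "gauss_sum b p = (\<Sum>a\<in>{0..<int p}. of_int (jac a p))" by (simp add: gauss_sum_def)
    \<comment> \<open>The symbol is the number of square roots minus 1, and the root counts add up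
      to \<open>p\<close>; hence the symbols sum to 0.\<close>
    also have "\<dots> = (\<Sum>a\<in>{0..<int p}. of_nat (card {r \<in> {0..<int p}. r\<^sup>2 mod int p = a})) - of_nat p"
    proof -
      have "jac a p = int (card {r \<in> {0..<int p}. r\<^sup>2 mod int p = a}) - 1" if "a \<in> {0..<int p}" for a
        using card_square_roots[OF p that] by simp
      thus ?thesis by (simp add: sum_subtractf)
    qed
    also have "(\<Sum>a\<in>{0..<int p}. of_nat (card {r \<in> {0..<int p}. r\<^sup>2 mod int p = a})) =
        (\<Sum>a\<in>{0..<int p}. \<Sum>r\<in>{r \<in> {0..<int p}. r\<^sup>2 mod int p = a}. (1::complex))" by simp
    also have "\<dots> = (\<Sum>r\<in>{0..<int p}. 1)" by (rule sum.group) (use p in auto)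
    finally show ?thesis by simp
  qed
  ultimately show ?thesis by simp
next
  case False
  have op: "odd p" using p prime_odd_nat by simp
  have cop: "coprime b (int p)" using False p prime_imp_coprime[of "int p" b] by (simp add: coprime_commute)
  have "(\<Sum>x\<in>{0..<int p}. of_int (jac (x * b) p) * ee (of_int (x * b * 1) / real p)) = gauss_sum 1 p"
    unfolding gauss_sum_def
  proof (rule residue_sum[where f = "\<lambda>a. of_int (jac a p) * ee (of_int (a * 1) / real p)"])
    show "inj_on (\<lambda>x. x * b mod int p) {0..<int p}"
    proof (rule inj_onI)
      fix x y assume xy: "x \<in> {0..<int p}" "y \<in> {0..<int p}" "x * b mod int p = y * b mod int p"
      hence "[x = y] (mod int p)" using cong_mult_rcancel[OF cop, of x y] by (simp add: cong_def)
      thus "x = y" using xy by (simp add: cong_def)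
    qed
    fix x
    have "ee (of_int (x mod int p) / real p) = ee (of_int x / real p)"
      by (rule ee_cong) (use p in \<open>auto simp: cong_def\<close>)
    thus "of_int (jac (x mod int p) p) * ee (of_int (x mod int p * 1) / real p) = of_int (jac x p) * ee (of_int (x * 1) / real p)"
      by (simp add: jac_mod[OF op])
  qed (use p in auto)
  hence "of_int (jac b p) * gauss_sum b p = gauss_sum 1 p"
    by (simp add: gauss_sum_def jac_mult_top[OF op] sum_distrib_left mult_ac)
  moreover have "(of_int (jac b p) :: complex) * of_int (jac b p) = 1"
    using jac_square[OF op, of b] cop by (simp add: power2_eq_square flip: of_int_mult)
  ultimately have "gauss_sum b p = of_int (jac b p) * gauss_sum 1 p"
    by (metis mult.assoc mult_1)
  thus ?thesis using gauss_sum_1_prime[OF p] by simp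
qed

text \<open>With \<open>r = u + n * t * v\<close> the sum over \<open>v\<close> is a complete sum
  modulo \<open>t\<close> of frequency \<open>2 * u\<close>, so only multiples
  \<open>u = t * w\<close> survive. This carries the question of the sign over to large
  moduli.\<close>

lemma quad_gauss_scale:
  assumes "odd t" "n > 0"
  shows "quad_gauss (n * t\<^sup>2) = of_nat t * quad_gauss n"
proof -
  have t: "t > 0" using assms odd_pos by blast
  let ?N = "n * t\<^sup>2"
  have N: "?N > 0" using t assms by simp
  let ?f = "\<lambda>r::int. ee (of_int (r\<^sup>2) / real ?N)"
  let ?h = "\<lambda>(u, v). u + int (n * t) * v"
  have "(\<Sum>p\<in>{0..<int (n * t)} \<times> {0..<int t}. ?f (?h p)) = (\<Sum>r\<in>{0..<int ?N}. ?f r)"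
  proof (rule residue_sum)
    show "inj_on (\<lambda>p. ?h p mod int ?N) ({0..<int (n * t)} \<times> {0..<int t})"
    proof (rule inj_onI, clarify)
      fix u v u' v'
      assume b: "u \<in> {0..<int (n * t)}" "v \<in> {0..<int t}" "u' \<in> {0..<int (n * t)}" "v' \<in> {0..<int t}"
        and eq: "(u + int (n * t) * v) mod int ?N = (u' + int (n * t) * v') mod int ?N"
      have rng: "0 \<le> u + int (n * t) * v \<and> u + int (n * t) * v < int ?N"
        if "u \<in> {0..<int (n * t)}" "v \<in> {0..<int t}" for u v
      proof -
        define c where "c = int (n * t)"
        have "c * v \<le> c * (int t - 1)" using that unfolding c_def by (intro mult_left_mono) auto
        hence "c * v \<le> c * int t - c" by (simp add: right_diff_distrib)
        moreover have "int ?N = c * int t" by (simp add: power2_eq_square c_def)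
        moreover have "u < c" using that(1) by (simp add: c_def)
        ultimately have "u + int (n * t) * v < int ?N" unfolding c_def by linarith
        moreover have "0 \<le> int (n * t) * v" using that by (intro mult_nonneg_nonneg) auto
        ultimately show ?thesis using that(1) by auto
      qed
      have e: "u + int (n * t) * v = u' + int (n * t) * v'"
        using eq rng[OF b(1,2)] rng[OF b(3,4)] by (simp only: mod_pos_pos_trivial)
      hence "(u + int (n * t) * v) mod int (n * t) = (u' + int (n * t) * v') mod int (n * t)" by simp
      hence "u = u'" using b by (simp only: mod_mult_self2) simp
      thus "u = u' \<and> v = v'" using e t assms by simp
    qed
    show "card ({0..<int (n * t)} \<times> {0..<int t}) = ?N"
      by (simp add: card_cartesian_product power2_eq_square nat_mult_distrib)
    show "?f (x mod int ?N) = ?f x" for x by (rule ee_sq_mod[OF N])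
  qed (use N in auto)
  hence "quad_gauss ?N = (\<Sum>p\<in>{0..<int (n * t)} \<times> {0..<int t}. ?f (?h p))"
    by (simp only: quad_gauss_def)
  also have "\<dots> = (\<Sum>u\<in>{0..<int (n * t)}. \<Sum>v\<in>{0..<int t}. ?f (u + int (n * t) * v))"
    unfolding sum.cartesian_product by (rule sum.cong) auto
  also have "\<dots> = (\<Sum>u\<in>{0..<int (n * t)}. ?f u * (\<Sum>v\<in>{0..<int t}. ee (of_int (2 * u) * of_int v / real t)))"
  proof (intro sum.cong refl, subst sum_distrib_left, intro sum.cong refl)
    fix u v :: int
    have "of_int ((u + int (n * t) * v)\<^sup>2) / real ?N =
      of_int (u\<^sup>2) / real ?N + of_int (2 * u) * of_int v / real t + of_int (int n * v\<^sup>2)"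
      using t assms by (simp add: field_simps power2_eq_square)
    thus "?f (u + int (n * t) * v) = ?f u * ee (of_int (2 * u) * of_int v / real t)"
      by (simp only: ee_add ee_int mult_1_right)
  qed
  also have "\<dots> = (\<Sum>u\<in>{0..<int (n * t)}. if int t dvd u then of_nat t * ?f u else 0)"
  proof (intro sum.cong refl)
    fix u
    have "coprime (int t) 2" using assms by simp
    hence "int t dvd 2 * u \<longleftrightarrow> int t dvd u" by (simp add: coprime_dvd_mult_right_iff)
    thus "?f u * (\<Sum>v\<in>{0..<int t}. ee (of_int (2 * u) * of_int v / real t)) = (if int t dvd u then of_nat t * ?f u else 0)"
      using root_sum[OF t, of "2 * u"] by simp
  qed
  also have "\<dots> = (\<Sum>u\<in>{u \<in> {0..<int (n * t)}. int t dvd u}. of_nat t * ?f u)"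
    by (rule sum.inter_filter[symmetric]) simp
  also have "\<dots> = (\<Sum>w\<in>{0..<int n}. of_nat t * ee (of_int (w\<^sup>2) / real n))"
  proof (rule sum.reindex_bij_witness[of _ "\<lambda>w. int t * w" "\<lambda>u. u div int t"])
    fix u assume u: "u \<in> {u \<in> {0..<int (n * t)}. int t dvd u}"
    then obtain w where w: "u = int t * w" by blast
    have "0 \<le> int t * w" "int t * w < int t * int n" using u w by (auto simp: mult.commute)
    hence "0 \<le> w" "w < int n" using t by (simp_all add: zero_le_mult_iff)
    thus "u div int t \<in> {0..<int n}" "int t * (u div int t) = u" using w t by auto
    have "of_int (w\<^sup>2) / real n = of_int (u\<^sup>2) / real ?N"
      using w t assms by (simp add: field_simps power2_eq_square)
    thus "of_nat t * ee (of_int ((u div int t)\<^sup>2) / real n) = of_nat t * ee (of_int (u\<^sup>2) / real ?N)"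
      using w t by simp
  next
    fix w assume w: "w \<in> {0..<int n}"
    hence "int t * w < int t * int n" using t by (intro mult_strict_left_mono) auto
    thus "int t * w \<in> {u \<in> {0..<int (n * t)}. int t dvd u}" using w t by (simp add: mult.commute)
    show "int t * w div int t = w" using t by simp
  qed
  also have "\<dots> = of_nat t * quad_gauss n" by (simp add: quad_gauss_def sum_distrib_left)
  finally show ?thesis .
qed


section \<open>The sign of the quadratic Gauss sum\<close>

lemma abel_bound:
  fixes c :: "nat \<Rightarrow> real" and E :: "nat \<Rightarrow> complex"
  assumes "m \<le> n" "\<And>j. m \<le> j \<Longrightarrow> j < n \<Longrightarrow> c (Suc j) \<le> c j" "\<And>j. m \<le> j \<Longrightarrow> j \<le> n \<Longrightarrow> c j \<ge> 0"
    "\<And>j. cmod (E j) \<le> 1"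
  shows "cmod (\<Sum>j=m..n. of_real (c j) * (E (Suc j) - E j)) \<le> 2 * c m"
proof -
  have "n' \<le> n \<Longrightarrow> cmod ((\<Sum>j=m..n'. of_real (c j) * (E (Suc j) - E j)) - of_real (c n') * E (Suc n')) \<le> 2 * c m - c n'"
    if "m \<le> n'" for n'
    using that
  proof (induction n' rule: dec_induct)
    case base
    have "cmod (of_real (c m) * E m) \<le> c m * 1"
      unfolding norm_mult using assms(3)[of m] assms(1,4) by (intro mult_mono) auto
    thus ?case by (simp add: right_diff_distrib norm_minus_commute)
  next
    case (step k)
    let ?S = "\<Sum>j=m..k. of_real (c j) * (E (Suc j) - E j)"
    have "(\<Sum>j=m..Suc k. of_real (c j) * (E (Suc j) - E j)) - of_real (c (Suc k)) * E (Suc (Suc k)) =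
      (?S - of_real (c k) * E (Suc k)) + of_real (c k - c (Suc k)) * E (Suc k)"
      using step(1) by (simp add: algebra_simps)
    moreover have "cmod (of_real (c k - c (Suc k)) * E (Suc k)) \<le> (c k - c (Suc k)) * 1"
      unfolding norm_mult norm_of_real using assms(2)[of k] step assms(4) by (intro mult_mono) auto
    moreover have "cmod (?S - of_real (c k) * E (Suc k)) \<le> 2 * c m - c k" using step by simp
    ultimately show ?case
      using norm_triangle_ineq[of "?S - of_real (c k) * E (Suc k)" "of_real (c k - c (Suc k)) * E (Suc k)"] by simp
  qed
  from this[OF assms(1)] have 1: "cmod ((\<Sum>j=m..n. of_real (c j) * (E (Suc j) - E j)) - of_real (c n) * E (Suc n)) \<le> 2 * c m - c n"
    by simp
  have "cmod (of_real (c n) * E (Suc n)) \<le> c n * 1"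
    unfolding norm_mult using assms(3)[of n] assms(1,4) by (intro mult_mono) auto
  with 1 norm_triangle_ineq[of "(\<Sum>j=m..n. of_real (c j) * (E (Suc j) - E j)) - of_real (c n) * E (Suc n)" "of_real (c n) * E (Suc n)"]
  show ?thesis by simp
qed

text \<open>The phase is a discrete derivative:
  \<open>ee ((x + 1/2)\<^sup>2 / K) - ee ((x - 1/2)\<^sup>2 / K)\<close> is
  \<open>ee (x\<^sup>2 / K)\<close> times a constant and \<open>sin (2 * pi * x / K)\<close>. As
  long as \<open>x \<le> K / 4\<close> the sine increases, so partial summation leaves twice the
  first coefficient.\<close>

lemma quadratic_tail:
  fixes K \<theta> :: real
  assumes "m \<le> n" "K > 0" "\<theta> > 0" "\<theta> + real n \<le> K / 4"
  shows "cmod (\<Sum>j=m..n. ee ((\<theta> + real j)\<^sup>2 / K)) \<le> 1 / sin (2 * pi * (\<theta> + real m) / K)"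
proof -
  define x where "x j = \<theta> + real j" for j
  define c where "c j = 1 / (2 * sin (2 * pi * x j / K))" for j
  define E where "E j = ee ((x j - 1/2)\<^sup>2 / K)" for j
  have ang: "0 < 2 * pi * x j / K" "2 * pi * x j / K \<le> pi / 2" if "j \<le> n" for j
  proof -
    have "0 < x j" "x j \<le> K / 4" using assms that by (auto simp: x_def)
    thus "0 < 2 * pi * x j / K" using assms by simp
    have "2 * pi * x j \<le> 2 * pi * (K / 4)" using \<open>x j \<le> K / 4\<close> by (intro mult_left_mono) auto
    hence "2 * pi * x j / K \<le> 2 * pi * (K / 4) / K" using assms(2) by (intro divide_right_mono) auto
    thus "2 * pi * x j / K \<le> pi / 2" using assms(2) by simp
  qed
  have sp: "sin (2 * pi * x j / K) > 0" if "j \<le> n" for j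
  proof -
    have "2 * pi * x j / K < pi" using ang(2)[OF that] pi_gt_zero by linarith
    thus ?thesis using ang(1)[OF that] by (rule sin_gt_zero[rotated])
  qed
  have key: "ee ((\<theta> + real j)\<^sup>2 / K) = (- \<i> * ee (- 1 / (4 * K))) * (of_real (c j) * (E (Suc j) - E j))" if "j \<le> n" for j
  proof -
    have e1: "(x (Suc j) - 1/2)\<^sup>2 / K = (x j)\<^sup>2 / K + 1 / (4 * K) + x j / K"
      using assms(2) by (simp add: x_def field_simps power2_eq_square)
    have e2: "(x j - 1/2)\<^sup>2 / K = (x j)\<^sup>2 / K + 1 / (4 * K) + - (x j / K)"
      using assms(2) by (simp add: x_def field_simps power2_eq_square)
    have "ee (x j / K) - ee (- (x j / K)) = 2 * \<i> * of_real (sin (2 * pi * x j / K))"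
      by (simp add: ee_def complex_eq_iff)
    hence "E (Suc j) - E j = ee ((x j)\<^sup>2 / K) * ee (1 / (4 * K)) * (2 * \<i> * of_real (sin (2 * pi * x j / K)))"
      unfolding E_def e1 e2 ee_add by (simp only: right_diff_distrib[symmetric])
    moreover have "of_real (c j) * (2 * \<i> * of_real (sin (2 * pi * x j / K))) = \<i>"
      using sp[OF that] by (simp add: c_def)
    ultimately have "of_real (c j) * (E (Suc j) - E j) = ee ((x j)\<^sup>2 / K) * ee (1 / (4 * K)) * \<i>"
      by (simp add: mult_ac)
    moreover have "ee (- 1 / (4 * K)) * ee (1 / (4 * K)) = 1" by (simp add: ee_add[symmetric])
    ultimately show ?thesis by (simp add: x_def mult_ac)
  qed
  have "(\<Sum>j=m..n. ee ((\<theta> + real j)\<^sup>2 / K)) = (- \<i> * ee (- 1 / (4 * K))) * (\<Sum>j=m..n. of_real (c j) * (E (Suc j) - E j))"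
    unfolding sum_distrib_left by (rule sum.cong) (use key in auto)
  hence "cmod (\<Sum>j=m..n. ee ((\<theta> + real j)\<^sup>2 / K)) = cmod (\<Sum>j=m..n. of_real (c j) * (E (Suc j) - E j))"
    by (simp add: norm_mult)
  also have "\<dots> \<le> 2 * c m"
  proof (rule abel_bound[OF assms(1)])
    fix j assume j: "m \<le> j" "j < n"
    have "sin (2 * pi * x j / K) \<le> sin (2 * pi * x (Suc j) / K)"
    proof (rule sin_monotone_2pi_le)
      show "- (pi / 2) \<le> 2 * pi * x j / K" using ang(1)[of j] j pi_gt_zero by linarith
      show "2 * pi * x j / K \<le> 2 * pi * x (Suc j) / K"
        using assms(2) by (intro divide_right_mono mult_left_mono) (auto simp: x_def)
      show "2 * pi * x (Suc j) / K \<le> pi / 2" using ang(2)[of "Suc j"] j by simp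
    qed
    thus "c (Suc j) \<le> c j" unfolding c_def using sp[of j] j by (intro divide_left_mono mult_pos_pos) auto
  next
    fix j assume "m \<le> j" "j \<le> n"
    thus "c j \<ge> 0" using sp[of j] by (simp add: c_def)
  qed (simp add: E_def)
  also have "\<dots> = 1 / sin (2 * pi * (\<theta> + real m) / K)" by (simp add: c_def x_def)
  finally show ?thesis .
qed

text \<open>Up to \<open>sqrt K / 2\<close> the angle stays in the first quadrant and both parts of
  a term are nonnegative; up to \<open>4/10 * sqrt K\<close> it is at most \<open>pi / 3\<close> and
  the real part at least 1/2. \<open>quadratic_tail\<close> bounds the rest by
  \<open>32/100 * sqrt K\<close>, as \<open>1 / pi < 32/100\<close>. Hence 20/100 - 32/100 for the
  real part.\<close>

lemma quadratic_sum_lower: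
  fixes K \<theta> :: real
  assumes "K \<ge> 1000" "0 < \<theta>" "\<theta> \<le> 1" "\<theta> + real n \<le> K / 4 + 1" "K / 4 \<le> \<theta> + real n"
  shows "Re (\<Sum>j<n. ee ((\<theta> + real j)\<^sup>2 / K)) \<ge> - 12/100 * sqrt K - 1/2"
    and "Im (\<Sum>j<n. ee ((\<theta> + real j)\<^sup>2 / K)) \<ge> - 32/100 * sqrt K"
proof -
  define s where "s = sqrt K"
  have s31: "s \<ge> 31" unfolding s_def using assms(1) by (intro real_le_rsqrt) auto
  have sK: "s\<^sup>2 = K" unfolding s_def using assms(1) by simp
  define m where "m = nat \<lfloor>s / 2 - \<theta>\<rfloor> + 1"
  define m2 where "m2 = nat \<lfloor>4/10 * s - \<theta>\<rfloor> + 1"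
  have m: "s / 2 < \<theta> + real m" "real m \<le> s / 2 - \<theta> + 1" using s31 assms(3) unfolding m_def by linarith+
  have m2: "4/10 * s < \<theta> + real m2" "real m2 \<le> 4/10 * s - \<theta> + 1" using s31 assms(3) unfolding m2_def by linarith+
  have "s * 31 \<le> s * s" using s31 by (intro mult_left_mono) auto
  hence sq: "31 * s \<le> K" using sK by (simp add: power2_eq_square mult.commute)
  have mn: "m < n" using m(2) assms(5) sq s31 assms(2) by linarith
  have m2m: "m2 \<le> m" unfolding m_def m2_def using s31 by (intro add_mono nat_mono floor_mono) auto
  let ?e = "\<lambda>j. ee ((\<theta> + real j)\<^sup>2 / K)"
  have split: "(\<Sum>j<n. ?e j) = (\<Sum>j<m. ?e j) + (\<Sum>j=m..n-1. ?e j)"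
  proof -
    have "{..<n} = {..<m} \<union> {m..n-1}" using mn by auto
    hence "(\<Sum>j<n. ?e j) = (\<Sum>j\<in>{..<m} \<union> {m..n-1}. ?e j)" by (rule arg_cong)
    also have "\<dots> = (\<Sum>j<m. ?e j) + (\<Sum>j=m..n-1. ?e j)" by (rule sum.union_disjoint) auto
    finally show ?thesis .
  qed
  have tail: "cmod (\<Sum>j=m..n-1. ?e j) \<le> 32/100 * s"
  proof -
    have "cmod (\<Sum>j=m..n-1. ?e j) \<le> 1 / sin (2 * pi * (\<theta> + real m) / K)"
      by (rule quadratic_tail) (use mn assms in auto)
    also have "\<dots> \<le> 1 / sin (pi / s)"
    proof (intro divide_left_mono mult_pos_pos)
      have e: "pi / s = 2 * pi * (s / 2) / K" using s31 unfolding sK[symmetric] by (simp add: power2_eq_square)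
      have up: "2 * pi * (\<theta> + real m) / K \<le> pi / 2"
      proof -
        have "\<theta> + real m \<le> K / 4" using m(2) sq s31 by linarith
        hence "2 * pi * (\<theta> + real m) \<le> 2 * pi * (K / 4)" by (intro mult_left_mono) auto
        hence "2 * pi * (\<theta> + real m) / K \<le> 2 * pi * (K / 4) / K" using assms(1) by (intro divide_right_mono) auto
        thus ?thesis using assms(1) by simp
      qed
      have le: "pi / s \<le> 2 * pi * (\<theta> + real m) / K"
        unfolding e using m(1) assms(1) by (intro divide_right_mono mult_left_mono) auto
      have p0: "0 < pi / s" using s31 by simp
      show "sin (pi / s) \<le> sin (2 * pi * (\<theta> + real m) / K)"
        by (rule sin_monotone_2pi_le) (use le up p0 pi_gt_zero in auto)
      show "0 < sin (pi / s)" by (rule sin_gt_zero) (use p0 le up pi_gt_zero in auto)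
      show "0 < sin (2 * pi * (\<theta> + real m) / K)" by (rule sin_gt_zero) (use p0 le up pi_gt_zero in auto)
    qed auto
    also have "\<dots> \<le> 32/100 * s"
    proof -
      define y where "y = pi / s"
      have p: "pi > 314/100" "pi < 315/100" using pi_approx by auto
      have y: "0 < y" "y \<le> (315/100) / 31"
        using s31 p unfolding y_def by (simp, intro frac_le) auto
      \<comment> \<open>Since \<open>y \<le> (315/100) / 31\<close>, the cubic error is at most
        \<open>y / 480\<close>, and \<open>479/480 * (314/100)\<close> still exceeds
        \<open>100/32\<close>.\<close>
      have "\<bar>sin y - (\<Sum>k<3. sin_coeff k * y ^ k)\<bar> \<le> inverse (fact 3) * \<bar>y\<bar> ^ 3"
        by (rule Maclaurin_sin_bound)
      moreover have "(\<Sum>k<3. sin_coeff k * y ^ k) = y"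
        by (simp add: sin_coeff_def eval_nat_numeral)
      moreover have "inverse (fact 3) * \<bar>y\<bar> ^ 3 = y ^ 3 / 6" using y(1) by (simp add: eval_nat_numeral)
      ultimately have "sin y \<ge> y - y ^ 3 / 6" by linarith
      moreover have "y ^ 3 \<le> (1/80) * y"
      proof -
        have "y * y \<le> (315/100 / 31) * (315/100 / 31)" using y by (intro mult_mono) auto
        also have "\<dots> \<le> 1/80" by simp
        finally have "(y * y) * y \<le> 1/80 * y" using y by (intro mult_right_mono) auto
        thus ?thesis by (simp add: power3_eq_cube)
      qed
      ultimately have "sin y \<ge> (479/480) * y" by simp
      moreover have "(100/32) / s \<le> ((479/480) * pi) / s"
        using p s31 by (intro divide_right_mono) auto
      ultimately have le: "(100/32) / s \<le> sin y" by (simp add: y_def)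
      have "0 < (100/32) / s" using s31 by simp
      hence "1 / sin y \<le> 1 / ((100/32) / s)" using le by (intro divide_left_mono mult_pos_pos) linarith+
      thus ?thesis using s31 by (simp add: y_def)
    qed
    finally show ?thesis .
  qed
  have ang: "0 \<le> 2 * pi * ((\<theta> + real j)\<^sup>2 / K)" "2 * pi * ((\<theta> + real j)\<^sup>2 / K) \<le> pi / 2" if "j < m" for j
  proof -
    have "\<theta> + real j \<le> s / 2" using that m(2) by linarith
    hence "(\<theta> + real j)\<^sup>2 \<le> (s / 2)\<^sup>2" using assms(2) by (intro power_mono) auto
    hence "(\<theta> + real j)\<^sup>2 / K \<le> 1/4" using sK assms(1) by (simp add: power_divide)
    hence "2 * pi * ((\<theta> + real j)\<^sup>2 / K) \<le> 2 * pi * (1/4)" by (intro mult_left_mono) auto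
    thus "2 * pi * ((\<theta> + real j)\<^sup>2 / K) \<le> pi / 2" by simp
    show "0 \<le> 2 * pi * ((\<theta> + real j)\<^sup>2 / K)" using assms(1) by simp
  qed
  have Im_head: "Im (\<Sum>j<m. ?e j) \<ge> 0"
    unfolding Im_sum
  proof (rule sum_nonneg)
    fix j assume "j \<in> {..<m}"
    hence j: "j < m" by simp
    have "0 \<le> sin (2 * pi * ((\<theta> + real j)\<^sup>2 / K))"
      by (rule sin_ge_zero) (use ang[OF j] pi_gt_zero in linarith)+
    thus "0 \<le> Im (?e j)" by (simp add: ee_def)
  qed
  have Re_head: "Re (\<Sum>j<m. ?e j) \<ge> 2/10 * s - 1/2"
  proof -
    have "2/10 * s - 1/2 \<le> (\<Sum>j<m2. 1/2::real)" using m2(1) assms(3) by simp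
    also have "\<dots> \<le> (\<Sum>j<m2. Re (?e j))"
    proof (rule sum_mono)
      fix j assume "j \<in> {..<m2}"
      hence j: "j < m2" "j < m" using m2m by auto
      have "\<theta> + real j \<le> 4/10 * s" using j m2(2) by linarith
      hence "(\<theta> + real j)\<^sup>2 \<le> (4/10 * s)\<^sup>2" using assms(2) by (intro power_mono) auto
      hence "(\<theta> + real j)\<^sup>2 / K \<le> 1/6" using sK assms(1) by (simp add: power_mult_distrib power_divide field_simps)
      hence "2 * pi * ((\<theta> + real j)\<^sup>2 / K) \<le> 2 * pi * (1/6)" by (intro mult_left_mono) auto
      hence "2 * pi * ((\<theta> + real j)\<^sup>2 / K) \<le> pi / 3" by simp
      hence "cos (pi / 3) \<le> cos (2 * pi * ((\<theta> + real j)\<^sup>2 / K))"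
        using ang(1)[OF j(2)] pi_gt_zero by (intro cos_monotone_0_pi_le) auto
      thus "1/2 \<le> Re (?e j)" by (simp add: ee_def cos_60)
    qed
    also have "\<dots> \<le> (\<Sum>j<m. Re (?e j))"
    proof (rule sum_mono2)
      fix j assume "j \<in> {..<m} - {..<m2}"
      hence j: "j < m" by simp
      have "0 \<le> cos (2 * pi * ((\<theta> + real j)\<^sup>2 / K))"
        by (rule cos_ge_zero) (use ang[OF j] pi_gt_zero in linarith)+
      thus "0 \<le> Re (?e j)" by (simp add: ee_def)
    qed (use m2m in auto)
    finally show ?thesis by simp
  qed
  have "Re (\<Sum>j=m..n-1. ?e j) \<ge> - (32/100 * s)" "Im (\<Sum>j=m..n-1. ?e j) \<ge> - (32/100 * s)"
    using tail abs_Re_le_cmod[of "\<Sum>j=m..n-1. ?e j"] abs_Im_le_cmod[of "\<Sum>j=m..n-1. ?e j"] by linarith+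
  with Im_head Re_head split show "Re (\<Sum>j<n. ?e j) \<ge> - 12/100 * sqrt K - 1/2" "Im (\<Sum>j<n. ?e j) \<ge> - 32/100 * sqrt K"
    by (simp_all add: s_def)
qed

text \<open>Residues up to about \<open>K / 4\<close> in modulus pair up and give the first sum.
  Beyond that, \<open>x = K / 2 + (1/2 + j)\<close> turns \<open>x\<^sup>2 / K\<close> into
  \<open>K / 4\<close>, a half-integer and the small phase \<open>(1/2 + j)\<^sup>2 / K\<close>, so
  these residues also form a slowly varying sum.\<close>

lemma quad_gauss_split:
  assumes "odd K" "J = K div 4" "n = (K - 1) div 2 - J"
  shows "quad_gauss K = 1 + 2 * (\<Sum>j<J. ee ((1 + real j)\<^sup>2 / real K)) - 2 * ee (real K / 4) * (\<Sum>j<n. ee ((1/2 + real j)\<^sup>2 / real K))"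
proof -
  have K: "K > 0" using assms odd_pos by blast
  obtain h where h: "K = 2 * h + 1" using assms(1) oddE by blast
  have n: "n = h - J" and Jh: "J \<le> h" using assms(2,3) h by auto
  let ?f = "\<lambda>x::int. ee (of_int (x\<^sup>2) / real K)"
  have "quad_gauss K = (\<Sum>x\<in>{- int J..<int K - int J}. ?f x)"
    unfolding quad_gauss_def
  proof (rule residue_sum[symmetric, where h = "\<lambda>x. x"])
    show "inj_on (\<lambda>x. x mod int K) {- int J..<int K - int J}"
    proof (rule inj_onI)
      fix x y assume xy: "x \<in> {- int J..<int K - int J}" "y \<in> {- int J..<int K - int J}" "x mod int K = y mod int K"
      have "int K dvd x - y" using xy(3) by (simp add: mod_eq_dvd_iff)
      moreover have "\<bar>x - y\<bar> < int K" using xy(1,2) by auto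
      ultimately show "x = y" using zdvd_not_zless[of "\<bar>x - y\<bar>" "int K"] by (cases "x = y") auto
    qed
  qed (use K ee_sq_mod[OF K] in auto)
  also have "{- int J..<int K - int J} = {- int J..<0} \<union> ({0} \<union> ({1..int J} \<union> ({int J + 1..int h} \<union> {int h + 1..<int K - int J})))"
    using h Jh by auto
  also have "sum ?f \<dots> = (\<Sum>x\<in>{- int J..<0}. ?f x) + (?f 0 + ((\<Sum>x\<in>{1..int J}. ?f x) +
     ((\<Sum>x\<in>{int J + 1..int h}. ?f x) + (\<Sum>x\<in>{int h + 1..<int K - int J}. ?f x))))"
  proof -
    have 1: "sum ?f ({- int J..<0} \<union> ({0} \<union> ({1..int J} \<union> ({int J + 1..int h} \<union> {int h + 1..<int K - int J})))) =
      sum ?f {- int J..<0} + sum ?f ({0} \<union> ({1..int J} \<union> ({int J + 1..int h} \<union> {int h + 1..<int K - int J})))"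
      by (rule sum.union_disjoint) auto
    have 2: "sum ?f ({0} \<union> ({1..int J} \<union> ({int J + 1..int h} \<union> {int h + 1..<int K - int J}))) =
      sum ?f {0} + sum ?f ({1..int J} \<union> ({int J + 1..int h} \<union> {int h + 1..<int K - int J}))"
      using Jh by (intro sum.union_disjoint) auto
    have 3: "sum ?f ({1..int J} \<union> ({int J + 1..int h} \<union> {int h + 1..<int K - int J})) =
      sum ?f {1..int J} + sum ?f ({int J + 1..int h} \<union> {int h + 1..<int K - int J})"
      using Jh by (intro sum.union_disjoint) auto
    have 4: "sum ?f ({int J + 1..int h} \<union> {int h + 1..<int K - int J}) =
      sum ?f {int J + 1..int h} + sum ?f {int h + 1..<int K - int J}"
      by (intro sum.union_disjoint) auto
    have 5: "sum ?f {0} = ?f 0" by simp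
    show ?thesis by (simp only: 1 2 3 4 5)
  qed
  also have "(\<Sum>x\<in>{- int J..<0}. ?f x) = (\<Sum>j<J. ee ((1 + real j)\<^sup>2 / real K))"
    by (rule sum.reindex_bij_witness[of _ "\<lambda>j. - 1 - int j" "\<lambda>x. nat (- 1 - x)"]) (auto simp: power2_eq_square algebra_simps)
  also have "(\<Sum>x\<in>{1..int J}. ?f x) = (\<Sum>j<J. ee ((1 + real j)\<^sup>2 / real K))"
    by (rule sum.reindex_bij_witness[of _ "\<lambda>j. 1 + int j" "\<lambda>x. nat (x - 1)"]) auto
  also have half: "(\<Sum>x\<in>{int h + 1..<int K - int J}. ?f x) = (\<Sum>j<n. - ee (real K / 4) * ee ((1/2 + real j)\<^sup>2 / real K))"
  proof (rule sum.reindex_bij_witness[of _ "\<lambda>j. int h + 1 + int j" "\<lambda>x. nat (x - int h - 1)"])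
    fix x assume x: "x \<in> {int h + 1..<int K - int J}"
    show "nat (x - int h - 1) \<in> {..<n}" "int h + 1 + int (nat (x - int h - 1)) = x" using x h n by auto
    define j where "j = nat (x - int h - 1)"
    have xj: "real_of_int x = real h + 1 + real j" using x by (simp add: j_def)
    have hK: "real h = (real K - 1) / 2" using h by simp
    have "of_int (x\<^sup>2) / real K = real K / 4 + (1/2 + of_int (int j)) + (1/2 + real j)\<^sup>2 / real K"
      using K unfolding of_int_power xj hK by (simp add: field_simps power2_eq_square)
    hence "?f x = ee (real K / 4) * (ee (1/2) * 1) * ee ((1/2 + real j)\<^sup>2 / real K)"
      by (simp only: ee_add ee_int)
    moreover have "ee (1/2) = -1" by (simp add: ee_def cis_pi)
    ultimately show "- ee (real K / 4) * ee ((1/2 + real (nat (x - int h - 1)))\<^sup>2 / real K) = ?f x"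
      by (simp add: j_def)
  qed (use h n in auto)
  also have "(\<Sum>x\<in>{int J + 1..int h}. ?f x) = (\<Sum>x\<in>{int h + 1..<int K - int J}. ?f x)"
  proof (rule sum.reindex_bij_witness[of _ "\<lambda>x. int K - x" "\<lambda>x. int K - x"])
    fix x
    have "(int K - x)\<^sup>2 - x\<^sup>2 = int K * (int K - 2 * x)" by (simp add: power2_eq_square algebra_simps)
    hence "int K dvd (int K - x)\<^sup>2 - x\<^sup>2" by (metis dvd_triv_left)
    thus "?f (int K - x) = ?f x"
      by (intro ee_cong K) (simp add: cong_iff_dvd_diff)
  qed (use h in auto)
  finally show ?thesis unfolding half sum_distrib_left[symmetric] by simp
qed

text \<open>The modulus of the Gauss sum is known and multiplying \<open>n\<close> by an odd square does not change the sign, so it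
  suffices to exclude the wrong sign for large odd \<open>K\<close> (Estermann).\<close>

lemma quad_gauss_not_negative:
  assumes "odd K" "K \<ge> 1000"
  shows "K mod 4 = 1 \<Longrightarrow> Re (quad_gauss K) > - sqrt (real K)"
    and "K mod 4 = 3 \<Longrightarrow> Im (quad_gauss K) > - sqrt (real K)"
proof -
  define J where "J = K div 4"
  define n where "n = (K - 1) div 2 - J"
  define A where "A = (\<Sum>j<J. ee ((1 + real j)\<^sup>2 / real K))"
  define B where "B = (\<Sum>j<n. ee ((1/2 + real j)\<^sup>2 / real K))"
  have G: "quad_gauss K = 1 + 2 * A - 2 * ee (real K / 4) * B"
    unfolding A_def B_def by (rule quad_gauss_split[OF assms(1) J_def n_def])
  have s: "sqrt (real K) \<ge> 31" using assms(2) by (intro real_le_rsqrt) auto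
  have Kdec: "K = 4 * J + K mod 4" unfolding J_def by simp
  have K4: "real K = 4 * real J + real (K mod 4)"
    using arg_cong[OF Kdec, of real] by (simp only: of_nat_add of_nat_mult of_nat_numeral)
  have m4: "K mod 4 = 1 \<or> K mod 4 = 3" by (rule odd_mod_4[OF assms(1)])
  have A: "Re A \<ge> - 12/100 * sqrt (real K) - 1/2" "Im A \<ge> - 32/100 * sqrt (real K)"
    unfolding A_def by (rule quadratic_sum_lower; use assms K4 m4 in auto)+
  {
    assume r: "K mod 4 = 1"
    hence nJ: "n = J" using Kdec unfolding n_def by simp
    have B: "Re B \<ge> - 12/100 * sqrt (real K) - 1/2" "Im B \<ge> - 32/100 * sqrt (real K)"
      unfolding B_def nJ by (rule quadratic_sum_lower; use assms K4 r in \<open>simp add: field_simps\<close>)+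
    have "real K / 4 = 1/4 + of_int (int J)" using K4 r by simp
    \<comment> \<open>The factor \<open>\<i>\<close> brings in the imaginary part of
      \<open>B\<close>: the real part is at least \<open>1 - (24/100 + 64/100) * sqrt K - 1\<close>.
      In the other class \<open>A\<close> and \<open>B\<close> exchange their parts.\<close>
    hence "ee (real K / 4) = \<i>" by (simp only: ee_add ee_int) (simp add: ee_def)
    hence "Re (quad_gauss K) = 1 + 2 * Re A + 2 * Im B" by (simp add: G)
    thus "Re (quad_gauss K) > - sqrt (real K)" using A B s by linarith
  next
    assume r: "K mod 4 = 3"
    hence nJ: "n = J + 1" using Kdec unfolding n_def by simp
    have B: "Re B \<ge> - 12/100 * sqrt (real K) - 1/2" "Im B \<ge> - 32/100 * sqrt (real K)"
      unfolding B_def nJ by (rule quadratic_sum_lower; use assms K4 r in \<open>simp add: field_simps\<close>)+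
    have "real K / 4 = - 1/4 + of_int (int J + 1)" using K4 r by simp
    hence "ee (real K / 4) = - \<i>" by (simp only: ee_add ee_int) (simp add: ee_def complex_eq_iff)
    hence "Im (quad_gauss K) = 2 * Im A + 2 * Re B" by (simp add: G)
    thus "Im (quad_gauss K) > - sqrt (real K)" using A B s by linarith
  }
qed

definition gauss_sign :: "nat \<Rightarrow> complex" where
  "gauss_sign n = (if n mod 4 = 1 then 1 else \<i>)"

text \<open>The modulus is known, and conjugation multiplies the sum by \<open>jac (-1) p\<close>,
  which puts it on the real or the imaginary axis according to \<open>p mod 4\<close>. Only a sign
  remains to be decided.\<close>

lemma quad_gauss_prime:
  assumes p: "prime p" "p > 2"
  shows "quad_gauss p = gauss_sign p * of_real (sqrt (real p))"
proof -
  have op: "odd p" using p prime_odd_nat by simp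
  \<comment> \<open>An odd square that lifts the modulus above 1000 without changing its class mod
    4; the sum and the square root both scale by 101.\<close>
  let ?G = "quad_gauss p" and ?K = "p * 101\<^sup>2"
  have nrm: "(Re ?G)\<^sup>2 + (Im ?G)\<^sup>2 = real p"
    using quad_gauss_norm[OF op] by (simp add: complex_mult_cnj complex_eq_iff)
  have cnj: "cnj ?G = of_int (jac (-1) p) * ?G"
  proof -
    have "cnj (gauss_sum 1 p) = gauss_sum (-1) p"
      by (simp add: gauss_sum_def cnj_ee)
    thus ?thesis using gauss_sum_1_prime[OF p] gauss_sum_prime[OF p, of "-1"] by simp
  qed
  have K: "odd ?K" "?K \<ge> 1000" using op p by auto
  have GK: "quad_gauss ?K = 101 * ?G" using quad_gauss_scale[of 101 p] p by simp
  have sK: "sqrt (real ?K) = 101 * sqrt (real p)" by (simp add: real_sqrt_mult)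
  have Km: "?K mod 4 = p mod 4" by (simp add: mod_mult_right_eq[of p, symmetric])
  show ?thesis
  proof (cases "p mod 4 = 1")
    case True
    have "Im ?G = 0" using cnj jac_minus_one[OF op] True by (simp add: complex_eq_iff)
    hence "(Re ?G)\<^sup>2 = (sqrt (real p))\<^sup>2" using nrm by simp
    moreover have "Re ?G > - sqrt (real p)"
      using quad_gauss_not_negative(1)[OF K] True Km GK sK by simp
    ultimately have "Re ?G = sqrt (real p)" using power2_eq_iff[of "Re ?G" "sqrt (real p)"] by auto
    thus ?thesis using \<open>Im ?G = 0\<close> True by (simp add: gauss_sign_def complex_eq_iff)
  next
    case False
    hence p3: "p mod 4 = 3" using odd_mod_4[OF op] by simp
    have "Re ?G = 0" using cnj jac_minus_one[OF op] False by (simp add: complex_eq_iff)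
    hence "(Im ?G)\<^sup>2 = (sqrt (real p))\<^sup>2" using nrm by simp
    moreover have "Im ?G > - sqrt (real p)"
      using quad_gauss_not_negative(2)[OF K] p3 Km GK sK by simp
    ultimately have "Im ?G = sqrt (real p)" using power2_eq_iff[of "Im ?G" "sqrt (real p)"] by auto
    thus ?thesis using \<open>Re ?G = 0\<close> False by (simp add: gauss_sign_def complex_eq_iff)
  qed
qed

text \<open>Multiplicativity up to the reciprocity sign: that sign is -1 exactly when both factors
  are 3 mod 4, and then it is compensated by \<open>\<i> * \<i> = -1\<close>.\<close>

theorem gauss_sum_eq:
  assumes "odd n" "squarefree n"
  shows "gauss_sum b n = of_int (jac b n) * gauss_sign n * of_real (sqrt (real n))"
  using assms
proof (induction n rule: odd_nat_prime_induct)
  case one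
  have "{0..<1::int} = {0}" by auto
  thus ?case by (simp add: gauss_sum_def gauss_sign_def)
next
  case (mult p m)
  have op: "odd p" using mult prime_odd_nat[of p] by simp
  have cop: "coprime p m"
  proof (rule ccontr)
    assume "\<not> coprime p m"
    hence "p dvd m" using mult(1) prime_imp_coprime by blast
    hence "p\<^sup>2 dvd p * m" by (simp add: power2_eq_square)
    hence "p dvd 1" using mult.prems squarefreeD by blast
    thus False using mult(2) by simp
  qed
  have sm: "squarefree m" using mult.prems squarefree_mono dvd_triv_right by blast
  have "gauss_sum b (p * m) = of_int (jac (int m) p * jac (int p) m) * (gauss_sum b p * gauss_sum b m)"
    by (rule gauss_sum_mult) (use op mult cop in auto)
  also have "jac (int m) p * jac (int p) m = rsgn p m"
    using jac_reciprocity[OF op mult(3) cop] by (simp add: mult.commute)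
  also have "gauss_sum b p = of_int (jac b p) * (gauss_sign p * of_real (sqrt (real p)))"
    using gauss_sum_prime[OF mult(1,2)] quad_gauss_prime[OF mult(1,2)] by simp
  also have "gauss_sum b m = of_int (jac b m) * gauss_sign m * of_real (sqrt (real m))"
    using mult.IH[OF sm] .
  also have "of_int (rsgn p m) * (of_int (jac b p) * (gauss_sign p * of_real (sqrt (real p))) *
       (of_int (jac b m) * gauss_sign m * of_real (sqrt (real m)))) =
     of_int (jac b (p * m)) * (of_int (rsgn p m) * (gauss_sign p * gauss_sign m)) * of_real (sqrt (real (p * m)))"
    using mult odd_pos[of m] prime_gt_0_nat[of p] by (simp add: jac_mult_bottom real_sqrt_mult mult_ac)
  also have "of_int (rsgn p m) * (gauss_sign p * gauss_sign m) = gauss_sign (p * m)"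
    using odd_mod_4[OF op] odd_mod_4[OF mult(3)] odd_mult_mod_4[OF op mult(3)]
    by (auto simp: rsgn_def gauss_sign_def)
  finally show ?case .
qed

section \<open>Poisson summation for the Jacobi symbol\<close>

lemma squarefree_nat_induct [consumes 1, case_names one mult]:
  assumes "squarefree n" "P 1"
    "\<And>p m. prime p \<Longrightarrow> \<not> p dvd m \<Longrightarrow> m > 0 \<Longrightarrow> squarefree m \<Longrightarrow> P m \<Longrightarrow> P (p * m)"
  shows "P (n::nat)"
  using assms(1)
proof (induction n rule: less_induct)
  case (less n)
  show ?case
  proof (cases "n = 1")
    case False
    then obtain p where p: "prime p" "p dvd n" using prime_factor_nat by blast
    then obtain m where m: "n = p * m" by blast
    have sm: "squarefree m" using less.prems m squarefree_mono dvd_triv_right by blast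
    have m0: "m > 0" using less.prems m by (cases "m = 0") auto
    have "\<not> p dvd m"
    proof
      assume "p dvd m"
      hence "p\<^sup>2 dvd n" using m by (simp add: power2_eq_square)
      hence "p dvd 1" using less.prems squarefreeD by blast
      thus False using p(1) by simp
    qed
    moreover have "m < n" using m m0 prime_gt_1_nat[OF p(1)] by simp
    ultimately show ?thesis using less.IH[OF _ sm] assms(3)[OF p(1) _ m0 sm] m by simp
  qed (use assms in simp)
qed

text \<open>Agrees with the Moebius function at squarefree arguments; elsewhere it is still a sign,
  so that its modulus is 1 unconditionally.\<close>

definition mu :: "nat \<Rightarrow> real" where "mu n = (-1) ^ card (prime_factors n)"

definition tau :: "nat \<Rightarrow> nat" where "tau n = card {d. d dvd n}"

lemma finite_divisors: "n > 0 \<Longrightarrow> finite {d. d dvd (n::nat)}"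
  by (rule finite_subset[of _ "{..n}"]) (auto dest: dvd_imp_le)

lemma abs_mu [simp]: "\<bar>mu n\<bar> = 1" by (simp add: mu_def power_abs)

lemma mu_1 [simp]: "mu 1 = 1" "mu (Suc 0) = 1" by (simp_all add: mu_def)

lemma mu_prime_mult: assumes "prime p" "\<not> p dvd e" "e > 0" shows "mu (p * e) = - mu e"
proof -
  have "prime_factors (p * e) = insert p (prime_factors e)"
    using assms prime_gt_0_nat[of p] by (simp add: prime_factorization_mult prime_factorization_prime)
  moreover have "p \<notin> prime_factors e" using assms by auto
  ultimately show ?thesis by (simp add: mu_def)
qed

lemma divisors_prime_mult:
  assumes "prime p" "\<not> p dvd m" "(m::nat) > 0"
  shows "{d. d dvd p * m} = {d. d dvd m} \<union> (*) p ` {d. d dvd m}" "{d. d dvd m} \<inter> (*) p ` {d. d dvd m} = {}"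
proof -
  show "{d. d dvd p * m} = {d. d dvd m} \<union> (*) p ` {d. d dvd m}"
  proof (intro equalityI subsetI)
    fix d assume d: "d \<in> {d. d dvd p * m}"
    show "d \<in> {d. d dvd m} \<union> (*) p ` {d. d dvd m}"
    proof (cases "p dvd d")
      case True
      then obtain d' where d': "d = p * d'" by blast
      hence "d' dvd m" using d prime_gt_0_nat[OF assms(1)] by simp
      thus ?thesis using d' by auto
    next
      case False
      hence "coprime d p" using assms(1) prime_imp_coprime coprime_commute by blast
      thus ?thesis using d by (simp add: coprime_dvd_mult_right_iff)
    qed
  qed auto
  show "{d. d dvd m} \<inter> (*) p ` {d. d dvd m} = {}" using assms(2) dvd_mult_left by blast
qed

lemma divisor_sum_prime_mult:
  fixes f :: "nat \<Rightarrow> real"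
  assumes "prime p" "\<not> p dvd m" "(m::nat) > 0"
  shows "(\<Sum>d | d dvd p * m. f d) = (\<Sum>d | d dvd m. f d) + (\<Sum>d | d dvd m. f (p * d))"
proof -
  have "(\<Sum>d | d dvd p * m. f d) = (\<Sum>d | d dvd m. f d) + sum f ((*) p ` {d. d dvd m})"
    unfolding divisors_prime_mult(1)[OF assms]
    by (rule sum.union_disjoint) (use divisors_prime_mult(2)[OF assms] finite_divisors[OF assms(3)] in auto)
  also have "sum f ((*) p ` {d. d dvd m}) = (\<Sum>d | d dvd m. f (p * d))"
    by (subst sum.reindex) (use prime_gt_0_nat[OF assms(1)] in \<open>auto simp: inj_on_def\<close>)
  finally show ?thesis .
qed

lemma mu_sum: assumes "squarefree n" shows "(\<Sum>d | d dvd n. mu d) = (if n = 1 then 1 else 0)"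
  using assms
proof (induction n rule: squarefree_nat_induct)
  case (mult p m)
  have "mu (p * d) = - mu d" if "d dvd m" for d
    using mu_prime_mult[OF mult(1), of d] mult(2,3) that dvd_trans dvd_pos_nat by blast
  hence "(\<Sum>d | d dvd m. mu (p * d)) = (\<Sum>d | d dvd m. - mu d)" by (intro sum.cong) auto
  thus ?case using divisor_sum_prime_mult[OF mult(1-3), of mu] mult(1) by (auto simp: sum_negf)
qed simp

lemma tau_prime_mult: assumes "prime p" "\<not> p dvd m" "m > 0" shows "tau (p * m) = 2 * tau m"
  using divisor_sum_prime_mult[OF assms, of "\<lambda>_. 1"] by (simp add: tau_def)

text \<open>Every prime factor doubles \<open>tau\<close>. A prime
  \<open>p \<ge> 2 powr (1 / \<delta>)\<close> pays for the doubling by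
  \<open>p powr \<delta> \<ge> 2\<close>; the smaller ones are counted.\<close>

lemma tau_bound_aux:
  assumes "squarefree n" "\<delta> > 0"
  shows "real (tau n) \<le> 2 ^ card {p \<in> prime_factors n. real p < 2 powr (1 / \<delta>)} * real n powr \<delta>"
  using assms(1)
proof (induction n rule: squarefree_nat_induct)
  case one
  thus ?case by (simp add: tau_def)
next
  case (mult p m)
  let ?A = "\<lambda>n. {p \<in> prime_factors n. real p < 2 powr (1 / \<delta>)}"
  have p0: "p > 0" using prime_gt_0_nat[OF mult(1)] .
  have pf: "prime_factors (p * m) = insert p (prime_factors m)"
    using mult p0 by (simp add: prime_factorization_mult prime_factorization_prime)
  have pn: "p \<notin> prime_factors m" using mult by auto
  have "2 * 2 ^ card (?A m) \<le> 2 ^ card (?A (p * m)) * real p powr \<delta>"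
  proof (cases "real p < 2 powr (1 / \<delta>)")
    case True
    hence "?A (p * m) = insert p (?A m)" using pf by auto
    hence "card (?A (p * m)) = Suc (card (?A m))" using pn by simp
    moreover have "1 \<le> real p powr \<delta>" using p0 assms(2) by (intro ge_one_powr_ge_zero) auto
    ultimately show ?thesis by simp
  next
    case False
    hence "?A (p * m) = ?A m" using pf by auto
    moreover have "(2 powr (1 / \<delta>)) powr \<delta> \<le> real p powr \<delta>"
      using False assms(2) by (intro powr_mono2) auto
    hence "2 \<le> real p powr \<delta>" using assms(2) by (simp add: powr_powr)
    ultimately show ?thesis by simp
  qed
  hence "2 * 2 ^ card (?A m) * real m powr \<delta> \<le> 2 ^ card (?A (p * m)) * real p powr \<delta> * real m powr \<delta>"
    by (rule mult_right_mono) simp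
  moreover have "real (tau (p * m)) = 2 * real (tau m)" using tau_prime_mult[OF mult(1-3)] by simp
  ultimately show ?case using mult.IH by (simp add: powr_mult mult_ac)
qed

text \<open>There are at most \<open>2 powr (1 / \<delta>)\<close> small primes. This makes the
  constant doubly exponential in \<open>1 / \<delta>\<close> and is where the iterated exponentials
  of the final constant originate.\<close>

lemma tau_bound:
  assumes "squarefree n" "\<delta> > 0"
  shows "real (tau n) \<le> 2 powr (2 powr (1 / \<delta>)) * real n powr \<delta>"
proof -
  let ?A = "{p \<in> prime_factors n. real p < 2 powr (1 / \<delta>)}"
  have "?A \<subseteq> {1..nat \<lfloor>2 powr (1 / \<delta>)\<rfloor>}"
  proof
    fix p assume p: "p \<in> ?A"
    hence "p \<ge> 1" using prime_ge_1_nat[of p] by auto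
    moreover have "int p \<le> \<lfloor>2 powr (1 / \<delta>)\<rfloor>" using p by (simp add: le_floor_iff)
    ultimately show "p \<in> {1..nat \<lfloor>2 powr (1 / \<delta>)\<rfloor>}" by auto
  qed
  hence "card ?A \<le> nat \<lfloor>2 powr (1 / \<delta>)\<rfloor>" using card_mono[of "{1..nat \<lfloor>2 powr (1 / \<delta>)\<rfloor>}" ?A] by simp
  hence "real (card ?A) \<le> 2 powr (1 / \<delta>)"
    using of_int_floor_le[of "2 powr (1 / \<delta>)"] powr_ge_zero[of 2 "1 / \<delta>"] by linarith
  hence "2 powr real (card ?A) \<le> 2 powr (2 powr (1 / \<delta>))" by (intro powr_mono) auto
  hence "2 ^ card ?A \<le> 2 powr (2 powr (1 / \<delta>))" by (simp add: powr_realpow)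
  hence "2 ^ card ?A * real n powr \<delta> \<le> 2 powr (2 powr (1 / \<delta>)) * real n powr \<delta>"
    by (rule mult_right_mono) simp
  thus ?thesis using tau_bound_aux[OF assms] by simp
qed

section \<open>Integers as a squarefree number times a square\<close>

lemma square_dvd_squarefree_mult:
  assumes "squarefree (s::nat)" "h > 0" "x\<^sup>2 dvd s * h\<^sup>2"
  shows "x dvd h"
proof -
  define g where "g = gcd x h"
  have g: "g > 0" using assms(2) by (simp add: g_def)
  obtain x' h' where xh: "x = g * x'" "h = g * h'" "coprime x' h'"
    using gcd_coprime_exists[of x h] g unfolding g_def by (auto simp: mult.commute)
  have "g\<^sup>2 * x'\<^sup>2 dvd g\<^sup>2 * (s * h'\<^sup>2)" using assms(3) by (simp add: xh power_mult_distrib mult_ac)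
  hence "x'\<^sup>2 dvd s * h'\<^sup>2" using g by simp
  hence "x'\<^sup>2 dvd s" using xh(3) by (simp add: coprime_dvd_mult_left_iff)
  hence "x' = 1" using squarefreeD[OF assms(1)] by auto
  thus ?thesis using xh by simp
qed

definition sq_pairs :: "(nat \<times> nat) set" where "sq_pairs = {(s, k). squarefree s \<and> 0 < k}"

lemma bij_betw_square_decomposition: "bij_betw (\<lambda>(s, h). s * h\<^sup>2) sq_pairs {m::nat. 0 < m}"
proof (rule bij_betwI')
  fix x y assume xy: "x \<in> sq_pairs" "y \<in> sq_pairs"
  obtain s h s' h' where e: "x = (s, h)" "y = (s', h')" by (cases x, cases y) auto
  have p: "squarefree s" "h > 0" "squarefree s'" "h' > 0" using xy e by (auto simp: sq_pairs_def)
  show "((case x of (s, h) \<Rightarrow> s * h\<^sup>2) = (case y of (s, h) \<Rightarrow> s * h\<^sup>2)) = (x = y)"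
  proof
    assume "(case x of (s, h) \<Rightarrow> s * h\<^sup>2) = (case y of (s, h) \<Rightarrow> s * h\<^sup>2)"
    hence eq: "s * h\<^sup>2 = s' * h'\<^sup>2" by (simp add: e)
    have "h dvd h'" by (rule square_dvd_squarefree_mult[OF p(3,4)]) (simp flip: eq)
    moreover have "h' dvd h" by (rule square_dvd_squarefree_mult[OF p(1,2)]) (simp add: eq)
    ultimately have "h = h'" by (rule dvd_antisym)
    thus "x = y" using eq p by (simp add: e)
  qed simp
next
  fix x assume "x \<in> sq_pairs"
  thus "(case x of (s, h) \<Rightarrow> s * h\<^sup>2) \<in> {m. 0 < m}" by (auto simp: sq_pairs_def intro!: Nat.gr0I)
next
  fix m :: nat assume m: "m \<in> {m. 0 < m}"
  have d: "m = squarefree_part m * square_part m ^ 2" by (rule squarefree_decompose)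
  have "square_part m > 0"
  proof (rule Nat.gr0I)
    assume "square_part m = 0"
    hence "m = 0" using d by simp
    thus False using m by simp
  qed
  hence "(squarefree_part m, square_part m) \<in> sq_pairs" by (simp add: sq_pairs_def)
  thus "\<exists>x\<in>sq_pairs. m = (case x of (s, h) \<Rightarrow> s * h\<^sup>2)" using d by force
qed

text \<open>The part of \<open>e\<close> not shared with \<open>s\<close> is coprime to
  \<open>s\<close>, so it must divide \<open>h\<^sup>2\<close>, and being squarefree it divides
  \<open>h\<close>. The multiples of \<open>e\<close> in the class of \<open>s\<close> thus have
  again a free parameter.\<close>

lemma squarefree_dvd_class_iff:
  assumes "squarefree (e::nat)" "squarefree s" "h > 0"
  shows "e dvd s * h\<^sup>2 \<longleftrightarrow> (e div gcd e s) dvd h"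
proof -
  define g where "g = gcd e s"
  define e' where "e' = e div g"
  have e0: "e > 0" using assms(1) by (cases "e = 0") auto
  have g: "g > 0" using e0 by (simp add: g_def)
  have e: "e = g * e'" by (simp add: e'_def g_def)
  have cop: "coprime e' s"
  proof -
    have "gcd e' s dvd e'" "gcd e' s dvd s" by auto
    moreover have "gcd e' s dvd g" unfolding g_def using calculation e by auto
    ultimately have "gcd e' s ^ 2 dvd e" unfolding e power2_eq_square by (simp add: mult_dvd_mono)
    hence "gcd e' s dvd 1" by (rule squarefreeD[OF assms(1)])
    thus ?thesis by (simp only: nat_dvd_1_iff_1 coprime_iff_gcd_eq_1)
  qed
  have se: "squarefree e'" using assms(1) e squarefree_mono dvd_triv_right by blast
  have "e dvd s * h\<^sup>2 \<longleftrightarrow> e' dvd h"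
  proof
    assume "e dvd s * h\<^sup>2"
    hence "e' dvd s * h\<^sup>2" using e dvd_mult_right by blast
    hence "e' dvd h\<^sup>2" using cop by (simp add: coprime_dvd_mult_right_iff)
    hence d: "e' * e' dvd e' * h\<^sup>2" by simp
    show "e' dvd h"
      by (rule square_dvd_squarefree_mult[OF se assms(3)]) (use d in \<open>simp add: power2_eq_square\<close>)
  next
    assume "e' dvd h"
    hence "e' dvd h\<^sup>2" by (simp add: power2_eq_square)
    moreover have "g dvd s" by (simp add: g_def)
    ultimately show "e dvd s * h\<^sup>2" unfolding e by (rule mult_dvd_mono[rotated])
  qed
  thus ?thesis by (simp add: e'_def g_def)
qed

definition jr :: "nat \<Rightarrow> nat \<Rightarrow> real" where "jr a n = of_int (jac (int a) n)"

lemma jr_abs_le: "odd n \<Longrightarrow> \<bar>jr a n\<bar> \<le> 1"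
  unfolding jr_def using jac_abs_le[of n "int a"] by (simp flip: of_int_abs)

lemma jr_mult: "odd n \<Longrightarrow> jr (a * b) n = jr a n * jr b n"
  by (simp add: jr_def jac_mult_top)

lemma jr_mult_bottom: "m > 0 \<Longrightarrow> n > 0 \<Longrightarrow> jr a (m * n) = jr a m * jr a n"
  by (simp add: jr_def jac_mult_bottom)

lemma jr_square: "odd n \<Longrightarrow> (jr a n)\<^sup>2 = of_bool (coprime a n)"
  unfolding jr_def using jac_square[of n "int a"] by (simp flip: of_int_power)

lemma gauss_nat_summable:
  assumes "c > (0::real)" shows "(\<lambda>m::nat. exp (- (c * (real m)\<^sup>2))) summable_on UNIV"
proof (rule norm_summable_imp_summable_on, rule summable_comparison_test')
  show "summable (\<lambda>m. exp (- c) ^ m)" using assms by (intro summable_geometric) simp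
  fix m :: nat
  have "real m * 1 \<le> real m * real m" by (cases "m = 0") (auto intro: mult_left_mono)
  hence "c * real m \<le> c * (real m)\<^sup>2" using assms by (simp add: power2_eq_square)
  thus "norm (norm (exp (- (c * (real m)\<^sup>2)))) \<le> exp (- c) ^ m"
    by (simp add: exp_of_nat_mult[symmetric] mult.commute)
qed

lemma gauss_weight_summable:
  assumes "c > (0::real)" "\<And>m. \<bar>u m\<bar> \<le> 1"
  shows "(\<lambda>m::nat. exp (- (c * (real m)\<^sup>2)) * u m) summable_on A"
proof -
  have "(\<lambda>m::nat. norm (exp (- (c * (real m)\<^sup>2)) * u m)) summable_on UNIV"
  proof (rule summable_on_comparison_test[OF gauss_nat_summable[OF assms(1)]])
    fix m
    show "norm (exp (- (c * (real m)\<^sup>2)) * u m) \<le> exp (- (c * (real m)\<^sup>2))"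
      using mult_left_mono[OF assms(2)[of m], of "exp (- (c * (real m)\<^sup>2))"] by (simp add: abs_mult)
  qed simp
  hence "(\<lambda>m::nat. exp (- (c * (real m)\<^sup>2)) * u m) summable_on UNIV" by (rule abs_summable_summable)
  thus ?thesis by (rule summable_on_subset_banach) simp
qed

text \<open>The substitution \<open>h = (e div gcd e s) * k\<close> parametrises the multiples
  \<open>s * h\<^sup>2\<close> of \<open>e\<close>. The square disappears from the symbol except for
  the condition that \<open>k\<close> be coprime to \<open>q\<close>, because \<open>e\<close> is
  coprime to \<open>q\<close>.\<close>

lemma class_sum:
  fixes \<beta> S :: real
  assumes e: "squarefree e" and q: "odd q" "coprime e q" and \<beta>: "\<beta> > 0"
  defines "g \<equiv> \<lambda>s k. exp (- (pi * (\<beta> * real (s * (e div gcd e s * k)\<^sup>2))\<^sup>2)) * (jr s q * of_bool (coprime k q))"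
  shows "(\<lambda>(s, k). g s k) summable_on sq_pairs"
    and "infsum (\<lambda>m. exp (- (pi * (\<beta> * real m)\<^sup>2)) * jr m q) {m. 0 < m \<and> e dvd m} = infsum (\<lambda>(s, k). g s k) sq_pairs"
    and "infsum (\<lambda>(s, h). if e dvd s * h\<^sup>2 then exp (- (pi * (\<beta> * real (s * h\<^sup>2))\<^sup>2)) * jr (s * h\<^sup>2) q else 0) {(s, h) \<in> sq_pairs. S < real s} =
         infsum (\<lambda>(s, k). g s k) {(s, k) \<in> sq_pairs. S < real s}"
proof -
  let ?f = "\<lambda>m. exp (- (pi * (\<beta> * real m)\<^sup>2)) * jr m q"
  have e0: "e > 0" using e by (cases "e = 0") auto
  have gs: "g s k = ?f (s * (e div gcd e s * k)\<^sup>2)" for s k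
  proof -
    have "e div gcd e s dvd e" by (metis dvd_div_mult_self dvd_triv_left gcd_dvd1)
    hence "coprime (e div gcd e s) q" using q(2) coprime_divisors dvd_refl by blast
    hence "coprime (e div gcd e s * k) q \<longleftrightarrow> coprime k q" by simp
    hence "jr (s * (e div gcd e s * k)\<^sup>2) q = jr s q * of_bool (coprime k q)"
      using q(1) jr_square[OF q(1), of "e div gcd e s * k"] by (simp add: jr_mult power2_eq_square)
    thus ?thesis by (simp add: g_def)
  qed
  let ?H = "{(s, h) \<in> sq_pairs. e dvd s * h\<^sup>2}"
  have bij2: "bij_betw (\<lambda>(s, k). (s, e div gcd e s * k)) {(s, k) \<in> sq_pairs. Q s} {(s, h) \<in> sq_pairs. e dvd s * h\<^sup>2 \<and> Q s}" for Q
  proof (rule bij_betwI')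
    have ep: "e div gcd e s > 0" for s using e0 by (simp add: div_greater_zero_iff gcd_le1_nat)
    fix x assume x: "x \<in> {(s, k) \<in> sq_pairs. Q s}"
    {
      fix y assume "y \<in> {(s, k) \<in> sq_pairs. Q s}"
      obtain s k s' k' where xy: "x = (s, k)" "y = (s', k')" by (cases x, cases y) auto
      have "e div gcd e s * k = e div gcd e s * k' \<longleftrightarrow> k = k'" using ep[of s] by simp
      thus "((case x of (s, k) \<Rightarrow> (s, e div gcd e s * k)) = (case y of (s, k) \<Rightarrow> (s, e div gcd e s * k))) = (x = y)"
        unfolding xy by auto
    next
      show "(case x of (s, k) \<Rightarrow> (s, e div gcd e s * k)) \<in> {(s, h) \<in> sq_pairs. e dvd s * h\<^sup>2 \<and> Q s}"
        using x ep squarefree_dvd_class_iff[OF e] by (cases x) (auto simp: sq_pairs_def)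
    }
  next
    fix y assume y: "y \<in> {(s, h) \<in> sq_pairs. e dvd s * h\<^sup>2 \<and> Q s}"
    obtain s h where sh: "y = (s, h)" by (cases y)
    have "(e div gcd e s) dvd h" using y sh squarefree_dvd_class_iff[OF e, of s h] by (auto simp: sq_pairs_def)
    then obtain k where "h = e div gcd e s * k" by blast
    thus "\<exists>x\<in>{(s, k) \<in> sq_pairs. Q s}. y = (case x of (s, k) \<Rightarrow> (s, e div gcd e s * k))"
      using y sh by (intro bexI[of _ "(s, k)"]) (auto simp: sq_pairs_def intro!: Nat.gr0I)
  qed
  have bij1: "bij_betw (\<lambda>(s, h). s * h\<^sup>2) ?H {m. 0 < m \<and> e dvd m}"
  proof -
    have inj: "inj_on (\<lambda>(s, h). s * h\<^sup>2) ?H"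
      by (rule inj_on_subset[OF bij_betw_imp_inj_on[OF bij_betw_square_decomposition]]) auto
    have im: "(\<lambda>(s, h). s * h\<^sup>2) ` sq_pairs = {m. 0 < m}" using bij_betw_square_decomposition by (simp add: bij_betw_def)
    have "(\<lambda>(s, h). s * h\<^sup>2) ` ?H = {m. 0 < m \<and> e dvd m}"
    proof (intro equalityI subsetI)
      fix m assume m: "m \<in> {m. 0 < m \<and> e dvd m}"
      hence "m \<in> (\<lambda>(s, h). s * h\<^sup>2) ` sq_pairs" using im by simp
      then obtain x where "x \<in> sq_pairs" "m = (\<lambda>(s, h). s * h\<^sup>2) x" by (rule imageE)
      thus "m \<in> (\<lambda>(s, h). s * h\<^sup>2) ` ?H" using m by (intro image_eqI[of _ _ x]) auto
    next
      fix m assume "m \<in> (\<lambda>(s, h). s * h\<^sup>2) ` ?H"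
      then obtain x where x: "x \<in> ?H" "m = (\<lambda>(s, h). s * h\<^sup>2) x" by (rule imageE)
      hence "m \<in> (\<lambda>(s, h). s * h\<^sup>2) ` sq_pairs" by (intro image_eqI[of _ _ x]) auto
      hence "0 < m" using im by simp
      thus "m \<in> {m. 0 < m \<and> e dvd m}" using x by auto
    qed
    thus ?thesis using inj by (simp add: bij_betw_def)
  qed
  have sf: "?f summable_on A" for A
  proof -
    have "(\<lambda>m. exp (- (pi * \<beta>\<^sup>2 * (real m)\<^sup>2)) * jr m q) summable_on A"
      by (rule gauss_weight_summable) (use \<beta> jr_abs_le[OF q(1)] in auto)
    thus ?thesis by (simp add: power_mult_distrib mult.assoc)
  qed
  have b2: "bij_betw (\<lambda>(s, k). (s, e div gcd e s * k)) sq_pairs ?H"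
    using bij2[of "\<lambda>_. True"] by (simp add: case_prod_unfold)
  let ?F = "\<lambda>x. ?f ((\<lambda>(s, h). s * h\<^sup>2) x)"
  have c: "?F ((\<lambda>(s, k). (s, e div gcd e s * k)) x) = (\<lambda>(s, k). g s k) x" for x
    by (cases x) (simp add: gs)
  have sH: "?F summable_on ?H"
    using summable_on_reindex_bij_betw[OF bij1, of ?f] sf by simp
  have "(\<lambda>x. ?F ((\<lambda>(s, k). (s, e div gcd e s * k)) x)) summable_on sq_pairs"
    using summable_on_reindex_bij_betw[OF b2, of ?F] sH by simp
  thus "(\<lambda>(s, k). g s k) summable_on sq_pairs" unfolding c .
  have "infsum ?f {m. 0 < m \<and> e dvd m} = infsum ?F ?H"
    by (rule infsum_reindex_bij_betw[OF bij1, symmetric])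
  also have "\<dots> = infsum (\<lambda>x. ?F ((\<lambda>(s, k). (s, e div gcd e s * k)) x)) sq_pairs"
    by (rule infsum_reindex_bij_betw[OF b2, symmetric])
  finally show "infsum ?f {m. 0 < m \<and> e dvd m} = infsum (\<lambda>(s, k). g s k) sq_pairs" unfolding c .
  have "infsum (\<lambda>(s, h). if e dvd s * h\<^sup>2 then ?f (s * h\<^sup>2) else 0) {(s, h) \<in> sq_pairs. S < real s} =
      infsum ?F {(s, h) \<in> sq_pairs. e dvd s * h\<^sup>2 \<and> S < real s}"
  proof (rule infsum_cong_neutral, goal_cases)
    case (1 x)
    thus ?case by (cases x) auto
  next
    case (2 x)
    thus ?case by (cases x) auto
  next
    case (3 x)
    thus ?case by (cases x) auto
  qed
  also have "\<dots> = infsum (\<lambda>x. ?F ((\<lambda>(s, k). (s, e div gcd e s * k)) x)) {(s, k) \<in> sq_pairs. S < real s}"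
    by (rule infsum_reindex_bij_betw[OF bij2[of "\<lambda>s. S < real s"], symmetric])
  finally show "infsum (\<lambda>(s, h). if e dvd s * h\<^sup>2 then ?f (s * h\<^sup>2) else 0) {(s, h) \<in> sq_pairs. S < real s} =
         infsum (\<lambda>(s, k). g s k) {(s, k) \<in> sq_pairs. S < real s}" unfolding c .
qed

lemma qtheta_has_sum:
  assumes "t > 0" "c > 0"
  shows "((\<lambda>k. exp (- (pi * (t * (real k)\<^sup>2)\<^sup>2))) has_sum qtheta (t * (real c)\<^sup>2)) {k. 0 < k \<and> c dvd k}"
proof -
  let ?u = "t * (real c)\<^sup>2"
  have u: "?u > 0" using assms by simp
  have h: "((\<lambda>j. exp (- (pi * ?u\<^sup>2 * real (Suc j) ^ 4))) has_sum qtheta ?u) UNIV"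
    unfolding qtheta_def by (rule norm_summable_imp_has_sum[OF _ summable_sums]) (use qtheta_summable[OF u] in auto)
  have b: "bij_betw (\<lambda>j. c * Suc j) UNIV {k. 0 < k \<and> c dvd k}"
  proof (rule bij_betwI')
    fix k assume "k \<in> {k. 0 < k \<and> c dvd k}"
    then obtain j where "k = c * j" "j > 0" by (auto elim!: dvdE intro: Nat.gr0I)
    thus "\<exists>x\<in>UNIV. k = c * Suc x" by (intro bexI[of _ "j - 1"]) auto
  qed (use assms in auto)
  have eq: "exp (- (pi * ?u\<^sup>2 * real (Suc j) ^ 4)) = exp (- (pi * (t * (real (c * Suc j))\<^sup>2)\<^sup>2))" for j
  proof -
    have "?u\<^sup>2 * real (Suc j) ^ 4 = (t * (real (c * Suc j))\<^sup>2)\<^sup>2"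
      by (simp only: of_nat_mult power_mult_distrib power_mult[symmetric]) simp
    thus ?thesis by (simp only: mult.assoc)
  qed
  have "((\<lambda>j. exp (- (pi * (t * (real (c * Suc j))\<^sup>2)\<^sup>2))) has_sum qtheta ?u) UNIV"
    using h unfolding eq .
  thus ?thesis
    unfolding has_sum_reindex_bij_betw[OF b, of "\<lambda>k. exp (- (pi * (t * (real k)\<^sup>2)\<^sup>2))" "qtheta ?u"] .
qed

lemma coprime_indicator_sum:
  assumes "squarefree (l::nat)"
  shows "of_bool (coprime k l) = (\<Sum>c | c dvd l. mu c * of_bool (c dvd k))"
proof -
  have l: "l > 0" using assms by (cases "l = 0") auto
  have "(\<Sum>c | c dvd l. mu c * of_bool (c dvd k)) = (\<Sum>c | c dvd gcd k l. mu c)"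
  proof (rule sum.mono_neutral_cong_right)
    show "finite {c. c dvd l}" by (rule finite_divisors[OF l])
    show "{c. c dvd gcd k l} \<subseteq> {c. c dvd l}" by auto
    show "\<forall>c\<in>{c. c dvd l} - {c. c dvd gcd k l}. mu c * of_bool (c dvd k) = 0" by auto
    show "mu c * of_bool (c dvd k) = mu c" if "c \<in> {c. c dvd gcd k l}" for c using that by simp
  qed
  also have "\<dots> = of_bool (coprime k l)"
    using mu_sum[OF squarefree_mono[OF gcd_dvd2 assms, of k]] by (simp only: coprime_iff_gcd_eq_1 of_bool_def)
  finally show ?thesis ..
qed

lemma has_sum_finite_sum:
  fixes f :: "'a \<Rightarrow> 'b \<Rightarrow> 'c :: real_normed_vector"
  assumes "finite I" "\<And>i. i \<in> I \<Longrightarrow> (f i has_sum s i) A"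
  shows "((\<lambda>x. \<Sum>i\<in>I. f i x) has_sum (\<Sum>i\<in>I. s i)) A"
  using assms by (induction I rule: finite_induct) (simp_all add: has_sum_add)

text \<open>Coprimality is expanded over \<open>l\<close> and \<open>l'\<close> separately instead
  of over the product, so that \<open>c\<close> belongs to \<open>l\<close> and \<open>c'\<close> to
  \<open>l'\<close> and the variables can be separated later. As \<open>l\<close> and
  \<open>l'\<close> are coprime, divisibility by \<open>c * c'\<close> splits accordingly.\<close>

lemma coprime_theta_sum:
  assumes "t > 0" "squarefree l" "squarefree l'" "coprime l l'"
  shows "((\<lambda>k. exp (- (pi * (t * (real k)\<^sup>2)\<^sup>2)) * of_bool (coprime k (l * l'))) has_sum
     (\<Sum>c | c dvd l. \<Sum>c' | c' dvd l'. mu c * mu c' * qtheta (t * (real (c * c'))\<^sup>2))) {k. 0 < k}"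
proof -
  have l: "l > 0" "l' > 0" using assms by (cases "l = 0"; cases "l' = 0"; auto)+
  have "((\<lambda>k. \<Sum>c | c dvd l. \<Sum>c' | c' dvd l'. mu c * mu c' * (if c * c' dvd k then exp (- (pi * (t * (real k)\<^sup>2)\<^sup>2)) else 0)) has_sum
     (\<Sum>c | c dvd l. \<Sum>c' | c' dvd l'. mu c * mu c' * qtheta (t * (real (c * c'))\<^sup>2))) {k. 0 < k}"
  proof (intro has_sum_finite_sum has_sum_cmult_right finite_divisors l)
    fix c c' assume "c \<in> {c. c dvd l}" "c' \<in> {c'. c' dvd l'}"
    hence "c * c' > 0" using l dvd_pos_nat by auto
    from qtheta_has_sum[OF assms(1) this]
    show "((\<lambda>k. if c * c' dvd k then exp (- (pi * (t * (real k)\<^sup>2)\<^sup>2)) else 0) has_sum qtheta (t * (real (c * c'))\<^sup>2)) {k. 0 < k}"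
      by (subst has_sum_cong_neutral[where T = "{k. 0 < k \<and> c * c' dvd k}" and g = "\<lambda>k. exp (- (pi * (t * (real k)\<^sup>2)\<^sup>2))"]) auto
  qed
  moreover have "(\<Sum>c | c dvd l. \<Sum>c' | c' dvd l'. mu c * mu c' * (if c * c' dvd k then x else 0)) =
     x * of_bool (coprime k (l * l'))" for k and x :: real
  proof -
    have "of_bool (coprime k (l * l')) = (of_bool (coprime k l) * of_bool (coprime k l') :: real)" by simp
    also have "\<dots> = (\<Sum>c | c dvd l. \<Sum>c' | c' dvd l'. (mu c * of_bool (c dvd k)) * (mu c' * of_bool (c' dvd k)))"
      unfolding coprime_indicator_sum[OF assms(2)] coprime_indicator_sum[OF assms(3)] sum_product ..
    finally have "x * of_bool (coprime k (l * l')) =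
       (\<Sum>c | c dvd l. \<Sum>c' | c' dvd l'. x * ((mu c * of_bool (c dvd k)) * (mu c' * of_bool (c' dvd k))))"
      by (simp add: sum_distrib_left)
    also have "\<dots> = (\<Sum>c | c dvd l. \<Sum>c' | c' dvd l'. mu c * mu c' * (if c * c' dvd k then x else 0))"
    proof (intro sum.cong refl)
      fix c c' assume "c \<in> {c. c dvd l}" "c' \<in> {c'. c' dvd l'}"
      hence "coprime c c'" using assms(4) coprime_divisors by blast
      hence "c * c' dvd k \<longleftrightarrow> c dvd k \<and> c' dvd k"
        using divides_mult[of c k c'] dvd_mult_left[of c c' k] dvd_mult_right[of c c' k] by blast
      thus "x * ((mu c * of_bool (c dvd k)) * (mu c' * of_bool (c' dvd k))) = mu c * mu c' * (if c * c' dvd k then x else 0)"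
        by auto
    qed
    finally show ?thesis ..
  qed
  ultimately show ?thesis by simp
qed


lemma even_int_infsum:
  fixes f :: "int \<Rightarrow> real"
  assumes even: "\<And>m. f (- m) = f m" and sm: "(\<lambda>m. f (int m)) summable_on UNIV"
  shows "f summable_on UNIV" "infsum f UNIV = f 0 + 2 * infsum (\<lambda>m. f (int m)) {m. 0 < m}"
proof -
  let ?P = "{m::nat. 0 < m}"
  let ?S = "infsum (\<lambda>m. f (int m)) ?P"
  have h: "((\<lambda>m. f (int m)) has_sum ?S) ?P"
    by (intro has_sum_infsum summable_on_subset_banach[OF sm]) simp
  have 1: "(f has_sum ?S) (int ` ?P)"
    using h by (subst has_sum_reindex) (auto simp: o_def)
  have 2: "(f has_sum ?S) ((\<lambda>m. - int m) ` ?P)"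
    using h by (subst has_sum_reindex) (auto simp: o_def inj_on_def even)
  have U: "UNIV = {0} \<union> (int ` ?P \<union> (\<lambda>m. - int m) ` ?P)"
  proof (intro equalityI subsetI)
    fix x :: int
    show "x \<in> {0} \<union> (int ` ?P \<union> (\<lambda>m. - int m) ` ?P)"
    proof (cases "x = 0")
      case False
      hence "x = int (nat \<bar>x\<bar>) \<or> x = - int (nat \<bar>x\<bar>)" "nat \<bar>x\<bar> \<in> ?P" by auto
      thus ?thesis by blast
    qed simp
  qed simp
  have "(f has_sum (f 0 + (?S + ?S))) ({0} \<union> (int ` ?P \<union> (\<lambda>m. - int m) ` ?P))"
    by (intro has_sum_Un_disjoint 1 2 has_sum_finiteI) auto
  hence "(f has_sum (f 0 + 2 * ?S)) UNIV" using U by simp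
  thus "f summable_on UNIV" "infsum f UNIV = f 0 + 2 * ?S"
    by (auto simp: summable_on_def infsumI)
qed

lemma bij_betw_residue_quotient:
  assumes "q > 0"
  shows "bij_betw (\<lambda>(a, k). a + int q * k) ({0..<int q} \<times> UNIV) UNIV"
proof (rule bij_betwI[where g = "\<lambda>m. (m mod int q, m div int q)"])
  fix x assume "x \<in> {0..<int q} \<times> (UNIV :: int set)"
  thus "(\<lambda>m. (m mod int q, m div int q)) ((\<lambda>(a, k). a + int q * k) x) = x"
    using assms by (cases x) simp
qed (use assms in auto)

lemma half_aux:
  fixes A B c d :: real
  assumes "d + 2 * A = c * (d + 2 * B)" shows "A + d / 2 = c * (B + d / 2)"
  using assms by (simp add: algebra_simps)

text \<open>Poisson summation in each residue class modulo \<open>q\<close> produces a Gauss sum.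
  The condition \<open>q mod 4 = 1\<close> makes the symbol even and the Gauss sum
  \<open>sqrt q\<close> times the same symbol. The terms with \<open>m = 0\<close> survive only for
  \<open>q = 1\<close> and are halved in passing to positive \<open>m\<close>.\<close>

lemma jac_poisson:
  assumes q: "odd q" "squarefree q" "q mod 4 = 1" and Y: "Y > 0"
  shows "infsum (\<lambda>m. exp (- (pi * (real m / Y)\<^sup>2)) * jr m q) {m. 0 < m} + of_bool (q = 1) / 2 =
     Y / sqrt (real q) * (infsum (\<lambda>m. exp (- (pi * (Y * real m / real q)\<^sup>2)) * jr m q) {m. 0 < m} + of_bool (q = 1) / 2)"
proof -
  have q0: "q > 0" using q(1) odd_pos by blast
  have sums: "(\<lambda>m. exp (- (pi * (real m * b)\<^sup>2)) * jr m q) summable_on A" if "b > 0" for A b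
  proof -
    have "(\<lambda>m. exp (- (pi * b\<^sup>2 * (real m)\<^sup>2)) * jr m q) summable_on A"
      by (rule gauss_weight_summable) (use that jr_abs_le[OF q(1)] in auto)
    thus ?thesis by (simp add: power_mult_distrib mult_ac)
  qed
  have even: "jac (- m) q = jac m q" for m
    using jac_mult_top[OF q(1), of "-1" m] jac_minus_one[OF q(1)] q(3) by simp
  have j0: "jac 0 q = of_bool (q = 1)"
    using jac_eq_0_iff[OF q(1), of 0] by (cases "q = 1") auto
  define F where "F b m = exp (- (pi * (of_int m * b)\<^sup>2)) * of_int (jac m q)" for b :: real and m :: int
  have FS: "F b summable_on UNIV" "infsum (F b) UNIV = of_bool (q = 1) + 2 * infsum (\<lambda>m. exp (- (pi * (real m * b)\<^sup>2)) * jr m q) {m. 0 < m}"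
    if "b > 0" for b
  proof -
    have f: "(\<lambda>m. F b (int m)) = (\<lambda>m. exp (- (pi * (real m * b)\<^sup>2)) * jr m q)"
      by (simp add: F_def jr_def)
    have ev: "F b (- m) = F b m" for m by (simp add: F_def even)
    have sm: "(\<lambda>m. F b (int m)) summable_on UNIV" unfolding f by (rule sums[OF that])
    show "F b summable_on UNIV" by (rule even_int_infsum(1)[OF ev sm])
    show "infsum (F b) UNIV = of_bool (q = 1) + 2 * infsum (\<lambda>m. exp (- (pi * (real m * b)\<^sup>2)) * jr m q) {m. 0 < m}"
    proof -
      have "F b 0 = of_bool (q = 1)" by (simp add: F_def j0)
      thus ?thesis using even_int_infsum(2)[OF ev sm] unfolding f by (simp only:)
    qed
  qed
  define y where "y = Y / real q"
  have y: "y > 0" using Y q0 by (simp add: y_def)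
  have "infsum (F (1 / Y)) UNIV = infsum (\<lambda>x. F (1 / Y) ((\<lambda>(a, k). a + int q * k) x)) ({0..<int q} \<times> UNIV)"
    by (rule infsum_reindex_bij_betw[OF bij_betw_residue_quotient[OF q0], symmetric])
  also have "\<dots> = (\<Sum>a\<in>{0..<int q}. infsum (\<lambda>k. F (1 / Y) (a + int q * k)) UNIV)"
  proof -
    have "(\<lambda>x. F (1 / Y) ((\<lambda>(a, k). a + int q * k) x)) summable_on ({0..<int q} \<times> UNIV)"
      using summable_on_reindex_bij_betw[OF bij_betw_residue_quotient[OF q0], of "F (1 / Y)"] FS(1)[of "1 / Y"] Y by simp
    from infsum_Sigma_banach[OF this] show ?thesis by simp
  qed
  also have "\<dots> = (\<Sum>a\<in>{0..<int q}. of_int (jac a q) * (y * infsum (\<lambda>b::int. exp (- (pi * y\<^sup>2 * (of_int b)\<^sup>2)) * cos (2 * pi * of_int b * (of_int a / real q))) UNIV))"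
  proof (rule sum.cong[OF refl])
    fix a assume a: "a \<in> {0..<int q}"
    have "F (1 / Y) (a + int q * k) = of_int (jac a q) * exp (- (pi / y\<^sup>2 * (of_int a / real q + of_int k)\<^sup>2))" for k
    proof -
      have "jac (a + int q * k) q = jac a q" by (rule jac_cong[OF q(1)]) (simp add: cong_def)
      moreover have "pi * (of_int (a + int q * k) * (1 / Y))\<^sup>2 = pi / y\<^sup>2 * (of_int a / real q + of_int k)\<^sup>2"
      proof -
        have "of_int (a + int q * k) * (1 / Y) = (of_int a / real q + of_int k) / y"
          using q0 Y by (simp add: y_def field_simps)
        thus ?thesis by (simp only: power_divide) (simp add: field_simps)
      qed
      ultimately show ?thesis by (simp add: F_def)
    qed
    hence "infsum (\<lambda>k. F (1 / Y) (a + int q * k)) UNIV =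
        of_int (jac a q) * infsum (\<lambda>k::int. exp (- (pi / y\<^sup>2 * (of_int a / real q + of_int k)\<^sup>2))) UNIV"
      by (simp add: infsum_cmult_right')
    also have "of_int a / real q \<in> {0..1}" using a q0 by (auto simp: field_simps)
    note gauss_poisson[OF y this]
    finally show "infsum (\<lambda>k. F (1 / Y) (a + int q * k)) UNIV = of_int (jac a q) *
      (y * infsum (\<lambda>b::int. exp (- (pi * y\<^sup>2 * (of_int b)\<^sup>2)) * cos (2 * pi * of_int b * (of_int a / real q))) UNIV)" .
  qed
  also have "\<dots> = y * (\<Sum>a\<in>{0..<int q}. infsum (\<lambda>b::int. exp (- (pi * y\<^sup>2 * (of_int b)\<^sup>2)) * (of_int (jac a q) * cos (2 * pi * of_int b * (of_int a / real q)))) UNIV)"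
    unfolding sum_distrib_left infsum_cmult_right'[symmetric] by (simp add: mult_ac)
  also have "(\<Sum>a\<in>{0..<int q}. infsum (\<lambda>b::int. exp (- (pi * y\<^sup>2 * (of_int b)\<^sup>2)) * (of_int (jac a q) * cos (2 * pi * of_int b * (of_int a / real q)))) UNIV)
     = infsum (\<lambda>b::int. \<Sum>a\<in>{0..<int q}. exp (- (pi * y\<^sup>2 * (of_int b)\<^sup>2)) * (of_int (jac a q) * cos (2 * pi * of_int b * (of_int a / real q)))) UNIV"
  proof (rule infsumI[symmetric], rule has_sum_finite_sum)
    fix a assume a: "a \<in> {0..<int q}"
    have "(\<lambda>b::int. exp (- (pi * y\<^sup>2 * (of_int b)\<^sup>2)) * (of_int (jac a q) * cos (2 * pi * of_int b * (of_int a / real q)))) summable_on UNIV"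
    proof (rule abs_summable_summable, rule summable_on_comparison_test[OF gauss_shift_summable[of "pi * y\<^sup>2"]])
      fix b :: int
      have "\<bar>of_int (jac a q) * cos (2 * pi * of_int b * (of_int a / real q))\<bar> \<le> 1 * 1"
        unfolding abs_mult using jac_abs_le[OF q(1), of a] by (intro mult_mono) (auto simp flip: of_int_abs)
      hence "norm (exp (- (pi * y\<^sup>2 * (of_int b)\<^sup>2)) * (of_int (jac a q) * cos (2 * pi * of_int b * (of_int a / real q))))
        \<le> exp (- (pi * y\<^sup>2 * (0 + of_int b)\<^sup>2))"
        using mult_left_mono[of "\<bar>of_int (jac a q) * cos (2 * pi * of_int b * (of_int a / real q))\<bar>" 1 "exp (- (pi * y\<^sup>2 * (of_int b)\<^sup>2))"]
        by (simp add: abs_mult)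
      also have "\<dots> \<le> exp (5/4 * (pi * y\<^sup>2)) * exp (- (pi * y\<^sup>2)) ^ nat \<bar>b\<bar>"
        by (rule gauss_shift_bound) auto
      finally show "norm (exp (- (pi * y\<^sup>2 * (of_int b)\<^sup>2)) * (of_int (jac a q) * cos (2 * pi * of_int b * (of_int a / real q))))
        \<le> exp (5/4 * (pi * y\<^sup>2)) * exp (- (pi * y\<^sup>2)) ^ nat \<bar>b\<bar>" .
    qed (use y in auto)
    thus "((\<lambda>b::int. exp (- (pi * y\<^sup>2 * (of_int b)\<^sup>2)) * (of_int (jac a q) * cos (2 * pi * of_int b * (of_int a / real q)))) has_sum
      infsum (\<lambda>b::int. exp (- (pi * y\<^sup>2 * (of_int b)\<^sup>2)) * (of_int (jac a q) * cos (2 * pi * of_int b * (of_int a / real q)))) UNIV) UNIV"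
      by (rule has_sum_infsum)
  qed simp
  also have "\<dots> = infsum (\<lambda>b. sqrt (real q) * F y b) UNIV"
  proof (rule infsum_cong)
    fix b :: int
    have "(\<Sum>a\<in>{0..<int q}. of_int (jac a q) * cos (2 * pi * of_int b * (of_int a / real q))) = Re (gauss_sum b q)"
      unfolding gauss_sum_def Re_sum by (rule sum.cong) (auto simp: ee_def mult_ac)
    also have "\<dots> = of_int (jac b q) * sqrt (real q)"
      using gauss_sum_eq[OF q(1,2), of b] q(3) by (simp add: gauss_sign_def)
    finally show "(\<Sum>a\<in>{0..<int q}. exp (- (pi * y\<^sup>2 * (of_int b)\<^sup>2)) * (of_int (jac a q) * cos (2 * pi * of_int b * (of_int a / real q)))) = sqrt (real q) * F y b"
      unfolding sum_distrib_left[symmetric] by (simp add: F_def power_mult_distrib mult_ac)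
  qed
  also have "\<dots> = sqrt (real q) * infsum (F y) UNIV" by (rule infsum_cmult_right')
  finally have "infsum (F (1 / Y)) UNIV = y * sqrt (real q) * infsum (F y) UNIV" by simp
  moreover have "y * sqrt (real q) = Y / sqrt (real q)" using q0 by (simp add: y_def real_div_sqrt field_simps)
  ultimately have "infsum (F (1 / Y)) UNIV = Y / sqrt (real q) * infsum (F y) UNIV" by simp
  hence "of_bool (q = 1) + 2 * infsum (\<lambda>m. exp (- (pi * (real m * (1 / Y))\<^sup>2)) * jr m q) {m. 0 < m} =
    Y / sqrt (real q) * (of_bool (q = 1) + 2 * infsum (\<lambda>m. exp (- (pi * (real m * y)\<^sup>2)) * jr m q) {m. 0 < m})"
    using FS(2)[of "1 / Y"] FS(2)[of y] y Y by (simp only: zero_less_divide_1_iff)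
  from half_aux[OF this] have "infsum (\<lambda>m. exp (- (pi * (real m * (1 / Y))\<^sup>2)) * jr m q) {m. 0 < m} + of_bool (q = 1) / 2 =
    Y / sqrt (real q) * (infsum (\<lambda>m. exp (- (pi * (real m * y)\<^sup>2)) * jr m q) {m. 0 < m} + of_bool (q = 1) / 2)" .
  moreover have "real m * (1 / Y) = real m / Y" "real m * y = Y * real m / real q" for m by (simp_all add: y_def)
  ultimately show ?thesis by (simp only:)
qed

text \<open>Writing multiples of \<open>e\<close> as \<open>e * m\<close> brings out
  \<open>jr e q\<close> on both sides. It equals 1 when \<open>q = 1\<close>, so the constant terms
  are not disturbed by it.\<close>

lemma multiples_poisson:
  assumes q: "odd q" "squarefree q" "q mod 4 = 1" and M: "M > 0" and e: "e > 0" "coprime e q"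
  shows "infsum (\<lambda>m. exp (- (pi * (1 / M * real m)\<^sup>2)) * jr m q) {m. 0 < m \<and> e dvd m} + of_bool (q = 1) / 2 =
    M / (real e * sqrt (real q)) * (infsum (\<lambda>m. exp (- (pi * (M / (real e ^ 2 * real q) * real m)\<^sup>2)) * jr m q) {m. 0 < m \<and> e dvd m} + of_bool (q = 1) / 2)"
proof -
  have bij: "bij_betw (\<lambda>m. e * m) {m. 0 < m} {m. 0 < m \<and> e dvd m}"
    by (rule bij_betwI[where g = "\<lambda>m. m div e"]) (use e in \<open>auto elim!: dvdE\<close>)
  have W: "infsum (\<lambda>m. exp (- (pi * (\<beta> * real m)\<^sup>2)) * jr m q) {m. 0 < m \<and> e dvd m} =
     jr e q * infsum (\<lambda>m. exp (- (pi * (\<beta> * real e * real m)\<^sup>2)) * jr m q) {m. 0 < m}" for \<beta>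
  proof -
    have "infsum (\<lambda>m. exp (- (pi * (\<beta> * real m)\<^sup>2)) * jr m q) {m. 0 < m \<and> e dvd m} =
      infsum (\<lambda>m. exp (- (pi * (\<beta> * real (e * m))\<^sup>2)) * jr (e * m) q) {m. 0 < m}"
      by (rule infsum_reindex_bij_betw[OF bij, symmetric])
    also have "\<dots> = infsum (\<lambda>m. jr e q * (exp (- (pi * (\<beta> * real e * real m)\<^sup>2)) * jr m q)) {m. 0 < m}"
      using q(1) by (simp add: jr_mult mult_ac)
    finally show ?thesis by (simp add: infsum_cmult_right')
  qed
  have d: "jr e q * (A + of_bool (q = 1) / 2) = jr e q * A + of_bool (q = 1) / 2" for A
    by (cases "q = 1") (simp_all add: jr_def distrib_left)
  have a: "1 / M * real e * real m = real m / (M / real e)" for m using M e by (simp add: field_simps)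
  have b: "M / (real e ^ 2 * real q) * real e * real m = M / real e * real m / real q" for m
    using e by (simp add: power2_eq_square field_simps)
  have "M / real e > 0" using M e by simp
  note P = jac_poisson[OF q this]
  have c: "M / (real e * sqrt (real q)) = M / real e / sqrt (real q)" by simp
  show ?thesis unfolding W a b d[symmetric] P c by (simp only: mult.left_commute)
qed

definition sqfree_upto :: "real \<Rightarrow> nat set" where "sqfree_upto Y = {s. squarefree s \<and> real s \<le> Y}"

lemma finite_sqfree_upto: "finite (sqfree_upto Y)"
  by (rule finite_subset[of _ "{..nat \<lfloor>Y\<rfloor>}"]) (auto simp: sqfree_upto_def le_nat_floor)

text \<open>Poisson summation maps the sum over all \<open>m = s h\<^sup>2\<close> to itself. The classes with \<open>s \<le> S\<close> are moved to the right-hand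
  side, where the main terms \<open>quartic_const / sqrt t\<close> of the theta sums on the two sides cancel exactly (this needs the
  sign of the Gauss sum), so that only \<open>qerr\<close> survives.\<close>

theorem sqfree_class_poisson:
  assumes e: "squarefree e" and l: "odd l" "odd l'" "squarefree l" "squarefree l'" "coprime l l'" "coprime e (l * l')"
    "l mod 4 = l' mod 4" and M: "M > 0"
  defines "q \<equiv> l * l'"
  shows "infsum (\<lambda>(s, h). if e dvd s * h\<^sup>2 then exp (- (pi * (1 / M * real (s * h\<^sup>2))\<^sup>2)) * jr (s * h\<^sup>2) q else 0) {(s, h) \<in> sq_pairs. S < real s} =
    M / (real e * sqrt (real q)) * infsum (\<lambda>(s, k). exp (- (pi * (M / (real e ^ 2 * real q) * real (s * (e div gcd e s * k)\<^sup>2))\<^sup>2)) *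
       (jr s q * of_bool (coprime k q))) {(s, k) \<in> sq_pairs. S < real s} +
    (\<Sum>s\<in>sqfree_upto S. jr s q * (\<Sum>c | c dvd l. \<Sum>c' | c' dvd l'. mu c * mu c' *
       (M / (real e * sqrt (real q)) * qerr (M / (real e ^ 2 * real q) * real (s * (e div gcd e s)\<^sup>2) * (real (c * c'))\<^sup>2) -
        qerr (1 / M * real (s * (e div gcd e s)\<^sup>2) * (real (c * c'))\<^sup>2)))) +
    of_bool (q = 1) * (M / (2 * real e) - 1 / 2)"
proof -
  have e0: "e > 0" using e by (cases "e = 0") auto
  have q: "odd q" "squarefree q" "coprime e q" using l by (auto simp: q_def squarefree_mult_coprime)
  have q1: "q mod 4 = 1" unfolding q_def using odd_mult_mod_4[OF l(1,2)] l(7) by simp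
  have q0: "q > 0" using q(1) odd_pos by blast
  define g where "g \<beta> s k = exp (- (pi * (\<beta> * real (s * (e div gcd e s * k)\<^sup>2))\<^sup>2)) * (jr s q * of_bool (coprime k q))" for \<beta> s k
  define b where "b = M / (real e ^ 2 * real q)"
  define c0 where "c0 = M / (real e * sqrt (real q))"
  have b: "b > 0" using M e0 q0 by (simp add: b_def)
  have SKsplit: "infsum (\<lambda>(s, k). g \<beta> s k) sq_pairs = infsum (\<lambda>(s, k). g \<beta> s k) {(s, k) \<in> sq_pairs. S < real s} + (\<Sum>s\<in>sqfree_upto S. infsum (g \<beta> s) {k. 0 < k})"
    if "\<beta> > 0" for \<beta>
  proof -
    have sm: "(\<lambda>(s, k). g \<beta> s k) summable_on sq_pairs" unfolding g_def by (rule class_sum(1)[OF e q(1,3) that])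
    have U: "sq_pairs = {(s, k) \<in> sq_pairs. S < real s} \<union> (sqfree_upto S \<times> {k. 0 < k})" by (auto simp: sq_pairs_def sqfree_upto_def)
    have s1: "(\<lambda>(s, k). g \<beta> s k) summable_on {(s, k) \<in> sq_pairs. S < real s}" by (rule summable_on_subset_banach[OF sm]) auto
    have s2: "(\<lambda>(s, k). g \<beta> s k) summable_on (sqfree_upto S \<times> {k. 0 < k})" by (rule summable_on_subset_banach[OF sm]) (auto simp: sq_pairs_def sqfree_upto_def)
    have "infsum (\<lambda>(s, k). g \<beta> s k) sq_pairs = infsum (\<lambda>(s, k). g \<beta> s k) ({(s, k) \<in> sq_pairs. S < real s} \<union> (sqfree_upto S \<times> {k. 0 < k}))"
      using U by simp
    also have "\<dots> = infsum (\<lambda>(s, k). g \<beta> s k) {(s, k) \<in> sq_pairs. S < real s} + infsum (\<lambda>(s, k). g \<beta> s k) (sqfree_upto S \<times> {k. 0 < k})"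
      by (rule infsum_Un_disjoint[OF s1 s2]) (auto simp: sqfree_upto_def)
    also have "infsum (\<lambda>(s, k). g \<beta> s k) (sqfree_upto S \<times> {k. 0 < k}) = infsum (\<lambda>s. infsum (g \<beta> s) {k. 0 < k}) (sqfree_upto S)"
      using infsum_Sigma_banach[OF s2] by simp
    finally show ?thesis by (simp add: finite_sqfree_upto)
  qed
  have inner: "infsum (g \<beta> s) {k. 0 < k} = jr s q * (\<Sum>c | c dvd l. \<Sum>c' | c' dvd l'. mu c * mu c' * qtheta (\<beta> * real (s * (e div gcd e s)\<^sup>2) * (real (c * c'))\<^sup>2))"
    if "\<beta> > 0" "s \<in> sqfree_upto S" for \<beta> s
  proof -
    have "s > 0" using that(2) by (cases "s = 0") (auto simp: sqfree_upto_def)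
    moreover have "e div gcd e s > 0" using e0 by (simp add: div_greater_zero_iff gcd_le1_nat)
    ultimately have t: "\<beta> * real (s * (e div gcd e s)\<^sup>2) > 0" using that(1) by simp
    have "g \<beta> s k = jr s q * (exp (- (pi * (\<beta> * real (s * (e div gcd e s)\<^sup>2) * (real k)\<^sup>2)\<^sup>2)) * of_bool (coprime k (l * l')))" for k
      by (simp add: g_def power_mult_distrib mult_ac q_def)
    hence "g \<beta> s = (\<lambda>k. jr s q * (exp (- (pi * (\<beta> * real (s * (e div gcd e s)\<^sup>2) * (real k)\<^sup>2)\<^sup>2)) * of_bool (coprime k (l * l'))))"
      by (rule ext)
    hence "infsum (g \<beta> s) {k. 0 < k} = jr s q * infsum (\<lambda>k. exp (- (pi * (\<beta> * real (s * (e div gcd e s)\<^sup>2) * (real k)\<^sup>2)\<^sup>2)) * of_bool (coprime k (l * l'))) {k. 0 < k}"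
      by (simp only: infsum_cmult_right')
    thus ?thesis using coprime_theta_sum[OF t l(3,4,5)] by (simp only: infsumI)
  qed
  have small: "c0 * infsum (g b s) {k. 0 < k} - infsum (g (1 / M) s) {k. 0 < k} =
     jr s q * (\<Sum>c | c dvd l. \<Sum>c' | c' dvd l'. mu c * mu c' *
       (c0 * qerr (b * real (s * (e div gcd e s)\<^sup>2) * (real (c * c'))\<^sup>2) - qerr (1 / M * real (s * (e div gcd e s)\<^sup>2) * (real (c * c'))\<^sup>2)))"
    if s: "s \<in> sqfree_upto S" for s
  proof -
    define w where "w = real (s * (e div gcd e s)\<^sup>2)"
    \<comment> \<open>The dual scale is \<open>b = c0\<^sup>2 / M\<close>, so the square root of the
      dual argument is \<open>c0\<close> times that of the original one. Hence \<open>c0\<close>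
      times the dual main term equals the original main term.\<close>
    have key: "c0 * qtheta (b * w * C) - qtheta (1 / M * w * C) = c0 * qerr (b * w * C) - qerr (1 / M * w * C)" for C
    proof -
      have "b = c0\<^sup>2 * (1 / M)"
        using M e0 q0 by (simp add: b_def c0_def power_divide power_mult_distrib power2_eq_square)
      hence "b * w * C = c0\<^sup>2 * (1 / M * w * C)" by (simp only: mult.assoc)
      moreover have "c0 > 0" using M e0 q0 by (simp add: c0_def)
      ultimately have "sqrt (b * w * C) = c0 * sqrt (1 / M * w * C)"
        by (simp only: real_sqrt_mult[of "c0\<^sup>2"] real_sqrt_abs abs_of_pos)
      thus ?thesis using \<open>c0 > 0\<close> by (simp add: qerr_def right_diff_distrib)
    qed
    have "c0 * infsum (g b s) {k. 0 < k} - infsum (g (1 / M) s) {k. 0 < k} =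
      jr s q * (\<Sum>c | c dvd l. \<Sum>c' | c' dvd l'. mu c * mu c' * (c0 * qtheta (b * w * (real (c * c'))\<^sup>2) - qtheta (1 / M * w * (real (c * c'))\<^sup>2)))"
      using inner[OF b s] inner[of "1 / M", OF _ s] M unfolding w_def
      by (simp only: zero_less_divide_1_iff) (simp add: sum_distrib_left right_diff_distrib sum_subtractf mult_ac)
    thus ?thesis unfolding key unfolding w_def .
  qed
  have W: "infsum (\<lambda>m. exp (- (pi * (\<beta> * real m)\<^sup>2)) * jr m q) {m. 0 < m \<and> e dvd m} = infsum (\<lambda>(s, k). g \<beta> s k) sq_pairs" if "\<beta> > 0" for \<beta>
    unfolding g_def by (rule class_sum(2)[OF e q(1,3) that])
  have "infsum (\<lambda>(s, k). g (1 / M) s k) sq_pairs + of_bool (q = 1) / 2 = c0 * (infsum (\<lambda>(s, k). g b s k) sq_pairs + of_bool (q = 1) / 2)"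
    using multiples_poisson[OF q(1,2) q1 M e0 q(3)] W[OF b] W[of "1 / M"] M by (simp add: b_def c0_def)
  hence "infsum (\<lambda>(s, k). g (1 / M) s k) {(s, k) \<in> sq_pairs. S < real s} =
     c0 * infsum (\<lambda>(s, k). g b s k) {(s, k) \<in> sq_pairs. S < real s} + (\<Sum>s\<in>sqfree_upto S. c0 * infsum (g b s) {k. 0 < k} - infsum (g (1 / M) s) {k. 0 < k})
     + (c0 * of_bool (q = 1) / 2 - of_bool (q = 1) / 2)"
    using SKsplit[OF b] SKsplit[of "1 / M"] M by (simp add: sum_subtractf sum_distrib_left distrib_left)
  moreover have "c0 * of_bool (q = 1) / 2 - of_bool (q = 1) / 2 = of_bool (q = 1) * (M / (2 * real e) - 1 / 2)"
    by (simp add: c0_def)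
  moreover have "infsum (\<lambda>(s, h). if e dvd s * h\<^sup>2 then exp (- (pi * (1 / M * real (s * h\<^sup>2))\<^sup>2)) * jr (s * h\<^sup>2) q else 0) {(s, h) \<in> sq_pairs. S < real s} =
    infsum (\<lambda>(s, k). g (1 / M) s k) {(s, k) \<in> sq_pairs. S < real s}"
    unfolding g_def by (rule class_sum(3)[OF e q(1,3)]) (use M in simp)
  ultimately show ?thesis using small by (simp add: g_def b_def c0_def)
qed

section \<open>Weights of the dual sum\<close>

text \<open>The ratio is that of the locale \<open>block\<close>; half-open blocks at successive
  powers of 11/10 partition the positive range.\<close>

definition odd_block :: "real \<Rightarrow> nat set" where
  "odd_block N = {n. odd n \<and> squarefree n \<and> N \<le> real n \<and> real n < 11/10 * N}"

text \<open>Columns run over a single block at \<open>N\<close>, rows over the full range up to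
  \<open>Y\<close>. Rows may be even, as they arise as squarefree parts of arbitrary
  integers.\<close>

definition sieve_bd :: "real \<Rightarrow> real \<Rightarrow> real \<Rightarrow> bool" where
  "sieve_bd Y N B \<longleftrightarrow> (\<forall>a :: nat \<Rightarrow> complex.
     (\<Sum>s\<in>sqfree_upto Y. (cmod (\<Sum>n\<in>odd_block N. a n * of_real (jr s n)))\<^sup>2) \<le> B * (\<Sum>n\<in>odd_block N. (cmod (a n))\<^sup>2))"

lemma finite_odd_block: "finite (odd_block N)"
  by (rule finite_subset[of _ "{..nat \<lfloor>11/10 * N\<rfloor>}"]) (auto simp: odd_block_def le_nat_floor)

lemma sieve_bdD: "sieve_bd Y N B \<Longrightarrow> (\<Sum>s\<in>sqfree_upto Y. (cmod (\<Sum>n\<in>odd_block N. a n * of_real (jr s n)))\<^sup>2) \<le> B * (\<Sum>n\<in>odd_block N. (cmod (a n))\<^sup>2)"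
  by (simp add: sieve_bd_def)

lemma sieve_bd_mono: assumes "sieve_bd Y N B" "Y' \<le> Y" "B \<le> B'" shows "sieve_bd Y' N B'"
  unfolding sieve_bd_def
proof
  fix a :: "nat \<Rightarrow> complex"
  have "(\<Sum>s\<in>sqfree_upto Y'. (cmod (\<Sum>n\<in>odd_block N. a n * of_real (jr s n)))\<^sup>2) \<le>
    (\<Sum>s\<in>sqfree_upto Y. (cmod (\<Sum>n\<in>odd_block N. a n * of_real (jr s n)))\<^sup>2)"
    by (rule sum_mono2[OF finite_sqfree_upto]) (use assms(2) in \<open>auto simp: sqfree_upto_def\<close>)
  also have "\<dots> \<le> B * (\<Sum>n\<in>odd_block N. (cmod (a n))\<^sup>2)" by (rule sieve_bdD[OF assms(1)])
  also have "\<dots> \<le> B' * (\<Sum>n\<in>odd_block N. (cmod (a n))\<^sup>2)" by (intro mult_right_mono assms(3) sum_nonneg) auto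
  finally show "(\<Sum>s\<in>sqfree_upto Y'. (cmod (\<Sum>n\<in>odd_block N. a n * of_real (jr s n)))\<^sup>2) \<le> B' * (\<Sum>n\<in>odd_block N. (cmod (a n))\<^sup>2)" .
qed

definition blk :: "real \<Rightarrow> nat" where "blk u = nat \<lfloor>log (11/10) u\<rfloor>"

lemma blk: assumes "u \<ge> 1" shows "(11/10) ^ blk u \<le> u" "u < 11/10 * (11/10) ^ blk u"
proof -
  have l: "0 \<le> log (11/10) u" using assms by simp
  have "real (blk u) \<le> log (11/10) u" "log (11/10) u < real (blk u) + 1"
    unfolding blk_def using l by linarith+
  hence "(11/10) powr real (blk u) \<le> (11/10) powr (log (11/10) u)"
    "(11/10) powr (log (11/10) u) < (11/10) powr (real (blk u) + 1)" by (auto intro: powr_mono)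
  thus "(11/10) ^ blk u \<le> u" "u < 11/10 * (11/10) ^ blk u"
    using assms by (simp_all add: powr_realpow powr_add mult.commute)
qed

lemma blk_less: assumes "u \<ge> 1" "u < (11/10) ^ n" shows "blk u < n"
proof (rule ccontr)
  assume "\<not> blk u < n"
  hence "(11/10 :: real) ^ n \<le> (11/10) ^ blk u" by (intro power_increasing) auto
  thus False using blk(1)[OF assms(1)] assms(2) by linarith
qed

lemma norm_sum_group:
  fixes f :: "'a \<Rightarrow> 'b::real_normed_vector"
  assumes "finite A" "finite I" "\<And>x. x \<in> A \<Longrightarrow> \<phi> x \<in> I"
  shows "norm (\<Sum>x\<in>A. f x) \<le> (\<Sum>i\<in>I. norm (\<Sum>x\<in>{x \<in> A. \<phi> x = i}. f x))"
proof -
  have "(\<Sum>x\<in>A. f x) = (\<Sum>i\<in>I. \<Sum>x\<in>{x \<in> A. \<phi> x = i}. f x)"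
    by (rule sum.group[symmetric]) (use assms in auto)
  thus ?thesis by (simp add: norm_sum)
qed

text \<open>The dual sums run over pairs \<open>(c, l)\<close> with \<open>c\<close> dividing
  \<open>l\<close>, but the symbol sees only \<open>l\<close>. Adding up the coefficients over each
  fibre reduces them to the bilinear estimate.\<close>

lemma fibre_bound:
  fixes c :: "nat \<times> nat \<Rightarrow> complex"
  assumes B: "sieve_bd Y L B" "B \<ge> 0" and P: "finite P" "\<And>p. p \<in> P \<Longrightarrow> snd p \<in> odd_block L"
  shows "(\<Sum>s\<in>sqfree_upto Y. (cmod (\<Sum>p\<in>P. c p * of_real (jr s (snd p))))\<^sup>2) \<le>
     B * (\<Sum>l\<in>odd_block L. (\<Sum>p\<in>{p \<in> P. snd p = l}. cmod (c p))\<^sup>2)"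
proof -
  define \<beta> where "\<beta> l = (\<Sum>p\<in>{p \<in> P. snd p = l}. c p)" for l
  have eq: "(\<Sum>p\<in>P. c p * of_real (jr s (snd p))) = (\<Sum>l\<in>odd_block L. \<beta> l * of_real (jr s l))" for s
  proof -
    have "(\<Sum>p\<in>P. c p * of_real (jr s (snd p))) = (\<Sum>l\<in>odd_block L. \<Sum>p\<in>{p \<in> P. snd p = l}. c p * of_real (jr s (snd p)))"
      by (rule sum.group[symmetric]) (use P finite_odd_block in auto)
    also have "\<dots> = (\<Sum>l\<in>odd_block L. \<beta> l * of_real (jr s l))"
      unfolding \<beta>_def sum_distrib_right by (intro sum.cong refl) auto
    finally show ?thesis .
  qed
  have "(\<Sum>s\<in>sqfree_upto Y. (cmod (\<Sum>p\<in>P. c p * of_real (jr s (snd p))))\<^sup>2) \<le> B * (\<Sum>l\<in>odd_block L. (cmod (\<beta> l))\<^sup>2)"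
    unfolding eq by (rule sieve_bdD[OF B(1)])
  also have "\<dots> \<le> B * (\<Sum>l\<in>odd_block L. (\<Sum>p\<in>{p \<in> P. snd p = l}. cmod (c p))\<^sup>2)"
    unfolding \<beta>_def by (intro mult_left_mono B(2) sum_mono power_mono norm_sum) auto
  finally show ?thesis .
qed

text \<open>At fixed \<open>s\<close> the trilinear sum is a product of two linear forms, bounded by
  half the sum of their squares. Test coefficients of modulus at most 1 do not increase
  \<open>G\<close>, which is formed with absolute values over all of \<open>PP\<close>, so one
  \<open>G\<close> serves every pair of blocks \<open>P\<close>, \<open>R\<close>.\<close>

lemma sieve_tri_bd:
  fixes \<gamma> :: "nat \<times> nat \<Rightarrow> complex"
  assumes B: "sieve_bd Y L B" "B \<ge> 0" and PP: "finite PP" "\<And>p. p \<in> PP \<Longrightarrow> snd p \<in> odd_block L"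
    and sub: "X \<subseteq> sqfree_upto Y" "P \<subseteq> PP" "R \<subseteq> PP"
    and G: "(\<Sum>l\<in>odd_block L. (\<Sum>p\<in>{p \<in> PP. snd p = l}. cmod (\<gamma> p))\<^sup>2) \<le> G"
  shows "tri_bd X P R (\<lambda>s p r. \<gamma> p * cnj (\<gamma> r) * of_real (jr s (snd p) * jr s (snd r))) (B * G)"
  unfolding tri_bd_def
proof (intro allI impI)
  fix u v w :: "_ \<Rightarrow> complex"
  assume b: "\<forall>s\<in>X. cmod (u s) \<le> 1" "\<forall>p\<in>P. cmod (v p) \<le> 1" "\<forall>r\<in>R. cmod (w r) \<le> 1"
  have half: "(\<Sum>s\<in>X. (cmod (\<Sum>p\<in>Q. c p * of_real (jr s (snd p))))\<^sup>2) \<le> B * G"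
    if Q: "Q \<subseteq> PP" and c: "\<And>p. p \<in> Q \<Longrightarrow> cmod (c p) \<le> cmod (\<gamma> p)" for Q c
  proof -
    have fQ: "finite Q" using Q PP(1) finite_subset by blast
    have "(\<Sum>s\<in>X. (cmod (\<Sum>p\<in>Q. c p * of_real (jr s (snd p))))\<^sup>2) \<le> (\<Sum>s\<in>sqfree_upto Y. (cmod (\<Sum>p\<in>Q. c p * of_real (jr s (snd p))))\<^sup>2)"
      by (rule sum_mono2[OF finite_sqfree_upto sub(1)]) auto
    also have "\<dots> \<le> B * (\<Sum>l\<in>odd_block L. (\<Sum>p\<in>{p \<in> Q. snd p = l}. cmod (c p))\<^sup>2)"
      by (rule fibre_bound[OF B fQ]) (use Q PP in auto)
    also have "\<dots> \<le> B * (\<Sum>l\<in>odd_block L. (\<Sum>p\<in>{p \<in> PP. snd p = l}. cmod (\<gamma> p))\<^sup>2)"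
    proof (intro mult_left_mono B(2) sum_mono power_mono sum_nonneg)
      fix l
      have "(\<Sum>p\<in>{p \<in> Q. snd p = l}. cmod (c p)) \<le> (\<Sum>p\<in>{p \<in> Q. snd p = l}. cmod (\<gamma> p))"
        by (rule sum_mono) (use c in auto)
      also have "\<dots> \<le> (\<Sum>p\<in>{p \<in> PP. snd p = l}. cmod (\<gamma> p))"
        by (rule sum_mono2) (use PP Q in auto)
      finally show "(\<Sum>p\<in>{p \<in> Q. snd p = l}. cmod (c p)) \<le> (\<Sum>p\<in>{p \<in> PP. snd p = l}. cmod (\<gamma> p))" .
    qed auto
    also have "\<dots> \<le> B * G" by (intro mult_left_mono G B(2))
    finally show ?thesis .
  qed
  define A where "A s = (\<Sum>p\<in>P. (\<gamma> p * v p) * of_real (jr s (snd p)))" for s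
  define A' where "A' s = (\<Sum>r\<in>R. (cnj (\<gamma> r) * w r) * of_real (jr s (snd r)))" for s
  have "(\<Sum>s\<in>X. \<Sum>p\<in>P. \<Sum>r\<in>R. \<gamma> p * cnj (\<gamma> r) * of_real (jr s (snd p) * jr s (snd r)) * u s * v p * w r) =
    (\<Sum>s\<in>X. u s * (A s * A' s))"
    unfolding A_def A'_def sum_product by (simp add: sum_distrib_left mult_ac)
  hence "cmod (\<Sum>s\<in>X. \<Sum>p\<in>P. \<Sum>r\<in>R. \<gamma> p * cnj (\<gamma> r) * of_real (jr s (snd p) * jr s (snd r)) * u s * v p * w r)
    \<le> (\<Sum>s\<in>X. cmod (u s * (A s * A' s)))" by (simp only: norm_sum)
  also have "\<dots> \<le> (\<Sum>s\<in>X. (cmod (A s))\<^sup>2 / 2 + (cmod (A' s))\<^sup>2 / 2)"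
  proof (rule sum_mono)
    fix s assume s: "s \<in> X"
    have "cmod (u s * (A s * A' s)) \<le> 1 * (cmod (A s) * cmod (A' s))"
      unfolding norm_mult using b(1) s by (intro mult_right_mono) auto
    also have "\<dots> \<le> (cmod (A s))\<^sup>2 / 2 + (cmod (A' s))\<^sup>2 / 2"
      using sum_squares_bound[of "cmod (A s)" "cmod (A' s)"] by simp
    finally show "cmod (u s * (A s * A' s)) \<le> (cmod (A s))\<^sup>2 / 2 + (cmod (A' s))\<^sup>2 / 2" .
  qed
  also have "\<dots> = (\<Sum>s\<in>X. (cmod (A s))\<^sup>2) / 2 + (\<Sum>s\<in>X. (cmod (A' s))\<^sup>2) / 2"
    by (simp add: sum.distrib sum_divide_distrib)
  also have "\<dots> \<le> B * G / 2 + B * G / 2"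
  proof (intro add_mono divide_right_mono)
    show "(\<Sum>s\<in>X. (cmod (A s))\<^sup>2) \<le> B * G" unfolding A_def
    proof (rule half[OF sub(2)])
      fix p assume "p \<in> P"
      thus "cmod (\<gamma> p * v p) \<le> cmod (\<gamma> p)" using b(2) mult_left_mono[of "cmod (v p)" 1 "cmod (\<gamma> p)"] by (simp add: norm_mult)
    qed
    show "(\<Sum>s\<in>X. (cmod (A' s))\<^sup>2) \<le> B * G" unfolding A'_def
    proof (rule half[OF sub(3)])
      fix p assume "p \<in> R"
      thus "cmod (cnj (\<gamma> p) * w p) \<le> cmod (\<gamma> p)" using b(3) mult_left_mono[of "cmod (w p)" 1 "cmod (\<gamma> p)"] by (simp add: norm_mult)
    qed
  qed auto
  finally show "cmod (\<Sum>s\<in>X. \<Sum>p\<in>P. \<Sum>r\<in>R. \<gamma> p * cnj (\<gamma> r) * of_real (jr s (snd p) * jr s (snd r)) * u s * v p * w r) \<le> B * G"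
    by simp
qed

lemma multiplier_sieve:
  fixes \<gamma> :: "nat \<times> nat \<Rightarrow> complex"
  assumes "multiplier X P R h c"
    "tri_bd X P R (\<lambda>s p r. \<gamma> p * cnj (\<gamma> r) * of_real (jr s (snd p) * jr s (snd r))) B"
  shows "cmod (\<Sum>s\<in>X. \<Sum>p\<in>P. \<Sum>r\<in>R. \<gamma> p * cnj (\<gamma> r) * of_real (jr s (snd p) * jr s (snd r)) * of_real (h s p r)) \<le> c * B"
  using tri_bdD[OF multiplierD[OF assms], of "\<lambda>_. 1" "\<lambda>_. 1" "\<lambda>_. 1"] by (simp add: mult_ac)

text \<open>The rows lie in one block, but \<open>y\<close> ranges over \<open>nb\<close> blocks.
  Each of the \<open>nb\<^sup>2\<close> pairs of blocks receives the better one of the two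
  multiplier bounds for \<open>qerr\<close>.\<close>

lemma qerr_sum_bound:
  fixes \<gamma> :: "nat \<times> nat \<Rightarrow> complex" and y :: "nat \<times> nat \<Rightarrow> real"
  assumes B: "sieve_bd Y L B" "B \<ge> 0" and PP: "finite PP" "\<And>p. p \<in> PP \<Longrightarrow> snd p \<in> odd_block L"
    and X: "X \<subseteq> sqfree_upto Y" "x0 > 0" "\<And>s. s \<in> X \<Longrightarrow> x0 \<le> real s \<and> real s \<le> 11/10 * x0"
    and y: "ym > 0" "\<And>p. p \<in> PP \<Longrightarrow> ym \<le> y p \<and> y p < ym * (11/10) ^ nb" and \<kappa>: "\<kappa> > 0"
    and G: "(\<Sum>l\<in>odd_block L. (\<Sum>p\<in>{p \<in> PP. snd p = l}. cmod (\<gamma> p))\<^sup>2) \<le> G" "G \<ge> 0"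
  shows "cmod (\<Sum>s\<in>X. \<Sum>p\<in>PP. \<Sum>r\<in>PP. \<gamma> p * cnj (\<gamma> r) * of_real (jr s (snd p) * jr s (snd r)) * of_real (qerr (\<kappa> * real s * y p * y r)))
    \<le> 10 * real nb ^ 2 * min 1 (1 / sqrt (\<kappa> * x0 * ym\<^sup>2)) * (B * G)"
proof -
  let ?f = "\<lambda>s p r. \<gamma> p * cnj (\<gamma> r) * of_real (jr s (snd p) * jr s (snd r)) * of_real (qerr (\<kappa> * real s * y p * y r))"
  define P where "P i = {p \<in> PP. blk (y p / ym) = i}" for i
  have yr: "y p / ym \<ge> 1" "y p / ym < (11/10) ^ nb" if "p \<in> PP" for p
    using y(2)[OF that] y(1) by (auto simp: field_simps)
  have dec: "(\<Sum>p\<in>PP. f p) = (\<Sum>i<nb. \<Sum>p\<in>P i. f p)" for f :: "nat \<times> nat \<Rightarrow> complex"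
    unfolding P_def by (rule sum.group[symmetric]) (use PP yr blk_less in auto)
  have fX: "finite X" using X(1) finite_sqfree_upto finite_subset by blast
  have blkb: "cmod (\<Sum>s\<in>X. \<Sum>p\<in>P i. \<Sum>r\<in>P j. ?f s p r) \<le> 10 * min 1 (1 / sqrt (\<kappa> * x0 * ym\<^sup>2)) * (B * G)" for i j
  proof -
    have Pb: "ym * (11/10) ^ i \<le> y p \<and> y p \<le> 11/10 * (ym * (11/10) ^ i)" if "p \<in> P i" for i p
      using blk[of "y p / ym"] yr[of p] that y(1) by (auto simp: P_def field_simps)
    interpret b: block X "P i" "P j" "\<lambda>s. \<kappa> * real s" y y "\<kappa> * x0" "ym * (11/10) ^ i" "ym * (11/10) ^ j"
      by unfold_locales (use fX PP X \<kappa> y Pb in \<open>auto simp: P_def\<close>)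
    have T: "tri_bd X (P i) (P j) (\<lambda>s p r. \<gamma> p * cnj (\<gamma> r) * of_real (jr s (snd p) * jr s (snd r))) (B * G)"
      by (rule sieve_tri_bd[OF B PP X(1) _ _ G(1)]) (auto simp: P_def)
    have BG: "B * G \<ge> 0" using B(2) G(2) by simp
    have "cmod (\<Sum>s\<in>X. \<Sum>p\<in>P i. \<Sum>r\<in>P j. ?f s p r) \<le> 10 * (B * G)"
      using multiplier_sieve[OF b.mult_qerr T] by (simp add: b.t_def)
    moreover have "cmod (\<Sum>s\<in>X. \<Sum>p\<in>P i. \<Sum>r\<in>P j. ?f s p r) \<le> 10 / sqrt b.t0 * (B * G)"
      using multiplier_sieve[OF b.mult_qerr' T] by (simp add: b.t_def)
    moreover have "10 / sqrt b.t0 * (B * G) \<le> 10 / sqrt (\<kappa> * x0 * ym\<^sup>2) * (B * G)"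
    proof (intro mult_right_mono divide_left_mono BG)
      have "1 * 1 \<le> (11/10 :: real) ^ i * (11/10) ^ j" by (intro mult_mono) auto
      hence "\<kappa> * x0 * ym\<^sup>2 * 1 \<le> \<kappa> * x0 * ym\<^sup>2 * ((11/10) ^ i * (11/10) ^ j)" using \<kappa> X(2) by (intro mult_left_mono) auto
      also have "\<dots> = b.t0" by (simp add: b.t0_def power2_eq_square mult_ac)
      finally show "sqrt (\<kappa> * x0 * ym\<^sup>2) \<le> sqrt b.t0" by simp
      show "0 < sqrt b.t0 * sqrt (\<kappa> * x0 * ym\<^sup>2)" using b.t0_pos \<kappa> X(2) y(1) by simp
    qed simp
    ultimately show ?thesis by (simp add: min_def)
  qed
  have "(\<Sum>s\<in>X. \<Sum>p\<in>PP. \<Sum>r\<in>PP. ?f s p r) = (\<Sum>s\<in>X. \<Sum>i<nb. \<Sum>p\<in>P i. \<Sum>j<nb. \<Sum>r\<in>P j. ?f s p r)"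
    unfolding dec ..
  also have "\<dots> = (\<Sum>s\<in>X. \<Sum>i<nb. \<Sum>j<nb. \<Sum>p\<in>P i. \<Sum>r\<in>P j. ?f s p r)"
    by (intro sum.cong refl sum.swap)
  also have "\<dots> = (\<Sum>i<nb. \<Sum>s\<in>X. \<Sum>j<nb. \<Sum>p\<in>P i. \<Sum>r\<in>P j. ?f s p r)" by (rule sum.swap)
  also have "\<dots> = (\<Sum>i<nb. \<Sum>j<nb. \<Sum>s\<in>X. \<Sum>p\<in>P i. \<Sum>r\<in>P j. ?f s p r)"
    by (rule sum.cong[OF refl], rule sum.swap)
  finally have "cmod (\<Sum>s\<in>X. \<Sum>p\<in>PP. \<Sum>r\<in>PP. ?f s p r) \<le> (\<Sum>i<nb. \<Sum>j<nb. 10 * min 1 (1 / sqrt (\<kappa> * x0 * ym\<^sup>2)) * (B * G))"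
    by (simp only:) (rule order_trans[OF norm_sum sum_mono[OF order_trans[OF norm_sum sum_mono[OF blkb]]]])
  thus ?thesis by (simp add: power2_eq_square mult_ac)
qed

text \<open>A cofinal family of finite sets is enough. It will consist of rectangles, on which the
  two summations can be interchanged.\<close>

lemma norm_infsum_le:
  fixes f :: "'a \<Rightarrow> complex"
  assumes "f summable_on A" "\<And>F. finite F \<Longrightarrow> F \<subseteq> A \<Longrightarrow> \<exists>F'. finite F' \<and> F \<subseteq> F' \<and> F' \<subseteq> A \<and> cmod (sum f F') \<le> B"
  shows "cmod (infsum f A) \<le> B"
proof (rule ccontr)
  assume "\<not> cmod (infsum f A) \<le> B"
  hence e: "cmod (infsum f A) - B > 0" by simp
  have "(sum f \<longlongrightarrow> infsum f A) (finite_subsets_at_top A)"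
    using has_sum_infsum[OF assms(1)] by (simp add: has_sum_def)
  from tendstoD[OF this e] obtain F where F: "finite F" "F \<subseteq> A"
    "\<And>F'. finite F' \<Longrightarrow> F \<subseteq> F' \<Longrightarrow> F' \<subseteq> A \<Longrightarrow> dist (sum f F') (infsum f A) < cmod (infsum f A) - B"
    unfolding eventually_finite_subsets_at_top by auto
  from assms(2)[OF F(1,2)] obtain F' where F': "finite F'" "F \<subseteq> F'" "F' \<subseteq> A" "cmod (sum f F') \<le> B" by auto
  have "cmod (infsum f A) \<le> cmod (sum f F') + dist (sum f F') (infsum f A)"
    using norm_triangle_ineq2[of "infsum f A" "sum f F'"] by (simp add: dist_norm norm_minus_commute)
  thus False using F(3)[OF F'(1-3)] F'(4) by linarith
qed


lemma exp_minus_cube_le: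
  fixes x :: real assumes "x > 0" shows "exp (- x) \<le> 6 / x ^ 3"
proof -
  have "(\<Sum>k\<in>{3::nat}. x ^ k /\<^sub>R fact k) \<le> (\<Sum>k. x ^ k /\<^sub>R fact k)"
    by (rule sum_le_suminf[OF summable_exp_generic]) (use assms in auto)
  hence "inverse (fact 3) * x ^ 3 \<le> exp x" by (simp only: exp_def sum.insert sum.empty finite.emptyI empty_iff not_False_eq_True add_0_right real_scaleR_def)
  moreover have "fact 3 = (6 :: real)" by (simp add: fact_numeral)
  ultimately have "x ^ 3 / 6 \<le> exp x" by (simp only: divide_inverse mult.commute)
  moreover have "0 < x ^ 3" using assms by simp
  ultimately have "1 / exp x \<le> 1 / (x ^ 3 / 6)" by (intro divide_left_mono) auto
  thus ?thesis by (simp add: exp_minus inverse_eq_divide)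
qed

text \<open>A geometric series of ratio
  \<open>(11/10) powr (- \<eta>) \<le> 1 - \<eta> / 22\<close>, by
  \<open>ln (11/10) \<ge> 1/11\<close>. It replaces a logarithm of the length by the factor
  \<open>1 / \<eta>\<close>.\<close>

lemma sum_block_powr:
  fixes S \<eta> :: real
  assumes S: "S > 0" and \<eta>: "0 < \<eta>" "\<eta> \<le> 1"
  shows "(\<Sum>j<J. (S / (11/10) ^ j) powr \<eta>) \<le> 22 / \<eta> * S powr \<eta>"
proof -
  define r where "r = (11/10 :: real) powr (- \<eta>)"
  have r0: "0 < r" by (simp add: r_def)
  have r1: "r \<le> 1 - \<eta> / 22"
  proof -
    have "ln (10/11 :: real) \<le> - (1/11)" using ln_le_minus_one[of "10/11"] by simp
    hence l: "1/11 \<le> ln (11/10 :: real)" using ln_inverse[of "11/10"] by (simp add: inverse_eq_divide)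
    have "1 + \<eta> / 11 \<le> 1 + \<eta> * ln (11/10)" using mult_left_mono[OF l, of \<eta>] \<eta> by simp
    also have "\<dots> \<le> exp (\<eta> * ln (11/10))" by (rule exp_ge_add_one_self)
    finally have "1 + \<eta> / 11 \<le> (11/10) powr \<eta>" by (simp add: powr_def)
    hence "r \<le> 1 / (1 + \<eta> / 11)" unfolding r_def powr_minus_divide using \<eta> by (intro divide_left_mono) auto
    also have "\<dots> \<le> 1 - \<eta> / 22"
    proof -
      have "1 \<le> (1 - \<eta> / 22) * (1 + \<eta> / 11)" using mult_left_mono[OF \<eta>(2), of \<eta>] \<eta> by (simp add: algebra_simps)
      thus ?thesis using \<eta> by (simp only: pos_divide_le_eq)
    qed
    finally show ?thesis .
  qed
  have r: "0 < r" "r < 1" using r0 r1 \<eta> by auto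
  have "(S / (11/10) ^ j) powr \<eta> = S powr \<eta> * r ^ j" for j
  proof -
    have "((11/10 :: real) ^ j) powr \<eta> = ((11/10) powr real j) powr \<eta>" by (simp add: powr_realpow)
    also have "\<dots> = ((11/10) powr \<eta>) powr real j" by (simp only: powr_powr mult.commute)
    also have "\<dots> = ((11/10) powr \<eta>) ^ j" by (simp add: powr_realpow)
    finally have p: "((11/10 :: real) ^ j) powr \<eta> = ((11/10) powr \<eta>) ^ j" .
    have "r ^ j = 1 / ((11/10) powr \<eta>) ^ j" unfolding r_def powr_minus_divide by (rule power_one_over)
    moreover have "(S / (11/10) ^ j) powr \<eta> = S powr \<eta> / ((11/10) ^ j) powr \<eta>" by (rule powr_divide)
    ultimately show ?thesis unfolding p by simp
  qed
  hence "(\<Sum>j<J. (S / (11/10) ^ j) powr \<eta>) = S powr \<eta> * (\<Sum>j<J. r ^ j)" by (simp add: sum_distrib_left)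
  also have "\<dots> \<le> S powr \<eta> * (1 / (1 - r))"
  proof (intro mult_left_mono)
    have "(\<Sum>j<J. r ^ j) = (1 - r ^ J) / (1 - r)" using r by (simp add: sum_gp_strict)
    also have "\<dots> \<le> 1 / (1 - r)" using r by (intro divide_right_mono) auto
    finally show "(\<Sum>j<J. r ^ j) \<le> 1 / (1 - r)" .
  qed simp
  also have "\<dots> \<le> S powr \<eta> * (22 / \<eta>)"
  proof (intro mult_left_mono)
    have "1 / (1 - r) \<le> 1 / (\<eta> / 22)" using r1 \<eta> r by (intro divide_left_mono mult_pos_pos) auto
    thus "1 / (1 - r) \<le> 22 / \<eta>" by simp
  qed simp
  finally show ?thesis by (simp add: mult.commute)
qed

text \<open>The data of one recursion step: \<open>H\<close> is the estimate to be improved,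
  \<open>\<tau>\<close> bounds the number of divisors of the squarefree integers that occur, and
  \<open>nb\<close> blocks of ratio 11/10 reach beyond the square of the largest column.\<close>

locale sieve_step =
  fixes K \<eta> \<xi> M N S \<tau> :: real and nb :: nat
  assumes H: "\<And>Y L. Y \<ge> 1 \<Longrightarrow> L \<ge> 1 \<Longrightarrow> sieve_bd Y L (K * Y powr \<eta> * (L + Y powr \<xi>))"
    and K: "K \<ge> 1" and \<eta>: "0 < \<eta>" "\<eta> \<le> 1" and \<xi>: "1 \<le> \<xi>" "\<xi> \<le> 2" and N: "N \<ge> 1" and MN: "M \<ge> N"
    and S: "S = max 1 (N\<^sup>2 / M)"
    and \<tau>: "\<And>n. squarefree n \<Longrightarrow> real n \<le> 11/10 * N \<Longrightarrow> real (tau n) \<le> \<tau>"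
    and nb: "121/100 * N\<^sup>2 < (11/10) ^ nb"
begin

definition "lam Y L = K * Y powr \<eta> * (L + Y powr \<xi>)"
text \<open>The size that all parts of the dual sum are compared with: \<open>M\<close> arises from
  the column term of the hypothesis, the other summand from its row term at length
  \<open>S\<close>.\<close>

definition "om = M + sqrt (M / S) * S powr \<xi>"
definition "Om = S powr \<eta> * om"

lemma M: "M \<ge> 1" using MN N by simp

lemma S1: "S \<ge> 1" "S * M \<ge> N\<^sup>2" "S \<le> M"
proof -
  show "S \<ge> 1" by (simp add: S)
  have "N\<^sup>2 / M \<le> S" by (simp add: S)
  thus "S * M \<ge> N\<^sup>2" using M by (simp add: field_simps)
  have "N\<^sup>2 \<le> M * M" unfolding power2_eq_square using MN N by (intro mult_mono) auto
  hence "N\<^sup>2 / M \<le> M" using M by (simp add: field_simps)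
  thus "S \<le> M" using M by (simp add: S)
qed

lemma lam_nonneg: "Y \<ge> 0 \<Longrightarrow> L \<ge> 0 \<Longrightarrow> lam Y L \<ge> 0"
  using K by (simp add: lam_def)

lemma om_ge: "om \<ge> M" unfolding om_def using M S1 by simp

lemma Om_nonneg: "Om \<ge> 0" unfolding Om_def using om_ge M by simp

lemma tau1: "\<tau> \<ge> 1"
  using \<tau>[of 1] N by (simp add: tau_def)

text \<open>For \<open>s\<close> near \<open>S \<rho>\<close> with \<open>\<rho> \<ge> 1\<close> the dual weight is exponentially small.\<close>

lemma big_weight:
  assumes "\<rho> \<ge> 1" "k \<ge> (1::real)" "0 < g" "g \<le> e" "1 \<le> e" "L \<ge> 1" "e * L \<le> 11/10 * N"
  shows "M / (e * L) * lam (11/10 * (S * \<rho>)) L * exp (- (pi * (M * k\<^sup>2 / g\<^sup>2)\<^sup>2 * (S * \<rho> * (1 / (11/10 * L)) * (1 / (11/10 * L)))\<^sup>2 / 5))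
    \<le> 340 * K * Om / \<rho>\<^sup>2 / k\<^sup>2"
proof -
  \<comment> \<open>With \<open>k = 1\<close>, this is the argument of the dual Gaussian at the
    lower corner of the block. As \<open>N\<^sup>2 \<le> S * M\<close>, it is at least
    \<open>\<rho>\<close> divided by \<open>(11/10) ^ 4\<close>.\<close>
  define z where "z = M * S * \<rho> / (121/100 * (g * L)\<^sup>2)"
  have pos: "M > 0" "N > 0" "S > 0" "e > 0" "L > 0" "K > 0" "\<rho> > 0" "k > 0" using M N S1 assms K by auto
  have gL: "g * L \<le> e * L" "0 < g * L" using assms pos by auto
  have z0: "z > 0" unfolding z_def using pos zero_less_power[OF gL(2), of 2] by (intro divide_pos_pos mult_pos_pos) auto
  have zlow: "\<rho> / (14641/10000) \<le> z"
  proof -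
    have "g * L \<le> 11/10 * N" using gL(1) assms(7) by (rule order_trans)
    hence "(g * L)\<^sup>2 \<le> (11/10 * N)\<^sup>2" using gL(2) by (intro power_mono) linarith+
    also have "\<dots> = 121/100 * N\<^sup>2" by (simp add: power2_eq_square)
    finally have "121/100 * (g * L)\<^sup>2 \<le> 14641/10000 * N\<^sup>2" by linarith
    also have "\<dots> \<le> 14641/10000 * (S * M)" using S1(2) by simp
    finally have "121/100 * (g * L)\<^sup>2 \<le> 14641/10000 * (S * M)" .
    hence "\<rho> * (121/100 * (g * L)\<^sup>2) \<le> \<rho> * (14641/10000 * (S * M))" using pos by (intro mult_left_mono) auto
    hence "\<rho> / (14641/10000) * (121/100 * (g * L)\<^sup>2) \<le> M * S * \<rho>" by (simp add: mult_ac)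
    moreover have "0 < 121/100 * (g * L)\<^sup>2" using zero_less_power[OF gL(2), of 2] by simp
    ultimately show ?thesis unfolding z_def by (simp only: pos_le_divide_eq)
  qed
  define E where "E = exp (- (pi * (M * k\<^sup>2 / g\<^sup>2)\<^sup>2 * (S * \<rho> * (1 / (11/10 * L)) * (1 / (11/10 * L)))\<^sup>2 / 5))"
  have Ez: "E = exp (- (pi / 5 * (z * k\<^sup>2)\<^sup>2))"
    unfolding E_def z_def using pos assms(3) by (simp add: field_simps power2_eq_square)
  define w where "w = 1 / sqrt z"
  have w0: "w > 0" using z0 by (simp add: w_def)
  have ww: "w * w = 1 / z" using z0 by (simp add: w_def)
  have iz: "1 / z \<le> (14641/10000) / \<rho>"
    using divide_left_mono[OF zlow, of 1] z0 pos by simp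
  have w1: "w \<le> 121/100"
  proof -
    have "w * w \<le> (14641/10000) / \<rho>" using ww iz by simp
    also have "\<dots> \<le> (121/100) * (121/100)" using assms(1) by (simp add: field_simps)
    finally have "w\<^sup>2 \<le> (121/100)\<^sup>2" by (simp add: power2_eq_square)
    thus ?thesis by (rule power2_le_imp_le) simp
  qed
  have E1: "E \<le> 190 * w\<^sup>2 / \<rho> ^ 5 / k\<^sup>2"
  proof -
    have "pi / 5 * (z * k\<^sup>2)\<^sup>2 \<ge> 3/5 * (z * k\<^sup>2)\<^sup>2" using pi_gt3 by (intro mult_right_mono) auto
    hence "E \<le> exp (- (3/5 * (z * k\<^sup>2)\<^sup>2))" unfolding Ez by simp
    also have "\<dots> \<le> 6 / (3/5 * (z * k\<^sup>2)\<^sup>2) ^ 3" using z0 pos by (intro exp_minus_cube_le) simp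
    also have "\<dots> = 250/9 * (1 / z) ^ 6 / k ^ 12"
      using z0 pos by (simp add: field_simps eval_nat_numeral)
    also have "\<dots> \<le> 28 * (1 / z) ^ 6 / k\<^sup>2"
    proof -
      have "k ^ 2 \<le> k ^ 12" using assms(2) by (intro power_increasing) auto
      thus ?thesis using z0 pos by (intro frac_le mult_right_mono) auto
    qed
    \<comment> \<open>One power of \<open>1 / z\<close> is kept as \<open>w\<^sup>2\<close>, the
      other five give \<open>\<rho> ^ 5\<close> in the denominator. Up to three of these absorb the
      growth of the hypothesis, since \<open>\<eta> + \<xi> \<le> 3\<close>, and the decay
      \<open>1 / \<rho>\<^sup>2\<close> remains.\<close>
    also have "(1 / z) ^ 6 = (1 / z) * (1 / z) ^ 5" by (simp add: eval_nat_numeral)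
    also have "28 * ((1 / z) * (1 / z) ^ 5) / k\<^sup>2 \<le> 28 * (w\<^sup>2 * ((14641/10000) / \<rho>) ^ 5) / k\<^sup>2"
      using iz z0 ww pos by (intro divide_right_mono mult_left_mono mult_mono power_mono) (auto simp: power2_eq_square)
    also have "\<dots> \<le> 190 * w\<^sup>2 / \<rho> ^ 5 / k\<^sup>2"
    proof -
      have "28 * (14641/10000 :: real) ^ 5 \<le> 190" by (simp add: eval_nat_numeral)
      hence "28 * (14641/10000) ^ 5 * (w\<^sup>2 / \<rho> ^ 5 / k\<^sup>2) \<le> 190 * (w\<^sup>2 / \<rho> ^ 5 / k\<^sup>2)"
        using pos by (intro mult_right_mono) auto
      thus ?thesis by (simp add: power_divide mult_ac)
    qed
    finally show ?thesis .
  qed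
  have "w\<^sup>2 \<le> (121/100)\<^sup>2" using w0 w1 by (intro power_mono) auto
  hence w2: "w\<^sup>2 \<le> 15/10" by (simp add: power2_eq_square)
  have E2: "E \<le> 285 / \<rho> ^ 5 / k\<^sup>2"
    by (rule order_trans[OF E1]) (intro divide_right_mono, use w2 pos in auto)
  \<comment> \<open>A single \<open>w = 1 / sqrt z\<close> is retained here: it turns the factor
    \<open>M / (e * L)\<close> into \<open>sqrt (M / S)\<close>.\<close>
  have E3: "E \<le> 230 * w / \<rho> ^ 5 / k\<^sup>2"
  proof (rule order_trans[OF E1], intro divide_right_mono)
    have "w * w \<le> 121/100 * w" using w0 w1 by (intro mult_right_mono) auto
    thus "190 * w\<^sup>2 \<le> 230 * w" using w0 by (simp add: power2_eq_square)
  qed (use pos in auto)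
  have E0: "E \<ge> 0" by (simp add: E_def)
  define Y where "Y = 11/10 * (S * \<rho>)"
  have Y0: "Y > 0" using pos by (simp add: Y_def)
  have powY: "Y powr \<theta> \<le> (11/10 * \<rho>) ^ n * S powr \<theta>" if "0 \<le> \<theta>" "\<theta> \<le> real n" for \<theta> n
  proof -
    have "Y powr \<theta> = (11/10 * \<rho>) powr \<theta> * S powr \<theta>" unfolding Y_def using pos by (simp add: powr_mult[symmetric] mult_ac)
    also have "(11/10 * \<rho>) powr \<theta> \<le> (11/10 * \<rho>) powr real n" using assms(1) that by (intro powr_mono) auto
    also have "\<dots> = (11/10 * \<rho>) ^ n" using pos by (intro powr_realpow) simp
    finally show ?thesis by (simp add: mult_right_mono)
  qed
  have p1: "M / (e * L) * (K * Y powr \<eta> * L) * E \<le> 314 * K * (S powr \<eta> * M) / \<rho>\<^sup>2 / k\<^sup>2"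
  proof -
    have "M / (e * L) * (K * Y powr \<eta> * L) = (M / e) * K * Y powr \<eta>" using pos by simp
    also have "\<dots> \<le> (M / 1) * K * ((11/10 * \<rho>) ^ 1 * S powr \<eta>)"
    proof (rule mult_mono)
      show "M / e * K \<le> M / 1 * K" using assms(5) pos by (intro mult_right_mono divide_left_mono) auto
      show "Y powr \<eta> \<le> (11/10 * \<rho>) ^ 1 * S powr \<eta>" by (rule powY) (use \<eta> in auto)
    qed (use pos in auto)
    finally have "M / (e * L) * (K * Y powr \<eta> * L) * E \<le> ((M / 1) * K * ((11/10 * \<rho>) ^ 1 * S powr \<eta>)) * (285 / \<rho> ^ 5 / k\<^sup>2)"
      by (rule mult_mono) (use E2 E0 pos in auto)
    also have "\<dots> = (3135/10) * K * (S powr \<eta> * M) / \<rho> ^ 4 / k\<^sup>2" using pos by (simp add: field_simps eval_nat_numeral)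
    also have "\<dots> \<le> 314 * K * (S powr \<eta> * M) / \<rho>\<^sup>2 / k\<^sup>2"
    proof -
      have "\<rho> ^ 2 \<le> \<rho> ^ 4" using assms(1) by (intro power_increasing) auto
      thus ?thesis using pos by (intro divide_right_mono frac_le mult_right_mono) auto
    qed
    finally show ?thesis .
  qed
  have p2: "M / (e * L) * (K * Y powr \<eta> * Y powr \<xi>) * E \<le> 340 * K * (S powr \<eta> * (sqrt (M / S) * S powr \<xi>)) / \<rho>\<^sup>2 / k\<^sup>2"
  proof -
    have "M / (e * L) * w \<le> 11/10 * sqrt (M / S)"
    proof -
      have "z = (M * S * \<rho>) / (11/10 * (g * L))\<^sup>2" unfolding z_def by (simp add: power2_eq_square)
      hence "sqrt z = sqrt (M * S * \<rho>) / (11/10 * (g * L))"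
        using gL(2) by (simp only: real_sqrt_divide real_sqrt_abs)
      hence "M / (e * L) * w = (g / e) * (11/10 * (M / sqrt (M * S * \<rho>)))" using pos unfolding w_def by (simp add: mult_ac)
      also have "\<dots> \<le> 1 * (11/10 * (M / sqrt (M * S * \<rho>)))" using assms pos by (intro mult_right_mono) auto
      also have "M / sqrt (M * S * \<rho>) \<le> sqrt (M / S)"
      proof -
        have "sqrt (M * S) \<le> sqrt (M * S * \<rho>)" using pos assms(1) by simp
        hence "M / sqrt (M * S * \<rho>) \<le> M / sqrt (M * S)" using pos by (intro divide_left_mono) auto
        also have "M / sqrt (M * S) = sqrt (M / S)"
          using pos by (simp add: real_sqrt_mult real_sqrt_divide real_div_sqrt field_simps)
        finally show ?thesis .
      qed
      finally show ?thesis by simp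
    qed
    moreover have "K * Y powr \<eta> * Y powr \<xi> \<le> K * ((11/10 * \<rho>) ^ 3 * (S powr \<eta> * S powr \<xi>))"
    proof -
      have "Y powr (\<eta> + \<xi>) \<le> (11/10 * \<rho>) ^ 3 * S powr (\<eta> + \<xi>)" by (rule powY) (use \<eta> \<xi> in auto)
      thus ?thesis using pos by (simp add: powr_add mult.assoc)
    qed
    ultimately have "(M / (e * L) * w) * (K * Y powr \<eta> * Y powr \<xi>) \<le> (11/10 * sqrt (M / S)) * (K * ((11/10 * \<rho>) ^ 3 * (S powr \<eta> * S powr \<xi>)))"
      by (rule mult_mono) (use pos in auto)
    hence "(M / (e * L) * w) * (K * Y powr \<eta> * Y powr \<xi>) * (230 / \<rho> ^ 5 / k\<^sup>2) \<le>
      (11/10 * sqrt (M / S)) * (K * ((11/10 * \<rho>) ^ 3 * (S powr \<eta> * S powr \<xi>))) * (230 / \<rho> ^ 5 / k\<^sup>2)"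
      using pos by (intro mult_right_mono) auto
    also have "\<dots> = (230 * (11/10) ^ 4) * K * (S powr \<eta> * (sqrt (M / S) * S powr \<xi>)) / \<rho>\<^sup>2 / k\<^sup>2"
      using pos by (simp add: field_simps eval_nat_numeral)
    also have "\<dots> \<le> 340 * K * (S powr \<eta> * (sqrt (M / S) * S powr \<xi>)) / \<rho>\<^sup>2 / k\<^sup>2"
      using pos by (intro divide_right_mono mult_right_mono) (auto simp: eval_nat_numeral)
    finally have "(M / (e * L) * w) * (K * Y powr \<eta> * Y powr \<xi>) * (230 / \<rho> ^ 5 / k\<^sup>2) \<le> 340 * K * (S powr \<eta> * (sqrt (M / S) * S powr \<xi>)) / \<rho>\<^sup>2 / k\<^sup>2" .
    moreover have "M / (e * L) * (K * Y powr \<eta> * Y powr \<xi>) * E \<le> M / (e * L) * (K * Y powr \<eta> * Y powr \<xi>) * (230 * w / \<rho> ^ 5 / k\<^sup>2)"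
      using E3 pos by (intro mult_left_mono) auto
    moreover have "M / (e * L) * (K * Y powr \<eta> * Y powr \<xi>) * (230 * w / \<rho> ^ 5 / k\<^sup>2) = (M / (e * L) * w) * (K * Y powr \<eta> * Y powr \<xi>) * (230 / \<rho> ^ 5 / k\<^sup>2)"
      by simp
    ultimately show ?thesis by linarith
  qed
  have "M / (e * L) * lam Y L * E = M / (e * L) * (K * Y powr \<eta> * L) * E + M / (e * L) * (K * Y powr \<eta> * Y powr \<xi>) * E"
    by (simp add: lam_def algebra_simps)
  also have "\<dots> \<le> 340 * K * (S powr \<eta> * M) / \<rho>\<^sup>2 / k\<^sup>2 + 340 * K * (S powr \<eta> * (sqrt (M / S) * S powr \<xi>)) / \<rho>\<^sup>2 / k\<^sup>2"
  proof (rule add_mono[OF order_trans[OF p1] p2])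
    show "314 * K * (S powr \<eta> * M) / \<rho>\<^sup>2 / k\<^sup>2 \<le> 340 * K * (S powr \<eta> * M) / \<rho>\<^sup>2 / k\<^sup>2"
      using pos by (intro divide_right_mono mult_right_mono) auto
  qed
  also have "\<dots> = 340 * K * Om / \<rho>\<^sup>2 / k\<^sup>2" by (simp add: Om_def om_def algebra_simps add_divide_distrib)
  finally show ?thesis by (simp add: Y_def E_def)
qed

text \<open>For the column term of \<open>lam\<close> the constant bound suffices, because
  \<open>L\<close> cancels. For the row term the decaying bound turns \<open>M / (e * L)\<close>
  into a multiple of \<open>sqrt (M / Y)\<close>, and \<open>sqrt (M / Y) * Y powr \<xi>\<close>
  increases with \<open>Y\<close>. The separate \<open>lam Y L\<close> stems from the original side
  of Poisson summation.\<close>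

lemma small_weight:
  assumes Y: "1 \<le> Y" "Y \<le> S" and "0 < g" "g \<le> e" "1 \<le> e" "1 \<le> L" "L \<le> N"
  shows "M / (e * L) * (min 1 (1 / sqrt (M / g\<^sup>2 * (10/11 * Y) * (1 / (11/10 * L))\<^sup>2)) * lam Y L) + lam Y L \<le> 3 * K * om * Y powr \<eta>"
proof -
  define z where "z = M / g\<^sup>2 * (10/11 * Y) * (1 / (11/10 * L))\<^sup>2"
  have pos: "M > 0" "S > 0" "e > 0" "L > 0" "K > 0" "Y > 0" using M S1 assms K by auto
  have sz: "sqrt z = sqrt (10/11 * (M * Y)) / (11/10 * (g * L))"
  proof -
    have "z = (10/11 * (M * Y)) / (11/10 * (g * L))\<^sup>2" unfolding z_def using pos assms(3) by (simp add: field_simps power2_eq_square)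
    thus ?thesis using pos assms(3) by (simp only: real_sqrt_divide real_sqrt_abs) simp
  qed
  have YS: "sqrt (M / Y) * Y powr \<xi> \<le> sqrt (M / S) * S powr \<xi>"
  proof -
    have e: "sqrt (M / u) * u powr \<xi> = sqrt M * u powr (\<xi> - 1/2)" if "u > 0" for u
      using that by (simp add: powr_diff powr_half_sqrt real_sqrt_divide)
    have "Y powr (\<xi> - 1/2) \<le> S powr (\<xi> - 1/2)" using assms \<xi> by (intro powr_mono2) auto
    thus ?thesis using e[of Y] e[of S] pos by (simp add: mult_left_mono)
  qed
  have a: "M / (e * L) * (min 1 (1 / sqrt z) * (K * Y powr \<eta> * L)) \<le> K * Y powr \<eta> * M"
  proof -
    have "M / (e * L) * (min 1 (1 / sqrt z) * (K * Y powr \<eta> * L)) \<le> M / (1 * L) * (1 * (K * Y powr \<eta> * L))"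
      using pos assms(5) by (intro mult_mono divide_left_mono) (auto simp: z_def)
    thus ?thesis using pos by (simp add: mult_ac)
  qed
  have b: "M / (e * L) * (min 1 (1 / sqrt z) * (K * Y powr \<eta> * Y powr \<xi>)) \<le> 2 * (K * Y powr \<eta> * (sqrt (M / S) * S powr \<xi>))"
  proof -
    have "M / (e * L) * (1 / sqrt z) \<le> 2 * sqrt (M / Y)"
    proof -
      have "M / (e * L) * (1 / sqrt z) = (g / e) * (11/10 * (M / sqrt (10/11 * (M * Y))))"
        unfolding sz using pos by (simp add: mult_ac)
      also have "\<dots> \<le> 1 * (11/10 * (M / sqrt (10/11 * (M * Y))))" using pos assms by (intro mult_right_mono) auto
      also have "M / sqrt (10/11 * (M * Y)) = sqrt (11/10) * sqrt (M / Y)"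
        using pos by (simp add: real_sqrt_mult real_sqrt_divide real_div_sqrt field_simps)
      also have "1 * (11/10 * (sqrt (11/10) * sqrt (M / Y))) \<le> 2 * sqrt (M / Y)"
      proof -
        have "sqrt (11/10) \<le> 11/10" by (rule real_le_lsqrt) (auto simp: power2_eq_square)
        hence "11/10 * sqrt (11/10) \<le> 2" by simp
        hence "(11/10 * sqrt (11/10)) * sqrt (M / Y) \<le> 2 * sqrt (M / Y)" by (intro mult_right_mono) (use pos in auto)
        thus ?thesis by simp
      qed
      finally show ?thesis .
    qed
    hence "M / (e * L) * (1 / sqrt z) * (K * Y powr \<eta> * Y powr \<xi>) \<le> 2 * sqrt (M / Y) * (K * Y powr \<eta> * Y powr \<xi>)"
      using pos by (intro mult_right_mono) auto
    also have "\<dots> = 2 * (K * Y powr \<eta> * (sqrt (M / Y) * Y powr \<xi>))" by simp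
    also have "\<dots> \<le> 2 * (K * Y powr \<eta> * (sqrt (M / S) * S powr \<xi>))" using YS pos by (intro mult_left_mono) auto
    finally have "M / (e * L) * (1 / sqrt z) * (K * Y powr \<eta> * Y powr \<xi>) \<le> 2 * (K * Y powr \<eta> * (sqrt (M / S) * S powr \<xi>))" .
    moreover have "M / (e * L) * (min 1 (1 / sqrt z) * (K * Y powr \<eta> * Y powr \<xi>)) \<le> M / (e * L) * ((1 / sqrt z) * (K * Y powr \<eta> * Y powr \<xi>))"
      using pos by (intro mult_left_mono mult_right_mono) auto
    ultimately show ?thesis by (simp add: mult.assoc)
  qed
  have c: "lam Y L \<le> K * Y powr \<eta> * (M + sqrt (M / S) * S powr \<xi>)"
  proof -
    have "1 \<le> M / S" using S1 pos by simp
    hence "1 * S powr \<xi> \<le> sqrt (M / S) * S powr \<xi>" by (intro mult_right_mono) auto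
    moreover have "Y powr \<xi> \<le> S powr \<xi>" using assms \<xi> by (intro powr_mono2) auto
    ultimately have "L + Y powr \<xi> \<le> M + sqrt (M / S) * S powr \<xi>" using assms MN by linarith
    thus ?thesis unfolding lam_def using pos by (intro mult_left_mono) auto
  qed
  have "M / (e * L) * (min 1 (1 / sqrt z) * lam Y L) = M / (e * L) * (min 1 (1 / sqrt z) * (K * Y powr \<eta> * L)) +
      M / (e * L) * (min 1 (1 / sqrt z) * (K * Y powr \<eta> * Y powr \<xi>))"
    by (simp add: lam_def algebra_simps)
  hence "M / (e * L) * (min 1 (1 / sqrt z) * lam Y L) + lam Y L \<le> K * Y powr \<eta> * M + 2 * (K * Y powr \<eta> * (sqrt (M / S) * S powr \<xi>)) +
     K * Y powr \<eta> * (M + sqrt (M / S) * S powr \<xi>)" using a b c by linarith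
  also have "\<dots> = 3 * K * om * Y powr \<eta> - K * Y powr \<eta> * M" by (simp add: om_def algebra_simps)
  also have "\<dots> \<le> 3 * K * om * Y powr \<eta>" using pos by simp
  finally show ?thesis by (simp add: z_def)
qed

end

section \<open>The dual sum\<close>

lemma pair_sum:
  fixes f :: "nat \<Rightarrow> nat \<Rightarrow> 'a::comm_monoid_add"
  assumes "finite C" "\<And>l. l \<in> C \<Longrightarrow> l > 0"
  shows "(\<Sum>l\<in>C. \<Sum>c | c dvd l. f c l) = (\<Sum>p\<in>{(c, l). l \<in> C \<and> c dvd l}. f (fst p) (snd p))"
    "finite {(c, l). l \<in> C \<and> c dvd l}"
proof -
  have "(\<Sum>l\<in>C. \<Sum>c | c dvd l. f c l) = (\<Sum>(l, c)\<in>(SIGMA l:C. {c. c dvd l}). f c l)"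
    by (rule sum.Sigma) (use assms in auto)
  also have "\<dots> = (\<Sum>p\<in>{(c, l). l \<in> C \<and> c dvd l}. f (fst p) (snd p))"
    by (rule sum.reindex_bij_witness[of _ prod.swap prod.swap]) auto
  finally show "(\<Sum>l\<in>C. \<Sum>c | c dvd l. f c l) = (\<Sum>p\<in>{(c, l). l \<in> C \<and> c dvd l}. f (fst p) (snd p))" .
  have "finite (SIGMA l:C. {c. c dvd l})" using assms by (intro finite_SigmaI) auto
  hence "finite (prod.swap ` (SIGMA l:C. {c. c dvd l}))" by (rule finite_imageI)
  moreover have "{(c, l). l \<in> C \<and> c dvd l} \<subseteq> prod.swap ` (SIGMA l:C. {c. c dvd l})" by (auto simp: image_iff)
  ultimately show "finite {(c, l). l \<in> C \<and> c dvd l}" by (rule rev_finite_subset)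
qed

context sieve_step
begin

lemma H_lam: assumes "Y \<ge> 1" "L \<ge> 1" shows "sieve_bd Y L (lam Y L)"
  unfolding lam_def by (rule H[OF assms])

definition "bigc e q s k = exp (- (pi * (M / (real e ^ 2 * real q) * real (s * (e div gcd e s * k)\<^sup>2))\<^sup>2)) * (jr s q * of_bool (coprime k q))"

text \<open>With \<open>gcd e s\<close> and \<open>k\<close> fixed, the dual Gaussian depends only
  on \<open>s / (l * l')\<close>, to which the block multiplier applies. The factor
  \<open>1 / sqrt (l * l')\<close> and the coprimality with \<open>k\<close> split between
  \<open>l\<close> and \<open>l'\<close> and go into \<open>\<gamma>\<close>.\<close>

lemma big_fibre:
  fixes \<alpha> :: "nat \<Rightarrow> complex"
  assumes e: "e > 0" "real e * L \<le> 11/10 * N" and L: "L \<ge> 1" and C: "finite C" "C \<subseteq> odd_block L" and k: "k > 0" and g: "g dvd e"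
    and X: "X \<subseteq> {s. squarefree s \<and> gcd e s = g \<and> S * \<rho> \<le> real s \<and> real s \<le> 11/10 * (S * \<rho>)}" and \<rho>: "\<rho> \<ge> 1"
  shows "cmod (\<Sum>s\<in>X. \<Sum>l\<in>C. \<Sum>l'\<in>C. \<alpha> l * cnj (\<alpha> l') * of_real (M / (real e * sqrt (real (l * l'))) * bigc e (l * l') s k))
    \<le> 340 * K * Om / \<rho>\<^sup>2 / (real k)\<^sup>2 * (\<Sum>l\<in>C. (cmod (\<alpha> l))\<^sup>2)"
proof -
  define \<gamma> where "\<gamma> = (\<lambda>p::nat\<times>nat. \<alpha> (snd p) * of_real (of_bool (coprime k (snd p)) / sqrt (real (snd p))))"
  \<comment> \<open>No divisor \<open>c\<close> occurs in this part; the dummy component 1 matches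
    the pair format of \<open>sieve_tri_bd\<close>.\<close>
  define P where "P = (\<lambda>l. (1::nat, l)) ` C"
  define \<kappa> where "\<kappa> = pi * (M * (real k)\<^sup>2 / (real g)\<^sup>2)\<^sup>2"
  have g0: "g > 0" using g e by (auto intro: dvd_pos_nat)
  have lpos: "l > 0" "L \<le> real l" "real l < 11/10 * L" if "l \<in> C" for l
    using that C L by (auto simp: odd_block_def intro!: Nat.gr0I)
  have SS: "S > 0" using S1 by simp
  have fX: "finite X"
  proof (rule finite_subset[OF _ finite_sqfree_upto[of "11/10 * (S * \<rho>)"]])
    show "X \<subseteq> sqfree_upto (11/10 * (S * \<rho>))" using X by (auto simp: sqfree_upto_def)
  qed
  have yb: "1 / (11/10 * L) \<le> 1 / real (snd p) \<and> 1 / real (snd p) \<le> 11/10 * (1 / (11/10 * L))" if "p \<in> P" for p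
  proof -
    obtain l where l: "l \<in> C" "p = (1, l)" using \<open>p \<in> P\<close> by (auto simp: P_def)
    have "1 / (11/10 * L) \<le> 1 / real l" using lpos[OF l(1)] L by (intro divide_left_mono) auto
    moreover have "1 / real l \<le> 1 / L" using lpos[OF l(1)] L by (intro divide_left_mono) auto
    ultimately show ?thesis using l by simp
  qed
  have fP: "finite P" using C by (simp add: P_def)
  have y0: "0 < 1 / (11/10 * L)" using L by simp
  have x0: "0 < S * \<rho>" using SS \<rho> by simp
  have xb: "S * \<rho> \<le> real s \<and> real s \<le> 11/10 * (S * \<rho>)" if "s \<in> X" for s using X that by auto
  interpret b: block X P P "\<lambda>s. real s" "\<lambda>p. 1 / real (snd p)" "\<lambda>p. 1 / real (snd p)" "S * \<rho>" "1 / (11/10 * L)" "1 / (11/10 * L)"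
    by unfold_locales (rule fX fP x0 y0 xb yb; assumption?)+
  define A where "A = (\<Sum>l\<in>C. (cmod (\<alpha> l))\<^sup>2)"
  have A0: "A \<ge> 0" by (simp add: A_def sum_nonneg)
  have Y1: "11/10 * (S * \<rho>) \<ge> 1" using mult_mono[of 1 S 1 \<rho>] S1 \<rho> by simp
  have G: "(\<Sum>l\<in>odd_block L. (\<Sum>p\<in>{p \<in> P. snd p = l}. cmod (\<gamma> p))\<^sup>2) \<le> A / L"
  proof -
    have "(\<Sum>l\<in>odd_block L. (\<Sum>p\<in>{p \<in> P. snd p = l}. cmod (\<gamma> p))\<^sup>2) = (\<Sum>l\<in>C. (\<Sum>p\<in>{p \<in> P. snd p = l}. cmod (\<gamma> p))\<^sup>2)"
    proof (rule sum.mono_neutral_right[OF finite_odd_block C(2)], rule ballI)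
      fix l assume "l \<in> odd_block L - C"
      hence "{p \<in> P. snd p = l} = {}" by (auto simp: P_def)
      thus "(\<Sum>p\<in>{p \<in> P. snd p = l}. cmod (\<gamma> p))\<^sup>2 = 0" by (simp only: sum.empty) simp
    qed
    also have "\<dots> \<le> (\<Sum>l\<in>C. (cmod (\<alpha> l))\<^sup>2 / L)"
    proof (rule sum_mono)
      fix l assume l: "l \<in> C"
      have "{p \<in> P. snd p = l} = {(1, l)}" using l by (auto simp: P_def)
      hence "(\<Sum>p\<in>{p \<in> P. snd p = l}. cmod (\<gamma> p))\<^sup>2 = (cmod (\<gamma> (1, l)))\<^sup>2" by simp
      also have "\<dots> = (cmod (\<alpha> l))\<^sup>2 * (of_bool (coprime k l) / sqrt (real l))\<^sup>2"
        unfolding \<gamma>_def by (simp only: norm_mult norm_of_real snd_conv power_mult_distrib power2_abs)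
      also have "\<dots> \<le> (cmod (\<alpha> l))\<^sup>2 * (1 / L)"
      proof (rule mult_left_mono)
        have "(of_bool (coprime k l) / sqrt (real l))\<^sup>2 \<le> (1 :: real) / real l" by (simp add: power_divide)
        also have "\<dots> \<le> 1 / L" using lpos[OF l] L by (intro divide_left_mono) auto
        finally show "(of_bool (coprime k l) / sqrt (real l))\<^sup>2 \<le> 1 / L" .
      qed simp
      finally show "(\<Sum>p\<in>{p \<in> P. snd p = l}. cmod (\<gamma> p))\<^sup>2 \<le> (cmod (\<alpha> l))\<^sup>2 / L" by simp
    qed
    also have "\<dots> = A / L" by (simp add: A_def sum_divide_distrib)
    finally show ?thesis .
  qed
  have T: "tri_bd X P P (\<lambda>s p r. \<gamma> p * cnj (\<gamma> r) * of_real (jr s (snd p) * jr s (snd r))) (lam (11/10 * (S * \<rho>)) L * (A / L))"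
  proof (rule sieve_tri_bd[OF H_lam[OF Y1 L] _ _ _ _ _ _ G])
    show "0 \<le> lam (11/10 * (S * \<rho>)) L" using Y1 L by (intro lam_nonneg) auto
    show "finite P" using C by (simp add: P_def)
    show "snd p \<in> odd_block L" if "p \<in> P" for p using that C by (auto simp: P_def)
    show "X \<subseteq> sqfree_upto (11/10 * (S * \<rho>))" using X by (auto simp: sqfree_upto_def)
  qed auto
  have "\<kappa> \<ge> 0" by (simp add: \<kappa>_def)
  from multiplier_sieve[OF b.mult_gauss[OF this] T]
  have bd: "cmod (\<Sum>s\<in>X. \<Sum>p\<in>P. \<Sum>r\<in>P. \<gamma> p * cnj (\<gamma> r) * of_real (jr s (snd p) * jr s (snd r)) * of_real (exp (- (\<kappa> * (b.t s p r)\<^sup>2))))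
    \<le> exp (- (\<kappa> * b.t0\<^sup>2 / 5)) * (lam (11/10 * (S * \<rho>)) L * (A / L))" .
  have term_eq: "\<alpha> l * cnj (\<alpha> l') * of_real (M / (real e * sqrt (real (l * l'))) * bigc e (l * l') s k) =
     of_real (M / real e) * (\<gamma> (1, l) * cnj (\<gamma> (1, l')) * of_real (jr s l * jr s l') * of_real (exp (- (\<kappa> * (b.t s (1, l) (1, l'))\<^sup>2))))"
    if "s \<in> X" "l \<in> C" "l' \<in> C" for s l l'
  proof -
    have gs: "gcd e s = g" using X that by auto
    have eg: "real (e div g) = real e / real g" using g g0 by (simp add: real_of_nat_div)
    have "M / (real e ^ 2 * real (l * l')) * real (s * (e div g * k)\<^sup>2) = M * (real k)\<^sup>2 / (real g)\<^sup>2 * (real s / (real l * real l'))"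
      using e g0 by (simp add: eg power2_eq_square mult_ac)
    hence E: "pi * (M / (real e ^ 2 * real (l * l')) * real (s * (e div g * k)\<^sup>2))\<^sup>2 = \<kappa> * (b.t s (1, l) (1, l'))\<^sup>2"
      unfolding \<kappa>_def b.t_def by (simp add: power_mult_distrib power_divide mult_ac)
    have j: "jr s (l * l') = jr s l * jr s l'" by (rule jr_mult_bottom) (use that lpos in auto)
    have c: "of_bool (coprime k (l * l')) = of_bool (coprime k l) * (of_bool (coprime k l') :: real)" by simp
    show ?thesis unfolding bigc_def gs E j c \<gamma>_def
      by (simp add: real_sqrt_mult field_simps)
  qed
  have "(\<Sum>s\<in>X. \<Sum>l\<in>C. \<Sum>l'\<in>C. \<alpha> l * cnj (\<alpha> l') * of_real (M / (real e * sqrt (real (l * l'))) * bigc e (l * l') s k)) =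
    of_real (M / real e) * (\<Sum>s\<in>X. \<Sum>p\<in>P. \<Sum>r\<in>P. \<gamma> p * cnj (\<gamma> r) * of_real (jr s (snd p) * jr s (snd r)) * of_real (exp (- (\<kappa> * (b.t s p r)\<^sup>2))))"
  proof -
    have inj: "inj_on (\<lambda>l. (1::nat, l)) C" by (simp add: inj_on_def)
    show ?thesis unfolding sum_distrib_left P_def sum.reindex[OF inj] o_def
      by (intro sum.cong refl) (simp only: term_eq snd_conv)
  qed
  hence "cmod (\<Sum>s\<in>X. \<Sum>l\<in>C. \<Sum>l'\<in>C. \<alpha> l * cnj (\<alpha> l') * of_real (M / (real e * sqrt (real (l * l'))) * bigc e (l * l') s k)) \<le>
    M / real e * (exp (- (\<kappa> * b.t0\<^sup>2 / 5)) * (lam (11/10 * (S * \<rho>)) L * (A / L)))"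
    using mult_left_mono[OF bd, of "M / real e"] M by (simp add: norm_mult norm_divide)
  also have "\<dots> = M / (real e * L) * lam (11/10 * (S * \<rho>)) L * exp (- (\<kappa> * b.t0\<^sup>2 / 5)) * A" by simp
  also have "\<dots> \<le> 340 * K * Om / \<rho>\<^sup>2 / (real k)\<^sup>2 * A"
  proof (rule mult_right_mono[OF _ A0])
    show "M / (real e * L) * lam (11/10 * (S * \<rho>)) L * exp (- (\<kappa> * b.t0\<^sup>2 / 5)) \<le> 340 * K * Om / \<rho>\<^sup>2 / (real k)\<^sup>2"
      unfolding \<kappa>_def b.t0_def
      by (rule big_weight) (use \<rho> k e L g0 dvd_imp_le[OF g] in auto)
  qed
  finally show ?thesis by (simp add: A_def)
qed

text \<open>The weight sees \<open>s\<close> through \<open>gcd e s\<close>, which takes at most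
  \<open>\<tau>\<close> values, and through its size. The bounds for successive blocks above
  \<open>S\<close> decay with ratio 100/121 and sum to at most 6 times the first;
  \<open>2040 = 340 * 6\<close>.\<close>

lemma big_rect:
  fixes \<alpha> :: "nat \<Rightarrow> complex"
  assumes e: "squarefree e" "real e * L \<le> 11/10 * N" and L: "L \<ge> 1" and C: "finite C" "C \<subseteq> odd_block L" and k: "k > 0"
    and X: "finite X" "\<And>s. s \<in> X \<Longrightarrow> squarefree s \<and> S \<le> real s"
  shows "cmod (\<Sum>s\<in>X. \<Sum>l\<in>C. \<Sum>l'\<in>C. \<alpha> l * cnj (\<alpha> l') * of_real (M / (real e * sqrt (real (l * l'))) * bigc e (l * l') s k))
    \<le> 2040 * \<tau> * K * Om / (real k)\<^sup>2 * (\<Sum>l\<in>C. (cmod (\<alpha> l))\<^sup>2)" (is "cmod (\<Sum>s\<in>X. ?f s) \<le> _")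
proof -
  define A where "A = (\<Sum>l\<in>C. (cmod (\<alpha> l))\<^sup>2)"
  have A0: "A \<ge> 0" by (simp add: A_def sum_nonneg)
  have e0: "e > 0" using e by (cases "e = 0") auto
  have SS: "S > 0" using S1 by simp
  have tau: "real (card {d. d dvd e}) \<le> \<tau>"
  proof -
    have "real e * 1 \<le> real e * L" using L by (intro mult_left_mono) auto
    hence "real (tau e) \<le> \<tau>" using e by (intro \<tau>) auto
    thus ?thesis by (simp add: tau_def)
  qed
  \<comment> \<open>An upper limit for the block indices of the finite set \<open>X\<close>; the
    resulting bound does not depend on it.\<close>
  define J where "J = Suc (Max (insert 0 ((\<lambda>s. blk (real s / S)) ` X)))"
  have J: "blk (real s / S) < J" if "s \<in> X" for s
    unfolding J_def using X(1) that by (auto simp: less_Suc_eq_le intro!: Max_ge)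
  have "cmod (\<Sum>s\<in>X. ?f s) \<le> (\<Sum>i\<in>{d. d dvd e} \<times> {..<J}. cmod (\<Sum>s\<in>{s \<in> X. (gcd e s, blk (real s / S)) = i}. ?f s))"
    by (rule norm_sum_group) (use X(1) e0 J in auto)
  also have "\<dots> \<le> (\<Sum>i\<in>{d. d dvd e} \<times> {..<J}. 340 * K * Om / (real k)\<^sup>2 * A * (100/121) ^ snd i)"
  proof (rule sum_mono)
    fix i assume i: "i \<in> {d. d dvd e} \<times> {..<J}"
    obtain d j where dj: "i = (d, j)" by (cases i)
    have d: "(d, j) \<in> {d. d dvd e} \<times> {..<J}" using i dj by simp
    have "cmod (\<Sum>s\<in>{s \<in> X. (gcd e s, blk (real s / S)) = (d, j)}. ?f s) \<le> 340 * K * Om / ((11/10) ^ j)\<^sup>2 / (real k)\<^sup>2 * (\<Sum>l\<in>C. (cmod (\<alpha> l))\<^sup>2)"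
    proof (rule big_fibre[OF e0 e(2) L C k])
      show "d dvd e" using d by simp
      show "{s \<in> X. (gcd e s, blk (real s / S)) = (d, j)} \<subseteq> {s. squarefree s \<and> gcd e s = d \<and> S * (11/10) ^ j \<le> real s \<and> real s \<le> 11/10 * (S * (11/10) ^ j)}"
      proof safe
        fix s assume s: "s \<in> X" and j: "j = blk (real s / S)"
        have "1 \<le> real s / S" using X(2)[OF s] SS by simp
        from blk[OF this] SS show "S * (11/10) ^ blk (real s / S) \<le> real s" "real s \<le> 11/10 * (S * (11/10) ^ blk (real s / S))"
          by (simp_all add: field_simps)
        show "squarefree s" using X(2)[OF s] by simp
      qed
    qed simp
    also have "\<dots> = 340 * K * Om / (real k)\<^sup>2 * A * (100/121) ^ j"
    proof -
      have "(((11/10) ^ j)\<^sup>2 :: real) = (121/100) ^ j" by (simp add: power2_eq_square power_mult_distrib[symmetric])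
      thus ?thesis by (simp add: A_def power_divide mult_ac)
    qed
    finally show "cmod (\<Sum>s\<in>{s \<in> X. (gcd e s, blk (real s / S)) = i}. ?f s) \<le> 340 * K * Om / (real k)\<^sup>2 * A * (100/121) ^ snd i"
      unfolding dj by (simp only: snd_conv)
  qed
  also have "\<dots> = 340 * K * Om / (real k)\<^sup>2 * A * (real (card {d. d dvd e}) * (\<Sum>j<J. (100/121) ^ j))"
  proof -
    have "(\<Sum>i\<in>{d. d dvd e} \<times> {..<J}. c * (100/121) ^ snd i) = (\<Sum>d\<in>{d. d dvd e}. \<Sum>j<J. c * (100/121) ^ j)" for c :: real
      unfolding sum.cartesian_product by (simp add: split_beta)
    also have "(\<Sum>d\<in>{d. d dvd e}. \<Sum>j<J. c * (100/121) ^ j) = c * (real (card {d. d dvd e}) * (\<Sum>j<J. (100/121) ^ j))" for c :: real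
      by (simp add: sum_distrib_left mult_ac)
    finally show ?thesis .
  qed
  also have "\<dots> \<le> 340 * K * Om / (real k)\<^sup>2 * A * (\<tau> * 6)"
  proof (intro mult_left_mono mult_mono tau)
    have "(\<Sum>j<J. (100/121 :: real) ^ j) = (1 - (100/121) ^ J) / (1 - 100/121)" by (simp add: sum_gp_strict)
    also have "\<dots> \<le> 1 / (1 - 100/121)" by (intro divide_right_mono) auto
    finally show "(\<Sum>j<J. (100/121 :: real) ^ j) \<le> 6" by simp
  qed (use A0 K Om_nonneg tau1 in \<open>auto intro!: sum_nonneg\<close>)
  finally show ?thesis by (simp add: A_def mult_ac)
qed

lemma sum_inverse_squares_le: "(\<Sum>k=1..n. 1 / (real k)\<^sup>2) \<le> 2"
proof -
  have "(\<Sum>k=1..n. 1 / (real k)\<^sup>2) \<le> 2 - 1 / real n"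
  proof (induction n)
    case (Suc n)
    show ?case
    proof (cases "n = 0")
      case False
      have "1 / (real (Suc n))\<^sup>2 \<le> 1 / (real n * real (Suc n))"
        unfolding power2_eq_square using False by (intro divide_left_mono mult_right_mono) auto
      also have "\<dots> = 1 / real n - 1 / real (Suc n)" using False by (simp add: field_simps)
      finally show ?thesis using Suc by simp
    qed simp
  qed simp
  thus ?thesis using order_trans[of _ "2 - 1 / real n" 2] by simp
qed

text \<open>On a rectangle the sum over \<open>k\<close> can be taken outside, so that
  \<open>big_rect\<close> applies to each \<open>k\<close>.\<close>

lemma rect_cover:
  assumes "finite F" "F \<subseteq> {(s, k) \<in> sq_pairs. S < real s}"
  obtains X m where "finite X" "F \<subseteq> X \<times> {1..m::nat}" "X \<times> {1..m} \<subseteq> {(s, k) \<in> sq_pairs. S < real s}"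
proof
  define X where "X = fst ` F"
  define m where "m = Max (insert 0 (snd ` F))"
  show "finite X" using assms by (simp add: X_def)
  show "F \<subseteq> X \<times> {1..m}"
  proof
    fix x assume x: "x \<in> F"
    have "snd x \<le> m" unfolding m_def using assms(1) x by (intro Max_ge) auto
    moreover have "snd x \<ge> 1" using x assms(2) by (auto simp: sq_pairs_def)
    ultimately show "x \<in> X \<times> {1..m}" using x by (cases x) (auto simp: X_def image_iff intro: bexI[of _ x])
  qed
  show "X \<times> {1..m} \<subseteq> {(s, k) \<in> sq_pairs. S < real s}" using assms(2) by (auto simp: X_def sq_pairs_def)
qed

lemma big_bound:
  fixes \<alpha> :: "nat \<Rightarrow> complex"
  assumes e: "squarefree e" "real e * L \<le> 11/10 * N" and L: "L \<ge> 1" and C: "finite C" "C \<subseteq> odd_block L" "\<And>l. l \<in> C \<Longrightarrow> coprime e l"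
  shows "cmod (\<Sum>l\<in>C. \<Sum>l'\<in>C. \<alpha> l * cnj (\<alpha> l') * of_real (M / (real e * sqrt (real (l * l'))) *
       infsum (\<lambda>(s, k). bigc e (l * l') s k) {(s, k) \<in> sq_pairs. S < real s}))
    \<le> 4080 * \<tau> * K * Om * (\<Sum>l\<in>C. (cmod (\<alpha> l))\<^sup>2)"
proof -
  let ?Z = "{(s, k) \<in> sq_pairs. S < real s}"
  define A where "A = (\<Sum>l\<in>C. (cmod (\<alpha> l))\<^sup>2)"
  have A0: "A \<ge> 0" by (simp add: A_def sum_nonneg)
  have e0: "e > 0" using e by (cases "e = 0") auto
  define f where "f x = (\<Sum>l\<in>C. \<Sum>l'\<in>C. \<alpha> l * cnj (\<alpha> l') * of_real (M / (real e * sqrt (real (l * l'))) * bigc e (l * l') (fst x) (snd x)))" for x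
  have hs: "(f has_sum (\<Sum>l\<in>C. \<Sum>l'\<in>C. \<alpha> l * cnj (\<alpha> l') * of_real (M / (real e * sqrt (real (l * l'))) *
       infsum (\<lambda>(s, k). bigc e (l * l') s k) ?Z))) ?Z"
    unfolding f_def
  proof (intro has_sum_finite_sum C(1))
    fix l l' assume l: "l \<in> C" "l' \<in> C"
    have o: "odd (l * l')" "coprime e (l * l')" "l * l' > 0" using l C by (auto simp: odd_block_def intro!: Nat.gr0I)
    have b: "M / (real e ^ 2 * real (l * l')) > 0" using M e0 o(3) by (intro divide_pos_pos mult_pos_pos) auto
    have "(\<lambda>(s, k). bigc e (l * l') s k) summable_on ?Z"
      by (rule summable_on_subset_banach[OF class_sum(1)[OF e(1) o(1,2) b, folded bigc_def]]) auto
    hence "((\<lambda>(s, k). bigc e (l * l') s k) has_sum infsum (\<lambda>(s, k). bigc e (l * l') s k) ?Z) ?Z" by (rule has_sum_infsum)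
    hence "((\<lambda>x. bigc e (l * l') (fst x) (snd x)) has_sum infsum (\<lambda>(s, k). bigc e (l * l') s k) ?Z) ?Z" by (simp add: split_beta')
    thus "((\<lambda>x. \<alpha> l * cnj (\<alpha> l') * of_real (M / (real e * sqrt (real (l * l'))) * bigc e (l * l') (fst x) (snd x))) has_sum
       \<alpha> l * cnj (\<alpha> l') * of_real (M / (real e * sqrt (real (l * l'))) * infsum (\<lambda>(s, k). bigc e (l * l') s k) ?Z)) ?Z"
      by (intro has_sum_cmult_right has_sum_of_real)
  qed
  have "cmod (infsum f ?Z) \<le> 4080 * \<tau> * K * Om * A"
  proof (rule norm_infsum_le)
    show "f summable_on ?Z" using hs by (rule has_sum_imp_summable)
    fix F assume F: "finite F" "F \<subseteq> ?Z"
    from rect_cover[OF this] obtain X m where X: "finite X" "F \<subseteq> X \<times> {1..m::nat}" "X \<times> {1..m} \<subseteq> ?Z" .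
    show "\<exists>F'. finite F' \<and> F \<subseteq> F' \<and> F' \<subseteq> ?Z \<and> cmod (sum f F') \<le> 4080 * \<tau> * K * Om * A"
    proof (intro exI conjI)
      show "finite (X \<times> {1..m})" "F \<subseteq> X \<times> {1..m}" "X \<times> {1..m} \<subseteq> ?Z" using X by auto
      have "sum f (X \<times> {1..m}) = (\<Sum>s\<in>X. \<Sum>k=1..m. f (s, k))" by (simp add: sum.cartesian_product)
      also have "\<dots> = (\<Sum>k=1..m. \<Sum>s\<in>X. f (s, k))" by (rule sum.swap)
      finally have "cmod (sum f (X \<times> {1..m})) \<le> (\<Sum>k=1..m. cmod (\<Sum>s\<in>X. f (s, k)))" by (simp only: norm_sum)
      also have "\<dots> \<le> (\<Sum>k=1..m. 2040 * \<tau> * K * Om / (real k)\<^sup>2 * A)"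
      proof (rule sum_mono)
        fix k assume k: "k \<in> {1..m}"
        have *: "squarefree s \<and> S \<le> real s" if "s \<in> X" for s
        proof -
          have "(s, k) \<in> ?Z" by (rule subsetD[OF X(3)]) (use that k in auto)
          thus ?thesis by (auto simp: sq_pairs_def)
        qed
        show "cmod (\<Sum>s\<in>X. f (s, k)) \<le> 2040 * \<tau> * K * Om / (real k)\<^sup>2 * A"
          unfolding f_def A_def fst_conv snd_conv by (rule big_rect[OF e L C(1,2) _ X(1) *]) (use k in auto)
      qed
      also have "\<dots> = 2040 * \<tau> * K * Om * A * (\<Sum>k=1..m. 1 / (real k)\<^sup>2)" by (simp add: sum_distrib_left mult_ac)
      also have "\<dots> \<le> 2040 * \<tau> * K * Om * A * 2"
        by (intro mult_left_mono sum_inverse_squares_le) (use A0 K Om_nonneg tau1 in auto)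
      finally show "cmod (sum f (X \<times> {1..m})) \<le> 4080 * \<tau> * K * Om * A" by simp
    qed
  qed
  thus ?thesis unfolding infsumI[OF hs] A_def .
qed

definition "smallc e l l' s c c' = mu c * mu c' *
   (M / (real e * sqrt (real (l * l'))) * qerr (M / (real e ^ 2 * real (l * l')) * real (s * (e div gcd e s)\<^sup>2) * (real (c * c'))\<^sup>2) -
        qerr (1 / M * real (s * (e div gcd e s)\<^sup>2) * (real (c * c'))\<^sup>2))"

text \<open>Once \<open>gcd e s\<close> is fixed, both arguments of \<open>qerr\<close> factor into
  a multiple of \<open>s\<close> and equal functions of the pairs \<open>(c, l)\<close> and
  \<open>(c', l')\<close>: \<open>c\<^sup>2 / l\<close> on the dual side, \<open>c\<^sup>2\<close>
  on the original side. Two applications of \<open>qerr_sum_bound\<close> follow.\<close>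

lemma small_fibre:
  fixes \<alpha> :: "nat \<Rightarrow> complex" and C :: "nat set"
  defines "PP \<equiv> {(c, l). l \<in> C \<and> c dvd l}"
  assumes e: "e > 0" "real e * L \<le> 11/10 * N" and L: "L \<ge> 1" "L \<le> N" and C: "finite C" "C \<subseteq> odd_block L" and g: "g dvd e"
    and X: "X \<subseteq> {s. squarefree s \<and> gcd e s = g \<and> 10/11 * Y \<le> real s \<and> real s \<le> Y}" and Y: "1 \<le> Y" "Y \<le> S"
  shows "cmod (\<Sum>s\<in>X. \<Sum>p\<in>PP. \<Sum>r\<in>PP. \<alpha> (snd p) * cnj (\<alpha> (snd r)) * of_real (jr s (snd p * snd r) * smallc e (snd p) (snd r) s (fst p) (fst r)))
    \<le> 30 * (real nb)\<^sup>2 * \<tau>\<^sup>2 * K * om * Y powr \<eta> * (\<Sum>l\<in>C. (cmod (\<alpha> l))\<^sup>2)"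
proof -
  define A where "A = (\<Sum>l\<in>C. (cmod (\<alpha> l))\<^sup>2)"
  have A0: "A \<ge> 0" by (simp add: A_def sum_nonneg)
  have g0: "g > 0" using g e by (auto intro: dvd_pos_nat)
  have lpos: "l > 0" "L \<le> real l" "real l < 11/10 * L" "squarefree l" if "l \<in> C" for l
    using that C L by (auto simp: odd_block_def intro!: Nat.gr0I)
  have fPP: "finite PP" unfolding PP_def by (rule pair_sum(2)[OF C(1)]) (use lpos in auto)
  have iter_const: "snd p \<in> odd_block L" "snd p \<in> C" "fst p dvd snd p" "fst p > 0" if "p \<in> PP" for p
  proof -
    show *: "snd p \<in> odd_block L" "snd p \<in> C" "fst p dvd snd p" using that C by (auto simp: PP_def)
    show "fst p > 0" by (rule dvd_pos_nat[OF lpos(1)[OF *(2)] *(3)])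
  qed
  have XR: "X \<subseteq> sqfree_upto Y" using X by (auto simp: sqfree_upto_def)
  have xb: "10/11 * Y \<le> real s \<and> real s \<le> 11/10 * (10/11 * Y)" if "s \<in> X" for s using X that by auto
  \<comment> \<open>\<open>\<gamma>\<close> serves the dual side and \<open>\<delta>\<close> the
    original one. The factor \<open>1 / sqrt l\<close> in \<open>\<gamma>\<close> yields the
    \<open>1 / L\<close> in \<open>G1\<close>.\<close>
  define \<gamma> where "\<gamma> p = \<alpha> (snd p) * of_real (mu (fst p) / sqrt (real (snd p)))" for p :: "nat \<times> nat"
  define \<delta> where "\<delta> p = \<alpha> (snd p) * of_real (mu (fst p))" for p :: "nat \<times> nat"
  have csq: "1 \<le> (real (fst p))\<^sup>2" "(real (fst p))\<^sup>2 \<le> (real (snd p))\<^sup>2" "(real (snd p))\<^sup>2 < (11/10) ^ nb" if p: "p \<in> PP" for p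
  proof -
    show "1 \<le> (real (fst p))\<^sup>2" using iter_const(4)[OF p] by (simp add: one_le_power)
    have "fst p \<le> snd p" using iter_const[OF p] lpos by (intro dvd_imp_le) auto
    thus "(real (fst p))\<^sup>2 \<le> (real (snd p))\<^sup>2" by (intro power_mono) auto
    have "real (snd p) \<le> 11/10 * N" using lpos[OF iter_const(2)[OF p]] L by linarith
    hence "(real (snd p))\<^sup>2 \<le> (11/10 * N)\<^sup>2" by (intro power_mono) auto
    also have "\<dots> = 121/100 * N\<^sup>2" by (simp add: power2_eq_square)
    finally show "(real (snd p))\<^sup>2 < (11/10) ^ nb" using nb by linarith
  qed
  have mu1: "\<bar>mu c\<bar> \<le> 1" for c by (simp add: abs_mu)
  have Gg: "(\<Sum>l\<in>odd_block L. (\<Sum>p\<in>{p \<in> PP. snd p = l}. cmod (f p))\<^sup>2) \<le> \<tau>\<^sup>2 * (D * A)"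
    if f: "\<And>p. p \<in> PP \<Longrightarrow> (cmod (f p))\<^sup>2 \<le> D * (cmod (\<alpha> (snd p)))\<^sup>2" and D: "D \<ge> 0" for f :: "nat \<times> nat \<Rightarrow> complex" and D
  proof -
    have "(\<Sum>l\<in>odd_block L. (\<Sum>p\<in>{p \<in> PP. snd p = l}. cmod (f p))\<^sup>2) = (\<Sum>l\<in>C. (\<Sum>p\<in>{p \<in> PP. snd p = l}. cmod (f p))\<^sup>2)"
    proof (rule sum.mono_neutral_right[OF finite_odd_block C(2)], rule ballI)
      fix l assume "l \<in> odd_block L - C"
      hence "{p \<in> PP. snd p = l} = {}" by (auto simp: PP_def)
      thus "(\<Sum>p\<in>{p \<in> PP. snd p = l}. cmod (f p))\<^sup>2 = 0" by (simp only: sum.empty) simp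
    qed
    also have "\<dots> \<le> (\<Sum>l\<in>C. \<tau>\<^sup>2 * (D * (cmod (\<alpha> l))\<^sup>2))"
    proof (rule sum_mono)
      fix l assume l: "l \<in> C"
      have eq: "{p \<in> PP. snd p = l} = (\<lambda>c. (c, l)) ` {c. c dvd l}" using l by (auto simp: PP_def)
      have "card {p \<in> PP. snd p = l} = tau l" unfolding eq tau_def by (rule card_image) (simp add: inj_on_def)
      hence cd: "real (card {p \<in> PP. snd p = l}) \<le> \<tau>" using \<tau>[of l] lpos[OF l] L by simp
      have b: "cmod (f p) \<le> sqrt (D * (cmod (\<alpha> l))\<^sup>2)" if "p \<in> {p \<in> PP. snd p = l}" for p
        by (rule real_le_rsqrt) (use f[of p] that in simp)
      have "(\<Sum>p\<in>{p \<in> PP. snd p = l}. cmod (f p)) \<le> real (card {p \<in> PP. snd p = l}) * sqrt (D * (cmod (\<alpha> l))\<^sup>2)"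
        by (rule sum_bounded_above) (rule b)
      also have "\<dots> \<le> \<tau> * sqrt (D * (cmod (\<alpha> l))\<^sup>2)" using cd D by (intro mult_right_mono) auto
      finally have "(\<Sum>p\<in>{p \<in> PP. snd p = l}. cmod (f p))\<^sup>2 \<le> (\<tau> * sqrt (D * (cmod (\<alpha> l))\<^sup>2))\<^sup>2"
        by (rule power_mono) (simp add: sum_nonneg)
      also have "\<dots> = \<tau>\<^sup>2 * (D * (cmod (\<alpha> l))\<^sup>2)" using D by (simp add: power_mult_distrib)
      finally show "(\<Sum>p\<in>{p \<in> PP. snd p = l}. cmod (f p))\<^sup>2 \<le> \<tau>\<^sup>2 * (D * (cmod (\<alpha> l))\<^sup>2)" .
    qed
    also have "\<dots> = \<tau>\<^sup>2 * (D * A)" by (simp add: A_def sum_distrib_left)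
    finally show ?thesis .
  qed
  have G1: "(\<Sum>l\<in>odd_block L. (\<Sum>p\<in>{p \<in> PP. snd p = l}. cmod (\<gamma> p))\<^sup>2) \<le> \<tau>\<^sup>2 * (1 / L * A)"
  proof (rule Gg)
    fix p assume p: "p \<in> PP"
    have "(cmod (\<gamma> p))\<^sup>2 = (cmod (\<alpha> (snd p)))\<^sup>2 * (mu (fst p) / sqrt (real (snd p)))\<^sup>2"
      unfolding \<gamma>_def by (simp only: norm_mult norm_of_real power_mult_distrib power2_abs)
    also have "\<dots> \<le> (cmod (\<alpha> (snd p)))\<^sup>2 * (1 / L)"
    proof (rule mult_left_mono)
      have "(mu (fst p))\<^sup>2 \<le> 1" using mu1 by (simp add: abs_square_le_1)
      hence "(mu (fst p) / sqrt (real (snd p)))\<^sup>2 \<le> 1 / real (snd p)" by (simp add: power_divide divide_right_mono)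
      also have "\<dots> \<le> 1 / L" using lpos[OF iter_const(2)[OF p]] L by (intro divide_left_mono) auto
      finally show "(mu (fst p) / sqrt (real (snd p)))\<^sup>2 \<le> 1 / L" .
    qed simp
    finally show "(cmod (\<gamma> p))\<^sup>2 \<le> 1 / L * (cmod (\<alpha> (snd p)))\<^sup>2" by simp
  qed (use L in simp)
  have G2: "(\<Sum>l\<in>odd_block L. (\<Sum>p\<in>{p \<in> PP. snd p = l}. cmod (\<delta> p))\<^sup>2) \<le> \<tau>\<^sup>2 * (1 * A)"
  proof (rule Gg)
    fix p assume p: "p \<in> PP"
    have "(mu (fst p))\<^sup>2 \<le> 1" using mu1 by (simp add: abs_square_le_1)
    hence "(cmod (\<alpha> (snd p)))\<^sup>2 * (mu (fst p))\<^sup>2 \<le> (cmod (\<alpha> (snd p)))\<^sup>2 * 1" by (intro mult_left_mono) auto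
    thus "(cmod (\<delta> p))\<^sup>2 \<le> 1 * (cmod (\<alpha> (snd p)))\<^sup>2"
      unfolding \<delta>_def by (simp only: norm_mult norm_of_real power_mult_distrib power2_abs mult_1 mult_1_right)
  qed simp
  define \<kappa> where "\<kappa> = M / (real g)\<^sup>2"
  define \<kappa>' where "\<kappa>' = (real e / real g)\<^sup>2 / M"
  have \<kappa>: "\<kappa> > 0" "\<kappa>' > 0" using M g0 e by (simp_all add: \<kappa>_def \<kappa>'_def)
  have lam0: "lam Y L \<ge> 0" using Y L by (intro lam_nonneg) auto
  define y where "y p = (real (fst p))\<^sup>2 / real (snd p)" for p :: "nat \<times> nat"
  have yb: "1 / (11/10 * L) \<le> y p \<and> y p < 1 / (11/10 * L) * (11/10) ^ nb" if p: "p \<in> PP" for p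
  proof
    note l = lpos[OF iter_const(2)[OF p]]
    have "1 / (11/10 * L) \<le> 1 / real (snd p)" using l L by (intro divide_left_mono) auto
    also have "\<dots> \<le> y p" unfolding y_def using csq(1)[OF p] l by (intro divide_right_mono) auto
    finally show "1 / (11/10 * L) \<le> y p" .
    have "y p \<le> (real (snd p))\<^sup>2 / real (snd p)" unfolding y_def using csq(2)[OF p] l by (intro divide_right_mono) auto
    also have "\<dots> = real (snd p)" using l by (simp add: power2_eq_square)
    also have "\<dots> \<le> 1 / (11/10 * L) * (11/10 * L)\<^sup>2" using l L by (simp add: power2_eq_square)
    also have "\<dots> < 1 / (11/10 * L) * (11/10) ^ nb"
    proof (rule mult_strict_left_mono)
      have "(11/10 * L)\<^sup>2 \<le> (11/10 * N)\<^sup>2" using L by (intro power_mono) auto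
      also have "\<dots> = 121/100 * N\<^sup>2" by (simp add: power2_eq_square)
      finally show "(11/10 * L)\<^sup>2 < (11/10) ^ nb" using nb by linarith
    qed (use L in simp)
    finally show "y p < 1 / (11/10 * L) * (11/10) ^ nb" .
  qed
  have cb: "1 \<le> (real (fst p))\<^sup>2 \<and> (real (fst p))\<^sup>2 < 1 * (11/10) ^ nb" if "p \<in> PP" for p
    using csq[OF that] by linarith
  have T1: "cmod (\<Sum>s\<in>X. \<Sum>p\<in>PP. \<Sum>r\<in>PP. \<gamma> p * cnj (\<gamma> r) * of_real (jr s (snd p) * jr s (snd r)) * of_real (qerr (\<kappa> * real s * y p * y r)))
    \<le> 10 * real nb ^ 2 * min 1 (1 / sqrt (\<kappa> * (10/11 * Y) * (1 / (11/10 * L))\<^sup>2)) * (lam Y L * (\<tau>\<^sup>2 * (1 / L * A)))"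
    by (rule qerr_sum_bound[OF H_lam[OF Y(1) L(1)] lam0 fPP iter_const(1) XR _ xb _ yb \<kappa>(1) G1]) (use Y L A0 in auto)
  have T2: "cmod (\<Sum>s\<in>X. \<Sum>p\<in>PP. \<Sum>r\<in>PP. \<delta> p * cnj (\<delta> r) * of_real (jr s (snd p) * jr s (snd r)) * of_real (qerr (\<kappa>' * real s * (real (fst p))\<^sup>2 * (real (fst r))\<^sup>2)))
    \<le> 10 * real nb ^ 2 * min 1 (1 / sqrt (\<kappa>' * (10/11 * Y) * 1\<^sup>2)) * (lam Y L * (\<tau>\<^sup>2 * (1 * A)))"
    by (rule qerr_sum_bound[OF H_lam[OF Y(1) L(1)] lam0 fPP iter_const(1) XR _ xb _ cb \<kappa>(2) G2])
       (use Y A0 in auto)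
  \<comment> \<open>On the original side no factor \<open>M / e\<close> precedes the sum, so the
    constant bound for \<open>qerr\<close> is enough.\<close>
  have T2': "10 * real nb ^ 2 * min 1 (1 / sqrt (\<kappa>' * (10/11 * Y) * 1\<^sup>2)) * (lam Y L * (\<tau>\<^sup>2 * (1 * A))) \<le> 10 * real nb ^ 2 * 1 * (lam Y L * (\<tau>\<^sup>2 * (1 * A)))"
    by (intro mult_right_mono mult_left_mono min.cobounded1) (use lam0 A0 in auto)
  have term_eq: "\<alpha> (snd p) * cnj (\<alpha> (snd r)) * of_real (jr s (snd p * snd r) * smallc e (snd p) (snd r) s (fst p) (fst r)) =
     of_real (M / real e) * (\<gamma> p * cnj (\<gamma> r) * of_real (jr s (snd p) * jr s (snd r)) * of_real (qerr (\<kappa> * real s * y p * y r))) -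
     \<delta> p * cnj (\<delta> r) * of_real (jr s (snd p) * jr s (snd r)) * of_real (qerr (\<kappa>' * real s * (real (fst p))\<^sup>2 * (real (fst r))\<^sup>2))"
    if s: "s \<in> X" and p: "p \<in> PP" "r \<in> PP" for s p r
  proof -
    have gs: "gcd e s = g" using X s by auto
    have eg: "real (e div g) = real e / real g" using g g0 by (simp add: real_of_nat_div)
    have l: "snd p > 0" "snd r > 0" using lpos iter_const p by auto
    have E1: "M / (real e ^ 2 * real (snd p * snd r)) * real (s * (e div g)\<^sup>2) * (real (fst p * fst r))\<^sup>2 = \<kappa> * real s * y p * y r"
      using e g0 l by (simp add: eg \<kappa>_def y_def power2_eq_square mult_ac)
    have E2: "1 / M * real (s * (e div g)\<^sup>2) * (real (fst p * fst r))\<^sup>2 = \<kappa>' * real s * (real (fst p))\<^sup>2 * (real (fst r))\<^sup>2"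
      using e g0 l by (simp add: eg \<kappa>'_def power2_eq_square mult_ac)
    have j: "jr s (snd p * snd r) = jr s (snd p) * jr s (snd r)" by (rule jr_mult_bottom) (use l in auto)
    show ?thesis unfolding smallc_def gs E1 E2 j \<gamma>_def \<delta>_def
      by (simp add: real_sqrt_mult algebra_simps)
  qed
  have "(\<Sum>s\<in>X. \<Sum>p\<in>PP. \<Sum>r\<in>PP. \<alpha> (snd p) * cnj (\<alpha> (snd r)) * of_real (jr s (snd p * snd r) * smallc e (snd p) (snd r) s (fst p) (fst r))) =
     of_real (M / real e) * (\<Sum>s\<in>X. \<Sum>p\<in>PP. \<Sum>r\<in>PP. \<gamma> p * cnj (\<gamma> r) * of_real (jr s (snd p) * jr s (snd r)) * of_real (qerr (\<kappa> * real s * y p * y r))) -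
     (\<Sum>s\<in>X. \<Sum>p\<in>PP. \<Sum>r\<in>PP. \<delta> p * cnj (\<delta> r) * of_real (jr s (snd p) * jr s (snd r)) * of_real (qerr (\<kappa>' * real s * (real (fst p))\<^sup>2 * (real (fst r))\<^sup>2)))"
    (is "?L = of_real (M / real e) * ?D - ?Q")
    unfolding sum_distrib_left sum_subtractf[symmetric] by (intro sum.cong refl term_eq)
  hence "cmod ?L \<le> cmod (of_real (M / real e) * ?D) + cmod ?Q" by (simp only: norm_triangle_ineq4)
  also have "\<dots> \<le> M / real e * (10 * real nb ^ 2 * min 1 (1 / sqrt (\<kappa> * (10/11 * Y) * (1 / (11/10 * L))\<^sup>2)) * (lam Y L * (\<tau>\<^sup>2 * (1 / L * A))))
      + 10 * real nb ^ 2 * 1 * (lam Y L * (\<tau>\<^sup>2 * (1 * A)))"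
  proof (rule add_mono[OF _ order_trans[OF T2 T2']])
    have "cmod (of_real (M / real e) * ?D) = M / real e * cmod ?D" using M e by (simp add: norm_mult norm_divide)
    also have "\<dots> \<le> M / real e * (10 * real nb ^ 2 * min 1 (1 / sqrt (\<kappa> * (10/11 * Y) * (1 / (11/10 * L))\<^sup>2)) * (lam Y L * (\<tau>\<^sup>2 * (1 / L * A))))"
      by (rule mult_left_mono[OF T1]) (use M in simp)
    finally show "cmod (of_real (M / real e) * ?D) \<le> M / real e * (10 * real nb ^ 2 * min 1 (1 / sqrt (\<kappa> * (10/11 * Y) * (1 / (11/10 * L))\<^sup>2)) * (lam Y L * (\<tau>\<^sup>2 * (1 / L * A))))" .
  qed
  also have "\<dots> = 10 * real nb ^ 2 * \<tau>\<^sup>2 * A * (M / (real e * L) * (min 1 (1 / sqrt (M / (real g)\<^sup>2 * (10/11 * Y) * (1 / (11/10 * L))\<^sup>2)) * lam Y L) + lam Y L)"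
    by (simp add: \<kappa>_def algebra_simps)
  also have "\<dots> \<le> 10 * real nb ^ 2 * \<tau>\<^sup>2 * A * (3 * K * om * Y powr \<eta>)"
    by (rule mult_left_mono[OF small_weight]) (use Y e L g0 dvd_imp_le[OF g] A0 in auto)
  finally show ?thesis by (simp add: A_def mult_ac)
qed

text \<open>The blocks of \<open>s\<close> are counted downward from \<open>S\<close>, so block
  \<open>j\<close> ends at \<open>S / (11/10) ^ j\<close> and the powers sum to
  \<open>22 / \<eta> * S powr \<eta>\<close>. The classes by \<open>gcd e s\<close> cost a third
  factor \<open>\<tau>\<close>; \<open>660 = 30 * 22\<close>.\<close>

lemma small_bound:
  fixes \<alpha> :: "nat \<Rightarrow> complex"
  assumes e: "squarefree e" "real e * L \<le> 11/10 * N" and L: "L \<ge> 1" "L \<le> N" and C: "finite C" "C \<subseteq> odd_block L"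
  shows "cmod (\<Sum>l\<in>C. \<Sum>l'\<in>C. \<alpha> l * cnj (\<alpha> l') * of_real (\<Sum>s\<in>sqfree_upto S. jr s (l * l') * (\<Sum>c | c dvd l. \<Sum>c' | c' dvd l'. smallc e l l' s c c')))
    \<le> 660 * (real nb)\<^sup>2 * \<tau> ^ 3 * (K / \<eta>) * Om * (\<Sum>l\<in>C. (cmod (\<alpha> l))\<^sup>2)"
proof -
  define A where "A = (\<Sum>l\<in>C. (cmod (\<alpha> l))\<^sup>2)"
  have A0: "A \<ge> 0" by (simp add: A_def sum_nonneg)
  have e0: "e > 0" using e by (cases "e = 0") auto
  have tau: "real (card {d. d dvd e}) \<le> \<tau>"
  proof -
    have "real e * 1 \<le> real e * L" using L by (intro mult_left_mono) auto
    hence "real (tau e) \<le> \<tau>" using e by (intro \<tau>) auto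
    thus ?thesis by (simp add: tau_def)
  qed
  have lpos: "l > 0" if "l \<in> C" for l using that C by (auto simp: odd_block_def intro!: Nat.gr0I)
  define PP where "PP = {(c, l). l \<in> C \<and> c dvd l}"
  define h where "h s = (\<Sum>p\<in>PP. \<Sum>r\<in>PP. \<alpha> (snd p) * cnj (\<alpha> (snd r)) * of_real (jr s (snd p * snd r) * smallc e (snd p) (snd r) s (fst p) (fst r)))" for s
  have hs: "(\<Sum>l\<in>C. \<Sum>l'\<in>C. \<alpha> l * cnj (\<alpha> l') * of_real (jr s (l * l') * (\<Sum>c | c dvd l. \<Sum>c' | c' dvd l'. smallc e l l' s c c'))) = h s" for s
  proof -
    have "(\<Sum>l\<in>C. \<Sum>l'\<in>C. \<alpha> l * cnj (\<alpha> l') * of_real (jr s (l * l') * (\<Sum>c | c dvd l. \<Sum>c' | c' dvd l'. smallc e l l' s c c'))) =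
      (\<Sum>l\<in>C. \<Sum>l'\<in>C. \<Sum>c | c dvd l. \<Sum>c' | c' dvd l'. \<alpha> l * cnj (\<alpha> l') * of_real (jr s (l * l') * smallc e l l' s c c'))"
      by (simp only: sum_distrib_left of_real_sum)
    also have "\<dots> = (\<Sum>l\<in>C. \<Sum>c | c dvd l. \<Sum>l'\<in>C. \<Sum>c' | c' dvd l'. \<alpha> l * cnj (\<alpha> l') * of_real (jr s (l * l') * smallc e l l' s c c'))"
      by (intro sum.cong[OF refl] sum.swap)
    also have "\<dots> = h s" unfolding h_def PP_def by (simp only: pair_sum(1)[OF C(1) lpos])
    finally show ?thesis .
  qed
  have "(\<Sum>l\<in>C. \<Sum>l'\<in>C. \<alpha> l * cnj (\<alpha> l') * of_real (\<Sum>s\<in>sqfree_upto S. jr s (l * l') * (\<Sum>c | c dvd l. \<Sum>c' | c' dvd l'. smallc e l l' s c c'))) =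
    (\<Sum>l\<in>C. \<Sum>l'\<in>C. \<Sum>s\<in>sqfree_upto S. \<alpha> l * cnj (\<alpha> l') * of_real (jr s (l * l') * (\<Sum>c | c dvd l. \<Sum>c' | c' dvd l'. smallc e l l' s c c')))"
    by (simp only: sum_distrib_left of_real_sum[of _ "sqfree_upto S"])
  also have "\<dots> = (\<Sum>l\<in>C. \<Sum>s\<in>sqfree_upto S. \<Sum>l'\<in>C. \<alpha> l * cnj (\<alpha> l') * of_real (jr s (l * l') * (\<Sum>c | c dvd l. \<Sum>c' | c' dvd l'. smallc e l l' s c c')))"
    by (intro sum.cong[OF refl] sum.swap)
  also have "\<dots> = (\<Sum>s\<in>sqfree_upto S. \<Sum>l\<in>C. \<Sum>l'\<in>C. \<alpha> l * cnj (\<alpha> l') * of_real (jr s (l * l') * (\<Sum>c | c dvd l. \<Sum>c' | c' dvd l'. smallc e l l' s c c')))"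
    by (rule sum.swap)
  also have "\<dots> = (\<Sum>s\<in>sqfree_upto S. h s)" by (simp only: hs)
  finally have eq: "(\<Sum>l\<in>C. \<Sum>l'\<in>C. \<alpha> l * cnj (\<alpha> l') * of_real (\<Sum>s\<in>sqfree_upto S. jr s (l * l') * (\<Sum>c | c dvd l. \<Sum>c' | c' dvd l'. smallc e l l' s c c'))) = (\<Sum>s\<in>sqfree_upto S. h s)" .
  define J where "J = Suc (Max (insert 0 ((\<lambda>s. blk (S / real s)) ` sqfree_upto S)))"
  have J: "blk (S / real s) < J" if "s \<in> sqfree_upto S" for s
    unfolding J_def using finite_sqfree_upto that by (auto simp: less_Suc_eq_le intro!: Max_ge)
  have "cmod (\<Sum>s\<in>sqfree_upto S. h s) \<le> (\<Sum>i\<in>{d. d dvd e} \<times> {..<J}. cmod (\<Sum>s\<in>{s \<in> sqfree_upto S. (gcd e s, blk (S / real s)) = i}. h s))"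
    by (rule norm_sum_group) (use finite_sqfree_upto e0 J in auto)
  also have "\<dots> \<le> (\<Sum>i\<in>{d. d dvd e} \<times> {..<J}. 30 * (real nb)\<^sup>2 * \<tau>\<^sup>2 * K * om * A * (S / (11/10) ^ snd i) powr \<eta>)"
  proof (rule sum_mono)
    fix i assume i: "i \<in> {d. d dvd e} \<times> {..<J}"
    obtain d j where dj: "i = (d, j)" by (cases i)
    define X where "X = {s \<in> sqfree_upto S. (gcd e s, blk (S / real s)) = i}"
    have X: "squarefree s" "gcd e s = d" "10/11 * (S / (11/10) ^ j) \<le> real s" "real s \<le> S / (11/10) ^ j" "real s \<ge> 1" if s: "s \<in> X" for s
    proof -
      have s': "squarefree s" "real s \<le> S" "gcd e s = d" "blk (S / real s) = j" using s by (auto simp: X_def sqfree_upto_def dj)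
      have s0: "s > 0" using s'(1) by (cases "s = 0") auto
      have "1 \<le> S / real s" using s'(2) s0 by simp
      from blk[OF this] s0 show "10/11 * (S / (11/10) ^ j) \<le> real s" "real s \<le> S / (11/10) ^ j"
        unfolding s'(4) by (simp_all add: field_simps)
      show "squarefree s" "gcd e s = d" "real s \<ge> 1" using s' s0 by auto
    qed
    have "cmod (\<Sum>s\<in>X. h s) \<le> 30 * (real nb)\<^sup>2 * \<tau>\<^sup>2 * K * om * (S / (11/10) ^ j) powr \<eta> * A"
    proof (cases "X = {}")
      case True
      thus ?thesis using A0 K om_ge M by simp
    next
      case False
      then obtain s where s: "s \<in> X" by auto
      have Y: "1 \<le> S / (11/10) ^ j" using X(4,5)[OF s] by linarith
      have Y': "S / (11/10) ^ j \<le> S" using S1 by (simp add: divide_le_eq mult_le_cancel_left1)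
      show ?thesis unfolding h_def A_def PP_def
        by (rule small_fibre[OF e0 e(2) L C _ _ Y Y', of d]) (use i dj X in auto)
    qed
    thus "cmod (\<Sum>s\<in>{s \<in> sqfree_upto S. (gcd e s, blk (S / real s)) = i}. h s) \<le> 30 * (real nb)\<^sup>2 * \<tau>\<^sup>2 * K * om * A * (S / (11/10) ^ snd i) powr \<eta>"
      unfolding X_def[symmetric] by (simp add: dj mult_ac)
  qed
  also have "\<dots> = 30 * (real nb)\<^sup>2 * \<tau>\<^sup>2 * K * om * A * (real (card {d. d dvd e}) * (\<Sum>j<J. (S / (11/10) ^ j) powr \<eta>))"
  proof -
    have "(\<Sum>i\<in>{d. d dvd e} \<times> {..<J}. c * (S / (11/10) ^ snd i) powr \<eta>) = (\<Sum>d\<in>{d. d dvd e}. \<Sum>j<J. c * (S / (11/10) ^ j) powr \<eta>)" for c :: real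
      unfolding sum.cartesian_product by (simp add: split_beta)
    also have "(\<Sum>d\<in>{d. d dvd e}. \<Sum>j<J. c * (S / (11/10) ^ j) powr \<eta>) = c * (real (card {d. d dvd e}) * (\<Sum>j<J. (S / (11/10) ^ j) powr \<eta>))" for c :: real
      by (simp add: sum_distrib_left mult_ac)
    finally show ?thesis .
  qed
  also have "\<dots> \<le> 30 * (real nb)\<^sup>2 * \<tau>\<^sup>2 * K * om * A * (\<tau> * (22 / \<eta> * S powr \<eta>))"
    by (intro mult_left_mono mult_mono tau sum_block_powr) (use A0 K om_ge M tau1 S1 \<eta> in \<open>auto intro!: sum_nonneg\<close>)
  also have "\<dots> = 660 * (real nb)\<^sup>2 * \<tau> ^ 3 * (K / \<eta>) * Om * A" by (simp add: Om_def eval_nat_numeral)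
  finally show ?thesis unfolding eq A_def .
qed

text \<open>Given by its formula instead of as the smoothed sum itself, so that it makes sense for
  all \<open>l\<close>, \<open>l'\<close>. The identity with the smoothed sum needs coprime
  \<open>l\<close>, \<open>l'\<close>, whereas \<open>full_bound\<close> is used after that
  condition has been removed.\<close>

definition "full e l l' = M / (real e * sqrt (real (l * l'))) * infsum (\<lambda>(s, k). bigc e (l * l') s k) {(s, k) \<in> sq_pairs. S < real s} +
   (\<Sum>s\<in>sqfree_upto S. jr s (l * l') * (\<Sum>c | c dvd l. \<Sum>c' | c' dvd l'. smallc e l l' s c c'))"

lemma full_bound:
  fixes \<alpha> :: "nat \<Rightarrow> complex"
  assumes e: "squarefree e" "real e * L \<le> 11/10 * N" and L: "L \<ge> 1" "L \<le> N" and C: "finite C" "C \<subseteq> odd_block L" "\<And>l. l \<in> C \<Longrightarrow> coprime e l"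
  shows "cmod (\<Sum>l\<in>C. \<Sum>l'\<in>C. \<alpha> l * cnj (\<alpha> l') * of_real (full e l l'))
    \<le> 4740 * (real nb)\<^sup>2 * \<tau> ^ 3 * (K / \<eta>) * Om * (\<Sum>l\<in>C. (cmod (\<alpha> l))\<^sup>2)"
proof -
  define A where "A = (\<Sum>l\<in>C. (cmod (\<alpha> l))\<^sup>2)"
  have A0: "A \<ge> 0" by (simp add: A_def sum_nonneg)
  have nb1: "nb \<ge> 1"
  proof (rule ccontr)
    assume "\<not> nb \<ge> 1"
    hence "nb = 0" by simp
    moreover have "N\<^sup>2 \<ge> 1" using N by (simp add: one_le_power)
    ultimately show False using nb by simp
  qed
  have 1: "4080 * \<tau> * K * Om * A \<le> 4080 * ((real nb)\<^sup>2 * \<tau> ^ 3) * (K / \<eta>) * Om * A"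
  proof -
    have "1 * \<tau> \<le> (real nb)\<^sup>2 * \<tau> ^ 3"
      using nb1 tau1 by (intro mult_mono) (auto simp: one_le_power intro: self_le_power)
    moreover have "K \<le> K / \<eta>" using K \<eta> by (simp add: le_divide_eq mult_le_cancel_left1)
    ultimately show ?thesis using K tau1 A0 Om_nonneg \<eta> by (intro mult_right_mono mult_mono) auto
  qed
  have 2: "(\<Sum>l\<in>C. \<Sum>l'\<in>C. \<alpha> l * cnj (\<alpha> l') * of_real (full e l l')) =
    (\<Sum>l\<in>C. \<Sum>l'\<in>C. \<alpha> l * cnj (\<alpha> l') * of_real (M / (real e * sqrt (real (l * l'))) * infsum (\<lambda>(s, k). bigc e (l * l') s k) {(s, k) \<in> sq_pairs. S < real s})) +
    (\<Sum>l\<in>C. \<Sum>l'\<in>C. \<alpha> l * cnj (\<alpha> l') * of_real (\<Sum>s\<in>sqfree_upto S. jr s (l * l') * (\<Sum>c | c dvd l. \<Sum>c' | c' dvd l'. smallc e l l' s c c')))"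
    (is "_ = ?B + ?S") unfolding full_def by (simp only: of_real_add distrib_left sum.distrib)
  have 3: "cmod ?B \<le> 4080 * \<tau> * K * Om * A" unfolding A_def by (rule big_bound[OF e L(1) C])
  have 4: "cmod ?S \<le> 660 * (real nb)\<^sup>2 * \<tau> ^ 3 * (K / \<eta>) * Om * A" unfolding A_def by (rule small_bound[OF e L C(1,2)])
  have 5: "4080 * ((real nb)\<^sup>2 * \<tau> ^ 3) * (K / \<eta>) * Om * A + 660 * (real nb)\<^sup>2 * \<tau> ^ 3 * (K / \<eta>) * Om * A =
      4740 * (real nb)\<^sup>2 * \<tau> ^ 3 * (K / \<eta>) * Om * A" by (simp add: algebra_simps)
  show ?thesis unfolding A_def[symmetric] 2
    using order_trans[OF norm_triangle_ineq add_mono[OF order_trans[OF 3 1] 4]] 5 by (simp only:)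
qed

end

section \<open>Opening the square\<close>

lemma coprime_of_squarefree_mult:
  assumes "squarefree (d * l :: nat)" shows "coprime d l"
proof -
  have "(gcd d l)\<^sup>2 dvd d * l" unfolding power2_eq_square by (intro mult_dvd_mono) auto
  hence "gcd d l dvd 1" by (rule squarefreeD[OF assms])
  thus ?thesis by (simp only: coprime_iff_gcd_eq_1 nat_dvd_1_iff_1)
qed

lemma sq_pairs_weight_summable:
  assumes M: "(M::real) > 0" and u: "\<And>m. \<bar>u m\<bar> \<le> 1" and Z: "Z \<subseteq> sq_pairs"
  shows "(\<lambda>(s, h). exp (- (pi * (1 / M * real (s * h\<^sup>2))\<^sup>2)) * u (s * h\<^sup>2)) summable_on Z"
proof -
  have "(\<lambda>m::nat. exp (- (pi / M\<^sup>2 * (real m)\<^sup>2)) * u m) summable_on {m. 0 < m}"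
    by (rule gauss_weight_summable) (use M u in auto)
  hence "(\<lambda>m::nat. exp (- (pi * (1 / M * real m)\<^sup>2)) * u m) summable_on {m. 0 < m}"
    by (simp add: power_divide)
  from this[folded summable_on_reindex_bij_betw[OF bij_betw_square_decomposition]]
  have "(\<lambda>(s, h). exp (- (pi * (1 / M * real (s * h\<^sup>2))\<^sup>2)) * u (s * h\<^sup>2)) summable_on sq_pairs" by (simp add: split_beta')
  thus ?thesis by (rule summable_on_subset_banach[OF _ Z])
qed

text \<open>Every pair is uniquely \<open>(d * l1, d * l2)\<close> with coprime \<open>l1\<close>,
  \<open>l2\<close>, where \<open>d\<close> is the gcd. Elements of \<open>Ds\<close> that divide no
  element of \<open>D\<close> contribute empty sums.\<close>

lemma gcd_regroup:
  fixes F :: "nat \<Rightarrow> nat \<Rightarrow> 'a::comm_semiring_1"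
  assumes D: "finite D" "\<And>n. n \<in> D \<Longrightarrow> n > 0" and Ds: "finite Ds" "\<And>d. d \<in> Ds \<Longrightarrow> d > 0" "\<And>n d. n \<in> D \<Longrightarrow> d dvd n \<Longrightarrow> d \<in> Ds"
  shows "(\<Sum>n1\<in>D. \<Sum>n2\<in>D. F n1 n2) = (\<Sum>d\<in>Ds. \<Sum>l1\<in>{l. d * l \<in> D}. \<Sum>l2\<in>{l. d * l \<in> D}. of_bool (coprime l1 l2) * F (d * l1) (d * l2))"
    "\<And>d. d \<in> Ds \<Longrightarrow> finite {l. d * l \<in> D}"
proof -
  show f: "finite {l. d * l \<in> D}" if "d \<in> Ds" for d
  proof -
    have "inj (\<lambda>l. d * l)" using Ds(2)[OF that] by (auto simp: inj_def)
    from finite_vimageI[OF D(1) this] show ?thesis by (simp add: vimage_def)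
  qed
  define G where "G x = of_bool (coprime (fst (snd x)) (snd (snd x))) * F (fst x * fst (snd x)) (fst x * snd (snd x))" for x
  have "(\<Sum>d\<in>Ds. \<Sum>l1\<in>{l. d * l \<in> D}. \<Sum>l2\<in>{l. d * l \<in> D}. of_bool (coprime l1 l2) * F (d * l1) (d * l2)) =
    (\<Sum>d\<in>Ds. \<Sum>y\<in>{l. d * l \<in> D} \<times> {l. d * l \<in> D}. G (d, y))"
    unfolding G_def sum.cartesian_product by (simp add: split_beta)
  also have "\<dots> = (\<Sum>x\<in>(SIGMA d:Ds. {l. d * l \<in> D} \<times> {l. d * l \<in> D}). G x)"
    by (subst sum.Sigma) (use Ds(1) f in \<open>auto simp: split_beta\<close>)
  also have "\<dots> = (\<Sum>x\<in>{x \<in> (SIGMA d:Ds. {l. d * l \<in> D} \<times> {l. d * l \<in> D}). coprime (fst (snd x)) (snd (snd x))}. G x)"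
    by (rule sum.mono_neutral_right) (use Ds(1) f in \<open>auto simp: G_def\<close>)
  also have "\<dots> = (\<Sum>z\<in>D \<times> D. F (fst z) (snd z))"
  proof (rule sum.reindex_bij_witness[of _ "\<lambda>(n1, n2). (gcd n1 n2, n1 div gcd n1 n2, n2 div gcd n1 n2)" "\<lambda>(d, l1, l2). (d * l1, d * l2)"])
    fix x assume "x \<in> {x \<in> (SIGMA d:Ds. {l. d * l \<in> D} \<times> {l. d * l \<in> D}). coprime (fst (snd x)) (snd (snd x))}"
    then obtain d l1 l2 where x: "x = (d, l1, l2)" "d \<in> Ds" "d * l1 \<in> D" "d * l2 \<in> D" "coprime l1 l2" by (cases x) auto
    have g: "gcd (d * l1) (d * l2) = d" using x(5) by (simp add: gcd_mult_distrib_nat[symmetric])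
    show "(case (case x of (d, l1, l2) \<Rightarrow> (d * l1, d * l2)) of (n1, n2) \<Rightarrow> (gcd n1 n2, n1 div gcd n1 n2, n2 div gcd n1 n2)) = x"
      unfolding x(1) prod.case g using Ds(2)[OF x(2)] by simp
    show "(case x of (d, l1, l2) \<Rightarrow> (d * l1, d * l2)) \<in> D \<times> D" using x by simp
    show "F (fst (case x of (d, l1, l2) \<Rightarrow> (d * l1, d * l2))) (snd (case x of (d, l1, l2) \<Rightarrow> (d * l1, d * l2))) = G x"
      using x by (simp add: G_def)
  next
    fix z assume "z \<in> D \<times> D"
    then obtain n1 n2 where z: "z = (n1, n2)" "n1 \<in> D" "n2 \<in> D" by (cases z) auto
    have "gcd n1 n2 \<in> Ds" using z Ds(3)[of n1 "gcd n1 n2"] by simp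
    moreover have "coprime (n1 div gcd n1 n2) (n2 div gcd n1 n2)" using D(2)[OF z(2)] by (intro div_gcd_coprime) auto
    ultimately show "(case z of (n1, n2) \<Rightarrow> (gcd n1 n2, n1 div gcd n1 n2, n2 div gcd n1 n2)) \<in>
       {x \<in> (SIGMA d:Ds. {l. d * l \<in> D} \<times> {l. d * l \<in> D}). coprime (fst (snd x)) (snd (snd x))}"
      using z by simp
    show "(case (case z of (n1, n2) \<Rightarrow> (gcd n1 n2, n1 div gcd n1 n2, n2 div gcd n1 n2)) of (d, l1, l2) \<Rightarrow> (d * l1, d * l2)) = z"
      using z by simp
  qed
  also have "\<dots> = (\<Sum>n1\<in>D. \<Sum>n2\<in>D. F n1 n2)" by (simp add: sum.cartesian_product split_beta)
  finally show "(\<Sum>n1\<in>D. \<Sum>n2\<in>D. F n1 n2) = (\<Sum>d\<in>Ds. \<Sum>l1\<in>{l. d * l \<in> D}. \<Sum>l2\<in>{l. d * l \<in> D}. of_bool (coprime l1 l2) * F (d * l1) (d * l2))" ..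
qed

lemma divisor_regroup:
  fixes g :: "nat \<Rightarrow> real"
  assumes D: "finite D" "\<And>n. n \<in> D \<Longrightarrow> n > 0" and Ds: "finite Ds" "\<And>d. d \<in> Ds \<Longrightarrow> d > 0" "\<And>n d. n \<in> D \<Longrightarrow> d dvd n \<Longrightarrow> d \<in> Ds"
  shows "(\<Sum>d\<in>Ds. \<Sum>l\<in>{l. d * l \<in> D}. g (d * l)) = (\<Sum>n\<in>D. real (tau n) * g n)"
proof -
  have "(\<Sum>d\<in>Ds. \<Sum>l\<in>{l. d * l \<in> D}. g (d * l)) = (\<Sum>(d, l)\<in>(SIGMA d:Ds. {l. d * l \<in> D}). g (d * l))"
    by (rule sum.Sigma) (use Ds(1) gcd_regroup(2)[OF D Ds] in auto)
  also have "\<dots> = (\<Sum>(n, d)\<in>(SIGMA n:D. {d. d dvd n}). g n)"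
    by (rule sum.reindex_bij_witness[of _ "\<lambda>(n, d). (d, n div d)" "\<lambda>(d, l). (d * l, d)"]) (use Ds in auto)
  also have "\<dots> = (\<Sum>n\<in>D. \<Sum>d | d dvd n. g n)"
    by (rule sum.Sigma[symmetric]) (use D in auto)
  finally show ?thesis by (simp add: tau_def)
qed

context sieve_step
begin

definition "Z = {(s, h) \<in> sq_pairs. S < real s}"

definition "W n1 n2 = infsum (\<lambda>(s, h). exp (- (pi * (1 / M * real (s * h\<^sup>2))\<^sup>2)) * (jr (s * h\<^sup>2) n1 * jr (s * h\<^sup>2) n2)) Z"

text \<open>The terms at zero of the two sides of Poisson summation. They occur only for
  \<open>l1 * l2 = 1\<close>, that is on the diagonal.\<close>

definition "diag n = (\<Sum>e | e dvd n. mu e * (M / (2 * real e) - 1 / 2))"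

text \<open>The product of the two symbols is the symbol modulo \<open>l1 * l2\<close>, restricted
  to \<open>m\<close> coprime to \<open>d\<close>; a Moebius sum over \<open>e\<close> dividing
  \<open>d\<close> leaves the multiples of \<open>e\<close>. As \<open>d\<close> is odd, the
  congruence mod 4 passes to \<open>l1\<close>, \<open>l2\<close>, as Poisson summation
  demands.\<close>

lemma smoothed_pair_expand:
  assumes d: "d > 0" and n: "d * l1 \<in> odd_block N" "d * l2 \<in> odd_block N" and cop: "coprime l1 l2" and md: "(d * l1) mod 4 = (d * l2) mod 4"
  shows "W (d * l1) (d * l2) = (\<Sum>e | e dvd d. mu e * full e l1 l2) + of_bool (d * l1 = d * l2) * diag (d * l1)"
proof -
  have o: "odd d" "odd l1" "odd l2" and sq: "squarefree (d * l1)" "squarefree (d * l2)" using n by (auto simp: odd_block_def)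
  have sd: "squarefree d" "squarefree l1" "squarefree l2" using sq squarefree_multD by blast+
  have cd: "coprime d l1" "coprime d l2" using sq coprime_of_squarefree_mult by blast+
  have p: "l1 > 0" "l2 > 0" using o odd_pos by auto
  have m4: "l1 mod 4 = l2 mod 4"
  proof -
    have "coprime d 4" using o(1) coprime_power_right_iff[of d 2 2] by simp
    moreover have "[d * l1 = d * l2] (mod 4)" using md by (simp add: cong_def)
    ultimately have "[l1 = l2] (mod 4)" by (simp add: cong_mult_lcancel_nat)
    thus ?thesis by (simp add: cong_def)
  qed
  define u where "u e m = (if e dvd m then jr m (l1 * l2) else 0)" for e m :: nat
  have jj: "jr m (d * l1) * jr m (d * l2) = (\<Sum>e | e dvd d. mu e * u e m)" for m
  proof -
    have "jr m (d * l1) * jr m (d * l2) = (jr m d)\<^sup>2 * jr m (l1 * l2)"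
      using d p by (simp add: jr_mult_bottom power2_eq_square)
    also have "\<dots> = (\<Sum>e | e dvd d. mu e * of_bool (e dvd m)) * jr m (l1 * l2)"
      by (simp only: jr_square[OF o(1)] coprime_indicator_sum[OF sd(1)])
    also have "\<dots> = (\<Sum>e | e dvd d. mu e * u e m)"
      unfolding sum_distrib_right by (intro sum.cong refl) (simp add: u_def)
    finally show ?thesis .
  qed
  have hs: "((\<lambda>(s, h). exp (- (pi * (1 / M * real (s * h\<^sup>2))\<^sup>2)) * u e (s * h\<^sup>2)) has_sum full e l1 l2 + of_bool (l1 * l2 = 1) * (M / (2 * real e) - 1 / 2)) Z"
    if e: "e dvd d" for e
  proof -
    have ce: "coprime e (l1 * l2)" using cd e by (auto intro: coprime_divisors[OF e dvd_refl])
    have se: "squarefree e" using e sd(1) by (rule squarefree_mono)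
    have M0: "M > 0" using M by simp
    have u1: "\<bar>u e m\<bar> \<le> 1" for m using jr_abs_le[of "l1 * l2" m] o by (simp add: u_def)
    have sm: "(\<lambda>(s, h). exp (- (pi * (1 / M * real (s * h\<^sup>2))\<^sup>2)) * u e (s * h\<^sup>2)) summable_on Z"
      by (rule sq_pairs_weight_summable[OF M0 u1]) (auto simp: Z_def)
    have "infsum (\<lambda>(s, h). exp (- (pi * (1 / M * real (s * h\<^sup>2))\<^sup>2)) * u e (s * h\<^sup>2)) Z =
        infsum (\<lambda>(s, h). if e dvd s * h\<^sup>2 then exp (- (pi * (1 / M * real (s * h\<^sup>2))\<^sup>2)) * jr (s * h\<^sup>2) (l1 * l2) else 0) {(s, h) \<in> sq_pairs. S < real s}"
      unfolding Z_def by (rule infsum_cong) (auto simp: u_def)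
    also note sqfree_class_poisson[OF se o(2,3) sd(2,3) cop ce m4 M0, of S]
    finally show ?thesis unfolding full_def bigc_def smallc_def using has_sum_infsum[OF sm] by (simp only:)
  qed
  have fd: "finite {e. e dvd d}" using d by simp
  have "((\<lambda>x. \<Sum>e | e dvd d. mu e * (case x of (s, h) \<Rightarrow> exp (- (pi * (1 / M * real (s * h\<^sup>2))\<^sup>2)) * u e (s * h\<^sup>2))) has_sum
     (\<Sum>e | e dvd d. mu e * (full e l1 l2 + of_bool (l1 * l2 = 1) * (M / (2 * real e) - 1 / 2)))) Z"
    by (rule has_sum_finite_sum[OF fd], rule has_sum_cmult_right, rule hs) simp
  moreover have "(\<Sum>e | e dvd d. mu e * (case x of (s, h) \<Rightarrow> exp (- (pi * (1 / M * real (s * h\<^sup>2))\<^sup>2)) * u e (s * h\<^sup>2))) =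
    (case x of (s, h) \<Rightarrow> exp (- (pi * (1 / M * real (s * h\<^sup>2))\<^sup>2)) * (jr (s * h\<^sup>2) (d * l1) * jr (s * h\<^sup>2) (d * l2)))" for x :: "nat \<times> nat"
    unfolding jj by (cases x) (simp only: prod.case sum_distrib_left mult.left_commute)
  ultimately have "W (d * l1) (d * l2) = (\<Sum>e | e dvd d. mu e * (full e l1 l2 + of_bool (l1 * l2 = 1) * (M / (2 * real e) - 1 / 2)))"
    unfolding W_def by (simp only: infsumI)
  also have "\<dots> = (\<Sum>e | e dvd d. mu e * full e l1 l2) + of_bool (l1 * l2 = 1) * diag d"
    by (simp add: diag_def distrib_left sum.distrib sum_distrib_left mult_ac)
  also have "of_bool (l1 * l2 = 1) * diag d = of_bool (d * l1 = d * l2) * diag (d * l1)"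
  proof (cases "l1 = l2")
    case True
    hence "l1 = 1" using cop by simp
    thus ?thesis using True by simp
  next
    case False
    thus ?thesis using d by auto
  qed
  finally show ?thesis .
qed

text \<open>The smoothed double sum is a sum of squares with positive weights, so the terms with
  \<open>h = 1\<close> and \<open>S < s \<le> M\<close> can be singled out. There the weight is at
  least \<open>exp (- pi)\<close>, which exceeds \<open>exp (- 4)\<close> and thus 1/81.\<close>

lemma smoothed_sum_lower:
  fixes a :: "nat \<Rightarrow> complex"
  assumes D: "finite D" "\<And>n. n \<in> D \<Longrightarrow> odd n"
  shows "(\<Sum>s\<in>sqfree_upto M - sqfree_upto S. (cmod (\<Sum>n\<in>D. a n * of_real (jr s n)))\<^sup>2) \<le>
     81 * cmod (\<Sum>n1\<in>D. \<Sum>n2\<in>D. a n1 * cnj (a n2) * of_real (W n1 n2))" (is "_ \<le> 81 * cmod ?T")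
proof -
  define w where "w m = exp (- (pi * (1 / M * real m)\<^sup>2))" for m :: nat
  define f where "f x = w (fst x * (snd x)\<^sup>2) * (cmod (\<Sum>n\<in>D. a n * of_real (jr (fst x * (snd x)\<^sup>2) n)))\<^sup>2" for x
  have M0: "M > 0" using M by simp
  have "((\<lambda>x. \<Sum>n1\<in>D. \<Sum>n2\<in>D. a n1 * cnj (a n2) * of_real (w (fst x * (snd x)\<^sup>2) * (jr (fst x * (snd x)\<^sup>2) n1 * jr (fst x * (snd x)\<^sup>2) n2))) has_sum ?T) Z"
  proof (intro has_sum_finite_sum D(1))
    fix n1 n2 assume n: "n1 \<in> D" "n2 \<in> D"
    have b: "\<bar>jr m n1 * jr m n2\<bar> \<le> 1" for m
      using mult_mono[OF jr_abs_le[OF D(2)[OF n(1)], of m] jr_abs_le[OF D(2)[OF n(2)], of m]] by (simp add: abs_mult)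
    have "(\<lambda>(s, h). w (s * h\<^sup>2) * (jr (s * h\<^sup>2) n1 * jr (s * h\<^sup>2) n2)) summable_on Z"
      unfolding w_def by (rule sq_pairs_weight_summable[OF M0 b]) (auto simp: Z_def)
    from has_sum_infsum[OF this] have "((\<lambda>x. w (fst x * (snd x)\<^sup>2) * (jr (fst x * (snd x)\<^sup>2) n1 * jr (fst x * (snd x)\<^sup>2) n2)) has_sum W n1 n2) Z"
      unfolding W_def w_def by (simp only: split_beta')
    thus "((\<lambda>x. a n1 * cnj (a n2) * of_real (w (fst x * (snd x)\<^sup>2) * (jr (fst x * (snd x)\<^sup>2) n1 * jr (fst x * (snd x)\<^sup>2) n2))) has_sum a n1 * cnj (a n2) * of_real (W n1 n2)) Z"
      by (intro has_sum_cmult_right has_sum_of_real)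
  qed
  moreover have "(\<Sum>n1\<in>D. \<Sum>n2\<in>D. a n1 * cnj (a n2) * of_real (w (fst x * (snd x)\<^sup>2) * (jr (fst x * (snd x)\<^sup>2) n1 * jr (fst x * (snd x)\<^sup>2) n2))) = of_real (f x)" for x
    unfolding f_def of_real_mult complex_norm_square cnj_sum sum_product complex_cnj_mult complex_cnj_complex_of_real
    by (simp add: sum_distrib_left mult_ac)
  ultimately have "((\<lambda>x. complex_of_real (f x)) has_sum ?T) Z" by simp
  from has_sum_Re[OF this] have hs: "(f has_sum Re ?T) Z" by simp
  define F where "F = (\<lambda>s. (s, 1::nat)) ` (sqfree_upto M - sqfree_upto S)"
  have "sum f F \<le> Re ?T"
  proof (rule finite_sum_le_has_sum[OF hs])
    show "finite F" unfolding F_def using finite_sqfree_upto by simp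
  qed (auto simp: F_def Z_def sq_pairs_def sqfree_upto_def f_def w_def)
  also have "\<dots> \<le> cmod ?T" by (rule complex_Re_le_cmod)
  finally have 1: "sum f F \<le> cmod ?T" .
  have "(\<Sum>s\<in>sqfree_upto M - sqfree_upto S. (cmod (\<Sum>n\<in>D. a n * of_real (jr s n)))\<^sup>2) \<le> (\<Sum>s\<in>sqfree_upto M - sqfree_upto S. 81 * f (s, 1))"
  proof (rule sum_mono)
    fix s assume "s \<in> sqfree_upto M - sqfree_upto S"
    hence "real s \<le> M" by (simp add: sqfree_upto_def)
    hence "(1 / M * real s)\<^sup>2 \<le> 1" using M0 by (simp add: abs_square_le_1)
    hence "pi * (1 / M * real s)\<^sup>2 \<le> 4" using pi_less_4 mult_mono[of pi 4 "(1 / M * real s)\<^sup>2" 1] by simp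
    hence "exp (- 4) \<le> w s" by (simp add: w_def)
    moreover have "1 / 81 \<le> exp (- 4 :: real)"
    proof -
      have "exp (4::real) = exp 1 ^ 4" by (simp flip: exp_of_nat_mult)
      also have "\<dots> \<le> 3 ^ 4" using exp_le by (intro power_mono) auto
      finally have "exp (4::real) \<le> 81" by simp
      hence "1 / 81 \<le> 1 / exp (4::real)" by (intro divide_left_mono) auto
      thus ?thesis by (simp add: exp_minus inverse_eq_divide)
    qed
    ultimately have "1 \<le> 81 * w s" by simp
    hence "1 * (cmod (\<Sum>n\<in>D. a n * of_real (jr s n)))\<^sup>2 \<le> 81 * w s * (cmod (\<Sum>n\<in>D. a n * of_real (jr s n)))\<^sup>2"
      by (rule mult_right_mono) simp
    thus "(cmod (\<Sum>n\<in>D. a n * of_real (jr s n)))\<^sup>2 \<le> 81 * f (s, 1)" by (simp add: f_def mult.assoc)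
  qed
  also have "\<dots> = 81 * sum f F"
    unfolding F_def by (subst sum.reindex) (auto simp: inj_on_def sum_distrib_left)
  finally show ?thesis using 1 by linarith
qed

text \<open>Coprimality of \<open>l1\<close> and \<open>l2\<close> would prevent a bilinear
  estimate. It is removed by a second Moebius sum, over \<open>f\<close>, whose divisibility
  conditions are absorbed into \<open>\<alpha>\<close>. The power \<open>\<tau> ^ 6\<close> is
  \<open>\<tau> ^ 3\<close> from \<open>full_bound\<close>, one factor each for \<open>e\<close> and
  \<open>f\<close>, and one for regrouping by \<open>d\<close>.\<close>

lemma smoothed_sum_upper:
  fixes a :: "nat \<Rightarrow> complex"
  assumes D: "D \<subseteq> odd_block N" "\<And>n. n \<in> D \<Longrightarrow> n mod 4 = r"
  shows "cmod (\<Sum>n1\<in>D. \<Sum>n2\<in>D. a n1 * cnj (a n2) * of_real (W n1 n2)) \<le>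
    (\<tau> * M + 4740 * (real nb)\<^sup>2 * \<tau> ^ 6 * (K / \<eta>) * Om) * (\<Sum>n\<in>D. (cmod (a n))\<^sup>2)"
proof -
  define A where "A = (\<Sum>n\<in>D. (cmod (a n))\<^sup>2)"
  define Ds where "Ds = {d::nat. 0 < d \<and> real d \<le> 11/10 * N}"
  define B where "B = 4740 * (real nb)\<^sup>2 * \<tau> ^ 3 * (K / \<eta>) * Om"
  have B0: "B \<ge> 0" unfolding B_def using K \<eta> Om_nonneg tau1 by simp
  have fD: "finite D" using D(1) finite_odd_block finite_subset by blast
  have Dn: "n > 0" "odd n" "squarefree n" "N \<le> real n" "real n < 11/10 * N" if "n \<in> D" for n
    using that D(1) by (auto simp: odd_block_def intro!: Nat.gr0I)
  have fDs: "finite Ds" by (rule finite_subset[of _ "{..nat \<lfloor>11/10 * N\<rfloor>}"]) (auto simp: Ds_def le_nat_floor)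
  have Dsp: "d > 0" if "d \<in> Ds" for d using that by (simp add: Ds_def)
  have Dsd: "d \<in> Ds" if "n \<in> D" "d dvd n" for n d
  proof -
    have "d > 0" using Dn(1)[OF that(1)] that(2) by (rule dvd_pos_nat)
    moreover have "d \<le> n" using that Dn(1) by (intro dvd_imp_le) auto
    ultimately show ?thesis using Dn(5)[OF that(1)] by (simp add: Ds_def)
  qed
  note reg = fD Dn(1) fDs Dsp Dsd
  define V where "V n1 n2 = (\<Sum>e | e dvd gcd n1 n2. mu e * full e (n1 div gcd n1 n2) (n2 div gcd n1 n2))" for n1 n2
  have WV: "W n1 n2 = V n1 n2 + of_bool (n1 = n2) * diag n1" if n: "n1 \<in> D" "n2 \<in> D" for n1 n2
  proof -
    define d where "d = gcd n1 n2"
    have d0: "d > 0" using Dn(1)[OF n(1)] by (simp add: d_def)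
    have e: "n1 = d * (n1 div d)" "n2 = d * (n2 div d)" by (simp_all add: d_def)
    have c: "coprime (n1 div d) (n2 div d)" unfolding d_def using Dn(1)[OF n(1)] by (intro div_gcd_coprime) auto
    have "W (d * (n1 div d)) (d * (n2 div d)) = (\<Sum>e | e dvd d. mu e * full e (n1 div d) (n2 div d)) + of_bool (d * (n1 div d) = d * (n2 div d)) * diag (d * (n1 div d))"
      by (rule smoothed_pair_expand[OF d0 _ _ c]) (use n D e in auto)
    thus ?thesis unfolding V_def d_def[symmetric] e(1,2)[symmetric] .
  qed
  have "(\<Sum>n1\<in>D. \<Sum>n2\<in>D. a n1 * cnj (a n2) * of_real (W n1 n2)) =
     (\<Sum>n1\<in>D. \<Sum>n2\<in>D. a n1 * cnj (a n2) * of_real (V n1 n2) + of_bool (n1 = n2) * (a n1 * cnj (a n2) * of_real (diag n1)))"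
    by (intro sum.cong refl) (simp add: WV algebra_simps)
  also have "\<dots> = (\<Sum>n1\<in>D. \<Sum>n2\<in>D. a n1 * cnj (a n2) * of_real (V n1 n2)) + (\<Sum>n1\<in>D. a n1 * cnj (a n1) * of_real (diag n1))"
    using fD by (simp add: sum.distrib of_bool_def if_distrib[of "\<lambda>x. x * _"] cong: if_cong)
  finally have split: "(\<Sum>n1\<in>D. \<Sum>n2\<in>D. a n1 * cnj (a n2) * of_real (W n1 n2)) =
     (\<Sum>n1\<in>D. \<Sum>n2\<in>D. a n1 * cnj (a n2) * of_real (V n1 n2)) + (\<Sum>n1\<in>D. a n1 * cnj (a n1) * of_real (diag n1))" .
  have part2: "cmod (\<Sum>n1\<in>D. a n1 * cnj (a n1) * of_real (diag n1)) \<le> \<tau> * M * A"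
  proof -
    have "cmod (\<Sum>n1\<in>D. a n1 * cnj (a n1) * of_real (diag n1)) \<le> (\<Sum>n\<in>D. (cmod (a n))\<^sup>2 * (\<tau> * M))"
    proof (rule sum_norm_le)
      fix n assume n: "n \<in> D"
      have "\<bar>diag n\<bar> \<le> (\<Sum>e | e dvd n. M)" unfolding diag_def
      proof (rule order_trans[OF sum_abs sum_mono])
        fix e assume e: "e \<in> {e. e dvd n}"
        have e1: "real e \<ge> 1" using e Dn(1)[OF n] by (auto dest: dvd_pos_nat)
        have "M / (2 * real e) \<le> M / 2" using M e1 by (intro divide_left_mono) auto
        moreover have "M / (2 * real e) \<ge> 0" using M by simp
        ultimately have b: "\<bar>M / (2 * real e) - 1 / 2\<bar> \<le> M" unfolding abs_le_iff using M by linarith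
        have m: "\<bar>mu e\<bar> \<le> 1" by (simp add: abs_mu)
        show "\<bar>mu e * (M / (2 * real e) - 1 / 2)\<bar> \<le> M"
          using mult_mono[OF m b] by (simp add: abs_mult)
      qed
      also have "\<dots> = real (tau n) * M" by (simp add: tau_def)
      also have "\<dots> \<le> \<tau> * M" using \<tau>[of n] Dn[OF n] M by (intro mult_right_mono) auto
      finally have "(cmod (a n))\<^sup>2 * \<bar>diag n\<bar> \<le> (cmod (a n))\<^sup>2 * (\<tau> * M)" by (rule mult_left_mono) simp
      thus "cmod (a n * cnj (a n) * of_real (diag n)) \<le> (cmod (a n))\<^sup>2 * (\<tau> * M)"
        by (simp add: norm_mult power2_eq_square)
    qed
    thus ?thesis by (simp add: A_def sum_distrib_left sum_distrib_right mult_ac)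
  qed
  define C where "C d = {l. d * l \<in> D}" for d
  have fC: "finite (C d)" if "d \<in> Ds" for d unfolding C_def by (rule gcd_regroup(2)[OF reg that])
  have regr: "(\<Sum>n1\<in>D. \<Sum>n2\<in>D. a n1 * cnj (a n2) * of_real (V n1 n2)) =
    (\<Sum>d\<in>Ds. \<Sum>l1\<in>C d. \<Sum>l2\<in>C d. of_bool (coprime l1 l2) * (a (d * l1) * cnj (a (d * l2)) * of_real (V (d * l1) (d * l2))))"
    unfolding C_def by (rule gcd_regroup(1)[OF reg])
  have perd: "cmod (\<Sum>l1\<in>C d. \<Sum>l2\<in>C d. of_bool (coprime l1 l2) * (a (d * l1) * cnj (a (d * l2)) * of_real (V (d * l1) (d * l2))))
     \<le> B * \<tau>\<^sup>2 * (\<Sum>l\<in>C d. (cmod (a (d * l)))\<^sup>2)" (is "cmod ?X \<le> _") if d: "d \<in> Ds" for d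
  proof (cases "C d = {}")
    case True
    thus ?thesis by simp
  next
    case False
    then obtain l0 where "l0 \<in> C d" by auto
    hence l0: "d * l0 \<in> D" by (simp add: C_def)
    have sd: "squarefree d" using Dn(3)[OF l0] squarefree_multD by blast
    have d0: "d > 0" using Dsp[OF d] .
    have dN: "real d \<le> 11/10 * N" using d by (simp add: Ds_def)
    have Cl: "l > 0" "squarefree l" "coprime d l" "N \<le> real d * real l" "real d * real l < 11/10 * N" "odd l" "real l \<le> 11/10 * N" if "l \<in> C d" for l
    proof -
      have n: "d * l \<in> D" using that by (simp add: C_def)
      show "l > 0" "odd l" using Dn(1,2)[OF n] by auto
      show "squarefree l" using Dn(3)[OF n] squarefree_multD by blast
      show "coprime d l" by (rule coprime_of_squarefree_mult[OF Dn(3)[OF n]])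
      show b: "N \<le> real d * real l" "real d * real l < 11/10 * N" using Dn(4,5)[OF n] by simp_all
      have "1 * real l \<le> real d * real l" using d0 by (intro mult_right_mono) auto
      thus "real l \<le> 11/10 * N" using b by linarith
    qed
    define L where "L = max 1 (N / real d)"
    have L: "L \<ge> 1" "L \<le> N"
    proof -
      show "L \<ge> 1" by (simp add: L_def)
      have "N / real d \<le> N / 1" using d0 N by (intro divide_left_mono) auto
      thus "L \<le> N" using N by (simp add: L_def)
    qed
    have dL: "real d * L \<le> 11/10 * N" unfolding L_def max_def using d0 dN N by auto
    have CL: "C d \<subseteq> odd_block L"
    proof
      fix l assume l: "l \<in> C d"
      have u: "real l < 11/10 * (N / real d)" "N / real d \<le> real l" using Cl(4,5)[OF l] d0 by (simp_all add: field_simps)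
      have "11/10 * (N / real d) \<le> 11/10 * L" by (simp add: L_def)
      moreover have "L \<le> real l" using u Cl(1)[OF l] by (simp add: L_def)
      ultimately show "l \<in> odd_block L" using u Cl[OF l] by (simp add: odd_block_def)
    qed
    \<comment> \<open>Pairs \<open>(e, f)\<close>: \<open>e\<close> opens the coprimality of
      \<open>m\<close> and \<open>d\<close>, \<open>f\<close> that of \<open>l1\<close> and
      \<open>l2\<close>.\<close>
    define E where "E = {e. e dvd d} \<times> Ds"
    have fE: "finite E" using d0 fDs by (simp add: E_def)
    define \<alpha> where "\<alpha> f l = of_bool (f dvd l) * a (d * l)" for f l :: nat
    have key: "of_bool (coprime l1 l2) * (a (d * l1) * cnj (a (d * l2)) * of_real (V (d * l1) (d * l2))) =
      (\<Sum>x\<in>E. of_real (mu (fst x) * mu (snd x)) * (\<alpha> (snd x) l1 * cnj (\<alpha> (snd x) l2) * of_real (full (fst x) l1 l2)))"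
      if l: "l1 \<in> C d" "l2 \<in> C d" for l1 l2
    proof -
      have ind: "of_bool (coprime l1 l2) = (\<Sum>f\<in>Ds. mu f * (of_bool (f dvd l1) * of_bool (f dvd l2)))"
      proof -
        have "of_bool (coprime l1 l2) = (\<Sum>f | f dvd l2. mu f * of_bool (f dvd l1))"
          by (rule coprime_indicator_sum[OF Cl(2)[OF l(2)]])
        also have "\<dots> = (\<Sum>f\<in>{f. f dvd l2}. mu f * (of_bool (f dvd l1) * of_bool (f dvd l2)))"
          by (intro sum.cong refl) auto
        also have "\<dots> = (\<Sum>f\<in>Ds. mu f * (of_bool (f dvd l1) * of_bool (f dvd l2)))"
        proof (rule sum.mono_neutral_left[OF fDs])
          have "d * l2 \<in> D" using l(2) by (simp add: C_def)
          thus "{f. f dvd l2} \<subseteq> Ds" using Dsd by (auto intro: dvd_trans)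
        qed auto
        finally show ?thesis .
      qed
      show ?thesis
      proof (cases "coprime l1 l2")
        case True
        have g: "gcd (d * l1) (d * l2) = d" using True by (simp add: gcd_mult_distrib_nat[symmetric])
        have V: "V (d * l1) (d * l2) = (\<Sum>e | e dvd d. mu e * full e l1 l2)" unfolding V_def g using d0 by simp
        have "(\<Sum>x\<in>E. of_real (mu (fst x) * mu (snd x)) * (\<alpha> (snd x) l1 * cnj (\<alpha> (snd x) l2) * of_real (full (fst x) l1 l2))) =
          (\<Sum>e | e dvd d. \<Sum>f\<in>Ds. (a (d * l1) * cnj (a (d * l2)) * of_real (mu e * full e l1 l2)) * of_real (mu f * (of_bool (f dvd l1) * of_bool (f dvd l2))))"
          unfolding E_def sum.cartesian_product by (intro sum.cong refl) (auto simp: \<alpha>_def)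
        also have "\<dots> = (\<Sum>e | e dvd d. (a (d * l1) * cnj (a (d * l2)) * of_real (mu e * full e l1 l2)) * of_real (of_bool (coprime l1 l2)))"
          unfolding ind of_real_sum by (simp only: sum_distrib_left)
        also have "\<dots> = a (d * l1) * cnj (a (d * l2)) * of_real (V (d * l1) (d * l2))"
          unfolding V of_real_sum using True by (simp add: sum_distrib_left)
        finally show ?thesis using True by simp
      next
        case False
        have "(\<Sum>x\<in>E. of_real (mu (fst x) * mu (snd x)) * (\<alpha> (snd x) l1 * cnj (\<alpha> (snd x) l2) * of_real (full (fst x) l1 l2))) =
          (\<Sum>e | e dvd d. \<Sum>f\<in>Ds. (a (d * l1) * cnj (a (d * l2)) * of_real (mu e * full e l1 l2)) * of_real (mu f * (of_bool (f dvd l1) * of_bool (f dvd l2))))"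
          unfolding E_def sum.cartesian_product by (intro sum.cong refl) (auto simp: \<alpha>_def)
        also have "\<dots> = (\<Sum>e | e dvd d. (a (d * l1) * cnj (a (d * l2)) * of_real (mu e * full e l1 l2)) * of_real (of_bool (coprime l1 l2)))"
          unfolding ind of_real_sum by (simp only: sum_distrib_left)
        finally show ?thesis using False by simp
      qed
    qed
    have "?X = (\<Sum>l1\<in>C d. \<Sum>l2\<in>C d. \<Sum>x\<in>E. of_real (mu (fst x) * mu (snd x)) * (\<alpha> (snd x) l1 * cnj (\<alpha> (snd x) l2) * of_real (full (fst x) l1 l2)))"
      by (intro sum.cong refl key)
    also have "\<dots> = (\<Sum>l1\<in>C d. \<Sum>x\<in>E. \<Sum>l2\<in>C d. of_real (mu (fst x) * mu (snd x)) * (\<alpha> (snd x) l1 * cnj (\<alpha> (snd x) l2) * of_real (full (fst x) l1 l2)))"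
      by (intro sum.cong refl sum.swap)
    also have "\<dots> = (\<Sum>x\<in>E. \<Sum>l1\<in>C d. \<Sum>l2\<in>C d. of_real (mu (fst x) * mu (snd x)) * (\<alpha> (snd x) l1 * cnj (\<alpha> (snd x) l2) * of_real (full (fst x) l1 l2)))"
      by (rule sum.swap)
    also have "\<dots> = (\<Sum>x\<in>E. of_real (mu (fst x) * mu (snd x)) * (\<Sum>l1\<in>C d. \<Sum>l2\<in>C d. \<alpha> (snd x) l1 * cnj (\<alpha> (snd x) l2) * of_real (full (fst x) l1 l2)))"
      by (simp only: sum_distrib_left)
    finally have "cmod ?X \<le> (\<Sum>x\<in>E. B * (\<Sum>l\<in>C d. (cmod (\<alpha> (snd x) l))\<^sup>2))"
    proof (elim ssubst, intro sum_norm_le)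
      fix x assume x: "x \<in> E"
      have e: "fst x dvd d" using x by (auto simp: E_def)
      have se: "squarefree (fst x)" using e sd by (rule squarefree_mono)
      have "fst x \<le> d" using e d0 by (intro dvd_imp_le) auto
      hence "real (fst x) * L \<le> real d * L" using L by (intro mult_right_mono) auto
      hence eL: "real (fst x) * L \<le> 11/10 * N" using dL by linarith
      have ce: "coprime (fst x) l" if "l \<in> C d" for l by (rule coprime_divisors[OF e dvd_refl Cl(3)[OF that]])
      have b: "cmod (\<Sum>l1\<in>C d. \<Sum>l2\<in>C d. \<alpha> (snd x) l1 * cnj (\<alpha> (snd x) l2) * of_real (full (fst x) l1 l2)) \<le> B * (\<Sum>l\<in>C d. (cmod (\<alpha> (snd x) l))\<^sup>2)"
        unfolding B_def by (rule full_bound[OF se eL L fC[OF d] CL ce])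
      have m: "\<bar>mu (fst x) * mu (snd x)\<bar> \<le> 1"
        using mult_mono[of "\<bar>mu (fst x)\<bar>" 1 "\<bar>mu (snd x)\<bar>" 1] by (simp add: abs_mult abs_mu)
      show "cmod (of_real (mu (fst x) * mu (snd x)) * (\<Sum>l1\<in>C d. \<Sum>l2\<in>C d. \<alpha> (snd x) l1 * cnj (\<alpha> (snd x) l2) * of_real (full (fst x) l1 l2)))
         \<le> B * (\<Sum>l\<in>C d. (cmod (\<alpha> (snd x) l))\<^sup>2)"
        unfolding norm_mult norm_of_real using mult_mono[OF m b] by simp
    qed
    also have "\<dots> = B * (real (tau d) * (\<Sum>f\<in>Ds. \<Sum>l\<in>C d. of_bool (f dvd l) * (cmod (a (d * l)))\<^sup>2))"
    proof -
      have "(\<Sum>x\<in>E. B * (\<Sum>l\<in>C d. (cmod (\<alpha> (snd x) l))\<^sup>2)) = (\<Sum>e | e dvd d. \<Sum>f\<in>Ds. B * (\<Sum>l\<in>C d. (cmod (\<alpha> f l))\<^sup>2))"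
        unfolding E_def sum.cartesian_product by (simp add: split_beta)
      also have "\<dots> = B * (real (tau d) * (\<Sum>f\<in>Ds. \<Sum>l\<in>C d. (cmod (\<alpha> f l))\<^sup>2))"
        by (simp add: tau_def sum_distrib_left mult_ac)
      also have "(\<Sum>f\<in>Ds. \<Sum>l\<in>C d. (cmod (\<alpha> f l))\<^sup>2) = (\<Sum>f\<in>Ds. \<Sum>l\<in>C d. of_bool (f dvd l) * (cmod (a (d * l)))\<^sup>2)"
        by (intro sum.cong refl) (simp add: \<alpha>_def)
      finally show ?thesis .
    qed
    also have "(\<Sum>f\<in>Ds. \<Sum>l\<in>C d. of_bool (f dvd l) * (cmod (a (d * l)))\<^sup>2) = (\<Sum>l\<in>C d. (\<Sum>f\<in>Ds. of_bool (f dvd l)) * (cmod (a (d * l)))\<^sup>2)"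
      unfolding sum_distrib_right by (rule sum.swap)
    also have "B * (real (tau d) * (\<Sum>l\<in>C d. (\<Sum>f\<in>Ds. of_bool (f dvd l)) * (cmod (a (d * l)))\<^sup>2)) \<le> B * (\<tau> * (\<Sum>l\<in>C d. \<tau> * (cmod (a (d * l)))\<^sup>2))"
    proof (rule mult_left_mono[OF mult_mono B0])
      show "real (tau d) \<le> \<tau>" using \<tau>[OF sd dN] .
      show "(\<Sum>l\<in>C d. (\<Sum>f\<in>Ds. of_bool (f dvd l)) * (cmod (a (d * l)))\<^sup>2) \<le> (\<Sum>l\<in>C d. \<tau> * (cmod (a (d * l)))\<^sup>2)"
      proof (rule sum_mono, rule mult_right_mono)
        fix l assume l: "l \<in> C d"
        have "(\<Sum>f\<in>Ds. of_bool (f dvd l)) = real (card (Ds \<inter> {f. f dvd l}))" using fDs by (simp add: sum_of_bool_eq)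
        also have "\<dots> \<le> real (tau l)" unfolding tau_def using Cl(1)[OF l] by (intro of_nat_mono card_mono) auto
        also have "\<dots> \<le> \<tau>" using \<tau>[OF Cl(2,7)[OF l]] .
        finally show "(\<Sum>f\<in>Ds. of_bool (f dvd l)) \<le> \<tau>" .
      qed simp
      show "0 \<le> (\<Sum>l\<in>C d. (\<Sum>f\<in>Ds. of_bool (f dvd l)) * (cmod (a (d * l)))\<^sup>2)"
        by (intro sum_nonneg mult_nonneg_nonneg) auto
    qed (use tau1 in simp)
    also have "\<dots> = B * \<tau>\<^sup>2 * (\<Sum>l\<in>C d. (cmod (a (d * l)))\<^sup>2)" by (simp add: sum_distrib_left power2_eq_square mult_ac)
    finally show ?thesis .
  qed
  have "cmod (\<Sum>n1\<in>D. \<Sum>n2\<in>D. a n1 * cnj (a n2) * of_real (V n1 n2)) \<le> (\<Sum>d\<in>Ds. B * \<tau>\<^sup>2 * (\<Sum>l\<in>C d. (cmod (a (d * l)))\<^sup>2))"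
    unfolding regr by (rule sum_norm_le) (rule perd)
  also have "\<dots> = B * \<tau>\<^sup>2 * (\<Sum>d\<in>Ds. \<Sum>l\<in>C d. (cmod (a (d * l)))\<^sup>2)" by (simp only: sum_distrib_left)
  also have "(\<Sum>d\<in>Ds. \<Sum>l\<in>C d. (cmod (a (d * l)))\<^sup>2) = (\<Sum>n\<in>D. real (tau n) * (cmod (a n))\<^sup>2)"
    unfolding C_def by (rule divisor_regroup[OF reg])
  also have "B * \<tau>\<^sup>2 * (\<Sum>n\<in>D. real (tau n) * (cmod (a n))\<^sup>2) \<le> B * \<tau>\<^sup>2 * (\<Sum>n\<in>D. \<tau> * (cmod (a n))\<^sup>2)"
  proof (intro mult_left_mono sum_mono mult_right_mono)
    fix n assume "n \<in> D"
    thus "real (tau n) \<le> \<tau>" using \<tau>[of n] Dn[of n] by simp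
  qed (use B0 in auto)
  also have "\<dots> = 4740 * (real nb)\<^sup>2 * \<tau> ^ 6 * (K / \<eta>) * Om * A"
    by (simp add: A_def B_def sum_distrib_left[symmetric] eval_nat_numeral)
  finally have part1: "cmod (\<Sum>n1\<in>D. \<Sum>n2\<in>D. a n1 * cnj (a n2) * of_real (V n1 n2)) \<le> 4740 * (real nb)\<^sup>2 * \<tau> ^ 6 * (K / \<eta>) * Om * A" .
  show ?thesis unfolding split A_def[symmetric]
    by (rule order_trans[OF norm_triangle_ineq order_trans[OF add_mono[OF part1 part2]]]) (simp add: algebra_simps)
qed

text \<open>Splitting the columns into the classes 1 and 3 mod 4 makes all pairs admissible for
  Poisson summation, at the price of a factor 2. The rows \<open>s \<le> S\<close>, left out by the
  smoothed sum, are covered by the hypothesis itself. The constants are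
  \<open>81 * 4741 + 1 \<le> 400000\<close> per class.\<close>

theorem step_bound: "sieve_bd M N (10 ^ 6 * (real nb)\<^sup>2 * \<tau> ^ 6 * (K / \<eta>) * Om)"
  unfolding sieve_bd_def
proof
  fix a :: "nat \<Rightarrow> complex"
  define D where "D r = {n \<in> odd_block N. n mod 4 = r}" for r
  define R where "R r s = (cmod (\<Sum>n\<in>D r. a n * of_real (jr s n)))\<^sup>2" for r s
  define A where "A r = (\<Sum>n\<in>D r. (cmod (a n))\<^sup>2)" for r
  define Q where "Q = (real nb)\<^sup>2 * \<tau> ^ 6 * (K / \<eta>) * Om"
  have A0: "A r \<ge> 0" for r by (simp add: A_def sum_nonneg)
  have fD: "finite (D r)" for r by (simp add: D_def finite_odd_block)
  have nb1: "real nb \<ge> 1"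
  proof (rule ccontr)
    assume "\<not> real nb \<ge> 1"
    hence "nb = 0" by simp
    moreover have "N\<^sup>2 \<ge> 1" using N by (simp add: one_le_power)
    ultimately show False using nb by simp
  qed
  have S\<eta>: "S powr \<eta> \<ge> 1" using S1 \<eta> by (simp add: ge_one_powr_ge_zero)
  have OmM: "Om \<ge> M"
  proof -
    have "1 * M \<le> S powr \<eta> * om" using S\<eta> om_ge M by (intro mult_mono) auto
    thus ?thesis by (simp add: Om_def)
  qed
  have K\<eta>: "K \<le> K / \<eta>" using K \<eta> by (simp add: le_divide_eq mult_le_cancel_left1)
  have big1: "(real nb)\<^sup>2 * \<tau> ^ 6 \<ge> \<tau>" "(real nb)\<^sup>2 * \<tau> ^ 6 \<ge> 1"
  proof -
    have "1 * \<tau> \<le> (real nb)\<^sup>2 * \<tau> ^ 6" using nb1 tau1 by (intro mult_mono) (auto simp: one_le_power intro: self_le_power)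
    thus "(real nb)\<^sup>2 * \<tau> ^ 6 \<ge> \<tau>" by simp
    thus "(real nb)\<^sup>2 * \<tau> ^ 6 \<ge> 1" using tau1 by linarith
  qed
  have tM: "\<tau> * M \<le> Q"
  proof -
    have "\<tau> * 1 * M \<le> (real nb)\<^sup>2 * \<tau> ^ 6 * (K / \<eta>) * Om"
      using big1 K\<eta> K \<eta> OmM M tau1 by (intro mult_mono) auto
    thus ?thesis by (simp add: Q_def)
  qed
  have lamQ: "lam S N \<le> Q"
  proof -
    have "1 \<le> sqrt (M / S)" using S1 by simp
    hence "1 * S powr \<xi> \<le> sqrt (M / S) * S powr \<xi>" by (intro mult_right_mono) auto
    hence "N + S powr \<xi> \<le> om" unfolding om_def using MN by linarith
    hence "lam S N \<le> K * S powr \<eta> * om" unfolding lam_def using K by (intro mult_left_mono) auto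
    also have "\<dots> = 1 * K * Om" by (simp add: Om_def)
    also have "\<dots> \<le> (real nb)\<^sup>2 * \<tau> ^ 6 * (K / \<eta>) * Om"
      using big1 K\<eta> K \<eta> Om_nonneg by (intro mult_mono) auto
    finally show ?thesis by (simp add: Q_def)
  qed
  have Q0: "Q \<ge> 0" using tM tau1 M by (auto intro: order_trans[rotated])
  have cls: "(\<Sum>s\<in>sqfree_upto M. R r s) \<le> 400000 * Q * A r" for r
  proof -
    have Dr: "D r \<subseteq> odd_block N" "\<And>n. n \<in> D r \<Longrightarrow> n mod 4 = r" "\<And>n. n \<in> D r \<Longrightarrow> odd n" by (auto simp: D_def odd_block_def)
    have "sqfree_upto S \<subseteq> sqfree_upto M" using S1 by (auto simp: sqfree_upto_def)
    hence "(\<Sum>s\<in>sqfree_upto M. R r s) = (\<Sum>s\<in>sqfree_upto M - sqfree_upto S. R r s) + (\<Sum>s\<in>sqfree_upto S. R r s)"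
      by (rule sum.subset_diff[OF _ finite_sqfree_upto])
    moreover have "(\<Sum>s\<in>sqfree_upto M - sqfree_upto S. R r s) \<le> 81 * ((\<tau> * M + 4740 * (real nb)\<^sup>2 * \<tau> ^ 6 * (K / \<eta>) * Om) * A r)"
      unfolding R_def A_def by (rule order_trans[OF smoothed_sum_lower[OF fD Dr(3)] mult_left_mono[OF smoothed_sum_upper[OF Dr(1,2)]]]) auto
    moreover have "(\<Sum>s\<in>sqfree_upto S. R r s) \<le> lam S N * A r"
    proof -
      define b where "b n = of_bool (n mod 4 = r) * a n" for n
      have 1: "(\<Sum>n\<in>odd_block N. b n * of_real (jr s n)) = (\<Sum>n\<in>D r. a n * of_real (jr s n))" for s
        unfolding D_def b_def by (subst sum.inter_filter[OF finite_odd_block]) (auto intro!: sum.cong)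
      have 2: "(\<Sum>n\<in>odd_block N. (cmod (b n))\<^sup>2) = A r"
        unfolding A_def D_def b_def by (subst sum.inter_filter[OF finite_odd_block]) (auto intro!: sum.cong)
      show ?thesis unfolding R_def 1[symmetric] 2[symmetric] by (rule sieve_bdD[OF H_lam[OF S1(1) N]])
    qed
    moreover have "lam S N * A r \<le> Q * A r" using lamQ A0 by (rule mult_right_mono)
    moreover have "81 * ((\<tau> * M + 4740 * (real nb)\<^sup>2 * \<tau> ^ 6 * (K / \<eta>) * Om) * A r) \<le> 81 * ((Q + 4740 * Q) * A r)"
      using tM A0 by (intro mult_left_mono mult_right_mono add_mono) (auto simp: Q_def)
    moreover have "81 * ((Q + 4740 * Q) * A r) + Q * A r \<le> 400000 * Q * A r"
    proof -
      have "0 \<le> Q * A r" using Q0 A0 by simp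
      thus ?thesis by (simp add: algebra_simps)
    qed
    ultimately show ?thesis by linarith
  qed
  have un: "odd_block N = D 1 \<union> D 3" "D 1 \<inter> D 3 = {}"
    using odd_mod_4 by (auto simp: D_def odd_block_def)
  have "(cmod (\<Sum>n\<in>odd_block N. a n * of_real (jr s n)))\<^sup>2 \<le> 2 * R 1 s + 2 * R 3 s" for s
  proof -
    have "(\<Sum>n\<in>odd_block N. a n * of_real (jr s n)) = (\<Sum>n\<in>D 1. a n * of_real (jr s n)) + (\<Sum>n\<in>D 3. a n * of_real (jr s n))"
      unfolding un(1) by (rule sum.union_disjoint[OF fD fD un(2)])
    hence "cmod (\<Sum>n\<in>odd_block N. a n * of_real (jr s n)) \<le> cmod (\<Sum>n\<in>D 1. a n * of_real (jr s n)) + cmod (\<Sum>n\<in>D 3. a n * of_real (jr s n))"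
      by (simp only: norm_triangle_ineq)
    hence "(cmod (\<Sum>n\<in>odd_block N. a n * of_real (jr s n)))\<^sup>2 \<le> (cmod (\<Sum>n\<in>D 1. a n * of_real (jr s n)) + cmod (\<Sum>n\<in>D 3. a n * of_real (jr s n)))\<^sup>2"
      by (rule power_mono) simp
    also have "\<dots> \<le> 2 * R 1 s + 2 * R 3 s"
      unfolding R_def using sum_squares_bound[of "cmod (\<Sum>n\<in>D 1. a n * of_real (jr s n))" "cmod (\<Sum>n\<in>D 3. a n * of_real (jr s n))"]
      by (simp add: power2_sum)
    finally show ?thesis .
  qed
  hence "(\<Sum>s\<in>sqfree_upto M. (cmod (\<Sum>n\<in>odd_block N. a n * of_real (jr s n)))\<^sup>2) \<le> (\<Sum>s\<in>sqfree_upto M. 2 * R 1 s + 2 * R 3 s)"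
    by (rule sum_mono)
  also have "\<dots> = 2 * (\<Sum>s\<in>sqfree_upto M. R 1 s) + 2 * (\<Sum>s\<in>sqfree_upto M. R 3 s)" by (simp add: sum.distrib sum_distrib_left)
  also have "\<dots> \<le> 800000 * Q * (A 1 + A 3)" using cls[of 1] cls[of 3] by (simp add: algebra_simps)
  also have "\<dots> \<le> 10 ^ 6 * Q * (A 1 + A 3)" using Q0 A0 by (intro mult_right_mono) (auto simp: add_nonneg_nonneg)
  also have "A 1 + A 3 = (\<Sum>n\<in>odd_block N. (cmod (a n))\<^sup>2)"
    unfolding un(1) A_def by (rule sum.union_disjoint[OF fD fD un(2), symmetric])
  finally show "(\<Sum>s\<in>sqfree_upto M. (cmod (\<Sum>n\<in>odd_block N. a n * of_real (jr s n)))\<^sup>2) \<le>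
     10 ^ 6 * (real nb)\<^sup>2 * \<tau> ^ 6 * (K / \<eta>) * Om * (\<Sum>n\<in>odd_block N. (cmod (a n))\<^sup>2)"
    by (simp add: Q_def mult_ac)
qed

end

section \<open>Duality and iteration\<close>

text \<open>A matrix and its transpose have the same norm: the square sum \<open>X\<close> of the
  values \<open>T n\<close> is itself a bilinear form in \<open>b\<close> and
  \<open>cnj (T n)\<close>, so Cauchy-Schwarz and the hypothesis give
  \<open>X\<^sup>2 \<le> B * A * X\<close>.\<close>

lemma bilinear_duality:
  fixes k :: "'a \<Rightarrow> 'b \<Rightarrow> real" and b :: "'a \<Rightarrow> complex"
  assumes B: "\<And>a :: 'b \<Rightarrow> complex. (\<Sum>s\<in>R. (cmod (\<Sum>n\<in>C. a n * of_real (k s n)))\<^sup>2) \<le> B * (\<Sum>n\<in>C. (cmod (a n))\<^sup>2)"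
    and "B \<ge> 0"
  shows "(\<Sum>n\<in>C. (cmod (\<Sum>s\<in>R. b s * of_real (k s n)))\<^sup>2) \<le> B * (\<Sum>s\<in>R. (cmod (b s))\<^sup>2)"
proof -
  define T where "T n = (\<Sum>s\<in>R. b s * of_real (k s n))" for n
  define U where "U s = (\<Sum>n\<in>C. cnj (T n) * of_real (k s n))" for s
  define X where "X = (\<Sum>n\<in>C. (cmod (T n))\<^sup>2)"
  define A where "A = (\<Sum>s\<in>R. (cmod (b s))\<^sup>2)"
  have X0: "X \<ge> 0" and A0: "A \<ge> 0" by (simp_all add: X_def A_def sum_nonneg)
  have Tz: "T n * z = (\<Sum>s\<in>R. b s * (z * of_real (k s n)))" for n z
    by (simp add: T_def sum_distrib_left mult_ac)
  have "complex_of_real X = (\<Sum>n\<in>C. T n * cnj (T n))"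
    by (simp only: X_def of_real_sum complex_norm_square)
  also have "\<dots> = (\<Sum>n\<in>C. \<Sum>s\<in>R. b s * (cnj (T n) * of_real (k s n)))"
    by (simp only: Tz)
  also have "\<dots> = (\<Sum>s\<in>R. \<Sum>n\<in>C. b s * (cnj (T n) * of_real (k s n)))" by (rule sum.swap)
  also have "\<dots> = (\<Sum>s\<in>R. b s * U s)" by (simp only: U_def sum_distrib_left)
  finally have "X = cmod (\<Sum>s\<in>R. b s * U s)" using X0 by (metis abs_of_nonneg norm_of_real)
  also have "\<dots> \<le> (\<Sum>s\<in>R. cmod (b s) * cmod (U s))" by (rule order_trans[OF norm_sum]) (simp add: norm_mult)
  finally have "X\<^sup>2 \<le> (\<Sum>s\<in>R. cmod (b s) * cmod (U s))\<^sup>2" using X0 by (rule power_mono)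
  also have "\<dots> \<le> A * (\<Sum>s\<in>R. (cmod (U s))\<^sup>2)" unfolding A_def by (rule Cauchy_Schwarz_ineq_sum)
  also have "\<dots> \<le> A * (B * (\<Sum>n\<in>C. (cmod (cnj (T n)))\<^sup>2))" unfolding U_def by (intro mult_left_mono B A0)
  also have "\<dots> = B * A * X" by (simp add: X_def)
  finally have "X * X \<le> B * A * X" by (simp add: power2_eq_square)
  hence "X \<le> B * A" using X0 A0 assms(2) by (cases "X = 0") (auto simp: mult_le_cancel_right)
  thus ?thesis by (simp add: X_def T_def A_def)
qed

text \<open>The same estimate with the powers carried by the column length or by the row length; the two are exchanged by duality
  and quadratic reciprocity.\<close>

definition col_estimate :: "real \<Rightarrow> real \<Rightarrow> real \<Rightarrow> bool" where
  "col_estimate K \<eta> \<xi> \<longleftrightarrow> (\<forall>Y\<ge>1. \<forall>N\<ge>1. sieve_bd Y N (K * N powr \<eta> * (Y + N powr \<xi>)))"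

definition row_estimate :: "real \<Rightarrow> real \<Rightarrow> real \<Rightarrow> bool" where
  "row_estimate K \<eta> \<xi> \<longleftrightarrow> (\<forall>Y\<ge>1. \<forall>N\<ge>1. sieve_bd Y N (K * Y powr \<eta> * (N + Y powr \<xi>)))"

definition odd_sqfree_upto :: "real \<Rightarrow> nat set" where "odd_sqfree_upto Y = {t. odd t \<and> squarefree t \<and> real t \<le> Y}"

lemma finite_odd_sqfree_upto: "finite (odd_sqfree_upto Y)"
  by (rule finite_subset[OF _ finite_sqfree_upto[of Y]]) (auto simp: odd_sqfree_upto_def sqfree_upto_def)

text \<open>Reciprocity needs an odd upper entry, and its sign depends on the class mod 4. Rows are
  therefore sorted by the power of 2 they contain and by the class of their odd part.\<close>

lemma sum_sqfree_upto_odd_parts: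
  fixes f :: "nat \<Rightarrow> 'a::comm_semiring_1"
  shows "(\<Sum>s\<in>sqfree_upto Y. f s) = (\<Sum>x\<in>{0, 1::nat} \<times> {1, 3::nat}. \<Sum>t\<in>odd_sqfree_upto Y. of_bool (t mod 4 = snd x \<and> 2 ^ fst x * t \<in> sqfree_upto Y) * f (2 ^ fst x * t))"
proof -
  let ?P = "({0, 1::nat} \<times> {1, 3::nat}) \<times> odd_sqfree_upto Y"
  let ?Q = "{x \<in> ?P. snd x mod 4 = snd (fst x) \<and> 2 ^ fst (fst x) * snd x \<in> sqfree_upto Y}"
  have "(\<Sum>x\<in>{0, 1::nat} \<times> {1, 3::nat}. \<Sum>t\<in>odd_sqfree_upto Y. of_bool (t mod 4 = snd x \<and> 2 ^ fst x * t \<in> sqfree_upto Y) * f (2 ^ fst x * t)) =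
    (\<Sum>x\<in>?P. of_bool (snd x mod 4 = snd (fst x) \<and> 2 ^ fst (fst x) * snd x \<in> sqfree_upto Y) * f (2 ^ fst (fst x) * snd x))"
    by (simp only: sum.cartesian_product split_beta')
  also have "\<dots> = (\<Sum>x\<in>?Q. of_bool (snd x mod 4 = snd (fst x) \<and> 2 ^ fst (fst x) * snd x \<in> sqfree_upto Y) * f (2 ^ fst (fst x) * snd x))"
  proof (rule sum.mono_neutral_right)
    show "finite ?P" using finite_odd_sqfree_upto by simp
  qed auto
  also have "\<dots> = (\<Sum>s\<in>sqfree_upto Y. f s)"
  proof (rule sum.reindex_bij_witness[of _ "\<lambda>s. ((of_bool (even s), (if even s then s div 2 else s) mod 4), if even s then s div 2 else s)" "\<lambda>x. 2 ^ fst (fst x) * snd x"])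
    fix x assume x: "x \<in> ?Q"
    then obtain i c t where xx: "x = ((i, c), t)" "i = 0 \<or> i = 1" "odd t" "t mod 4 = c" "2 ^ i * t \<in> sqfree_upto Y"
      by (cases x) (auto simp: odd_sqfree_upto_def)
    show "((of_bool (even (2 ^ fst (fst x) * snd x)), (if even (2 ^ fst (fst x) * snd x) then (2 ^ fst (fst x) * snd x) div 2 else 2 ^ fst (fst x) * snd x) mod 4),
       if even (2 ^ fst (fst x) * snd x) then (2 ^ fst (fst x) * snd x) div 2 else 2 ^ fst (fst x) * snd x) = x"
      using xx by auto
    show "2 ^ fst (fst x) * snd x \<in> sqfree_upto Y" using xx by simp
    show "f (2 ^ fst (fst x) * snd x) = of_bool (snd x mod 4 = snd (fst x) \<and> 2 ^ fst (fst x) * snd x \<in> sqfree_upto Y) * f (2 ^ fst (fst x) * snd x)"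
      using xx by simp
  next
    fix s assume s: "s \<in> sqfree_upto Y"
    define t where "t = (if even s then s div 2 else s)"
    have st: "s = 2 ^ of_bool (even s) * t" by (simp add: t_def)
    have o: "odd t"
    proof (cases "even s")
      case True
      show ?thesis
      proof
        assume "even t"
        hence "2\<^sup>2 dvd s" using True st by (auto simp: power2_eq_square elim!: evenE)
        hence "(2::nat) dvd 1" using s squarefreeD[of s 2] by (auto simp: sqfree_upto_def)
        thus False by simp
      qed
    qed (simp add: t_def)
    have sq: "squarefree t" using s st squarefree_multD(2)[of "2 ^ of_bool (even s)" t] by (auto simp: sqfree_upto_def)
    have "t \<le> s" by (simp add: t_def)
    hence "t \<in> odd_sqfree_upto Y" using o sq s by (auto simp: odd_sqfree_upto_def sqfree_upto_def)
    moreover have "t mod 4 \<in> {1, 3}" using odd_mod_4[OF o] by auto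
    ultimately have "((of_bool (even s), t mod 4), t) \<in> ?Q" using s st by auto
    thus "((of_bool (even s), (if even s then s div 2 else s) mod 4), if even s then s div 2 else s) \<in> ?Q" unfolding t_def .
    show "2 ^ fst (fst ((of_bool (even s), (if even s then s div 2 else s) mod 4), if even s then s div 2 else s)) *
       snd ((of_bool (even s), (if even s then s div 2 else s) mod 4), if even s then s div 2 else s) = s"
      using st unfolding t_def by simp
  qed
  finally show ?thesis by simp
qed

lemma Cauchy_weighted:
  fixes x :: "'a \<Rightarrow> real" assumes "\<And>j. j \<in> J \<Longrightarrow> w j > 0"
  shows "(\<Sum>j\<in>J. x j)\<^sup>2 \<le> (\<Sum>j\<in>J. w j) * (\<Sum>j\<in>J. (x j)\<^sup>2 / w j)"
proof -
  have "(\<Sum>j\<in>J. x j) = (\<Sum>j\<in>J. sqrt (w j) * (x j / sqrt (w j)))" using assms by (intro sum.cong refl) (simp add: less_imp_neq[OF assms, THEN not_sym])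
  moreover have "(\<Sum>j\<in>J. sqrt (w j) * (x j / sqrt (w j)))\<^sup>2 \<le> (\<Sum>j\<in>J. (sqrt (w j))\<^sup>2) * (\<Sum>j\<in>J. (x j / sqrt (w j))\<^sup>2)"
    by (rule Cauchy_Schwarz_ineq_sum)
  moreover have "(\<Sum>j\<in>J. (sqrt (w j))\<^sup>2) = (\<Sum>j\<in>J. w j)" using assms by (intro sum.cong refl) (simp add: less_imp_le)
  moreover have "(\<Sum>j\<in>J. (x j / sqrt (w j))\<^sup>2) = (\<Sum>j\<in>J. (x j)\<^sup>2 / w j)"
    using assms by (intro sum.cong refl) (simp add: power_divide less_imp_le)
  ultimately show ?thesis by simp
qed

text \<open>The hypothesis concerns one block of \<open>t\<close> at a time. In the weighted
  Cauchy-Schwarz inequality the weights equal the losses \<open>((11/10) ^ j) powr \<eta>\<close> of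
  the blocks; they cancel, and their sum costs \<open>22 / \<eta> * Y powr \<eta>\<close>. Together
  with 11/10 from the row length this gives 25.\<close>

lemma odd_row_bound:
  fixes b :: "nat \<Rightarrow> complex"
  assumes H: "col_estimate K \<eta> \<xi>" and K: "K \<ge> 0" and \<eta>: "0 < \<eta>" "\<eta> \<le> 1" and \<xi>: "\<xi> \<ge> 0" and Y: "Y \<ge> 1" and L: "L \<ge> 1"
  shows "(\<Sum>n\<in>odd_block L. (cmod (\<Sum>t\<in>odd_sqfree_upto Y. b t * of_real (jr n t)))\<^sup>2) \<le> 25 * K / \<eta> * Y powr \<eta> * (L + Y powr \<xi>) * (\<Sum>t\<in>odd_sqfree_upto Y. (cmod (b t))\<^sup>2)"
proof -
  define J where "J = Suc (blk Y)"
  define w where "w j = ((11/10) ^ j :: real) powr \<eta>" for j :: nat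
  define bj where "bj j t = of_bool (t \<in> odd_sqfree_upto Y \<and> blk (real t) = j) * b t" for j t
  define X where "X j n = (\<Sum>t\<in>odd_block ((11/10) ^ j). bj j t * of_real (jr n t))" for j n
  define A where "A j = (\<Sum>t\<in>odd_block ((11/10) ^ j). (cmod (bj j t))\<^sup>2)" for j
  have w0: "w j > 0" for j by (simp add: w_def)
  have p1: "(11/10 :: real) ^ j \<ge> 1" for j by (simp add: one_le_power)
  have t1: "real t \<ge> 1" if "t \<in> odd_sqfree_upto Y" for t using that odd_pos[of t] by (auto simp: odd_sqfree_upto_def)
  have tJ: "blk (real t) < J" if "t \<in> odd_sqfree_upto Y" for t
  proof (rule blk_less[OF t1[OF that]])
    have "real t \<le> Y" using that by (simp add: odd_sqfree_upto_def)
    also have "\<dots> < (11/10) ^ J" using blk(2)[OF Y] by (simp add: J_def)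
    finally show "real t < (11/10) ^ J" .
  qed
  have Yj: "(11/10) ^ j \<le> Y" if "j < J" for j
  proof -
    have "(11/10 :: real) ^ j \<le> (11/10) ^ blk Y" using that by (intro power_increasing) (auto simp: J_def)
    thus ?thesis using blk(1)[OF Y] by linarith
  qed
  have Cj: "{t \<in> odd_sqfree_upto Y. blk (real t) = j} \<subseteq> odd_block ((11/10) ^ j)" for j
    using blk[OF t1] by (auto simp: odd_block_def odd_sqfree_upto_def)
  have fibre: "(\<Sum>t\<in>odd_block ((11/10) ^ j). of_bool (t \<in> odd_sqfree_upto Y \<and> blk (real t) = j) * g t) = (\<Sum>t\<in>{t \<in> odd_sqfree_upto Y. blk (real t) = j}. g t)"
    for j and g :: "nat \<Rightarrow> 'c::comm_semiring_1"
  proof -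
    have "(\<Sum>t\<in>{t \<in> odd_sqfree_upto Y. blk (real t) = j}. g t) = (\<Sum>t\<in>{t \<in> odd_sqfree_upto Y. blk (real t) = j}. of_bool (t \<in> odd_sqfree_upto Y \<and> blk (real t) = j) * g t)"
      by (intro sum.cong refl) auto
    also have "\<dots> = (\<Sum>t\<in>odd_block ((11/10) ^ j). of_bool (t \<in> odd_sqfree_upto Y \<and> blk (real t) = j) * g t)"
      by (rule sum.mono_neutral_left[OF finite_odd_block Cj]) auto
    finally show ?thesis ..
  qed
  have dec: "(\<Sum>t\<in>odd_sqfree_upto Y. b t * of_real (jr n t)) = (\<Sum>j<J. X j n)" for n
  proof -
    have "(\<Sum>t\<in>odd_sqfree_upto Y. b t * of_real (jr n t)) = (\<Sum>j<J. \<Sum>t\<in>{t \<in> odd_sqfree_upto Y. blk (real t) = j}. b t * of_real (jr n t))"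
      by (rule sum.group[symmetric]) (use finite_odd_sqfree_upto tJ in auto)
    also have "\<dots> = (\<Sum>j<J. X j n)" unfolding X_def bj_def mult.assoc fibre ..
    finally show ?thesis .
  qed
  have decA: "(\<Sum>t\<in>odd_sqfree_upto Y. (cmod (b t))\<^sup>2) = (\<Sum>j<J. A j)"
  proof -
    have "(\<Sum>t\<in>odd_sqfree_upto Y. (cmod (b t))\<^sup>2) = (\<Sum>j<J. \<Sum>t\<in>{t \<in> odd_sqfree_upto Y. blk (real t) = j}. (cmod (b t))\<^sup>2)"
      by (rule sum.group[symmetric]) (use finite_odd_sqfree_upto tJ in auto)
    also have "\<dots> = (\<Sum>j<J. A j)" unfolding A_def bj_def fibre[symmetric]
      by (intro sum.cong refl) (auto simp: of_bool_def)
    finally show ?thesis .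
  qed
  have Wsum: "(\<Sum>j<J. w j) \<le> 22 / \<eta> * Y powr \<eta>"
  proof -
    \<comment> \<open>Reversed, the sum runs downward from the largest block, as in
      \<open>sum_block_powr\<close>.\<close>
    have "(\<Sum>j<J. w j) = (\<Sum>j<J. w (J - Suc j))" by (rule sum.nat_diff_reindex[symmetric])
    also have "\<dots> = (\<Sum>j<J. ((11/10) ^ blk Y / (11/10) ^ j) powr \<eta>)"
      by (intro sum.cong refl) (auto simp: w_def J_def power_diff)
    also have "\<dots> \<le> 22 / \<eta> * ((11/10) ^ blk Y) powr \<eta>" by (rule sum_block_powr) (use \<eta> in auto)
    also have "\<dots> \<le> 22 / \<eta> * Y powr \<eta>" using \<eta> blk(1)[OF Y] by (intro mult_left_mono powr_mono2) auto
    finally show ?thesis .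
  qed
  have Xb: "(\<Sum>n\<in>odd_block L. (cmod (X j n))\<^sup>2 / w j) \<le> 11/10 * K * (L + Y powr \<xi>) * A j" if j: "j < J" for j
  proof -
    \<comment> \<open>Here \<open>n\<close> is the row and \<open>t\<close> the column: the block of
      \<open>n\<close> is enlarged to all squarefree integers up to
      \<open>11/10 * L\<close>.\<close>
    have "(\<Sum>n\<in>odd_block L. (cmod (X j n))\<^sup>2) \<le> (\<Sum>n\<in>sqfree_upto (11/10 * L). (cmod (X j n))\<^sup>2)"
      by (rule sum_mono2[OF finite_sqfree_upto]) (auto simp: odd_block_def sqfree_upto_def)
    also have "\<dots> \<le> K * w j * (11/10 * L + ((11/10) ^ j) powr \<xi>) * A j"
      unfolding X_def A_def w_def by (rule sieve_bdD) (use H L p1 in \<open>simp add: col_estimate_def\<close>)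
    also have "\<dots> \<le> K * w j * (11/10 * (L + Y powr \<xi>)) * A j"
    proof (intro mult_right_mono mult_left_mono)
      have "((11/10) ^ j) powr \<xi> \<le> Y powr \<xi>" using \<xi> Yj[OF j] by (intro powr_mono2) auto
      moreover have "0 \<le> Y powr \<xi>" by simp
      moreover have "u \<le> v \<Longrightarrow> 0 \<le> v \<Longrightarrow> 11/10 * L + u \<le> 11/10 * (L + v)" for u v :: real by simp
      ultimately show "11/10 * L + ((11/10) ^ j) powr \<xi> \<le> 11/10 * (L + Y powr \<xi>)" by (simp only:)
    qed (use K w0[of j] in \<open>auto simp: A_def sum_nonneg\<close>)
    finally have "(\<Sum>n\<in>odd_block L. (cmod (X j n))\<^sup>2) / w j \<le> K * w j * (11/10 * (L + Y powr \<xi>)) * A j / w j"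
      using w0[of j] by (intro divide_right_mono) auto
    thus ?thesis using w0[of j] by (simp add: sum_divide_distrib mult_ac)
  qed
  have A0: "A j \<ge> 0" for j by (simp add: A_def sum_nonneg)
  have "(\<Sum>n\<in>odd_block L. (cmod (\<Sum>t\<in>odd_sqfree_upto Y. b t * of_real (jr n t)))\<^sup>2) \<le> (\<Sum>n\<in>odd_block L. (\<Sum>j<J. w j) * (\<Sum>j<J. (cmod (X j n))\<^sup>2 / w j))"
  proof (rule sum_mono)
    fix n
    have "(cmod (\<Sum>t\<in>odd_sqfree_upto Y. b t * of_real (jr n t)))\<^sup>2 \<le> (\<Sum>j<J. cmod (X j n))\<^sup>2"
      unfolding dec by (intro power_mono norm_sum) auto
    also have "\<dots> \<le> (\<Sum>j<J. w j) * (\<Sum>j<J. (cmod (X j n))\<^sup>2 / w j)" by (rule Cauchy_weighted) (rule w0)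
    finally show "(cmod (\<Sum>t\<in>odd_sqfree_upto Y. b t * of_real (jr n t)))\<^sup>2 \<le> (\<Sum>j<J. w j) * (\<Sum>j<J. (cmod (X j n))\<^sup>2 / w j)" .
  qed
  also have "\<dots> = (\<Sum>j<J. w j) * (\<Sum>j<J. \<Sum>n\<in>odd_block L. (cmod (X j n))\<^sup>2 / w j)"
    by (subst sum.swap) (simp only: sum_distrib_left)
  also have "\<dots> \<le> (22 / \<eta> * Y powr \<eta>) * (\<Sum>j<J. 11/10 * K * (L + Y powr \<xi>) * A j)"
  proof (rule mult_mono[OF Wsum])
    show "(\<Sum>j<J. \<Sum>n\<in>odd_block L. (cmod (X j n))\<^sup>2 / w j) \<le> (\<Sum>j<J. 11/10 * K * (L + Y powr \<xi>) * A j)"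
      by (rule sum_mono) (rule Xb, simp)
    show "0 \<le> 22 / \<eta> * Y powr \<eta>" using \<eta> by simp
    show "0 \<le> (\<Sum>j<J. \<Sum>n\<in>odd_block L. (cmod (X j n))\<^sup>2 / w j)"
      using w0 by (intro sum_nonneg divide_nonneg_pos) auto
  qed
  also have "\<dots> = (242/10) * (K / \<eta> * Y powr \<eta> * (L + Y powr \<xi>) * (\<Sum>j<J. A j))"
    by (simp only: sum_distrib_left[symmetric]) simp
  also have "\<dots> \<le> 25 * (K / \<eta> * Y powr \<eta> * (L + Y powr \<xi>) * (\<Sum>j<J. A j))"
    using K \<eta> L sum_nonneg[of "{..<J}" A, OF A0] by (intro mult_right_mono) auto
  finally show ?thesis unfolding decA by (simp add: mult_ac)
qed

text \<open>By duality the sums over \<open>s\<close> at fixed \<open>n\<close> are to be bounded.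
  For \<open>s = 2 ^ i * t\<close> the symbol of \<open>s\<close> over \<open>n\<close> is that of
  \<open>2 ^ i\<close>, times the reciprocity sign, times the symbol of \<open>n\<close> over
  \<open>t\<close>. The first two factors are constant on each of four classes, and Cauchy-Schwarz
  over these gives \<open>100 = 4 * 25\<close>.\<close>

lemma row_estimate_of_col_estimate:
  assumes H: "col_estimate K \<eta> \<xi>" and K: "K \<ge> 0" and \<eta>: "0 < \<eta>" "\<eta> \<le> 1" and \<xi>: "\<xi> \<ge> 0"
  shows "row_estimate (100 * K / \<eta>) \<eta> \<xi>"
  unfolding row_estimate_def
proof (intro allI impI)
  fix Y L :: real assume Y: "Y \<ge> 1" and L: "L \<ge> 1"
  define B where "B = 25 * K / \<eta> * Y powr \<eta> * (L + Y powr \<xi>)"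
  have B0: "B \<ge> 0" unfolding B_def using K \<eta> L by simp
  have dual: "(\<Sum>n\<in>odd_block L. (cmod (\<Sum>s\<in>sqfree_upto Y. b s * of_real (jr s n)))\<^sup>2) \<le> 4 * B * (\<Sum>s\<in>sqfree_upto Y. (cmod (b s))\<^sup>2)" for b :: "nat \<Rightarrow> complex"
  proof -
    let ?I = "{0, 1::nat} \<times> {1, 3::nat}"
    define \<beta> where "\<beta> x t = of_bool (t mod 4 = snd x \<and> 2 ^ fst x * t \<in> sqfree_upto Y) * b (2 ^ fst x * t)" for x :: "nat \<times> nat" and t
    have cls: "cmod (\<Sum>t\<in>odd_sqfree_upto Y. \<beta> x t * of_real (jr (2 ^ fst x * t) n)) \<le> cmod (\<Sum>t\<in>odd_sqfree_upto Y. \<beta> x t * of_real (jr n t))"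
      if n: "n \<in> odd_block L" for x n
    proof -
      have on: "odd n" using n by (simp add: odd_block_def)
      have "(\<Sum>t\<in>odd_sqfree_upto Y. \<beta> x t * of_real (jr (2 ^ fst x * t) n)) =
        (\<Sum>t\<in>odd_sqfree_upto Y. of_real (jr (2 ^ fst x) n * of_int (rsgn (snd x) n)) * (\<beta> x t * of_real (jr n t)))"
      proof (intro sum.cong refl)
        fix t assume t: "t \<in> odd_sqfree_upto Y"
        hence ot: "odd t" by (simp add: odd_sqfree_upto_def)
        show "\<beta> x t * of_real (jr (2 ^ fst x * t) n) = of_real (jr (2 ^ fst x) n * of_int (rsgn (snd x) n)) * (\<beta> x t * of_real (jr n t))"
        proof (cases "t mod 4 = snd x")
          case True
          have r: "rsgn (snd x) n = rsgn t n" by (simp add: rsgn_def flip: True)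
          have "jr t n = of_int (rsgn t n) * jr n t"
          proof (cases "coprime t n")
            case True
            have "jac (int t) n * jac (int n) t = rsgn t n" by (rule jac_reciprocity[OF ot on True])
            hence "jac (int t) n * (jac (int n) t * jac (int n) t) = rsgn t n * jac (int n) t" by (simp flip: mult.assoc)
            moreover have "jac (int n) t * jac (int n) t = 1"
              using jac_square[OF ot, of "int n"] True by (simp add: power2_eq_square coprime_commute)
            ultimately have "jac (int t) n = rsgn t n * jac (int n) t" by simp
            thus ?thesis by (simp add: jr_def)
          next
            case False
            hence "jac (int t) n = 0" "jac (int n) t = 0"
              using jac_eq_0_iff[OF on, of "int t"] jac_eq_0_iff[OF ot, of "int n"] by (simp_all add: coprime_commute)
            thus ?thesis by (simp add: jr_def)
          qed
          thus ?thesis unfolding r jr_mult[OF on] by simp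
        next
          case False
          thus ?thesis by (simp add: \<beta>_def)
        qed
      qed
      also have "\<dots> = of_real (jr (2 ^ fst x) n * of_int (rsgn (snd x) n)) * (\<Sum>t\<in>odd_sqfree_upto Y. \<beta> x t * of_real (jr n t))"
        by (simp only: sum_distrib_left)
      finally have "cmod (\<Sum>t\<in>odd_sqfree_upto Y. \<beta> x t * of_real (jr (2 ^ fst x * t) n)) =
         \<bar>jr (2 ^ fst x) n * of_int (rsgn (snd x) n)\<bar> * cmod (\<Sum>t\<in>odd_sqfree_upto Y. \<beta> x t * of_real (jr n t))"
        by (simp only: norm_mult norm_of_real)
      also have "\<dots> \<le> 1 * cmod (\<Sum>t\<in>odd_sqfree_upto Y. \<beta> x t * of_real (jr n t))"
        using jr_abs_le[OF on, of "2 ^ fst x"] by (intro mult_right_mono) (auto simp: rsgn_def abs_mult)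
      finally show ?thesis by simp
    qed
    have "(\<Sum>n\<in>odd_block L. (cmod (\<Sum>s\<in>sqfree_upto Y. b s * of_real (jr s n)))\<^sup>2) \<le> (\<Sum>n\<in>odd_block L. 4 * (\<Sum>x\<in>?I. (cmod (\<Sum>t\<in>odd_sqfree_upto Y. \<beta> x t * of_real (jr n t)))\<^sup>2))"
    proof (rule sum_mono)
      fix n assume n: "n \<in> odd_block L"
      have "(\<Sum>s\<in>sqfree_upto Y. b s * of_real (jr s n)) = (\<Sum>x\<in>?I. \<Sum>t\<in>odd_sqfree_upto Y. \<beta> x t * of_real (jr (2 ^ fst x * t) n))"
        unfolding sum_sqfree_upto_odd_parts \<beta>_def by (simp only: mult.assoc)
      hence "cmod (\<Sum>s\<in>sqfree_upto Y. b s * of_real (jr s n)) \<le> (\<Sum>x\<in>?I. cmod (\<Sum>t\<in>odd_sqfree_upto Y. \<beta> x t * of_real (jr (2 ^ fst x * t) n)))"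
        by (simp only: norm_sum)
      also have "\<dots> \<le> (\<Sum>x\<in>?I. cmod (\<Sum>t\<in>odd_sqfree_upto Y. \<beta> x t * of_real (jr n t)))" by (rule sum_mono) (rule cls[OF n])
      finally have "(cmod (\<Sum>s\<in>sqfree_upto Y. b s * of_real (jr s n)))\<^sup>2 \<le> (\<Sum>x\<in>?I. cmod (\<Sum>t\<in>odd_sqfree_upto Y. \<beta> x t * of_real (jr n t)))\<^sup>2"
        by (rule power_mono) simp
      also have "\<dots> \<le> (\<Sum>x\<in>?I. 1) * (\<Sum>x\<in>?I. (cmod (\<Sum>t\<in>odd_sqfree_upto Y. \<beta> x t * of_real (jr n t)))\<^sup>2 / 1)"
        by (rule Cauchy_weighted) simp
      finally show "(cmod (\<Sum>s\<in>sqfree_upto Y. b s * of_real (jr s n)))\<^sup>2 \<le> 4 * (\<Sum>x\<in>?I. (cmod (\<Sum>t\<in>odd_sqfree_upto Y. \<beta> x t * of_real (jr n t)))\<^sup>2)"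
        by simp
    qed
    also have "\<dots> = 4 * (\<Sum>x\<in>?I. \<Sum>n\<in>odd_block L. (cmod (\<Sum>t\<in>odd_sqfree_upto Y. \<beta> x t * of_real (jr n t)))\<^sup>2)"
      unfolding sum_distrib_left by (rule sum.swap)
    also have "\<dots> \<le> 4 * (\<Sum>x\<in>?I. B * (\<Sum>t\<in>odd_sqfree_upto Y. (cmod (\<beta> x t))\<^sup>2))"
      unfolding B_def by (rule mult_left_mono, rule sum_mono, rule odd_row_bound[OF H K \<eta> \<xi> Y L]) simp
    also have "\<dots> = 4 * B * (\<Sum>x\<in>?I. \<Sum>t\<in>odd_sqfree_upto Y. (cmod (\<beta> x t))\<^sup>2)" by (simp only: sum_distrib_left mult.assoc)
    also have "(\<Sum>x\<in>?I. \<Sum>t\<in>odd_sqfree_upto Y. (cmod (\<beta> x t))\<^sup>2) = (\<Sum>s\<in>sqfree_upto Y. (cmod (b s))\<^sup>2)"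
      unfolding sum_sqfree_upto_odd_parts[of "\<lambda>s. (cmod (b s))\<^sup>2"] split_beta by (intro sum.cong refl) (auto simp: \<beta>_def)
    finally show ?thesis .
  qed
  have "sieve_bd Y L (4 * B)" unfolding sieve_bd_def
    by (rule allI, rule bilinear_duality[where k = "\<lambda>n s. jr s n", OF dual]) (use B0 in simp)
  thus "sieve_bd Y L (100 * K / \<eta> * Y powr \<eta> * (L + Y powr \<xi>))" by (simp add: B_def mult_ac)
qed

lemma col_estimate_mono: "col_estimate K \<eta> \<xi> \<Longrightarrow> K \<le> K' \<Longrightarrow> col_estimate K' \<eta> \<xi>"
  unfolding col_estimate_def by (intro allI impI, rule sieve_bd_mono[OF _ order_refl]) (auto intro!: mult_right_mono)

section \<open>One recursion step and its iteration\<close>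

definition tau_const :: "real \<Rightarrow> real" where "tau_const \<delta> = 2 powr (2 powr (1 / \<delta>))"

lemma tau_const_ge_1: "tau_const \<delta> \<ge> 1" by (simp add: tau_const_def ge_one_powr_ge_zero)

lemma ln_11_10: "1/11 \<le> ln (11/10 :: real)"
proof -
  have "ln (10/11 :: real) \<le> - (1/11)" using ln_le_minus_one[of "10/11"] by simp
  thus ?thesis using ln_inverse[of "11/10"] by (simp add: inverse_eq_divide)
qed

text \<open>Both \<open>\<tau>\<close> and \<open>nb\<close> are at most a constant times
  \<open>N powr \<delta>\<close>, the latter since a logarithm is at most
  \<open>N powr \<delta> / \<delta>\<close>. Six factors of the first and two of the second make up
  \<open>N powr (8 * \<delta>)\<close>, and
  \<open>4 * 10 ^ 10 = 10 ^ 6 * 25\<^sup>2 * 2 ^ 6\<close>.\<close>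

lemma step_general:
  assumes H: "row_estimate K \<eta> \<xi>" and K: "K \<ge> 1" and \<eta>: "0 < \<eta>" "\<eta> \<le> 1" and \<xi>: "1 \<le> \<xi>" "\<xi> \<le> 2"
    and \<delta>: "0 < \<delta>" "\<delta> \<le> 1" and N: "N \<ge> 1" and MN: "M \<ge> N" and S: "S = max 1 (N\<^sup>2 / M)"
  shows "sieve_bd M N (4 * 10 ^ 10 * tau_const \<delta> ^ 6 * (K / (\<delta>\<^sup>2 * \<eta>)) * N powr (8 * \<delta>) * (S powr \<eta> * (M + sqrt (M / S) * S powr \<xi>)))"
proof -
  define nb where "nb = Suc (blk (121/100 * N\<^sup>2))"
  define \<tau> where "\<tau> = 2 * tau_const \<delta> * N powr \<delta>"
  have N2: "N\<^sup>2 \<ge> 1" using N by (simp add: one_le_power)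
  have u1: "121/100 * N\<^sup>2 \<ge> 1" using N2 by linarith
  have Nd: "N powr \<delta> \<ge> 1" using N \<delta> by (simp add: ge_one_powr_ge_zero)
  interpret s: sieve_step K \<eta> \<xi> M N S \<tau> nb
  proof
    show "sieve_bd Y L (K * Y powr \<eta> * (L + Y powr \<xi>))" if "Y \<ge> 1" "L \<ge> 1" for Y L using H that by (simp add: row_estimate_def)
    show "121/100 * N\<^sup>2 < (11/10) ^ nb" using blk(2)[OF u1] by (simp add: nb_def)
    show "real (tau n) \<le> \<tau>" if n: "squarefree n" "real n \<le> 11/10 * N" for n
    proof -
      have "real n powr \<delta> \<le> (2 * N) powr \<delta>" using n(2) N \<delta> by (intro powr_mono2) auto
      also have "\<dots> = 2 powr \<delta> * N powr \<delta>" using N by (simp add: powr_mult)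
      also have "\<dots> \<le> 2 powr 1 * N powr \<delta>" using \<delta> by (intro mult_right_mono powr_mono) auto
      finally have "real n powr \<delta> \<le> 2 * N powr \<delta>" by simp
      hence "tau_const \<delta> * real n powr \<delta> \<le> tau_const \<delta> * (2 * N powr \<delta>)" using tau_const_ge_1[of \<delta>] by (intro mult_left_mono) auto
      thus ?thesis using tau_bound[OF n(1) \<delta>(1), folded tau_const_def] by (simp only: \<tau>_def mult.assoc mult.left_commute)
    qed
  qed (use assms in auto)
  have nb: "real nb \<le> 25 * N powr \<delta> / \<delta>"
  proof -
    define b where "b = real (blk (121/100 * N\<^sup>2))"
    have "(11/10) ^ blk (121/100 * N\<^sup>2) \<le> (11/10 * N)\<^sup>2"
      using blk(1)[OF u1] by (simp add: power2_eq_square)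
    hence "ln ((11/10) ^ blk (121/100 * N\<^sup>2)) \<le> ln ((11/10 * N)\<^sup>2)" using N by (subst ln_le_cancel_iff) auto
    hence "b * ln (11/10) \<le> 2 * ln (11/10 * N)" using N unfolding b_def by (subst (asm) (1 2) ln_realpow) auto
    also have "ln (11/10 * N) = ln (11/10) + ln N" using N by (subst ln_mult) auto
    finally have b: "(b - 2) * ln (11/10) \<le> 2 * ln N" by (simp only: algebra_simps)
    have "b \<le> 2 + 22 * ln N"
    proof (cases "b \<le> 2")
      case True
      moreover have "ln N \<ge> 0" using N by simp
      ultimately show ?thesis by linarith
    next
      case False
      hence "(b - 2) * (1/11) \<le> (b - 2) * ln (11/10)" using ln_11_10 by (intro mult_left_mono) auto
      from order_trans[OF this b] show ?thesis by (simp add: field_simps)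
    qed
    hence "real nb \<le> 3 + 22 * ln N" by (simp add: nb_def b_def)
    also have "\<dots> \<le> 3 * (N powr \<delta> / \<delta>) + 22 * (N powr \<delta> / \<delta>)"
    proof (intro add_mono mult_left_mono)
      have "1 \<le> N powr \<delta> / \<delta>" using Nd \<delta> by (simp add: le_divide_eq)
      thus "3 \<le> 3 * (N powr \<delta> / \<delta>)" by linarith
      show "ln N \<le> N powr \<delta> / \<delta>" using ln_powr_bound[OF N \<delta>(1)] .
    qed simp
    finally show ?thesis by simp
  qed
  have "10 ^ 6 * (real nb)\<^sup>2 * \<tau> ^ 6 * (K / \<eta>) * s.Om \<le> 10 ^ 6 * (25 * N powr \<delta> / \<delta>)\<^sup>2 * \<tau> ^ 6 * (K / \<eta>) * s.Om"
    using nb K \<eta> s.Om_nonneg s.tau1 by (intro mult_right_mono mult_left_mono power_mono) auto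
  also have "\<dots> = (10 ^ 6 * 625 * 64) * tau_const \<delta> ^ 6 * (K / (\<delta>\<^sup>2 * \<eta>)) * ((N powr \<delta>)\<^sup>2 * (N powr \<delta>) ^ 6) * s.Om"
    unfolding \<tau>_def power_mult_distrib power_divide by (simp add: mult_ac)
  also have "(N powr \<delta>)\<^sup>2 * (N powr \<delta>) ^ 6 = N powr (8 * \<delta>)"
  proof -
    have "(N powr \<delta>)\<^sup>2 * (N powr \<delta>) ^ 6 = (N powr \<delta>) ^ 8" by (simp flip: power_add)
    also have "\<dots> = N powr (8 * \<delta>)" using N by (simp add: powr_power mult.commute)
    finally show ?thesis .
  qed
  finally have "10 ^ 6 * (real nb)\<^sup>2 * \<tau> ^ 6 * (K / \<eta>) * s.Om \<le> (10 ^ 6 * 625 * 64) * tau_const \<delta> ^ 6 * (K / (\<delta>\<^sup>2 * \<eta>)) * N powr (8 * \<delta>) * s.Om" .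
  moreover have "10 ^ 6 * 625 * 64 = (4 * 10 ^ 10 :: real)" by simp
  ultimately show ?thesis using sieve_bd_mono[OF s.step_bound order_refl] unfolding s.Om_def s.om_def by (simp only:)
qed

text \<open>The rows may be extended to length at least \<open>Z = N powr (2 - 1 / \<xi>)\<close>.
  Then \<open>S \<le> N powr (1 / \<xi>)\<close>, and \<open>(1 / \<xi>) * (\<xi> - 1/2)\<close> is
  half the exponent of \<open>Z\<close>, so \<open>sqrt (M / S) * S powr \<xi> \<le> M\<close>: this
  is where the new exponent comes from.\<close>

lemma col_estimate_step:
  assumes H: "row_estimate K \<eta> \<xi>" and K: "K \<ge> 1" and \<eta>: "0 < \<eta>" "\<eta> \<le> 1" and \<xi>: "1 \<le> \<xi>" "\<xi> \<le> 2" and \<delta>: "0 < \<delta>" "\<delta> \<le> 1"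
  shows "col_estimate (8 * 10 ^ 10 * tau_const \<delta> ^ 6 * (K / (\<delta>\<^sup>2 * \<eta>))) (\<eta> + 8 * \<delta>) (2 - 1 / \<xi>)"
  unfolding col_estimate_def
proof (intro allI impI)
  fix Y N :: real assume Y: "Y \<ge> 1" and N: "N \<ge> 1"
  define Z where "Z = N powr (2 - 1 / \<xi>)"
  define M where "M = max Y Z"
  define S where "S = max 1 (N\<^sup>2 / M)"
  define c where "c = 4 * 10 ^ 10 * tau_const \<delta> ^ 6 * (K / (\<delta>\<^sup>2 * \<eta>))"
  have c0: "c \<ge> 0" using K \<eta> tau_const_ge_1[of \<delta>] by (simp add: c_def)
  have ix: "1 / \<xi> \<le> 1" "1 / \<xi> > 0" using \<xi> by auto
  have ZN: "N \<le> Z" unfolding Z_def using powr_mono[of 1 "2 - 1 / \<xi>" N] N ix by simp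
  have M1: "M \<ge> N" "M \<ge> Y" "M \<ge> Z" "M \<ge> 1" "M \<le> Y + Z" using ZN Y N by (auto simp: M_def)
  have S1: "S \<ge> 1" by (simp add: S_def)
  have SN: "S \<le> N powr (1 / \<xi>)"
  proof -
    have "N\<^sup>2 / M \<le> N\<^sup>2 / Z" using M1 ZN N by (intro divide_left_mono) auto
    also have "\<dots> = N powr (2 - (2 - 1 / \<xi>))" unfolding Z_def using N by (subst powr_diff) simp
    finally show ?thesis using N ix by (simp add: S_def ge_one_powr_ge_zero)
  qed
  have SNN: "S \<le> N" using SN powr_mono[of "1 / \<xi>" 1 N] N ix by simp
  have "sqrt (M / S) * S powr \<xi> \<le> M"
  proof -
    have "sqrt (M / S) * S powr \<xi> = sqrt M * S powr (\<xi> - 1/2)"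
      using S1 by (simp add: powr_diff powr_half_sqrt real_sqrt_divide)
    also have "S powr (\<xi> - 1/2) \<le> (N powr (1 / \<xi>)) powr (\<xi> - 1/2)" using S1 SN \<xi> by (intro powr_mono2) auto
    also have "\<dots> = Z powr (1/2)" unfolding Z_def powr_powr using \<xi> by (simp add: field_simps)
    also have "\<dots> \<le> sqrt M" using M1 ZN N by (simp add: powr_half_sqrt)
    finally show ?thesis using M1 by (simp add: mult_left_mono)
  qed
  moreover have "S powr \<eta> \<le> N powr \<eta>" using S1 SNN \<eta> by (intro powr_mono2) auto
  ultimately have "S powr \<eta> * (M + sqrt (M / S) * S powr \<xi>) \<le> N powr \<eta> * (2 * (Y + Z))"
    using M1 S1 by (intro mult_mono) auto
  hence "c * N powr (8 * \<delta>) * (S powr \<eta> * (M + sqrt (M / S) * S powr \<xi>)) \<le> c * N powr (8 * \<delta>) * (N powr \<eta> * (2 * (Y + Z)))"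
    using c0 by (intro mult_left_mono) auto
  also have "\<dots> = 8 * 10 ^ 10 * tau_const \<delta> ^ 6 * (K / (\<delta>\<^sup>2 * \<eta>)) * N powr (\<eta> + 8 * \<delta>) * (Y + Z)"
    by (simp add: c_def powr_add)
  finally have le: "c * N powr (8 * \<delta>) * (S powr \<eta> * (M + sqrt (M / S) * S powr \<xi>)) \<le> 8 * 10 ^ 10 * tau_const \<delta> ^ 6 * (K / (\<delta>\<^sup>2 * \<eta>)) * N powr (\<eta> + 8 * \<delta>) * (Y + Z)" .
  show "sieve_bd Y N (8 * 10 ^ 10 * tau_const \<delta> ^ 6 * (K / (\<delta>\<^sup>2 * \<eta>)) * N powr (\<eta> + 8 * \<delta>) * (Y + N powr (2 - 1 / \<xi>)))"
    using sieve_bd_mono[OF step_general[OF H K \<eta> \<xi> \<delta> N M1(1) S_def] M1(2) le[unfolded c_def]] unfolding Z_def .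
qed

lemma card_positive_le: assumes "A \<subseteq> {n::nat. 0 < n \<and> real n \<le> Y}" "Y \<ge> 0" shows "real (card A) \<le> Y"
proof -
  have "A \<subseteq> {1..nat \<lfloor>Y\<rfloor>}" using assms by (auto simp: le_nat_floor)
  hence "card A \<le> card {1..nat \<lfloor>Y\<rfloor>}" by (intro card_mono) auto
  hence "real (card A) \<le> real (nat \<lfloor>Y\<rfloor>)" by simp
  also have "\<dots> \<le> Y" using assms(2) by simp
  finally show ?thesis .
qed

lemma norm_sum_square_le:
  fixes a :: "'a \<Rightarrow> complex"
  assumes "\<And>n. n \<in> A \<Longrightarrow> \<bar>k n\<bar> \<le> (1::real)"
  shows "(cmod (\<Sum>n\<in>A. a n * of_real (k n)))\<^sup>2 \<le> real (card A) * (\<Sum>n\<in>A. (cmod (a n))\<^sup>2)"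
proof -
  have "cmod (\<Sum>n\<in>A. a n * of_real (k n)) \<le> (\<Sum>n\<in>A. 1 * cmod (a n))"
  proof (rule sum_norm_le)
    fix n assume "n \<in> A"
    thus "cmod (a n * of_real (k n)) \<le> 1 * cmod (a n)" using mult_left_mono[OF assms, of n "cmod (a n)"] by (simp add: norm_mult)
  qed
  hence "(cmod (\<Sum>n\<in>A. a n * of_real (k n)))\<^sup>2 \<le> (\<Sum>n\<in>A. 1 * cmod (a n))\<^sup>2" by (rule power_mono) simp
  also have "\<dots> \<le> (\<Sum>n\<in>A. 1\<^sup>2) * (\<Sum>n\<in>A. (cmod (a n))\<^sup>2)" by (rule Cauchy_Schwarz_ineq_sum)
  finally show ?thesis by simp
qed

lemma row_estimate_trivial: "row_estimate 2 1 1"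
  unfolding row_estimate_def sieve_bd_def
proof (intro allI impI)
  fix Y L :: real and a :: "nat \<Rightarrow> complex" assume Y: "Y \<ge> 1" and L: "L \<ge> 1"
  define A where "A = (\<Sum>n\<in>odd_block L. (cmod (a n))\<^sup>2)"
  have A0: "A \<ge> 0" by (simp add: A_def sum_nonneg)
  have cC: "real (card (odd_block L)) \<le> 11/10 * L"
    by (rule card_positive_le) (use L in \<open>auto simp: odd_block_def intro!: Nat.gr0I\<close>)
  have cR: "real (card (sqfree_upto Y)) \<le> Y"
    by (rule card_positive_le) (use Y in \<open>auto simp: sqfree_upto_def intro!: Nat.gr0I\<close>)
  have "(\<Sum>s\<in>sqfree_upto Y. (cmod (\<Sum>n\<in>odd_block L. a n * of_real (jr s n)))\<^sup>2) \<le> (\<Sum>s\<in>sqfree_upto Y. 11/10 * L * A)"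
  proof (rule sum_mono)
    fix s
    have "(cmod (\<Sum>n\<in>odd_block L. a n * of_real (jr s n)))\<^sup>2 \<le> real (card (odd_block L)) * A"
      unfolding A_def by (rule norm_sum_square_le) (rule jr_abs_le, simp add: odd_block_def)
    also have "\<dots> \<le> 11/10 * L * A" by (rule mult_right_mono[OF cC A0])
    finally show "(cmod (\<Sum>n\<in>odd_block L. a n * of_real (jr s n)))\<^sup>2 \<le> 11/10 * L * A" .
  qed
  also have "\<dots> = real (card (sqfree_upto Y)) * (11/10 * L * A)" by simp
  also have "\<dots> \<le> Y * (11/10 * L * A)" using cR L A0 by (intro mult_right_mono) auto
  also have "\<dots> \<le> 2 * Y powr 1 * (L + Y powr 1) * A"
  proof -
    have "11/10 * L \<le> 2 * (L + Y)" using L Y by simp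
    hence "Y * (11/10 * L) * A \<le> Y * (2 * (L + Y)) * A" using Y A0 by (intro mult_right_mono mult_left_mono) auto
    thus ?thesis using Y by (simp add: mult_ac)
  qed
  finally show "(\<Sum>s\<in>sqfree_upto Y. (cmod (\<Sum>n\<in>odd_block L. a n * of_real (jr s n)))\<^sup>2) \<le> 2 * Y powr 1 * (L + Y powr 1) * (\<Sum>n\<in>odd_block L. (cmod (a n))\<^sup>2)"
    by (simp only: A_def)
qed

text \<open>For \<open>M \<ge> N\<^sup>2\<close> the dual length \<open>S\<close> is 1, and the
  large loss \<open>S powr \<eta>\<close> of the trivial estimate with \<open>\<eta> = 1\<close>
  disappears. This provides the starting exponent 2.\<close>

lemma col_estimate_base:
  assumes \<delta>: "0 < \<delta>" "\<delta> \<le> 1"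
  shows "col_estimate (16 * 10 ^ 10 * tau_const \<delta> ^ 6 / \<delta>\<^sup>2) (8 * \<delta>) 2"
  unfolding col_estimate_def
proof (intro allI impI)
  fix Y N :: real assume Y: "Y \<ge> 1" and N: "N \<ge> 1"
  define M where "M = max Y (N\<^sup>2)"
  have N2: "N \<le> N\<^sup>2" using N by (simp add: power2_eq_square)
  have M: "M \<ge> N" "M \<ge> Y" "M \<ge> 1" "M \<le> Y + N\<^sup>2" "M \<ge> N\<^sup>2" using N2 Y N by (auto simp: M_def)
  have S: "1 = max 1 (N\<^sup>2 / M)" using M by (simp add: divide_le_eq)
  have sM: "sqrt M \<le> M" using M(3) by (intro real_le_lsqrt) (auto simp: power2_eq_square)
  have "4 * 10 ^ 10 * tau_const \<delta> ^ 6 * (2 / (\<delta>\<^sup>2 * 1)) * N powr (8 * \<delta>) * (1 powr 1 * (M + sqrt (M / 1) * 1 powr 1)) =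
     8 * 10 ^ 10 * tau_const \<delta> ^ 6 / \<delta>\<^sup>2 * N powr (8 * \<delta>) * (M + sqrt M)" by simp
  also have "\<dots> \<le> 8 * 10 ^ 10 * tau_const \<delta> ^ 6 / \<delta>\<^sup>2 * N powr (8 * \<delta>) * (2 * (Y + N powr 2))"
    using sM M N tau_const_ge_1[of \<delta>] by (intro mult_left_mono) auto
  also have "\<dots> = 16 * 10 ^ 10 * tau_const \<delta> ^ 6 / \<delta>\<^sup>2 * N powr (8 * \<delta>) * (Y + N powr 2)" by simp
  finally have le: "4 * 10 ^ 10 * tau_const \<delta> ^ 6 * (2 / (\<delta>\<^sup>2 * 1)) * N powr (8 * \<delta>) * (1 powr 1 * (M + sqrt (M / 1) * 1 powr 1)) \<le>
     16 * 10 ^ 10 * tau_const \<delta> ^ 6 / \<delta>\<^sup>2 * N powr (8 * \<delta>) * (Y + N powr 2)" .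
  show "sieve_bd Y N (16 * 10 ^ 10 * tau_const \<delta> ^ 6 / \<delta>\<^sup>2 * N powr (8 * \<delta>) * (Y + N powr 2))"
    by (rule sieve_bd_mono[OF step_general[OF row_estimate_trivial _ _ _ _ _ \<delta> N M(1) S] M(2) le]) auto
qed

text \<open>The step multiplies the constant by \<open>8 * 10 ^ 10 * tau_const \<delta> ^ 6 /
  (\<delta>\<^sup>2 * \<eta>)\<close> and the passage to rows by \<open>100 / \<eta>\<close>; as
  \<open>\<eta> \<ge> \<delta>\<close> throughout, this bounds their product.\<close>

definition iter_const :: "real \<Rightarrow> real" where "iter_const \<delta> = 8 * 10 ^ 12 * tau_const \<delta> ^ 6 / \<delta> ^ 4"

lemma iter_const_ge_1: assumes "0 < \<delta>" "\<delta> \<le> 1" shows "iter_const \<delta> \<ge> 1"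
proof -
  have "1 \<le> tau_const \<delta> ^ 6" using tau_const_ge_1 by (intro one_le_power)
  moreover have "\<delta> ^ 4 \<le> 1" using assms by (intro power_le_one) auto
  ultimately have "\<delta> ^ 4 \<le> 8 * 10 ^ 12 * tau_const \<delta> ^ 6" by simp
  thus ?thesis using assms by (simp add: iter_const_def le_divide_eq)
qed

text \<open>The map \<open>\<xi>\<close> to \<open>2 - 1 / \<xi>\<close> sends
  \<open>1 + 1/m\<close> to \<open>1 + 1/(m + 1)\<close>, beginning with 2 at \<open>m = 1\<close>,
  and each step adds \<open>8 * \<delta>\<close> to the exponent of the loss.\<close>

lemma col_estimate_iterate:
  assumes \<delta>: "0 < \<delta>" and "m \<ge> 1" "8 * \<delta> * real m \<le> 1"
  shows "col_estimate (iter_const \<delta> ^ m) (8 * \<delta> * real m) (1 + 1 / real m)"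
  using assms(2,3)
proof (induction m rule: nat_induct_at_least)
  case base
  hence d1: "\<delta> \<le> 1" by simp
  have "16 * 10 ^ 10 * tau_const \<delta> ^ 6 / \<delta>\<^sup>2 \<le> 8 * 10 ^ 12 * tau_const \<delta> ^ 6 / \<delta> ^ 4"
  proof (intro frac_le)
    show "\<delta> ^ 4 \<le> \<delta>\<^sup>2" using \<delta> d1 by (intro power_decreasing) auto
  qed (use \<delta> tau_const_ge_1[of \<delta>] in auto)
  from col_estimate_mono[OF col_estimate_base[OF \<delta> d1] this] show ?case by (simp add: iter_const_def)
next
  case (Suc m)
  define \<eta> where "\<eta> = 8 * \<delta> * real m"
  have m: "real m \<ge> 1" using Suc.hyps by simp
  have "8 * \<delta> * real (Suc m) = \<eta> + 8 * \<delta>" by (simp add: \<eta>_def algebra_simps)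
  hence \<eta>1: "\<eta> + 8 * \<delta> \<le> 1" "8 * \<delta> * real (Suc m) = \<eta> + 8 * \<delta>" using Suc.prems by auto
  have d: "\<delta> \<le> \<eta>" "\<delta> \<le> 1"
  proof -
    have "\<delta> * 1 \<le> 8 * \<delta> * real m" using \<delta> m by (intro mult_mono) auto
    thus "\<delta> \<le> \<eta>" by (simp add: \<eta>_def)
    thus "\<delta> \<le> 1" using \<eta>1 \<delta> by linarith
  qed
  have \<eta>: "0 < \<eta>" "\<eta> \<le> 1" using d \<delta> \<eta>1 by auto
  have P1: "iter_const \<delta> ^ m \<ge> 1" using iter_const_ge_1[OF \<delta> d(2)] by (rule one_le_power)
  have "col_estimate (iter_const \<delta> ^ m) \<eta> (1 + 1 / real m)" using Suc.IH \<eta>(2) by (simp add: \<eta>_def)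
  hence H': "row_estimate (100 * iter_const \<delta> ^ m / \<eta>) \<eta> (1 + 1 / real m)" using P1 \<eta> by (intro row_estimate_of_col_estimate) auto
  have K1: "100 * iter_const \<delta> ^ m / \<eta> \<ge> 1" using P1 \<eta> by (simp add: le_divide_eq)
  have "col_estimate (8 * 10 ^ 10 * tau_const \<delta> ^ 6 * (100 * iter_const \<delta> ^ m / \<eta> / (\<delta>\<^sup>2 * \<eta>))) (\<eta> + 8 * \<delta>) (2 - 1 / (1 + 1 / real m))"
    by (rule col_estimate_step[OF H' K1 \<eta> _ _ \<delta> d(2)]) (use m in auto)
  moreover have "2 - 1 / (1 + 1 / real m) = 1 + 1 / real (Suc m)" using m by (simp add: field_simps)
  moreover have "8 * 10 ^ 10 * tau_const \<delta> ^ 6 * (100 * iter_const \<delta> ^ m / \<eta> / (\<delta>\<^sup>2 * \<eta>)) \<le> iter_const \<delta> ^ Suc m"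
  proof -
    have "8 * 10 ^ 10 * tau_const \<delta> ^ 6 * (100 * iter_const \<delta> ^ m / \<eta> / (\<delta>\<^sup>2 * \<eta>)) = 8 * 10 ^ 12 * tau_const \<delta> ^ 6 * iter_const \<delta> ^ m / (\<delta>\<^sup>2 * \<eta>\<^sup>2)"
      by (simp add: power2_eq_square mult_ac)
    also have "\<dots> \<le> 8 * 10 ^ 12 * tau_const \<delta> ^ 6 * iter_const \<delta> ^ m / (\<delta>\<^sup>2 * \<delta>\<^sup>2)"
      using \<delta> d P1 tau_const_ge_1[of \<delta>] by (intro divide_left_mono mult_left_mono power_mono mult_nonneg_nonneg mult_pos_pos) auto
    also have "\<delta>\<^sup>2 * \<delta>\<^sup>2 = \<delta> ^ 4" by (simp flip: power_add)
    finally show ?thesis by (simp add: iter_const_def)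
  qed
  ultimately show ?case unfolding \<eta>1(2) using col_estimate_mono by simp
qed

section \<open>The dyadic sieve constant\<close>

text \<open>With \<open>x = inverse \<epsilon>\<close> one has
  \<open>1 / \<delta> = 16 * m * x \<le> 48 * x\<^sup>2\<close>, and
  \<open>tau_const \<delta>\<close> is at most a double exponential of this. Raising
  \<open>iter_const \<delta>\<close> to the power \<open>m\<close> only multiplies the outermost
  exponent by \<open>m\<close>.\<close>

lemma constant_bound:
  assumes \<epsilon>: "0 < \<epsilon>" "\<epsilon> \<le> 1" and m: "1 \<le> m" "real m \<le> 3 / \<epsilon>" and \<delta>: "\<delta> = \<epsilon> / (16 * real m)"
  shows "32 * iter_const \<delta> ^ m \<le> exp (exp (exp (exp (10 * inverse \<epsilon>))))"
proof -
  define x where "x = inverse \<epsilon>"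
  define D where "D = 1 / \<delta>"
  define E where "E = exp D"
  have x: "x \<ge> 1" using \<epsilon> by (simp add: x_def one_le_inverse)
  have m1: "real m \<ge> 1" using m by simp
  have mx: "real m \<le> 3 * x" using m(2) unfolding x_def divide_inverse .
  have Dx: "D = 16 * real m * x" unfolding D_def \<delta> x_def by (simp add: inverse_eq_divide)
  have D16: "D \<ge> 16" unfolding Dx using mult_mono[of 1 "real m" 1 x] m1 x by simp
  have D48: "D \<le> 48 * x\<^sup>2"
  proof -
    have "16 * real m * x \<le> 16 * (3 * x) * x" using mx x by (intro mult_right_mono mult_left_mono) auto
    thus ?thesis by (simp add: Dx power2_eq_square)
  qed
  have \<delta>0: "\<delta> > 0" unfolding \<delta> using \<epsilon> m1 by simp
  have two: "2 ^ n \<le> exp (real n)" for n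
  proof -
    have "(2::real) ^ n \<le> exp 1 ^ n" using exp_ge_add_one_self[of 1] by (intro power_mono) auto
    thus ?thesis by (simp flip: exp_of_nat_mult)
  qed
  have ED: "D \<le> E" using exp_ge_add_one_self[of D] unfolding E_def by linarith
  have E43: "43 \<le> E"
  proof -
    have "(2::real) ^ 16 \<le> exp 16" using two[of 16] by simp
    also have "\<dots> \<le> E" using D16 by (simp add: E_def)
    finally show ?thesis by simp
  qed
  have tau_const: "tau_const \<delta> \<le> exp E"
  proof -
    have two_powr: "2 powr y \<le> exp y" if "y \<ge> 0" for y :: real
    proof -
      have "2 powr y \<le> exp 1 powr y" using that exp_ge_add_one_self[of 1] by (intro powr_mono2) auto
      thus ?thesis by (simp add: powr_def)
    qed
    have "2 powr D \<le> E" unfolding E_def by (rule two_powr) (use D16 in simp)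
    hence "2 powr (2 powr D) \<le> 2 powr E" by (intro powr_mono) auto
    also have "\<dots> \<le> exp E" by (rule two_powr) (use E43 in simp)
    finally show ?thesis by (simp add: tau_const_def D_def)
  qed
  have P: "iter_const \<delta> \<le> exp (11 * E)"
  proof -
    have "iter_const \<delta> = 8 * 10 ^ 12 * tau_const \<delta> ^ 6 * D ^ 4" by (simp add: iter_const_def D_def power_one_over)
    also have "\<dots> \<le> exp E * exp E ^ 6 * exp E ^ 4"
    proof (intro mult_mono power_mono tau_const)
      have "(8 * 10 ^ 12 :: real) \<le> 2 ^ 43" by simp
      also have "\<dots> \<le> exp 43" using two[of 43] by simp
      also have "\<dots> \<le> exp E" using E43 by simp
      finally show "8 * 10 ^ 12 \<le> exp E" .
      show "D \<le> exp E" using ED exp_ge_add_one_self[of E] by linarith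
    qed (use D16 tau_const_ge_1[of \<delta>] in auto)
    also have "\<dots> = exp (E + real 6 * E + real 4 * E)" by (simp only: exp_add exp_of_nat_mult)
    also have "E + real 6 * E + real 4 * E = 11 * E" by simp
    finally show ?thesis .
  qed
  have exp_lin: "t \<le> exp t" for t :: real using exp_ge_add_one_self[of t] by linarith
  have "32 * iter_const \<delta> ^ m \<le> exp E * exp (11 * E) ^ m"
  proof (intro mult_mono power_mono P)
    have "(32::real) \<le> exp 5" using two[of 5] by simp
    also have "\<dots> \<le> exp E" using E43 by simp
    finally show "32 \<le> exp E" .
  qed (use \<delta>0 tau_const_ge_1[of \<delta>] in \<open>auto simp: iter_const_def\<close>)
  also have "\<dots> = exp (E + real m * (11 * E))" by (simp add: exp_add exp_of_nat_mult)
  also have "\<dots> \<le> exp (36 * x * E)"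
  proof -
    have "1 * E \<le> real m * E" using m1 E43 by (intro mult_right_mono) auto
    hence "E + real m * (11 * E) \<le> 12 * (real m * E)" by linarith
    also have "\<dots> \<le> 12 * (3 * x * E)" using mx E43 by (intro mult_left_mono mult_right_mono) auto
    finally show ?thesis by simp
  qed
  also have "\<dots> \<le> exp (exp (exp (10 * x)))"
  proof -
    have x2: "x * 1 \<le> x\<^sup>2" unfolding power2_eq_square using x by (intro mult_left_mono) auto
    have "36 * x * E \<le> exp (36 * x\<^sup>2) * exp (48 * x\<^sup>2)"
    proof (rule mult_mono)
      show "36 * x \<le> exp (36 * x\<^sup>2)" using exp_lin[of "36 * x\<^sup>2"] x2 by linarith
      show "E \<le> exp (48 * x\<^sup>2)" using D48 by (simp add: E_def)
    qed (use E43 in auto)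
    also have "\<dots> = exp (84 * x\<^sup>2)" by (simp flip: exp_add)
    also have "84 * x\<^sup>2 \<le> exp (10 * x)"
    proof -
      have "x\<^sup>2 \<le> (exp x)\<^sup>2" using exp_lin[of x] x by (intro power_mono) auto
      also have "\<dots> = exp (2 * x)" by (simp add: exp_double)
      finally have a: "x\<^sup>2 \<le> exp (2 * x)" .
      have "(84::real) \<le> exp 8" using two[of 8] by simp
      also have "\<dots> \<le> exp (8 * x)" using x by simp
      finally have "84 * x\<^sup>2 \<le> exp (8 * x) * exp (2 * x)" using a by (intro mult_mono) auto
      thus ?thesis by (simp flip: exp_add)
    qed
    finally have "36 * x * E \<le> exp (exp (10 * x))" by simp
    thus ?thesis by simp
  qed
  \<comment> \<open>Three exponentials bound the constant up to here; the fourth is added by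
    \<open>t \<le> exp t\<close> to reach the form of the theorem.\<close>
  also have "\<dots> \<le> exp (exp (exp (exp (10 * x))))" using exp_lin[of "10 * x"] by simp
  finally show ?thesis by (simp add: x_def)
qed

lemma sieve_bd_uniform:
  assumes \<epsilon>: "0 < \<epsilon>" "\<epsilon> \<le> 1"
  obtains Q where "Q \<ge> 0" "32 * Q \<le> exp (exp (exp (exp (10 * inverse \<epsilon>))))"
    "\<And>Y N. Y \<ge> 1 \<Longrightarrow> N \<ge> 1 \<Longrightarrow> sieve_bd Y N (Q * N powr \<epsilon> * (Y + N))"
proof
  \<comment> \<open>Half of \<open>\<epsilon>\<close> is spent on the excess \<open>1 / m\<close> of
    the exponent over 1, the other half on the accumulated loss \<open>8 * \<delta> * m\<close>;
    this determines \<open>m\<close> and \<open>\<delta>\<close>.\<close>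
  define m where "m = nat \<lceil>2 / \<epsilon>\<rceil>"
  define \<delta> where "\<delta> = \<epsilon> / (16 * real m)"
  have e2: "2 / \<epsilon> \<ge> 2" using \<epsilon> by (simp add: le_divide_eq)
  have m2: "real m \<ge> 2 / \<epsilon>" unfolding m_def by (rule real_nat_ceiling_ge)
  have m1: "m \<ge> 1" using m2 e2 by linarith
  have "real m < 2 / \<epsilon> + 1" unfolding m_def using e2 by linarith
  moreover have "1 \<le> 1 / \<epsilon>" using \<epsilon> by simp
  ultimately have m3: "real m \<le> 3 / \<epsilon>" by (simp add: add_divide_distrib[symmetric])
  have \<delta>0: "\<delta> > 0" using \<epsilon> m1 by (simp add: \<delta>_def)
  have \<delta>m: "8 * \<delta> * real m = \<epsilon> / 2" using m1 by (simp add: \<delta>_def)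
  have im: "1 / real m \<le> \<epsilon> / 2"
  proof -
    have "2 \<le> real m * \<epsilon>" using m2 \<epsilon> by (simp add: divide_le_eq)
    thus ?thesis using m1 by (simp add: divide_le_eq mult_ac)
  qed
  show "32 * iter_const \<delta> ^ m \<le> exp (exp (exp (exp (10 * inverse \<epsilon>))))" by (rule constant_bound[OF \<epsilon> m1 m3 \<delta>_def])
  show P0: "iter_const \<delta> ^ m \<ge> 0" using \<delta>0 tau_const_ge_1[of \<delta>] by (simp add: iter_const_def)
  have H: "col_estimate (iter_const \<delta> ^ m) (8 * \<delta> * real m) (1 + 1 / real m)"
    by (rule col_estimate_iterate[OF \<delta>0 m1]) (use \<delta>m \<epsilon> in simp)
  fix Y N :: real assume Y: "Y \<ge> 1" and N: "N \<ge> 1"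
  have "Y + N powr (1 + 1 / real m) \<le> N powr (\<epsilon> / 2) * (Y + N)"
  proof -
    have 1: "N powr (1 / real m) \<le> N powr (\<epsilon> / 2)" using N im by (intro powr_mono) auto
    have 2: "1 \<le> N powr (\<epsilon> / 2)" using N \<epsilon> by (simp add: ge_one_powr_ge_zero)
    have "N powr (1 + 1 / real m) = N * N powr (1 / real m)" using N by (simp add: powr_add)
    also have "\<dots> \<le> N * N powr (\<epsilon> / 2)" using 1 N by (intro mult_left_mono) auto
    finally have 3: "N powr (1 + 1 / real m) \<le> N * N powr (\<epsilon> / 2)" .
    have "1 * Y \<le> N powr (\<epsilon> / 2) * Y" using 2 Y by (intro mult_right_mono) auto
    moreover have "N powr (\<epsilon> / 2) * (Y + N) = N powr (\<epsilon> / 2) * Y + N * N powr (\<epsilon> / 2)" by (simp add: algebra_simps)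
    ultimately show ?thesis using 3 by linarith
  qed
  hence "iter_const \<delta> ^ m * N powr (\<epsilon> / 2) * (Y + N powr (1 + 1 / real m)) \<le> iter_const \<delta> ^ m * N powr (\<epsilon> / 2) * (N powr (\<epsilon> / 2) * (Y + N))"
    using P0 by (intro mult_left_mono) auto
  also have "\<dots> = iter_const \<delta> ^ m * N powr \<epsilon> * (Y + N)" by (simp add: mult.assoc[symmetric] powr_add[symmetric])
  finally have le: "iter_const \<delta> ^ m * N powr (\<epsilon> / 2) * (Y + N powr (1 + 1 / real m)) \<le> iter_const \<delta> ^ m * N powr \<epsilon> * (Y + N)" .
  have "sieve_bd Y N (iter_const \<delta> ^ m * N powr (\<epsilon> / 2) * (Y + N powr (1 + 1 / real m)))"
    using H Y N unfolding col_estimate_def \<delta>m by simp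
  from sieve_bd_mono[OF this order_refl le] show "sieve_bd Y N (iter_const \<delta> ^ m * N powr \<epsilon> * (Y + N))" .
qed

section \<open>Passage from dyadic ranges of integers to natural numbers\<close>

lemma dyadic_star_nat: "dyadic_star N = int ` {k. int k \<in> dyadic_star N}"
proof
  show "dyadic_star N \<subseteq> int ` {k. int k \<in> dyadic_star N}"
  proof
    fix n assume n: "n \<in> dyadic_star N"
    hence "n = int (nat n)" by (simp add: dyadic_star_def)
    thus "n \<in> int ` {k. int k \<in> dyadic_star N}" using n by (metis imageI mem_Collect_eq)
  qed
qed auto

lemma squarefree_int_iff: "squarefree (int k) \<longleftrightarrow> squarefree k"
proof
  assume a: "squarefree (int k)"
  show "squarefree k" unfolding squarefree_def
  proof (intro allI impI)
    fix x :: nat assume "x\<^sup>2 dvd k"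
    hence "(int x)\<^sup>2 dvd int k" by (simp flip: of_nat_power)
    hence "int x dvd 1" by (rule squarefreeD[OF a])
    thus "x dvd 1" by simp
  qed
next
  assume a: "squarefree k"
  show "squarefree (int k)" unfolding squarefree_def
  proof (intro allI impI)
    fix x :: int assume "x\<^sup>2 dvd int k"
    hence "(int (nat \<bar>x\<bar>))\<^sup>2 dvd int k" by simp
    hence "(nat \<bar>x\<bar>)\<^sup>2 dvd k" by (simp only: of_nat_dvd_iff flip: of_nat_power)
    hence "nat \<bar>x\<bar> dvd 1" by (rule squarefreeD[OF a])
    thus "x dvd 1" by simp
  qed
qed

lemma int_mem_dyadic_star: "int k \<in> dyadic_star N \<longleftrightarrow> N < real k \<and> real k \<le> 2 * N \<and> 0 < k \<and> squarefree k \<and> odd k"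
  by (auto simp: dyadic_star_def dyadic_def squarefree_int_iff)

lemma sieve_sum_nat:
  "sieve_sum M N a = (\<Sum>k\<in>{k. int k \<in> dyadic_star M}. (cmod (\<Sum>j\<in>{j. int j \<in> dyadic_star N}. a (int j) * of_real (jr j k)))\<^sup>2)"
proof -
  have 1: "(\<Sum>n\<in>dyadic_star L. f n) = (\<Sum>k\<in>{k. int k \<in> dyadic_star L}. f (int k))" for f :: "int \<Rightarrow> 'a::comm_monoid_add" and L
    by (subst dyadic_star_nat, subst sum.reindex) (auto simp: inj_on_def)
  show ?thesis unfolding sieve_sum_def 1 by (simp add: jr_def jac_def)
qed

lemma finite_nat_dyadic_star: "finite {k. int k \<in> dyadic_star N}"
  using finite_vimageI[OF finite_dyadic_star, of int N] by (simp add: vimage_def inj_on_def)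

lemma seq_norm_ge: "(\<Sum>j\<in>{j. int j \<in> dyadic_star N}. (cmod (a (int j)))\<^sup>2) \<le> (seq_norm N a)\<^sup>2"
proof -
  have "(\<Sum>j\<in>{j. int j \<in> dyadic_star N}. (cmod (a (int j)))\<^sup>2) = (\<Sum>n\<in>dyadic_star N. (cmod (a n))\<^sup>2)"
    by (subst (2) dyadic_star_nat, subst sum.reindex) (auto simp: inj_on_def)
  also have "\<dots> \<le> (\<Sum>n\<in>dyadic N. (cmod (a n))\<^sup>2)"
    by (rule sum_mono2[OF finite_dyadic]) (auto simp: dyadic_star_def)
  finally show ?thesis by (simp only: seq_norm_power2)
qed

text \<open>Cauchy-Schwarz in the inner sum and counting in the outer one. It serves the case
  \<open>\<epsilon> > 1\<close>, where \<open>M * N \<le> (M * N) powr \<epsilon>\<close>.\<close>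

lemma sieve_sum_trivial:
  assumes M: "M \<ge> 1" and N: "N \<ge> 1"
  shows "sieve_sum M N a \<le> 4 * (M * N) * (seq_norm N a)\<^sup>2"
proof -
  define A where "A = (\<Sum>j\<in>{j. int j \<in> dyadic_star N}. (cmod (a (int j)))\<^sup>2)"
  have A0: "A \<ge> 0" by (simp add: A_def sum_nonneg)
  have c: "real (card {k. int k \<in> dyadic_star L}) \<le> 2 * L" if "L \<ge> 1" for L
    by (rule card_positive_le) (use that in \<open>auto simp: int_mem_dyadic_star\<close>)
  have "sieve_sum M N a \<le> (\<Sum>k\<in>{k. int k \<in> dyadic_star M}. 2 * N * A)"
    unfolding sieve_sum_nat
  proof (rule sum_mono)
    fix k assume "k \<in> {k. int k \<in> dyadic_star M}"
    hence o: "odd k" by (simp add: int_mem_dyadic_star)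
    have "(cmod (\<Sum>j\<in>{j. int j \<in> dyadic_star N}. a (int j) * of_real (jr j k)))\<^sup>2 \<le> real (card {j. int j \<in> dyadic_star N}) * A"
      unfolding A_def by (rule norm_sum_square_le) (rule jr_abs_le[OF o])
    also have "\<dots> \<le> 2 * N * A" by (rule mult_right_mono[OF c[OF N] A0])
    finally show "(cmod (\<Sum>j\<in>{j. int j \<in> dyadic_star N}. a (int j) * of_real (jr j k)))\<^sup>2 \<le> 2 * N * A" .
  qed
  also have "\<dots> = real (card {k. int k \<in> dyadic_star M}) * (2 * N * A)" by simp
  also have "\<dots> \<le> 2 * M * (2 * N * A)" using c[OF M] N A0 by (intro mult_right_mono) auto
  also have "\<dots> = 4 * (M * N) * A" by simp
  also have "\<dots> \<le> 4 * (M * N) * (seq_norm N a)\<^sup>2"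
    using seq_norm_ge[of a N] M N unfolding A_def by (intro mult_left_mono) auto
  finally show ?thesis .
qed

text \<open>In \<open>sieve_sum\<close> the outer variable is the lower entry of the symbol, in
  \<open>sieve_bd\<close> the upper one, so duality is applied once more. As
  \<open>(11/10) ^ 8 > 2\<close>, eight blocks cover the outer range; each loses a factor 2 in
  \<open>L powr \<epsilon>\<close> and a factor 2 in the sum of the lengths, whence
  \<open>32 = 8 * 4\<close>.\<close>

lemma sieve_sum_bound:
  assumes \<epsilon>: "0 < \<epsilon>" "\<epsilon> \<le> 1" and Q: "Q \<ge> 0" "\<And>Y N. Y \<ge> 1 \<Longrightarrow> N \<ge> 1 \<Longrightarrow> sieve_bd Y N (Q * N powr \<epsilon> * (Y + N))"
    and M: "M \<ge> 1" and N: "N \<ge> 1"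
  shows "sieve_sum M N a \<le> 32 * Q * M powr \<epsilon> * (M + N) * (seq_norm N a)\<^sup>2"
proof -
  define D where "D = {j. int j \<in> dyadic_star N}"
  define b where "b j = of_bool (j \<in> D) * a (int j)" for j
  define A where "A = (\<Sum>j\<in>D. (cmod (a (int j)))\<^sup>2)"
  define T where "T k = (cmod (\<Sum>j\<in>sqfree_upto (2 * N). b j * of_real (jr j k)))\<^sup>2" for k
  have A0: "A \<ge> 0" by (simp add: A_def sum_nonneg)
  have DR: "D \<subseteq> sqfree_upto (2 * N)" by (auto simp: D_def int_mem_dyadic_star sqfree_upto_def)
  have restrict: "(\<Sum>j\<in>sqfree_upto (2 * N). of_bool (j \<in> D) * f j) = (\<Sum>j\<in>D. f j)" for f :: "nat \<Rightarrow> 'b::comm_semiring_1"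
  proof -
    have "(\<Sum>j\<in>D. f j) = (\<Sum>j\<in>D. of_bool (j \<in> D) * f j)" by (intro sum.cong refl) simp
    also have "\<dots> = (\<Sum>j\<in>sqfree_upto (2 * N). of_bool (j \<in> D) * f j)" by (rule sum.mono_neutral_left[OF finite_sqfree_upto DR]) auto
    finally show ?thesis ..
  qed
  have bA: "(\<Sum>j\<in>sqfree_upto (2 * N). (cmod (b j))\<^sup>2) = A"
    unfolding A_def restrict[symmetric] by (intro sum.cong refl) (auto simp: b_def)
  have S: "sieve_sum M N a = (\<Sum>k\<in>{k. int k \<in> dyadic_star M}. T k)"
    unfolding sieve_sum_nat T_def b_def mult.assoc restrict unfolding D_def ..
  have k: "1 \<le> real k / M" "real k / M \<le> 2" "k > 0" "odd k" "squarefree k" if "int k \<in> dyadic_star M" for k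
    using that M by (auto simp: int_mem_dyadic_star field_simps)
  have "(\<Sum>k\<in>{k. int k \<in> dyadic_star M}. T k) = (\<Sum>i<8. \<Sum>k\<in>{k \<in> {k. int k \<in> dyadic_star M}. blk (real k / M) = i}. T k)"
  proof (rule sum.group[symmetric, OF finite_nat_dyadic_star])
    show "(\<lambda>k. blk (real k / M)) ` {k. int k \<in> dyadic_star M} \<subseteq> {..<8}"
    proof safe
      fix k' assume "int k' \<in> dyadic_star M"
      note kk = k[OF this]
      have "(2::real) < (11/10) ^ 8" by (simp add: eval_nat_numeral)
      thus "blk (real k' / M) < 8" using kk(2) by (intro blk_less[OF kk(1)]) linarith
    qed
  qed simp
  also have "\<dots> \<le> (\<Sum>i<8::nat. 4 * Q * M powr \<epsilon> * (M + N) * A)"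
  proof (rule sum_mono)
    fix i :: nat assume i: "i \<in> {..<8}"
    define L where "L = M * (11/10) ^ i"
    have i1: "(11/10 :: real) ^ i \<ge> 1" by (simp add: one_le_power)
    have i2: "(11/10 :: real) ^ i \<le> 2"
    proof -
      have "(11/10 :: real) ^ i \<le> (11/10) ^ 7" using i by (intro power_increasing) auto
      also have "\<dots> \<le> 2" by (simp add: eval_nat_numeral)
      finally show ?thesis .
    qed
    have L: "M \<le> L" "L \<le> 2 * M" using mult_left_mono[OF i1, of M] mult_left_mono[OF i2, of M] M by (simp_all add: L_def)
    have L1: "L \<ge> 1" using L M by linarith
    have sub: "{k \<in> {k. int k \<in> dyadic_star M}. blk (real k / M) = i} \<subseteq> odd_block L"
    proof
      fix k' assume "k' \<in> {k \<in> {k. int k \<in> dyadic_star M}. blk (real k / M) = i}"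
      hence kk: "int k' \<in> dyadic_star M" "blk (real k' / M) = i" by auto
      from blk[OF k(1)[OF kk(1)]] k[OF kk(1)] M show "k' \<in> odd_block L"
        unfolding kk(2) odd_block_def L_def by (simp add: field_simps)
    qed
    have "(\<Sum>k\<in>{k \<in> {k. int k \<in> dyadic_star M}. blk (real k / M) = i}. T k) \<le> (\<Sum>k\<in>odd_block L. T k)"
      by (rule sum_mono2[OF finite_odd_block sub]) (simp add: T_def)
    also have "\<dots> \<le> Q * L powr \<epsilon> * (2 * N + L) * A"
      unfolding T_def bA[symmetric]
    proof (rule bilinear_duality)
      show "(\<Sum>s\<in>sqfree_upto (2 * N). (cmod (\<Sum>n\<in>odd_block L. c n * of_real (jr s n)))\<^sup>2) \<le> Q * L powr \<epsilon> * (2 * N + L) * (\<Sum>n\<in>odd_block L. (cmod (c n))\<^sup>2)" for c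
        by (rule sieve_bdD, rule Q(2)) (use N L1 in auto)
    qed (use Q N L1 in auto)
    also have "\<dots> \<le> Q * (2 * M powr \<epsilon>) * (2 * (M + N)) * A"
    proof (intro mult_right_mono mult_mono mult_left_mono)
      have "L powr \<epsilon> \<le> (2 * M) powr \<epsilon>" using L L1 \<epsilon> by (intro powr_mono2) auto
      also have "\<dots> = 2 powr \<epsilon> * M powr \<epsilon>" using M by (simp add: powr_mult)
      also have "\<dots> \<le> 2 powr 1 * M powr \<epsilon>" using \<epsilon> by (intro mult_right_mono powr_mono) auto
      finally show "L powr \<epsilon> \<le> 2 * M powr \<epsilon>" by simp
    qed (use Q N L L1 A0 in auto)
    finally show "(\<Sum>k\<in>{k \<in> {k. int k \<in> dyadic_star M}. blk (real k / M) = i}. T k) \<le> 4 * Q * M powr \<epsilon> * (M + N) * A" by (simp add: algebra_simps)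
  qed
  also have "\<dots> = 32 * Q * M powr \<epsilon> * (M + N) * A" by simp
  also have "\<dots> \<le> 32 * Q * M powr \<epsilon> * (M + N) * (seq_norm N a)\<^sup>2"
    using seq_norm_ge[of a N] Q M N unfolding A_def D_def by (intro mult_left_mono) auto
  finally show ?thesis unfolding S .
qed

lemma sieve_const_le:
  assumes "N \<ge> 1" "\<And>a. sieve_sum M N a \<le> B * (seq_norm N a)\<^sup>2"
  shows "sieve_const M N \<le> B"
  unfolding sieve_const_def
proof (rule cSUP_least[OF seq_norm_nontrivial[OF assms(1)]])
  fix a assume "a \<in> {a. seq_norm N a \<noteq> 0}"
  thus "sieve_sum M N a / (seq_norm N a)\<^sup>2 \<le> B" using assms(2)[of a] by (simp add: divide_le_eq)
qed

theorem theorem1: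
  shows "\<exists>C::real. C > 0 \<and>
    (\<forall>(M::real) (N::real) (\<epsilon>::real). M \<ge> 1 \<longrightarrow> N \<ge> 1 \<longrightarrow> \<epsilon> > 0 \<longrightarrow>
       sieve_const M N \<le> (exp ^^ 4) (C * inverse \<epsilon>) * (M * N) powr \<epsilon> * (M + N))"
proof (intro exI[of _ 10] conjI allI impI)
  fix M N \<epsilon> :: real assume M: "M \<ge> 1" and N: "N \<ge> 1" and \<epsilon>: "\<epsilon> > 0"
  have e4: "(exp ^^ 4) (10 * inverse \<epsilon>) = exp (exp (exp (exp (10 * inverse \<epsilon>))))"
    by (simp add: eval_nat_numeral)
  show "sieve_const M N \<le> (exp ^^ 4) (10 * inverse \<epsilon>) * (M * N) powr \<epsilon> * (M + N)"
  \<comment> \<open>The recursion works with loss exponents at most 1. For larger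
    \<open>\<epsilon>\<close> the trivial bound \<open>4 * (M * N)\<close> suffices, as the iterated
    exponential is at least 4.\<close>
  proof (cases "\<epsilon> \<le> 1")
    case True
    obtain Q where Q: "Q \<ge> 0" "32 * Q \<le> exp (exp (exp (exp (10 * inverse \<epsilon>))))"
      "\<And>Y N. Y \<ge> 1 \<Longrightarrow> N \<ge> 1 \<Longrightarrow> sieve_bd Y N (Q * N powr \<epsilon> * (Y + N))"
      using sieve_bd_uniform[OF \<epsilon> True] by blast
    have "sieve_const M N \<le> 32 * Q * M powr \<epsilon> * (M + N)"
      by (rule sieve_const_le[OF N]) (rule sieve_sum_bound[OF \<epsilon> True Q(1,3) M N])
    also have "\<dots> \<le> exp (exp (exp (exp (10 * inverse \<epsilon>)))) * (M * N) powr \<epsilon> * (M + N)"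
    proof (intro mult_right_mono mult_mono Q(2))
      show "M powr \<epsilon> \<le> (M * N) powr \<epsilon>" using M N \<epsilon> by (intro powr_mono2) (auto simp: mult_le_cancel_left1)
    qed (use M N in auto)
    finally show ?thesis unfolding e4 .
  next
    case False
    have MN: "M * N \<ge> 1" using mult_mono[of 1 M 1 N] M N by simp
    have step: "exp t \<ge> u + 1" if "t \<ge> u" for t u :: real using exp_ge_add_one_self[of t] that by linarith
    have "exp (exp (exp (exp (10 * inverse \<epsilon>)))) \<ge> 0 + 1 + 1 + 1 + 1" using \<epsilon> by (intro step) simp
    hence E: "4 \<le> exp (exp (exp (exp (10 * inverse \<epsilon>))))" by simp
    have P: "M * N \<le> (M * N) powr \<epsilon>" using powr_mono[of 1 \<epsilon> "M * N"] False MN by simp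
    have "sieve_const M N \<le> 4 * (M * N)"
      by (rule sieve_const_le[OF N]) (rule sieve_sum_trivial[OF M N])
    also have "\<dots> \<le> exp (exp (exp (exp (10 * inverse \<epsilon>)))) * (M * N) powr \<epsilon>"
      using E P MN by (intro mult_mono) auto
    also have "\<dots> \<le> exp (exp (exp (exp (10 * inverse \<epsilon>)))) * (M * N) powr \<epsilon> * (M + N)"
      using mult_left_mono[of 1 "M + N" "exp (exp (exp (exp (10 * inverse \<epsilon>)))) * (M * N) powr \<epsilon>"] M N by simp
    finally show ?thesis unfolding e4 .
  qed
qed simp

end
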